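(* In the production-inventory model described in the context, for each $\{i,j\}=\{1,2\}$ the optimal cost function $V_i$ (extended continuously to $[l,b]$) is a viscosity solution of the Hamilton-Jacobi-Bellman equation $$\min\{\mathcal{L}_i(V_i)(x),\; V_j(x)+K_{ij}-V_i(x)\}=0$$ at every $x\in[l,b)$.
   Context: **Model.** Fix $l\le 0<b$ (minimum inventory level and storage capacity), production rates $0<\sigma_2<\sigma_1$, $\sigma_0=0$, a discount rate $q>0$, and a compound Poisson demand process $\sum_{n=1}^{N_t}Y_n$, where $N$ is a Poisson process of rate $\lambda>0$ with arrival times $\tau_1<\tau_2<\cdots$, and $Y_n$ are i.i.d. positive random variables, independent of $N$, with distribution function $F$ and finite mean. $(\mathcal F_t)$ is the filtration generated by the demand process. **Costs.** For $i=1,2$, $h_i:[l,b)\to[0,\infty)$ is bounded with finitely many discontinuities and is Lipschitz (constant $m_h$) between discontinuities; $h_0(b)\ge 0$ is a constant. $p:[0,\infty)\to[0,\infty)$ is non-decreasing with $\int_0^\infty p(y)\,dF(y)<\infty$. Switching costs $K_{ij}\ge 0$ ($i\ne j$ in $\{0,1,2\}$) satisfy $K_{0i}\le K_{0j}+K_{ji}$ for $\{i,j\}=\{1,2\}$ and $K_{12}+K_{21}>0$. **Strategies.** A production strategy starting from inventory level $x$ and phase $i$ is $\pi=(T_k,J_k)_{k\ge0}$ with $T_0=0$, $J_0=i$, $0\le T_1<T_2<\cdots$ stopping times (possibly $+\infty$ from some index on, not accumulating at a finite time), $J_k\in\{0,1,2\}$ being $\mathcal F_{T_k}$-measurable, $J_k\neq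 J_{k-1}$. The phase process is $\mathcal J_t=J_k$ for $t\in[T_k,T_{k+1})$. The inventory $X^\pi_t$ starts at $X^\pi_0=x$, grows at rate $\sigma_{\mathcal J_t}$ between demands, and at each $\tau_n$ jumps down by $\min\{Y_n,X^\pi_{\tau_n^-}-l\}$ (the part of the demand that would bring inventory below $l$ is lost). $\pi$ is admissible ($\pi\in\Pi_{x,i}$) if: whenever $X_t^\pi<b$, the phase is $1$ or $2$; whenever $X^\pi$ reaches $b$ in phase $1$ or $2$, at that time there is a mandatory switch to phase $0$, after which $X^\pi=b$ until the next demand arrival, which is the next switching time, at which the new phase is $1$ or $2$. Initial data are either $x\in[l,b)$, $i\in\{1,2\}$, or $x=b$, $i=0$. **Cost functions.** For $\pi\in\Pi_{x,i}$, $$V_i^\pi(x)=\mathbb E\Big[\int_0^\infty e^{-qt}h_{\mathcal J_t}(X_t^\pi)dt\Big]+\mathbb E\Big[\sum_{k\ge0}e^{-qT_{k+1}}K_{J_k,J_{k+1}}\Big]+\mathbb E\Big[\sum_{n\ge1}e^{-q\tau_n}1_{\{X^\pi_{\tau_n^-}-l<Y_n\}}\,p(Y_n-X^\pi_{\tau_n^-}+l)\Big],$$ (where $h_0$ is used at level $b$), $V_i(x)=\inf_{\pi\in\Pi_{x,i}}V_i^\pi(x)$ for $i=1,2$, $x\in[l,b)$, and $V_0(b)=\inf_{\pi\in\Pi_{b,0}}V_0^\pi(b)$. The functions $V_1,V_2$ are Lipschitz on $[l,b)$ and are extended to $b$ by continuity. **Operators.** For $i=1,2$, $$\mathcal L_i(u)(x)=\sigma_iu'(x)-(\lambda+q)u(x)+\lambda\int_0^{x-l}u(x-\alpha)dF(\alpha)+\lambda\int_{x-l}^\infty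 p(\alpha-x+l)dF(\alpha)+\lambda u(l)(1-F(x-l))+h_i(x),$$ where the integral $\int_0^{x-l}$ includes the endpoint $\alpha=x-l$ and $\int_{x-l}^\infty$ excludes it. **Viscosity solutions.** Let $\{i,j\}=\{1,2\}$, $x\in[l,b)$. A Lipschitz function $\underline u_i:[l,b]\to\mathbb R$ is a viscosity subsolution at $x$ if every continuously differentiable $\psi_i:[l,b]\to\mathbb R$ with $\psi_i(x)=\underline u_i(x)$ such that $\underline u_i-\psi_i$ attains its minimum at $x$ satisfies $\min\{\mathcal L_i(\psi_i)(x),V_j(x)+K_{ij}-\underline u_i(x)\}\le0$. A Lipschitz function $\overline u_i:[l,b]\to\mathbb R$ is a viscosity supersolution at $x$ if every continuously differentiable $\varphi_i:[l,b]\to\mathbb R$ with $\varphi_i(x)=\overline u_i(x)$ such that $\overline u_i-\varphi_i$ attains its maximum at $x$ satisfies $\min\{\mathcal L_i(\varphi_i)(x),V_j(x)+K_{ij}-\overline u_i(x)\}\ge0$. A viscosity solution at $x$ is a function that is both.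
   Formalization: Two conditions are added, without which the claim can fail: each h_i is right-continuous at its discontinuities, and the expected penalty, the integral of p(α-x+l) dF(α) over α>x-l, is right-continuous in x on [l,b) (automatic if F has no atoms or p is left-continuous). *)

theory Defs
  imports "HOL-Probability.Probability"
begin

text \<open>
  Phases are the natural numbers 0, 1, 2. Demands are numbered from 1: \<open>arrival n\<close> is the time of
  the \<open>n\<close>-th demand and \<open>demand n\<close> its size; \<open>arrival 0 = 0\<close> is a convention and \<open>demand 0\<close> is never
  used. The cost \<open>h\<^sub>0(b)\<close> is stored as \<open>hold 0 cap\<close>.
\<close>

record 'a inventory =
  sample :: "'a measure"
  low :: real
  cap :: real
  rate :: "nat \<Rightarrow> real"
  disc :: real
  intensity :: real
  arrival :: "nat \<Rightarrow> 'a \<Rightarrow> real"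
  demand :: "nat \<Rightarrow> 'a \<Rightarrow> real"
  hold :: "nat \<Rightarrow> real \<Rightarrow> real"
  penalty :: "real \<Rightarrow> real"
  switch :: "nat \<Rightarrow> nat \<Rightarrow> real"

definition demand_law :: "'a inventory \<Rightarrow> real measure" where
  "demand_law m = distr (sample m) borel (demand m 1)"

definition expected_penalty :: "'a inventory \<Rightarrow> real \<Rightarrow> real" where
  "expected_penalty m x =
     (LINT \<alpha>:{x - low m<..}|demand_law m. penalty m (\<alpha> - x + low m))"


subsection \<open>Standing assumptions\<close>

text \<open>
  The Poisson process is given by its arrival times: the interarrival times are independent and
  exponentially distributed, and together with the demand sizes they form an independent family.

  \<open>hold_piecewise_lipschitz\<close> asks for the Lipschitz estimate on pieces \<open>[d, d')\<close> that contain their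
  left end point. Since the inventory crosses a level below capacity instantaneously and upwards,
  the optimal costs do not depend on the value of \<open>h\<^sub>i\<close> at a jump, but the operator at the jump does;
  it sees the correct value exactly when \<open>h\<^sub>i\<close> is right-continuous there. \<open>penalty_right_continuous\<close>
  is the corresponding condition for the other term of the operator that may jump. It holds
  automatically if the distribution of the demands has no atoms, or if the penalty is
  left-continuous, but not for every non-decreasing penalty.
\<close>

locale production_inventory =
  fixes m :: "'a inventory"
  assumes prob_space_sample: "prob_space (sample m)"
    and levels: "low m \<le> 0" "0 < cap m"
    and rates: "rate m 0 = 0" "0 < rate m 2" "rate m 2 < rate m 1"
    and disc_pos: "0 < disc m"
    and intensity_pos: "0 < intensity m"
    and arrival_paths: "\<forall>\<omega>\<in>space (sample m). arrival m 0 \<omega> = 0 \<and>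
          strict_mono (\<lambda>n. arrival m n \<omega>) \<and> filterlim (\<lambda>n. arrival m n \<omega>) at_top sequentially"
    and interarrival_exponential: "\<forall>n. distributed (sample m) lborel
          (\<lambda>\<omega>. arrival m (Suc n) \<omega> - arrival m n \<omega>) (exponential_density (intensity m))"
    and demand_pos: "\<forall>n\<ge>1. \<forall>\<omega>\<in>space (sample m). 0 < demand m n \<omega>"
    and demand_identically_distributed:
          "\<forall>n\<ge>1. distr (sample m) borel (demand m n) = demand_law m"
    and independent: "prob_space.indep_vars (sample m) (\<lambda>_. borel)
          (\<lambda>k. case k of Inl n \<Rightarrow> \<lambda>\<omega>. arrival m (Suc n) \<omega> - arrival m n \<omega>
                       | Inr n \<Rightarrow> demand m (Suc n)) (UNIV :: (nat + nat) set)"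
    and demand_finite_mean: "integrable (demand_law m) (\<lambda>y. y)"
    and hold_nonneg: "\<forall>i\<in>{1, 2}. \<forall>x\<in>{low m..<cap m}. 0 \<le> hold m i x"
    and hold_bounded: "\<forall>i\<in>{1, 2}. bounded (hold m i ` {low m..<cap m})"
    and hold_piecewise_lipschitz: "\<exists>c. \<forall>i\<in>{1, 2}. \<exists>D. finite D \<and>
          (\<forall>x\<in>{low m..<cap m}. \<forall>y\<in>{low m..<cap m}. x < y \<longrightarrow> {x<..y} \<inter> D = {} \<longrightarrow>
             \<bar>hold m i x - hold m i y\<bar> \<le> c * \<bar>x - y\<bar>)"
    and hold_cap_nonneg: "0 \<le> hold m 0 (cap m)"
    and penalty_nonneg: "\<forall>y\<ge>0. 0 \<le> penalty m y"
    and penalty_mono: "mono_on {0..} (penalty m)"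
    and penalty_integrable: "set_integrable (demand_law m) {0..} (penalty m)"
    and penalty_right_continuous:
          "\<forall>x\<in>{low m..<cap m}. continuous (at_right x) (expected_penalty m)"
    and switch_nonneg: "\<forall>i\<in>{0, 1, 2}. \<forall>j\<in>{0, 1, 2}. i \<noteq> j \<longrightarrow> 0 \<le> switch m i j"
    and switch_triangle: "\<forall>i j. {i, j} = {1, 2} \<longrightarrow> switch m 0 i \<le> switch m 0 j + switch m j i"
    and switch_pos: "0 < switch m 1 2 + switch m 2 1"


subsection \<open>Demand process and filtration\<close>

definition demand_count :: "'a inventory \<Rightarrow> real \<Rightarrow> 'a \<Rightarrow> nat" where
  "demand_count m t \<omega> = card {n. 1 \<le> n \<and> arrival m n \<omega> \<le> t}"

definition demand_process :: "'a inventory \<Rightarrow> real \<Rightarrow> 'a \<Rightarrow> real" where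
  "demand_process m t \<omega> = (\<Sum>n = 1..demand_count m t \<omega>. demand m n \<omega>)"

text \<open>Time is indexed by \<^typ>\<open>ennreal\<close> so that stopping times may be infinite.\<close>

definition demand_filtration :: "'a inventory \<Rightarrow> ennreal \<Rightarrow> 'a measure" where
  "demand_filtration m t = sigma (space (sample m))
     {demand_process m s -` B \<inter> space (sample m) | s B.
        0 \<le> s \<and> ennreal s \<le> t \<and> B \<in> sets borel}"


subsection \<open>Strategies\<close>

record 'a strategy =
  stime :: "nat \<Rightarrow> 'a \<Rightarrow> ennreal"
  sphase :: "nat \<Rightarrow> 'a \<Rightarrow> nat"

definition phase_at :: "'a strategy \<Rightarrow> 'a \<Rightarrow> real \<Rightarrow> nat" where
  "phase_at \<pi> \<omega> t =
     sphase \<pi> (THE k. stime \<pi> k \<omega> \<le> ennreal t \<and> ennreal t < stime \<pi> (Suc k) \<omega>) \<omega>"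

definition produced :: "'a inventory \<Rightarrow> 'a strategy \<Rightarrow> 'a \<Rightarrow> real \<Rightarrow> real \<Rightarrow> real" where
  "produced m \<pi> \<omega> s t = (LINT u:{s..t}|lborel. rate m (phase_at \<pi> \<omega> u))"

text \<open>
  \<open>level_after\<close> is the inventory level at \<open>arrival n\<close> (after the jump), and \<open>level_before\<close> the left
  limit at \<open>arrival (n + 1)\<close>.
\<close>

primrec level_after :: "'a inventory \<Rightarrow> real \<Rightarrow> 'a strategy \<Rightarrow> 'a \<Rightarrow> nat \<Rightarrow> real" where
  "level_after m x \<pi> \<omega> 0 = x"
| "level_after m x \<pi> \<omega> (Suc n) =
     (let z = level_after m x \<pi> \<omega> n + produced m \<pi> \<omega> (arrival m n \<omega>) (arrival m (Suc n) \<omega>)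
      in z - min (demand m (Suc n) \<omega>) (z - low m))"

definition level_before :: "'a inventory \<Rightarrow> real \<Rightarrow> 'a strategy \<Rightarrow> 'a \<Rightarrow> nat \<Rightarrow> real" where
  "level_before m x \<pi> \<omega> n =
     level_after m x \<pi> \<omega> n + produced m \<pi> \<omega> (arrival m n \<omega>) (arrival m (Suc n) \<omega>)"

definition level :: "'a inventory \<Rightarrow> real \<Rightarrow> 'a strategy \<Rightarrow> 'a \<Rightarrow> real \<Rightarrow> real" where
  "level m x \<pi> \<omega> t =
     level_after m x \<pi> \<omega> (demand_count m t \<omega>)
       + produced m \<pi> \<omega> (arrival m (demand_count m t \<omega>) \<omega>) t"

definition strategy_path :: "nat \<Rightarrow> 'a strategy \<Rightarrow> 'a \<Rightarrow> bool" where
  "strategy_path i \<pi> \<omega> \<longleftrightarrow>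
     stime \<pi> 0 \<omega> = 0 \<and> sphase \<pi> 0 \<omega> = i \<and>
     (\<forall>k. stime \<pi> k \<omega> \<le> stime \<pi> (Suc k) \<omega>) \<and>
     (\<forall>k\<ge>1. stime \<pi> k \<omega> < \<infinity> \<longrightarrow> stime \<pi> k \<omega> < stime \<pi> (Suc k) \<omega>) \<and>
     (\<forall>t. finite {k. stime \<pi> k \<omega> \<le> ennreal t}) \<and>
     (\<forall>k. stime \<pi> (Suc k) \<omega> < \<infinity> \<longrightarrow> sphase \<pi> (Suc k) \<omega> \<noteq> sphase \<pi> k \<omega>)"

text \<open>
  The phase process is right-continuous, so its vanishing when the level is \<open>b\<close> means that reaching
  \<open>b\<close> in phase 1 or 2 at time \<open>t\<close> forces a switch to phase 0 at \<open>t\<close>.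
\<close>

definition admissible_path :: "'a inventory \<Rightarrow> real \<Rightarrow> 'a strategy \<Rightarrow> 'a \<Rightarrow> bool" where
  "admissible_path m x \<pi> \<omega> \<longleftrightarrow>
     (\<forall>t\<ge>0. level m x \<pi> \<omega> t < cap m \<longrightarrow> phase_at \<pi> \<omega> t \<in> {1, 2}) \<and>
     (\<forall>t\<ge>0. level m x \<pi> \<omega> t = cap m \<longrightarrow> phase_at \<pi> \<omega> t = 0) \<and>
     (\<forall>k. stime \<pi> k \<omega> < \<infinity> \<and> sphase \<pi> k \<omega> = 0 \<longrightarrow>
        stime \<pi> (Suc k) \<omega>
          = ennreal (arrival m (Suc (demand_count m (enn2real (stime \<pi> k \<omega>)) \<omega>)) \<omega>) \<and>
        sphase \<pi> (Suc k) \<omega> \<in> {1, 2})"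

definition admissible :: "'a inventory \<Rightarrow> real \<Rightarrow> nat \<Rightarrow> 'a strategy set" where
  "admissible m x i = {\<pi>.
     (\<forall>k. stopping_time (demand_filtration m) (stime \<pi> k)) \<and>
     (\<forall>k. sphase \<pi> k \<in>
        filtration.pre_sigma (space (sample m)) (demand_filtration m) (stime \<pi> k)
          \<rightarrow>\<^sub>M count_space {0, 1, 2}) \<and>
     (AE \<omega> in sample m. strategy_path i \<pi> \<omega> \<and> admissible_path m x \<pi> \<omega>)}"


subsection \<open>Cost functions\<close>

definition discount :: "'a inventory \<Rightarrow> ennreal \<Rightarrow> real" where
  "discount m t = (if t = \<infinity> then 0 else exp (- disc m * enn2real t))"

text \<open>All costs are non-negative, so the cost of a strategy is a possibly infinite number.\<close>

definition cost :: "'a inventory \<Rightarrow> real \<Rightarrow> 'a strategy \<Rightarrow> ennreal" where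
  "cost m x \<pi> =
     (\<integral>\<^sup>+\<omega>. (\<integral>\<^sup>+t\<in>{0..}. ennreal (exp (- disc m * t)
          * hold m (phase_at \<pi> \<omega> t) (level m x \<pi> \<omega> t)) \<partial>lborel) \<partial>sample m)
   + (\<integral>\<^sup>+\<omega>. (\<Sum>k. ennreal (discount m (stime \<pi> (Suc k) \<omega>)
          * switch m (sphase \<pi> k \<omega>) (sphase \<pi> (Suc k) \<omega>))) \<partial>sample m)
   + (\<integral>\<^sup>+\<omega>. (\<Sum>n. ennreal (exp (- disc m * arrival m (Suc n) \<omega>)
          * (if level_before m x \<pi> \<omega> n - low m < demand m (Suc n) \<omega>
             then penalty m (demand m (Suc n) \<omega> - level_before m x \<pi> \<omega> n + low m)
             else 0))) \<partial>sample m)"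

text \<open>
  Meaningful for \<open>x \<in> [l, b)\<close> and \<open>i \<in> {1, 2}\<close>, where the infimum is finite, and for \<open>x = b\<close>, \<open>i = 0\<close>.
\<close>

definition optimal_cost :: "'a inventory \<Rightarrow> nat \<Rightarrow> real \<Rightarrow> real" where
  "optimal_cost m i x = enn2real (INF \<pi>\<in>admissible m x i. cost m x \<pi>)"

definition optimal_cost_ext :: "'a inventory \<Rightarrow> nat \<Rightarrow> real \<Rightarrow> real" where
  "optimal_cost_ext m i x =
     (if x = cap m then Lim (at_left (cap m)) (optimal_cost m i) else optimal_cost m i x)"


subsection \<open>The operator and viscosity solutions\<close>

definition hjb_op :: "'a inventory \<Rightarrow> nat \<Rightarrow> (real \<Rightarrow> real) \<Rightarrow> real \<Rightarrow> real" where
  "hjb_op m i u x =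
     rate m i * vector_derivative u (at x within {low m..cap m})
     - (intensity m + disc m) * u x
     + intensity m * (LINT \<alpha>:{0..x - low m}|demand_law m. u (x - \<alpha>))
     + intensity m * expected_penalty m x
     + intensity m * u (low m) * (1 - cdf (demand_law m) (x - low m))
     + hold m i x"

definition C1_on :: "real set \<Rightarrow> (real \<Rightarrow> real) \<Rightarrow> bool" where
  "C1_on S f \<longleftrightarrow>
     (\<exists>D. (\<forall>x\<in>S. (f has_vector_derivative D x) (at x within S)) \<and> continuous_on S D)"

definition viscosity_subsolution_at ::
    "'a inventory \<Rightarrow> nat \<Rightarrow> nat \<Rightarrow> (real \<Rightarrow> real) \<Rightarrow> real \<Rightarrow> bool" where
  "viscosity_subsolution_at m i j u x \<longleftrightarrow>
     (\<exists>L. L-lipschitz_on {low m..cap m} u) \<and>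
     (\<forall>\<psi>. C1_on {low m..cap m} \<psi> \<and> \<psi> x = u x \<and>
        (\<forall>y\<in>{low m..cap m}. u x - \<psi> x \<le> u y - \<psi> y) \<longrightarrow>
        min (hjb_op m i \<psi> x) (optimal_cost_ext m j x + switch m i j - u x) \<le> 0)"

definition viscosity_supersolution_at ::
    "'a inventory \<Rightarrow> nat \<Rightarrow> nat \<Rightarrow> (real \<Rightarrow> real) \<Rightarrow> real \<Rightarrow> bool" where
  "viscosity_supersolution_at m i j u x \<longleftrightarrow>
     (\<exists>L. L-lipschitz_on {low m..cap m} u) \<and>
     (\<forall>\<phi>. C1_on {low m..cap m} \<phi> \<and> \<phi> x = u x \<and>
        (\<forall>y\<in>{low m..cap m}. u y - \<phi> y \<le> u x - \<phi> x) \<longrightarrow>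
        0 \<le> min (hjb_op m i \<phi> x) (optimal_cost_ext m j x + switch m i j - u x))"

definition viscosity_solution_at ::
    "'a inventory \<Rightarrow> nat \<Rightarrow> nat \<Rightarrow> (real \<Rightarrow> real) \<Rightarrow> real \<Rightarrow> bool" where
  "viscosity_solution_at m i j u x \<longleftrightarrow>
     viscosity_subsolution_at m i j u x \<and> viscosity_supersolution_at m i j u x"

end

theory Submission
  imports Defs
begin

text \<open>
  The optimal cost is identified without a dynamic programming principle. Let \<open>val\<close> be the largest pair
  of functions that satisfies the integrated form of the inequalities of the Hamilton-Jacobi-Bellman
  equation: \<open>u\<^sub>i \<le> u\<^sub>j + K\<^sub>i\<^sub>j\<close>, and from a level \<open>x\<close> it does not pay to produce at rate \<open>\<sigma>\<^sub>i\<close> up to a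
  level \<open>y\<close> unless a demand comes first. By maximality \<open>val\<close> is Lipschitz, and the second inequality is an
  equality wherever switching is strictly suboptimal.

  Along any admissible strategy the discounted value of the state, added to the costs paid so far, does
  not decrease in the mean, so \<open>val\<close> bounds all costs from below. Switching as soon as the gain from
  waiting drops to a small \<open>e\<close> keeps the state where the equality holds; as \<open>K\<^sub>1\<^sub>2 + K\<^sub>2\<^sub>1 > 0\<close>, switches
  are separated and the expected loss is \<open>O(e)\<close>. Hence \<open>val\<close> is the optimal cost, and dividing the
  inequality, or equality, over \<open>[x, r]\<close> by \<open>r - x\<close> gives the viscosity property.
\<close>

text \<open>Pasting strategies together would need measurable selection; inequalities between
  functions of one real variable that are stable under suprema replace it. Up to the next demand a
  strategy is a function of the past and of the elapsed time, so that demand can be integrated out.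
  It then acts as killing at rate \<open>intensity m\<close>, and the operator discounts at
  \<open>intensity m + disc m\<close>, whereas costs on a path are discounted at
  \<open>disc m\<close> alone. The inequalities are therefore converted to the smaller rate, which
  creates a running term \<open>intensity m * val\<close>; by the compensator formula it has the
  same mean as the value just before the next demand and cancels. At capacity nothing is decided
  until the next demand, so a single number, \<open>idle\<close>, represents phase 0. The class of
  subsolutions carries an explicit bound \<open>val_max\<close>, chosen so that every modification
  used in a maximality argument stays in the class. The final division by \<open>r - x\<close>
  involves right-hand limits only, because the level moves upwards between demands; this is the
  origin of the two right-continuity conditions.\<close>

declare One_nat_def [simp del]

section \<open>Demand law, penalty and holding cost\<close>

context production_inventory
begin

abbreviation lo where "lo \<equiv> low m"
abbreviation hi where "hi \<equiv> cap m"
abbreviation dlaw where "dlaw \<equiv> demand_law m"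

lemma lo_less_hi: "lo < hi"
  using levels by linarith

lemma rate_pos: "c \<in> {1, 2} \<Longrightarrow> 0 < rate m c"
  and rate_ge: "c \<in> {1, 2} \<Longrightarrow> rate m 2 \<le> rate m c"
  and rate_le: "c \<in> {1, 2} \<Longrightarrow> rate m c \<le> rate m 1"
  using rates by auto

sublocale P: prob_space "sample m"
  by (rule prob_space_sample)

lemma demand_measurable [measurable]: "demand m (Suc n) \<in> borel_measurable (sample m)"
proof -
  have "(case Inr n of Inl n \<Rightarrow> \<lambda>\<omega>. arrival m (Suc n) \<omega> - arrival m n \<omega> | Inr n \<Rightarrow> demand m (Suc n))
          \<in> borel_measurable (sample m)"
    using independent unfolding P.indep_vars_def by blast
  then show ?thesis by simp
qed

lemma gap_measurable [measurable]:
  "(\<lambda>\<omega>. arrival m (Suc n) \<omega> - arrival m n \<omega>) \<in> borel_measurable (sample m)"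
  using interarrival_exponential by (auto simp: distributed_def)

lemma sets_dlaw [measurable_cong, simp]: "sets dlaw = sets borel"
  by (simp add: demand_law_def)

lemma space_dlaw [simp]: "space dlaw = UNIV"
  by (simp add: demand_law_def)

sublocale law: prob_space dlaw
  unfolding demand_law_def using demand_measurable[of 0] by (intro P.prob_space_distr) (simp add: One_nat_def)

lemma AE_dlaw_pos: "AE \<alpha> in dlaw. 0 < \<alpha>"
  unfolding demand_law_def using demand_measurable[of 0] demand_pos
  by (subst AE_distr_iff) (auto simp: One_nat_def)

text \<open>Continues the penalty constantly below 0, where nothing is assumed about it, so that it
  is monotone and hence Borel on the whole line. Demands are almost surely positive, so integrals
  against \<open>dlaw\<close> do not notice the change.\<close>

definition pen :: "real \<Rightarrow> real" where
  "pen z = penalty m (max z 0)"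

lemma pen_nonneg: "0 \<le> pen z"
  using penalty_nonneg by (simp add: pen_def)

lemma pen_mono: "z \<le> z' \<Longrightarrow> pen z \<le> pen z'"
  using penalty_mono unfolding pen_def by (rule mono_onD) auto

lemma pen_measurable [measurable]: "pen \<in> borel_measurable borel"
  by (intro borel_measurable_mono monoI pen_mono)

lemma pen_integrable: "integrable dlaw pen"
proof -
  have "integrable dlaw (\<lambda>\<alpha>. indicator {0..} \<alpha> *\<^sub>R penalty m \<alpha>)"
    using penalty_integrable unfolding set_integrable_def .
  moreover have "AE \<alpha> in dlaw. indicator {0..} \<alpha> *\<^sub>R penalty m \<alpha> = pen \<alpha>"
    using AE_dlaw_pos by eventually_elim (auto simp: pen_def)
  ultimately show ?thesis
    by (intro integrable_cong_AE_imp[of dlaw _ pen]) auto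
qed

text \<open>The integrand of \<open>expected_penalty\<close>, kept as a function of level and demand
  because costs along a path need it before the demand is averaged out.\<close>

definition shortage :: "real \<Rightarrow> real \<Rightarrow> real" where
  "shortage y \<alpha> = (if y - lo < \<alpha> then pen (\<alpha> - y + lo) else 0)"

lemma shortage_measurable [measurable]: "case_prod shortage \<in> borel_measurable (borel \<Otimes>\<^sub>M borel)"
  unfolding shortage_def split_beta' by measurable

lemma shortage_measurable' [measurable]: "shortage y \<in> borel_measurable borel"
  unfolding shortage_def by measurable

lemma shortage_nonneg: "0 \<le> shortage y \<alpha>"
  by (simp add: shortage_def pen_nonneg)

lemma shortage_le: "lo \<le> y \<Longrightarrow> shortage y \<alpha> \<le> pen \<alpha>"
  by (auto simp: shortage_def pen_nonneg intro!: pen_mono)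

lemma shortage_integrable: "lo \<le> y \<Longrightarrow> integrable dlaw (shortage y)"
  by (rule Bochner_Integration.integrable_bound[OF pen_integrable])
     (auto intro!: AE_I2 simp: shortage_nonneg pen_nonneg shortage_le)

lemma expected_penalty_eq: "expected_penalty m y = (\<integral>\<alpha>. shortage y \<alpha> \<partial>dlaw)"
  unfolding expected_penalty_def set_lebesgue_integral_def
  by (rule Bochner_Integration.integral_cong) (auto simp: shortage_def pen_def indicator_def)

lemma expected_penalty_measurable [measurable]: "expected_penalty m \<in> borel_measurable borel"
  unfolding expected_penalty_eq[abs_def] by (rule law.borel_measurable_lebesgue_integral) simp

definition pen_mean :: real where
  "pen_mean = (\<integral>\<alpha>. pen \<alpha> \<partial>dlaw)"

lemma pen_mean_nonneg: "0 \<le> pen_mean"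
  unfolding pen_mean_def by (simp add: pen_nonneg)

lemma expected_penalty_nonneg: "0 \<le> expected_penalty m y"
  unfolding expected_penalty_eq by (simp add: shortage_nonneg)

lemma expected_penalty_le: "lo \<le> y \<Longrightarrow> expected_penalty m y \<le> pen_mean"
  unfolding expected_penalty_eq pen_mean_def
  by (intro integral_mono shortage_integrable pen_integrable shortage_le)

text \<open>Cut off outside \<open>[l, b)\<close>, where nothing is assumed about the holding cost.\<close>

definition run :: "nat \<Rightarrow> real \<Rightarrow> real" where
  "run c y = (if c = 0 then hold m 0 hi else if lo \<le> y \<and> y < hi then hold m c y else 0)"

lemma run_nonneg: "c \<in> {0, 1, 2} \<Longrightarrow> 0 \<le> run c y"
  using hold_nonneg hold_cap_nonneg by (auto simp: run_def)

text \<open>Merges the exceptional sets of both phases and makes the constant nonnegative. The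
  segment \<open>{x<..y}\<close> may start at an exceptional point but may neither cross one nor end
  at one.\<close>

lemma run_right_lipschitz:
  obtains C D where "0 \<le> C" "finite D"
    "\<And>c x y. c \<in> {1, 2} \<Longrightarrow> x \<in> {lo..<hi} \<Longrightarrow> y \<in> {lo..<hi} \<Longrightarrow> x < y \<Longrightarrow> {x<..y} \<inter> D = {} \<Longrightarrow>
       \<bar>run c x - run c y\<bar> \<le> C * \<bar>x - y\<bar>"
proof -
  obtain C where C: "\<forall>i\<in>{1, 2}. \<exists>D. finite D \<and>
          (\<forall>x\<in>{lo..<hi}. \<forall>y\<in>{lo..<hi}. x < y \<longrightarrow> {x<..y} \<inter> D = {} \<longrightarrow>
             \<bar>hold m i x - hold m i y\<bar> \<le> C * \<bar>x - y\<bar>)"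
    using hold_piecewise_lipschitz by (rule exE)
  obtain D1 where D1: "finite D1" "\<forall>x\<in>{lo..<hi}. \<forall>y\<in>{lo..<hi}. x < y \<longrightarrow> {x<..y} \<inter> D1 = {} \<longrightarrow>
             \<bar>hold m 1 x - hold m 1 y\<bar> \<le> C * \<bar>x - y\<bar>"
    using bspec[OF C, of 1] by auto
  obtain D2 where D2: "finite D2" "\<forall>x\<in>{lo..<hi}. \<forall>y\<in>{lo..<hi}. x < y \<longrightarrow> {x<..y} \<inter> D2 = {} \<longrightarrow>
             \<bar>hold m 2 x - hold m 2 y\<bar> \<le> C * \<bar>x - y\<bar>"
    using bspec[OF C, of 2] by auto
  show thesis
  proof (rule that[of "\<bar>C\<bar>" "D1 \<union> D2"])
    fix c :: nat and x y :: real
    assume *: "c \<in> {1, 2}" "x \<in> {lo..<hi}" "y \<in> {lo..<hi}" "x < y" "{x<..y} \<inter> (D1 \<union> D2) = {}"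
    then have "{x<..y} \<inter> D1 = {}" "{x<..y} \<inter> D2 = {}" by auto
    then have "\<bar>hold m c x - hold m c y\<bar> \<le> C * \<bar>x - y\<bar>"
      using *(1-4) D1(2) D2(2) by blast
    also have "\<dots> \<le> \<bar>C\<bar> * \<bar>x - y\<bar>" by (intro mult_right_mono) auto
    finally show "\<bar>run c x - run c y\<bar> \<le> \<bar>C\<bar> * \<bar>x - y\<bar>"
      using * by (auto simp: run_def)
  qed (use D1 D2 in auto)
qed

text \<open>Immediately to the right of \<open>x\<close> the segment \<open>{x<..y}\<close> misses
  the finite exceptional set even if \<open>x\<close> itself belongs to it.\<close>

lemma run_continuous_right:
  assumes "c \<in> {1, 2}" "x \<in> {lo..<hi}"
  shows "continuous (at_right x) (run c)"
proof -
  obtain C D where CD: "0 \<le> C" "finite D"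
    "\<And>c x y. c \<in> {1, 2} \<Longrightarrow> x \<in> {lo..<hi} \<Longrightarrow> y \<in> {lo..<hi} \<Longrightarrow> x < y \<Longrightarrow> {x<..y} \<inter> D = {} \<Longrightarrow>
       \<bar>run c x - run c y\<bar> \<le> C * \<bar>x - y\<bar>"
    by (rule run_right_lipschitz) (rule that, assumption+)
  have "eventually (\<lambda>y. {x<..y} \<inter> D = {}) (at_right x)"
  proof -
    have "open (- (D - {x}))"
      using CD(2) by (intro open_Compl finite_imp_closed) simp
    then obtain e where e: "0 < e" "ball x e \<subseteq> - (D - {x})"
      by (metis ComplI Diff_iff openE singletonI)
    have "{x<..y} \<inter> D = {}" if "y < x + e" for y
    proof -
      have "z \<in> ball x e" if "z \<in> {x<..y}" for z
        using that \<open>y < x + e\<close> by (auto simp: dist_real_def)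
      then show ?thesis using e(2) by fastforce
    qed
    then show ?thesis
      unfolding eventually_at_right_field using e(1) by (intro exI[of _ "x + e"]) auto
  qed
  moreover have "eventually (\<lambda>y. y \<in> {x<..<hi}) (at_right x)"
    using assms(2) by (intro eventually_at_right_real) auto
  ultimately have "eventually (\<lambda>y. norm (run c y - run c x) \<le> C * \<bar>x - y\<bar>) (at_right x)"
  proof eventually_elim
    case (elim y)
    then show ?case using CD(3)[of c x y] assms by (auto simp: abs_minus_commute)
  qed
  moreover have "((\<lambda>y. C * \<bar>x - y\<bar>) \<longlongrightarrow> 0) (at_right x)"
    by (auto intro!: tendsto_eq_intros)
  ultimately have "((\<lambda>y. run c y - run c x) \<longlongrightarrow> 0) (at_right x)"
    by (rule Lim_null_comparison)
  then show ?thesis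
    unfolding continuous_within by (rule LIM_zero_cancel)
qed

lemma run_measurable [measurable]:
  assumes "c \<in> {0, 1, 2}"
  shows "run c \<in> borel_measurable borel"
proof (cases "c = 0")
  case True
  then show ?thesis by (simp add: run_def[abs_def])
next
  case False
  obtain C D where CD: "0 \<le> C" "finite D"
    "\<And>c x y. c \<in> {1, 2} \<Longrightarrow> x \<in> {lo..<hi} \<Longrightarrow> y \<in> {lo..<hi} \<Longrightarrow> x < y \<Longrightarrow> {x<..y} \<inter> D = {} \<Longrightarrow>
       \<bar>run c x - run c y\<bar> \<le> C * \<bar>x - y\<bar>"
    by (rule run_right_lipschitz) (rule that, assumption+)
  \<comment> \<open>The end points join the exceptional set because the cut-off in
    \<open>run\<close> may jump there. Off this finite set \<open>run c\<close> is continuous, which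
    suffices for measurability.\<close>
  let ?X = "insert lo (insert hi D)"
  have op: "open (- ?X)" using CD(2) by (intro open_Compl finite_imp_closed) simp
  have "isCont (run c) x" if xX: "x \<in> - ?X" for x
  proof -
    obtain e where e: "0 < e" "ball x e \<subseteq> - ?X"
      using openE[OF op xX] by blast
    have seg: "{y<..z} \<inter> ?X = {}" if "y \<in> ball x e" "z \<in> ball x e" for y z
    proof -
      have "w \<in> ball x e" if "w \<in> {y<..z}" for w
        using that \<open>y \<in> _\<close> \<open>z \<in> _\<close> by (auto simp: dist_real_def abs_less_iff)
      then show ?thesis using e(2) by fastforce
    qed
    have side: "(y \<in> {lo..<hi}) = (x \<in> {lo..<hi})" if "y \<in> ball x e" for y
    proof -
      have "x \<in> ball x e" using e(1) by simp
      then have "lo \<notin> {y<..x}" "hi \<notin> {y<..x}" "lo \<notin> {x<..y}" "hi \<notin> {x<..y}" "x \<noteq> lo" "x \<noteq> hi" "y \<noteq> lo" "y \<noteq> hi"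
        using seg[of x y] seg[of y x] that e(2) by blast+
      then show ?thesis by auto
    qed
    have est: "norm (run c y - run c x) \<le> C * \<bar>x - y\<bar>" if "y \<in> ball x e" for y
    proof (cases "x \<in> {lo..<hi}")
      case True
      have "y \<in> {lo..<hi}" "x \<in> ball x e" "c \<in> {1, 2}"
        using side[OF that] True e(1) False assms by auto
      then show ?thesis
        using CD(3)[of c x y] CD(3)[of c y x] seg[of x y] seg[of y x] that True
        by (cases x y rule: linorder_cases) (auto simp: abs_minus_commute Int_insert_right)
    next
      case F: False
      then have "run c y = 0" "run c x = 0" using side[OF that] False by (auto simp: run_def)
      then show ?thesis using CD(1) by simp
    qed
    have "eventually (\<lambda>y. y \<in> ball x e) (at x)"
      using e(1) by (intro eventually_at_in_open') auto
    then have "eventually (\<lambda>y. norm (run c y - run c x) \<le> C * \<bar>x - y\<bar>) (at x)"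
      by eventually_elim (rule est)
    moreover have "((\<lambda>y. C * \<bar>x - y\<bar>) \<longlongrightarrow> 0) (at x)"
      by (auto intro!: tendsto_eq_intros)
    ultimately have "((\<lambda>y. run c y - run c x) \<longlongrightarrow> 0) (at x)"
      by (rule Lim_null_comparison)
    then show ?thesis unfolding isCont_def by (rule LIM_zero_cancel)
  qed
  then have "continuous_on (- ?X) (run c)" by (simp add: continuous_at_imp_continuous_on)
  then show ?thesis
    using CD(2) by (intro borel_measurable_continuous_countable_exceptions[of ?X]) (auto intro: countable_finite)
qed

definition run_max :: real where
  "run_max = (SOME B. 0 \<le> B \<and> (\<forall>c\<in>{0, 1, 2}. \<forall>y. run c y \<le> B))"

lemma run_max: "0 \<le> run_max" "c \<in> {0, 1, 2} \<Longrightarrow> run c y \<le> run_max"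
proof -
  obtain B1 where B1: "\<forall>y\<in>{lo..<hi}. norm (hold m 1 y) \<le> B1"
    using hold_bounded unfolding bounded_iff by auto
  obtain B2 where B2: "\<forall>y\<in>{lo..<hi}. norm (hold m 2 y) \<le> B2"
    using hold_bounded unfolding bounded_iff by auto
  have "\<exists>B. 0 \<le> B \<and> (\<forall>c\<in>{0, 1, 2}. \<forall>y. run c y \<le> B)"
  proof (intro exI[of _ "\<bar>B1\<bar> + \<bar>B2\<bar> + hold m 0 hi"] conjI ballI allI)
    fix c :: nat and y :: real
    assume "c \<in> {0, 1, 2}"
    then have "c = 0 \<or> c = 1 \<or> c = 2" by blast
    moreover have "hold m 1 y \<le> \<bar>B1\<bar> \<and> hold m 2 y \<le> \<bar>B2\<bar>" if "lo \<le> y" "y < hi"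
      using bspec[OF B1, of y] bspec[OF B2, of y] that by auto
    ultimately show "run c y \<le> \<bar>B1\<bar> + \<bar>B2\<bar> + hold m 0 hi"
      using hold_cap_nonneg abs_ge_zero[of B1] abs_ge_zero[of B2]
      by (elim disjE; cases "lo \<le> y \<and> y < hi") (simp_all add: run_def del: abs_ge_zero, linarith+)
  qed (use hold_cap_nonneg in simp)
  then have "0 \<le> run_max \<and> (\<forall>c\<in>{0, 1, 2}. \<forall>y. run c y \<le> run_max)"
    unfolding run_max_def by (rule someI_ex)
  then show "0 \<le> run_max" "c \<in> {0, 1, 2} \<Longrightarrow> run c y \<le> run_max"
    by (blast, blast)
qed

end


lemma set_integrable_bounded_real:
  fixes f :: "real \<Rightarrow> real"
  assumes [measurable]: "f \<in> borel_measurable borel" and "\<And>z. x \<le> z \<Longrightarrow> z \<le> y \<Longrightarrow> \<bar>f z\<bar> \<le> B"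
  shows "set_integrable lborel {x..y} f"
  unfolding set_integrable_def using assms(2)
  by (intro integrableI_bounded_set[where A = "{x..y}" and B = B]) (auto simp: indicator_def emeasure_lborel_Icc_eq)

lemma integrable_on_bounded_real:
  fixes f :: "real \<Rightarrow> real"
  assumes "f \<in> borel_measurable borel" and "\<And>z. x \<le> z \<Longrightarrow> z \<le> y \<Longrightarrow> \<bar>f z\<bar> \<le> B"
  shows "f integrable_on {x..y}"
  using set_borel_integral_eq_integral(1)[OF set_integrable_bounded_real[OF assms]] .

context production_inventory
begin

subsection \<open>The largest subsolution\<close>

text \<open>Cost to go just after a demand that was met in phase \<open>c\<close>. Phase 0 has to be
  left at a demand and is worth the cheaper of its two exits. In phases 1 and 2 an immediate switch
  need not be offered, since subsolutions satisfy the switching inequality.\<close>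

definition wt :: "(nat \<Rightarrow> real \<Rightarrow> real) \<Rightarrow> nat \<Rightarrow> real \<Rightarrow> real" where
  "wt u c z = (if c = 0 then min (switch m 0 1 + u 1 z) (switch m 0 2 + u 2 z) else u c z)"

definition jmp :: "(nat \<Rightarrow> real \<Rightarrow> real) \<Rightarrow> nat \<Rightarrow> real \<Rightarrow> real" where
  "jmp u c y = expected_penalty m y + (\<integral>\<alpha>. wt u c (max lo (y - \<alpha>)) \<partial>dlaw)"

text \<open>The part of the operator that contains neither the derivative nor the local discount
  term: on \<open>[lo, hi)\<close> and for \<open>c\<close> in \<open>{1, 2}\<close>, the operator
  applied to \<open>u c\<close> is \<open>rate m c * u' - tot * u + gain u c\<close>.\<close>

definition gain :: "(nat \<Rightarrow> real \<Rightarrow> real) \<Rightarrow> nat \<Rightarrow> real \<Rightarrow> real" where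
  "gain u c y = run c y + intensity m * jmp u c y"

abbreviation tot where "tot \<equiv> intensity m + disc m"

definition switch0 :: real where
  "switch0 = switch m 0 1 + switch m 0 2"

text \<open>Chosen such that \<open>(switch m 1 0 + switch m 2 0) * tot + gain_max = tot *
  val_max\<close>. Functions bounded by \<open>val_max\<close> then have a gain below
  \<open>tot * val_max\<close>, and neither collecting this gain nor entering phase 0 at capacity
  leads out of the bound.\<close>

definition val_max :: real where
  "val_max = ((switch m 1 0 + switch m 2 0) * tot + run_max + intensity m * (pen_mean + switch0)) / disc m"

definition gain_max :: real where
  "gain_max = run_max + intensity m * (pen_mean + switch0 + val_max)"

text \<open>The constant solution of \<open>tot * v = gain u 0 hi\<close>: at capacity the same gain
  is collected, discounted at rate \<open>tot\<close>, for ever.\<close>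

definition idle :: "(nat \<Rightarrow> real \<Rightarrow> real) \<Rightarrow> real" where
  "idle u = gain u 0 hi / tot"

text \<open>Time is measured by the level: \<open>dsc c y / dsc c x\<close> discounts from level \<open>y\<close> back to \<open>x\<close> at the combined
  rate of interest and of the next demand, \<open>fdsc c y / fdsc c x\<close> at the rate of interest alone.\<close>

definition dsc :: "nat \<Rightarrow> real \<Rightarrow> real" where
  "dsc c z = exp (- (tot * z / rate m c))"

definition bnd :: "(nat \<Rightarrow> real \<Rightarrow> real) \<Rightarrow> bool" where
  "bnd u \<longleftrightarrow> (\<forall>c\<in>{1, 2}. u c \<in> borel_measurable borel \<and> (\<forall>y. 0 \<le> u c y \<and> u c y \<le> val_max))"

text \<open>Gain collected while the level rises from \<open>x\<close> to \<open>y\<close> in phase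
  \<open>c\<close>; \<open>1 / rate m c\<close> converts level into time. Discounting refers to
  level 0 instead of \<open>x\<close>, so that contributions of adjacent intervals simply add
  up.\<close>

definition along :: "(nat \<Rightarrow> real \<Rightarrow> real) \<Rightarrow> nat \<Rightarrow> real \<Rightarrow> real \<Rightarrow> real" where
  "along u c x y = integral {x..y} (\<lambda>z. dsc c z * gain u c z / rate m c)"

text \<open>Each constraint bounds \<open>u\<close> from above by an expression that is monotone in
  \<open>u\<close>, and none contains a derivative; this makes the class stable under suprema. The
  last constraint prices the mandatory switch to phase 0 at capacity.\<close>

definition subval :: "(nat \<Rightarrow> real \<Rightarrow> real) \<Rightarrow> bool" where
  "subval u \<longleftrightarrow> bnd u \<and>
     (\<forall>i\<in>{1, 2}. \<forall>j\<in>{1, 2}. i \<noteq> j \<longrightarrow> (\<forall>y\<in>{lo..hi}. u i y \<le> u j y + switch m i j)) \<and>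
     (\<forall>i\<in>{1, 2}. \<forall>x y. lo \<le> x \<longrightarrow> x \<le> y \<longrightarrow> y \<le> hi \<longrightarrow>
        dsc i x * u i x \<le> along u i x y + dsc i y * u i y) \<and>
     (\<forall>i\<in>{1, 2}. u i hi \<le> switch m i 0 + idle u)"

lemma tot_pos: "0 < tot"
  using intensity_pos disc_pos by linarith

lemma switch_nn: "i \<in> {0, 1, 2} \<Longrightarrow> j \<in> {0, 1, 2} \<Longrightarrow> i \<noteq> j \<Longrightarrow> 0 \<le> switch m i j"
  using switch_nonneg by blast

lemma switch0_nonneg: "0 \<le> switch0"
  unfolding switch0_def using switch_nn[of 0 1] switch_nn[of 0 2] by simp

lemma val_max_nonneg: "0 \<le> val_max"
  unfolding val_max_def using switch_nn[of 1 0] switch_nn[of 2 0] run_max(1) pen_mean_nonneg switch0_nonneg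
    tot_pos intensity_pos disc_pos
  by (intro divide_nonneg_pos add_nonneg_nonneg mult_nonneg_nonneg) auto

lemma gain_max_nonneg: "0 \<le> gain_max"
  unfolding gain_max_def using run_max(1) pen_mean_nonneg switch0_nonneg val_max_nonneg intensity_pos
  by (intro add_nonneg_nonneg mult_nonneg_nonneg) auto

lemma val_max_eq: "(switch m 1 0 + switch m 2 0) * tot + gain_max = tot * val_max"
proof -
  have "disc m * val_max = (switch m 1 0 + switch m 2 0) * tot + run_max + intensity m * (pen_mean + switch0)"
    unfolding val_max_def using disc_pos by simp
  then show ?thesis unfolding gain_max_def by (simp add: algebra_simps)
qed

lemma gain_max_le: "gain_max \<le> tot * val_max"
proof -
  have "0 \<le> (switch m 1 0 + switch m 2 0) * tot"
    using switch_nn[of 1 0] switch_nn[of 2 0] tot_pos by (intro mult_nonneg_nonneg) auto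
  then show ?thesis using val_max_eq by linarith
qed

lemma dsc_pos [simp]: "0 < dsc c z"
  by (simp add: dsc_def)

lemma dsc_anti: "c \<in> {1, 2} \<Longrightarrow> x \<le> y \<Longrightarrow> dsc c y \<le> dsc c x"
  unfolding dsc_def using rate_pos[of c] tot_pos
  by (simp add: divide_right_mono mult_left_mono)

lemma dsc_measurable [measurable]: "dsc c \<in> borel_measurable borel"
  unfolding dsc_def[abs_def] by measurable

lemma dsc_integral:
  assumes c: "c \<in> {1, 2}" and "x \<le> y"
  shows "((\<lambda>z. dsc c z / rate m c) has_integral (dsc c x - dsc c y) / tot) {x..y}"
proof -
  have "((\<lambda>z. dsc c z / rate m c) has_integral (- dsc c y / tot) - (- dsc c x / tot)) {x..y}"
  proof (rule fundamental_theorem_of_calculus[OF assms(2)])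
    fix z
    have *: "((\<lambda>z. - exp (- (a * z / r)) / a) has_real_derivative exp (- (a * z / r)) / r) (at z within {x..y})"
      if "r \<noteq> 0" "a \<noteq> 0" for a r :: real
      using that by (auto intro!: derivative_eq_intros)
    have "((\<lambda>z. - dsc c z / tot) has_real_derivative dsc c z / rate m c) (at z within {x..y})"
      unfolding dsc_def using rate_pos[OF c] tot_pos by (intro *) auto
    then show "((\<lambda>z. - dsc c z / tot) has_vector_derivative dsc c z / rate m c) (at z within {x..y})"
      by (simp add: has_real_derivative_iff_has_vector_derivative)
  qed
  then show ?thesis by (simp add: diff_divide_distrib)
qed

lemma bndD: "bnd u \<Longrightarrow> c \<in> {1, 2} \<Longrightarrow> 0 \<le> u c y" "bnd u \<Longrightarrow> c \<in> {1, 2} \<Longrightarrow> u c y \<le> val_max"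
  "bnd u \<Longrightarrow> c \<in> {1, 2} \<Longrightarrow> u c \<in> borel_measurable borel"
  unfolding bnd_def by blast+

lemma wt_bounds:
  assumes "bnd u" "c \<in> {0, 1, 2}"
  shows "0 \<le> wt u c z" "wt u c z \<le> switch0 + val_max" "wt u c \<in> borel_measurable borel"
proof -
  have K: "0 \<le> switch m 0 1" "0 \<le> switch m 0 2" using switch_nn[of 0 1] switch_nn[of 0 2] by auto
  have u: "0 \<le> u 1 z" "0 \<le> u 2 z" "u 1 z \<le> val_max" "u 2 z \<le> val_max"
    using bndD[OF assms(1)] by auto
  have [measurable]: "u 1 \<in> borel_measurable borel" "u 2 \<in> borel_measurable borel"
    using bndD[OF assms(1)] by auto
  show "0 \<le> wt u c z" "wt u c z \<le> switch0 + val_max"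
    using K u assms(2) unfolding wt_def switch0_def by auto
  show "wt u c \<in> borel_measurable borel"
    using assms(2) unfolding wt_def[abs_def] by auto
qed

lemma wt_integrable:
  assumes "bnd u" "c \<in> {0, 1, 2}"
  shows "integrable dlaw (\<lambda>\<alpha>. wt u c (max lo (y - \<alpha>)))"
proof (rule law.integrable_const_bound)
  have [measurable]: "wt u c \<in> borel_measurable borel" by (rule wt_bounds(3)[OF assms])
  show "(\<lambda>\<alpha>. wt u c (max lo (y - \<alpha>))) \<in> borel_measurable dlaw" by measurable
  show "AE \<alpha> in dlaw. norm (wt u c (max lo (y - \<alpha>))) \<le> switch0 + val_max"
    using wt_bounds(1,2)[OF assms] by auto
qed

lemma jmp_bounds:
  assumes "bnd u" "c \<in> {0, 1, 2}"
  shows "0 \<le> jmp u c y" "lo \<le> y \<Longrightarrow> jmp u c y \<le> pen_mean + switch0 + val_max"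
proof -
  show "0 \<le> jmp u c y"
    unfolding jmp_def using expected_penalty_nonneg wt_bounds(1)[OF assms]
    by (intro add_nonneg_nonneg integral_nonneg_AE) auto
  have "(\<integral>\<alpha>. wt u c (max lo (y - \<alpha>)) \<partial>dlaw) \<le> (\<integral>\<alpha>. switch0 + val_max \<partial>dlaw)"
    using wt_bounds(2)[OF assms] by (intro integral_mono wt_integrable[OF assms]) auto
  then show "lo \<le> y \<Longrightarrow> jmp u c y \<le> pen_mean + switch0 + val_max"
    unfolding jmp_def using expected_penalty_le[of y] law.prob_space by simp
qed

lemma jmp_measurable:
  assumes "bnd u" "c \<in> {0, 1, 2}"
  shows "jmp u c \<in> borel_measurable borel"
proof -
  have [measurable]: "wt u c \<in> borel_measurable borel" by (rule wt_bounds(3)[OF assms])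
  have "(\<lambda>y. \<integral>\<alpha>. wt u c (max lo (y - \<alpha>)) \<partial>dlaw) \<in> borel_measurable borel"
    by (rule law.borel_measurable_lebesgue_integral) simp
  then show ?thesis unfolding jmp_def[abs_def] by measurable
qed

lemma gain_bounds:
  assumes "bnd u" "c \<in> {0, 1, 2}"
  shows "0 \<le> gain u c y" "lo \<le> y \<Longrightarrow> gain u c y \<le> gain_max"
  unfolding gain_def gain_max_def
  using run_nonneg[OF assms(2)] run_max(2)[OF assms(2)] jmp_bounds[OF assms] intensity_pos
  by (auto intro!: add_nonneg_nonneg mult_nonneg_nonneg add_mono mult_left_mono)

lemma gain_measurable:
  assumes "bnd u" "c \<in> {0, 1, 2}"
  shows "gain u c \<in> borel_measurable borel"
  unfolding gain_def[abs_def] using jmp_measurable[OF assms] run_measurable[OF assms(2)] by measurable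

lemma jmp_mono:
  assumes "bnd u" "bnd v" "\<And>c y. c \<in> {1, 2} \<Longrightarrow> y \<in> {lo..hi} \<Longrightarrow> u c y \<le> v c y"
    and "c \<in> {0, 1, 2}" "y \<le> hi"
  shows "jmp u c y \<le> jmp v c y"
proof -
  have "(\<integral>\<alpha>. wt u c (max lo (y - \<alpha>)) \<partial>dlaw) \<le> (\<integral>\<alpha>. wt v c (max lo (y - \<alpha>)) \<partial>dlaw)"
  proof (intro integral_mono_AE wt_integrable assms)
    show "AE \<alpha> in dlaw. wt u c (max lo (y - \<alpha>)) \<le> wt v c (max lo (y - \<alpha>))"
      using AE_dlaw_pos
    proof eventually_elim
      case (elim \<alpha>)
      then have "max lo (y - \<alpha>) \<in> {lo..hi}" using assms(5) lo_less_hi by auto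
      then have "\<And>c. c \<in> {1, 2} \<Longrightarrow> u c (max lo (y - \<alpha>)) \<le> v c (max lo (y - \<alpha>))"
        using assms(3) by blast
      then show ?case
        using assms(4) unfolding wt_def by (auto simp: min_le_iff_disj)
    qed
  qed
  then show ?thesis unfolding jmp_def by simp
qed

lemma gain_mono:
  assumes "bnd u" "bnd v" "\<And>c y. c \<in> {1, 2} \<Longrightarrow> y \<in> {lo..hi} \<Longrightarrow> u c y \<le> v c y"
    and "c \<in> {0, 1, 2}" "y \<le> hi"
  shows "gain u c y \<le> gain v c y"
  unfolding gain_def using jmp_mono[OF assms] intensity_pos by (auto intro!: mult_left_mono)

lemma along_integrable:
  assumes "bnd u" "c \<in> {1, 2}" "lo \<le> x"
  shows "(\<lambda>z. dsc c z * gain u c z / rate m c) integrable_on {x..y}"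
proof (rule integrable_on_bounded_real)
  have c: "c \<in> {0, 1, 2}" using assms by auto
  show "(\<lambda>z. dsc c z * gain u c z / rate m c) \<in> borel_measurable borel"
    using gain_measurable[OF assms(1) c] by measurable
  fix z assume "x \<le> z" "z \<le> y"
  then show "\<bar>dsc c z * gain u c z / rate m c\<bar> \<le> dsc c x * gain_max / rate m c"
    using gain_bounds[OF assms(1) c, of z] dsc_anti[OF assms(2), of x z] rate_pos[OF assms(2)] assms(3)
    by (auto simp: abs_mult less_imp_le[OF dsc_pos] intro!: divide_right_mono mult_mono)
qed

lemma along_bounds:
  assumes "bnd u" "c \<in> {1, 2}" "lo \<le> x" "x \<le> y"
  shows "0 \<le> along u c x y" "along u c x y \<le> gain_max * ((dsc c x - dsc c y) / tot)"
proof -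
  have c: "c \<in> {0, 1, 2}" using assms by auto
  note r = rate_pos[OF assms(2)]
  show "0 \<le> along u c x y"
    unfolding along_def using gain_bounds(1)[OF assms(1) c] r
    by (intro integral_nonneg along_integrable[OF assms(1-3)]) (auto simp: less_imp_le[OF dsc_pos])
  have *: "((\<lambda>z. gain_max * (dsc c z / rate m c)) has_integral gain_max * ((dsc c x - dsc c y) / tot)) {x..y}"
    by (intro has_integral_mult_right dsc_integral[OF assms(2,4)])
  have "along u c x y \<le> integral {x..y} (\<lambda>z. gain_max * (dsc c z / rate m c))"
    unfolding along_def
  proof (intro integral_le along_integrable[OF assms(1-3)] has_integral_integrable[OF *])
    fix z assume "z \<in> {x..y}"
    then have "gain u c z \<le> gain_max" using gain_bounds(2)[OF assms(1) c, of z] assms(3) by auto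
    then have "dsc c z * gain u c z \<le> gain_max * dsc c z"
      by (simp add: mult.commute[of gain_max] mult_left_mono less_imp_le[OF dsc_pos])
    then show "dsc c z * gain u c z / rate m c \<le> gain_max * (dsc c z / rate m c)"
      using r by (simp add: divide_right_mono)
  qed
  then show "along u c x y \<le> gain_max * ((dsc c x - dsc c y) / tot)"
    using integral_unique[OF *] by simp
qed

text \<open>From \<open>1 - s \<le> exp (- s)\<close>. The slower rate \<open>rate m 2\<close>
  appears because it bounds the climbing time in either phase.\<close>

lemma dsc_diff_le:
  assumes "c \<in> {1, 2}" "x \<le> y"
  shows "(dsc c x - dsc c y) / tot \<le> dsc c x * ((y - x) / rate m 2)"
proof -
  have r: "0 < rate m c" "rate m 2 \<le> rate m c" "0 < rate m 2" using rate_pos[OF assms(1)] rate_ge[OF assms(1)] rates by auto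
  have "dsc c y = dsc c x * exp (- (tot * (y - x) / rate m c))"
    unfolding dsc_def exp_add[symmetric] by (simp add: field_simps diff_divide_distrib)
  moreover have "1 - tot * (y - x) / rate m c \<le> exp (- (tot * (y - x) / rate m c))"
    using exp_ge_add_one_self[of "- (tot * (y - x) / rate m c)"] by simp
  ultimately have "dsc c x - dsc c y \<le> dsc c x * (tot * (y - x) / rate m c)"
    using mult_left_mono[of _ _ "dsc c x"] less_imp_le[OF dsc_pos[of c x]] by (fastforce simp: algebra_simps)
  then have "(dsc c x - dsc c y) / tot \<le> dsc c x * ((y - x) / rate m c)"
    using tot_pos by (simp add: field_simps)
  also have "\<dots> \<le> dsc c x * ((y - x) / rate m 2)"
    using r assms(2) by (intro mult_left_mono divide_left_mono) (auto simp: less_imp_le[OF dsc_pos])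
  finally show ?thesis .
qed

lemma along_le:
  assumes "bnd u" "c \<in> {1, 2}" "lo \<le> x" "x \<le> y"
  shows "along u c x y \<le> dsc c x * (gain_max / rate m 2 * (y - x))"
proof -
  have "gain_max * ((dsc c x - dsc c y) / tot) \<le> gain_max * (dsc c x * ((y - x) / rate m 2))"
    by (intro mult_left_mono dsc_diff_le assms gain_max_nonneg)
  then show ?thesis using along_bounds(2)[OF assms] by (simp add: mult_ac)
qed

lemma along_combine:
  assumes "bnd u" "c \<in> {1, 2}" "lo \<le> x" "x \<le> y" "y \<le> z"
  shows "along u c x z = along u c x y + along u c y z"
  unfolding along_def
  by (rule Henstock_Kurzweil_Integration.integral_combine[symmetric, OF assms(4,5) along_integrable[OF assms(1-3)]])

lemma along_mono:
  assumes "bnd u" "bnd v" "\<And>c y. c \<in> {1, 2} \<Longrightarrow> y \<in> {lo..hi} \<Longrightarrow> u c y \<le> v c y"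
    and "c \<in> {1, 2}" "lo \<le> x" "y \<le> hi"
  shows "along u c x y \<le> along v c x y"
  unfolding along_def
proof (intro integral_le along_integrable assms)
  fix z assume "z \<in> {x..y}"
  then have "gain u c z \<le> gain v c z"
    using assms by (intro gain_mono[OF assms(1-3)]) auto
  then show "dsc c z * gain u c z / rate m c \<le> dsc c z * gain v c z / rate m c"
    using rate_pos[OF assms(4)] by (intro divide_right_mono mult_left_mono) (auto simp: less_imp_le[OF dsc_pos])
qed

lemma along_same [simp]: "along u c x x = 0"
  unfolding along_def by simp

lemma subvalD:
  assumes "subval u" "i \<in> {1, 2}"
  shows "j \<in> {1, 2} \<Longrightarrow> i \<noteq> j \<Longrightarrow> y \<in> {lo..hi} \<Longrightarrow> u i y \<le> u j y + switch m i j"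
    and "lo \<le> x \<Longrightarrow> x \<le> y \<Longrightarrow> y \<le> hi \<Longrightarrow> dsc i x * u i x \<le> along u i x y + dsc i y * u i y"
    and "u i hi \<le> switch m i 0 + idle u"
    and "bnd u"
  using assms unfolding subval_def by blast+

lemma idle_bounds:
  assumes "bnd u"
  shows "0 \<le> idle u" "idle u \<le> gain_max / tot"
  unfolding idle_def using gain_bounds[OF assms, of 0 hi] tot_pos lo_less_hi
  by (auto intro: divide_right_mono)

lemma idle_mono:
  assumes "bnd u" "bnd v" "\<And>c y. c \<in> {1, 2} \<Longrightarrow> y \<in> {lo..hi} \<Longrightarrow> u c y \<le> v c y"
  shows "idle u \<le> idle v"
  unfolding idle_def using tot_pos gain_mono[OF assms, of 0 hi] by (simp add: divide_right_mono)

text \<open>One half of the Lipschitz estimate, valid for every subsolution: climbing from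
  \<open>x\<close> to \<open>y\<close> takes at most \<open>(y - x) / rate m 2\<close> time units
  and costs at most \<open>gain_max\<close> per unit. The other half, \<open>val_back\<close>,
  depends on maximality.\<close>

lemma subval_step:
  assumes "subval u" "c \<in> {1, 2}" "lo \<le> x" "x \<le> y" "y \<le> hi"
  shows "u c x \<le> u c y + gain_max / rate m 2 * (y - x)"
proof -
  note u = subvalD(4)[OF assms(1,2)]
  have "dsc c x * u c x \<le> along u c x y + dsc c y * u c y"
    by (rule subvalD(2)[OF assms])
  also have "\<dots> \<le> dsc c x * (gain_max / rate m 2 * (y - x)) + dsc c x * u c y"
    by (intro add_mono along_le[OF u assms(2-4)] mult_right_mono dsc_anti[OF assms(2,4)] bndD(1)[OF u assms(2)])
  finally have "dsc c x * u c x \<le> dsc c x * (u c y + gain_max / rate m 2 * (y - x))"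
    by (simp add: algebra_simps)
  then show ?thesis by simp
qed

text \<open>Makes the class nonempty, so that the supremum in \<open>val\<close> is meaningful, and
  supplies the bound \<open>0 \<le> val\<close>.\<close>

lemma subval_0: "subval (\<lambda>c y. 0)"
proof -
  have b: "bnd (\<lambda>c y. 0)" unfolding bnd_def using val_max_nonneg by auto
  show ?thesis
    unfolding subval_def
    using b along_bounds(1)[OF b] idle_bounds(1)[OF b] switch_nn
    by (auto intro!: add_nonneg_nonneg)
qed

section \<open>The supremum of all subsolutions\<close>

definition clip :: "real \<Rightarrow> real" where
  "clip y = max lo (min hi y)"

lemma clip [simp]: "y \<in> {lo..hi} \<Longrightarrow> clip y = y" "lo \<le> clip y" "clip y \<le> hi" "y \<le> y' \<Longrightarrow> clip y \<le> clip y'"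
  unfolding clip_def using lo_less_hi by auto

lemma clip_measurable [measurable]: "clip \<in> borel_measurable borel"
  unfolding clip_def[abs_def] by measurable

text \<open>The argument is clipped because members of the class are restrained outside
  \<open>[lo, hi]\<close> by \<open>bnd\<close> alone. The constant extension makes
  \<open>val\<close> Lipschitz and measurable on the whole line.\<close>

definition val :: "nat \<Rightarrow> real \<Rightarrow> real" where
  "val c y = (SUP u\<in>{u. subval u}. u c (clip y))"

lemma val_ge: "subval u \<Longrightarrow> c \<in> {1, 2} \<Longrightarrow> u c (clip y) \<le> val c y"
  unfolding val_def
  by (intro cSUP_upper bdd_aboveI2[where M = val_max] bndD(2) subvalD(4)[of _ c]) auto

lemma val_ge': "subval u \<Longrightarrow> c \<in> {1, 2} \<Longrightarrow> y \<in> {lo..hi} \<Longrightarrow> u c y \<le> val c y"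
  using val_ge[of u c y] by simp

lemma val_least: "(\<And>u. subval u \<Longrightarrow> u c (clip y) \<le> B) \<Longrightarrow> val c y \<le> B"
  unfolding val_def using subval_0 by (intro cSUP_least) auto

lemma val_step:
  assumes "c \<in> {1, 2}" "x \<le> y"
  shows "val c x \<le> val c y + gain_max / rate m 2 * (clip y - clip x)"
proof (rule val_least)
  fix u assume u: "subval u"
  have "u c (clip x) \<le> u c (clip y) + gain_max / rate m 2 * (clip y - clip x)"
    using assms by (intro subval_step[OF u]) auto
  then show "u c (clip x) \<le> val c y + gain_max / rate m 2 * (clip y - clip x)"
    using val_ge[OF u assms(1), of y] by linarith
qed

lemma val_bnd: "bnd val"
  unfolding bnd_def
proof (intro ballI conjI allI)
  fix c :: nat and y assume c: "c \<in> {1, 2}"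
  show "0 \<le> val c y" using val_ge[OF subval_0 c] .
  show "val c y \<le> val_max"
    by (rule val_least) (rule bndD(2)[OF subvalD(4)[OF _ c] c])
  \<comment> \<open>A supremum over an uncountable class need not be measurable. Here
    \<open>val_step\<close> exhibits it as the difference of two monotone functions.\<close>
  have "mono (\<lambda>y. val c y + gain_max / rate m 2 * clip y)"
  proof (rule monoI)
    fix x y :: real assume "x \<le> y"
    from val_step[OF c this] show "val c x + gain_max / rate m 2 * clip x \<le> val c y + gain_max / rate m 2 * clip y"
      by (simp add: right_diff_distrib)
  qed
  then have [measurable]: "(\<lambda>y. val c y + gain_max / rate m 2 * clip y) \<in> borel_measurable borel"
    by (rule borel_measurable_mono)
  have "(\<lambda>y. (val c y + gain_max / rate m 2 * clip y) - gain_max / rate m 2 * clip y) \<in> borel_measurable borel"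
    by measurable
  then show "val c \<in> borel_measurable borel" by simp
qed

text \<open>For a member of the class the right-hand side of each constraint does not decrease when
  the member is replaced by \<open>val\<close> in it; the resulting bound no longer depends on the
  member and passes to the supremum.\<close>

lemma val_subval: "subval val"
  unfolding subval_def
proof (intro conjI ballI allI impI val_bnd)
  fix i j :: nat and y assume ij: "i \<in> {1, 2}" "j \<in> {1, 2}" "i \<noteq> j" "y \<in> {lo..hi}"
  show "val i y \<le> val j y + switch m i j"
  proof (rule val_least)
    fix u assume "subval u"
    then show "u i (clip y) \<le> val j y + switch m i j"
      using subvalD(1)[of u i j y] val_ge'[of u j y] ij by fastforce
  qed
next
  fix i :: nat and x y assume i: "i \<in> {1, 2}" and xy: "lo \<le> x" "x \<le> y" "y \<le> hi"
  have "val i x \<le> (along val i x y + dsc i y * val i y) / dsc i x"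
  proof (rule val_least)
    fix u assume u: "subval u"
    have "dsc i x * u i x \<le> along u i x y + dsc i y * u i y"
      by (rule subvalD(2)[OF u i xy])
    also have "\<dots> \<le> along val i x y + dsc i y * val i y"
      using xy i u by (intro add_mono along_mono mult_left_mono val_ge' subvalD(4)[OF u i] val_bnd)
        (auto simp: less_imp_le[OF dsc_pos])
    finally show "u i (clip x) \<le> (along val i x y + dsc i y * val i y) / dsc i x"
      using xy by (simp add: pos_le_divide_eq mult.commute)
  qed
  then show "dsc i x * val i x \<le> along val i x y + dsc i y * val i y"
    by (simp add: pos_le_divide_eq mult.commute)
next
  fix i :: nat assume i: "i \<in> {1, 2}"
  show "val i hi \<le> switch m i 0 + idle val"
  proof (rule val_least)
    fix u assume u: "subval u"
    have "idle u \<le> idle val" by (intro idle_mono subvalD(4)[OF u i] val_bnd val_ge' u)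
    then show "u i (clip hi) \<le> switch m i 0 + idle val"
      using subvalD(3)[OF u i] lo_less_hi by simp
  qed
qed

text \<open>Perron's principle: any modification of \<open>val\<close> upwards that keeps the inequalities, with the gain
  still computed from \<open>val\<close>, is no modification at all.\<close>

lemma val_maximal:
  assumes v: "bnd v"
    and ge: "\<And>c y. c \<in> {1, 2} \<Longrightarrow> y \<in> {lo..hi} \<Longrightarrow> val c y \<le> v c y"
    and sw: "\<And>i j y. i \<in> {1, 2} \<Longrightarrow> j \<in> {1, 2} \<Longrightarrow> i \<noteq> j \<Longrightarrow> y \<in> {lo..hi} \<Longrightarrow> v i y \<le> v j y + switch m i j"
    and dr: "\<And>i x y. i \<in> {1, 2} \<Longrightarrow> lo \<le> x \<Longrightarrow> x \<le> y \<Longrightarrow> y \<le> hi \<Longrightarrow>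
               dsc i x * v i x \<le> along val i x y + dsc i y * v i y"
    and cp: "\<And>i. i \<in> {1, 2} \<Longrightarrow> v i hi \<le> switch m i 0 + idle val"
    and c: "c \<in> {1, 2}" "y \<in> {lo..hi}"
  shows "v c y = val c y"
proof -
  have "subval v"
    unfolding subval_def
  proof (intro conjI ballI allI impI v sw)
    fix i :: nat and x y assume i: "i \<in> {1, 2}" and xy: "lo \<le> x" "x \<le> y" "y \<le> hi"
    have "along val i x y \<le> along v i x y"
      by (intro along_mono val_bnd v ge i xy)
    then show "dsc i x * v i x \<le> along v i x y + dsc i y * v i y"
      using dr[OF i xy] by linarith
  next
    fix i :: nat assume i: "i \<in> {1, 2}"
    have "idle val \<le> idle v" by (intro idle_mono val_bnd v ge)
    then show "v i hi \<le> switch m i 0 + idle v" using cp[OF i] by linarith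
  qed auto
  then show ?thesis using val_ge'[of v c y] ge[of c y] c by force
qed

text \<open>Maximality tested by raising \<open>val i\<close> at the single point \<open>hi\<close>
  to the smaller of its two upper bounds. Drift inequalities that end at \<open>hi\<close> become
  weaker, and the only one that starts there is trivial. As the switching bound is not attained, the
  bound through phase 0 must be.\<close>

lemma val_cap:
  assumes ij: "i \<in> {1, 2}" "j \<in> {1, 2}" "i \<noteq> j" and lt: "val i hi < val j hi + switch m i j"
  shows "val i hi = switch m i 0 + idle val"
proof -
  note s = subvalD[OF val_subval]
  have hi: "hi \<in> {lo..hi}" using lo_less_hi by simp
  define w where "w = min (val j hi + switch m i j) (switch m i 0 + idle val)"
  define v where "v c y = (if c = i \<and> y = hi then w else val c y)" for c y
  have w: "val i hi \<le> w" "w \<le> val j hi + switch m i j" "w \<le> switch m i 0 + idle val"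
    unfolding w_def using lt s(3)[OF ij(1)] by auto
  have ge: "val c y \<le> v c y" for c y
    using w(1) unfolding v_def by auto
  have vj: "v k y = val k y" if "k \<noteq> i" for k y using that unfolding v_def by simp
  \<comment> \<open>The costs of switching to phase 0 were included in \<open>val_max\<close> for
    the sake of this bound.\<close>
  have "w \<le> val_max"
  proof -
    have "switch m i 0 * tot \<le> (switch m 1 0 + switch m 2 0) * tot"
      using switch_nn[of 1 0] switch_nn[of 2 0] ij(1) tot_pos by (intro mult_right_mono) auto
    then have "switch m i 0 + gain_max / tot \<le> val_max"
      using val_max_eq tot_pos by (simp add: field_simps)
    then show ?thesis using w(3) idle_bounds(2)[OF val_bnd] by linarith
  qed
  moreover have "0 \<le> w" using w(1) bndD(1)[OF val_bnd ij(1), of hi] by linarith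
  moreover have "v c \<in> borel_measurable borel" if "c \<in> {1, 2}" for c
    using bndD(3)[OF val_bnd that] unfolding v_def[abs_def] by measurable
  ultimately have "bnd v"
    unfolding bnd_def using bndD[OF val_bnd] by (auto simp: v_def)
  then have "v i hi = val i hi"
  proof (rule val_maximal)
    show "v i' y \<le> v j' y + switch m i' j'" if "i' \<in> {1, 2}" "j' \<in> {1, 2}" "i' \<noteq> j'" "y \<in> {lo..hi}" for i' j' y
    proof (cases "i' = i \<and> y = hi")
      case True
      then have "j' = j" "v j' y = val j hi" using that ij vj by auto
      then show ?thesis using True w(2) by (simp add: v_def)
    next
      case False
      then show ?thesis using s(1)[OF that] ge[of j' y] unfolding v_def by auto
    qed
    show "dsc i' x * v i' x \<le> along val i' x y + dsc i' y * v i' y"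
      if "i' \<in> {1, 2}" "lo \<le> x" "x \<le> y" "y \<le> hi" for i' x y
    proof (cases "x = hi")
      case True
      then show ?thesis using that by simp
    next
      case False
      then have "dsc i' x * v i' x \<le> along val i' x y + dsc i' y * val i' y"
        using s(2)[OF that] by (simp add: v_def)
      also have "\<dots> \<le> along val i' x y + dsc i' y * v i' y"
        using ge by (intro add_left_mono mult_left_mono) (auto simp: less_imp_le[OF dsc_pos])
      finally show ?thesis .
    qed
    show "v i' hi \<le> switch m i' 0 + idle val" if "i' \<in> {1, 2}" for i'
      using s(3)[OF that] w(3) by (auto simp: v_def)
  qed (use ge ij hi in auto)
  then have "w = val i hi" by (simp add: v_def)
  then show ?thesis using lt unfolding w_def by (auto simp: min_def split: if_splits)
qed

section \<open>Lipschitz estimate, and equality where switching does not pay\<close>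

definition lip :: real where
  "lip = tot * val_max / rate m 2"

lemma lip_nonneg: "0 \<le> lip"
  unfolding lip_def using tot_pos val_max_nonneg rates by simp

text \<open>Maximality tested with the maximum of \<open>val c y\<close> and the damped value
  \<open>e y * val c r\<close> below \<open>r\<close>. The damping factor is the same in both phases
  and at most 1, so the switching inequalities survive; it decays fast enough towards lower levels
  for the drift inequality to hold by nonnegativity of the gain alone.\<close>

lemma val_back:
  assumes c: "c \<in> {1, 2}" and xr: "lo \<le> x" "x \<le> r" "r \<le> hi"
  shows "exp (- (tot / rate m 2 * (r - x))) * val c r \<le> val c x"
proof -
  note s = subvalD[OF val_subval]
  define k where "k = tot / rate m 2"
  have k: "0 \<le> k" unfolding k_def using tot_pos rates by simp
  define e where "e y = exp (- (k * (r - y)))" for y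
  have e: "0 < e y" "y \<le> r \<Longrightarrow> e y \<le> 1" for y
    unfolding e_def using k by (auto intro!: mult_nonneg_nonneg)
  \<comment> \<open>With the smallest rate in its exponent, \<open>e\<close> grows in the level at
    least as fast as \<open>dsc i\<close> decays, whichever phase \<open>i\<close> is.\<close>
  have ee: "dsc i x * e x \<le> dsc i y * e y" if "i \<in> {1, 2}" "x \<le> y" for i x y
  proof -
    have "tot * (y - x) / rate m i \<le> k * (y - x)"
      unfolding k_def using that rate_pos[OF that(1)] rate_ge[OF that(1)] tot_pos rates
      by (auto intro!: mult_right_mono divide_left_mono mult_nonneg_nonneg simp: times_divide_eq_left[symmetric] simp del: times_divide_eq_left)
    then show ?thesis
      unfolding dsc_def e_def exp_add[symmetric] by (simp add: algebra_simps diff_divide_distrib add_divide_distrib)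
  qed
  define v where "v c y = (if y \<le> r then max (val c y) (e y * val c r) else val c y)" for c y
  note nn = bndD(1)[OF val_bnd]
  have ge: "val c y \<le> v c y" for c y unfolding v_def by auto
  have r: "r \<in> {lo..hi}" using xr by auto
  have "bnd v"
    unfolding bnd_def
  proof (intro ballI conjI allI)
    fix c :: nat and y assume c: "c \<in> {1, 2}"
    have [measurable]: "val c \<in> borel_measurable borel" by (rule bndD(3)[OF val_bnd c])
    show "v c \<in> borel_measurable borel" unfolding v_def[abs_def] e_def by measurable
    show "0 \<le> v c y" using ge[of c y] nn[OF c, of y] by linarith
    have "e y * val c r \<le> 1 * val_max" if "y \<le> r"
      using e[of y] that nn[OF c, of r] bndD(2)[OF val_bnd c, of r] by (intro mult_mono) auto
    then show "v c y \<le> val_max" using bndD(2)[OF val_bnd c, of y] unfolding v_def by auto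
  qed
  then have "v c x = val c x"
  proof (rule val_maximal)
    show "v i y \<le> v j y + switch m i j" if "i \<in> {1, 2}" "j \<in> {1, 2}" "i \<noteq> j" "y \<in> {lo..hi}" for i j y
    proof -
      have "e y * val i r \<le> e y * val j r + switch m i j" if "y \<le> r"
      proof -
        have "e y * val i r \<le> e y * (val j r + switch m i j)"
          using s(1)[OF \<open>i \<in> _\<close> \<open>j \<in> _\<close> \<open>i \<noteq> j\<close> r] e[of y] by (intro mult_left_mono) auto
        also have "\<dots> \<le> e y * val j r + 1 * switch m i j"
          unfolding distrib_left using e[of y] that switch_nn[of i j] \<open>i \<in> _\<close> \<open>j \<in> _\<close> \<open>i \<noteq> j\<close>
          by (intro add_left_mono mult_right_mono) auto
        finally show ?thesis by simp
      qed
      then show ?thesis using s(1)[OF that] unfolding v_def by auto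
    qed
    show "dsc i x * v i x \<le> along val i x y + dsc i y * v i y" if i: "i \<in> {1, 2}" and xy: "lo \<le> x" "x \<le> y" "y \<le> hi" for i x y
    proof -
      have 1: "dsc i x * val i x \<le> along val i x y + dsc i y * v i y"
        using s(2)[OF i xy] mult_left_mono[OF ge[of i y] less_imp_le[OF dsc_pos[of i y]]] by linarith
      have 2: "dsc i x * (e x * val i r) \<le> along val i x y + dsc i y * v i y" if "x \<le> r"
      proof (cases "y \<le> r")
        case True
        have "(dsc i x * e x) * val i r \<le> (dsc i y * e y) * val i r"
          by (intro mult_right_mono ee i xy nn)
        also have "\<dots> \<le> dsc i y * v i y"
          unfolding mult.assoc using True by (intro mult_left_mono) (auto simp: v_def less_imp_le[OF dsc_pos])
        finally show ?thesis using along_bounds(1)[OF val_bnd i xy(1,2)] by (simp add: mult.assoc)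
      next
        case False
        have "(dsc i x * e x) * val i r \<le> (dsc i r * e r) * val i r"
          by (intro mult_right_mono ee i that nn)
        also have "\<dots> = dsc i r * val i r" by (simp add: e_def)
        also have "\<dots> \<le> along val i r y + dsc i y * val i y"
          using False that xy by (intro s(2) i) auto
        also have "\<dots> \<le> along val i x y + dsc i y * v i y"
          using along_combine[OF val_bnd i xy(1) that less_imp_le, of y] along_bounds(1)[OF val_bnd i xy(1) that] False
            mult_left_mono[OF ge[of i y] less_imp_le[OF dsc_pos[of i y]]] by linarith
        finally show ?thesis by (simp add: mult.assoc)
      qed
      show ?thesis using 1 2 by (auto simp: v_def[of i x] max_def)
    qed
    show "v i hi \<le> switch m i 0 + idle val" if "i \<in> {1, 2}" for i
      using s(3)[OF that] xr by (cases "r = hi") (auto simp: v_def e_def)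
  qed (use ge c xr in auto)
  moreover have "e x * val c r \<le> v c x" unfolding v_def using xr by auto
  ultimately show ?thesis unfolding e_def k_def by simp
qed

lemma val_lipschitz:
  assumes c: "c \<in> {1, 2}"
  shows "\<bar>val c x - val c y\<bar> \<le> lip * \<bar>x - y\<bar>"
proof -
  have *: "\<bar>val c x - val c y\<bar> \<le> lip * (y - x)" if xy: "lo \<le> x" "x \<le> y" "y \<le> hi" for x y
  proof -
    have "gain_max / rate m 2 * (y - x) \<le> lip * (y - x)"
      unfolding lip_def using gain_max_le rates xy by (intro mult_right_mono divide_right_mono) auto
    then have 1: "val c x - val c y \<le> lip * (y - x)"
      using val_step[OF c xy(2)] xy by simp
    have "val c y - exp (- (tot / rate m 2 * (y - x))) * val c y = (1 - exp (- (tot / rate m 2 * (y - x)))) * val c y"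
      by (simp add: algebra_simps)
    also have "\<dots> \<le> (tot / rate m 2 * (y - x)) * val_max"
    proof (rule mult_mono)
      show "1 - exp (- (tot / rate m 2 * (y - x))) \<le> tot / rate m 2 * (y - x)"
        using exp_ge_add_one_self[of "- (tot / rate m 2 * (y - x))"] by simp
    qed (use bndD(1,2)[OF val_bnd c, of y] tot_pos rates xy in auto)
    finally have "val c y - val c x \<le> lip * (y - x)"
      using val_back[OF c xy] unfolding lip_def by (simp add: mult_ac)
    then show ?thesis using 1 by linarith
  qed
  have vc: "val c z = val c (clip z)" for z
  proof -
    have "clip z \<in> {lo..hi}" by simp
    then show ?thesis unfolding val_def by simp
  qed
  have "\<bar>val c (clip x) - val c (clip y)\<bar> \<le> lip * \<bar>clip x - clip y\<bar>"
  proof (cases "clip x \<le> clip y")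
    case True
    then show ?thesis using *[of "clip x" "clip y"] by simp
  next
    case False
    then show ?thesis using *[of "clip y" "clip x"] by (simp add: abs_minus_commute)
  qed
  also have "\<dots> \<le> lip * \<bar>x - y\<bar>"
    by (intro mult_left_mono lip_nonneg) (auto simp: clip_def)
  finally show ?thesis using vc[of x] vc[of y] by simp
qed

lemma val_continuous: "c \<in> {1, 2} \<Longrightarrow> continuous_on A (val c)"
  using val_lipschitz[of c] lip_nonneg
  by (intro lipschitz_on_continuous_on[of lip] lipschitz_onI) (auto simp: dist_real_def)

end

section \<open>Change of the discount rate\<close>

lemma triangle_integral:
  fixes f :: "real \<Rightarrow> real" and a :: real
  assumes [measurable]: "f \<in> borel_measurable borel" and B: "\<And>z. x \<le> z \<Longrightarrow> z \<le> y \<Longrightarrow> \<bar>f z\<bar> \<le> B"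
    and "x \<le> y"
  shows "(LINT z:{x..y}|lborel. a * exp (a * z) * (LINT r:{z..y}|lborel. f r))
       = (LINT r:{x..y}|lborel. f r * (exp (a * r) - exp (a * x)))"
proof -
  \<comment> \<open>Fubini on the triangle \<open>x \<le> z \<le> r \<le> y\<close>: for fixed
    \<open>r\<close> the exponential factor integrates over \<open>[x, r]\<close> to
    \<open>exp (a * r) - exp (a * x)\<close>.\<close>
  define F where "F z r = indicator {x..y} z * indicator {z..y} r * (a * exp (a * z)) * f r" for z r :: real
  have "F z r = (if x \<le> z \<and> z \<le> y \<and> z \<le> r \<and> r \<le> y then a * exp (a * z) * f r else 0)" for z r
    unfolding F_def by (auto simp: indicator_def)
  then have "case_prod F = (\<lambda>p. if x \<le> fst p \<and> fst p \<le> y \<and> fst p \<le> snd p \<and> snd p \<le> y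
      then a * exp (a * fst p) * f (snd p) else 0)"
    by (auto simp: fun_eq_iff)
  also have "\<dots> \<in> borel_measurable (borel \<Otimes>\<^sub>M borel)" by measurable
  finally have [measurable]: "case_prod F \<in> borel_measurable (lborel \<Otimes>\<^sub>M lborel)"
    by (subst measurable_cong_sets[OF sets_pair_measure_cong[OF sets_lborel sets_lborel] refl])
  have [simp]: "0 \<le> B" using B[of x] assms(3) by fastforce
  have int: "integrable (lborel \<Otimes>\<^sub>M lborel) (case_prod F)"
  proof (rule integrableI_bounded_set[where A = "{x..y} \<times> {x..y}" and B = "\<bar>a\<bar> * exp (\<bar>a\<bar> * max \<bar>x\<bar> \<bar>y\<bar>) * B"])
    show "{x..y} \<times> {x..y} \<in> sets (lborel \<Otimes>\<^sub>M lborel)" by simp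
    show "emeasure (lborel \<Otimes>\<^sub>M lborel) ({x..y} \<times> {x..y}) < \<infinity>"
      by (simp add: lborel.emeasure_pair_measure_Times emeasure_lborel_Icc_eq ennreal_mult_less_top)
    show "AE p\<in>{x..y} \<times> {x..y} in lborel \<Otimes>\<^sub>M lborel. norm (case_prod F p) \<le> \<bar>a\<bar> * exp (\<bar>a\<bar> * max \<bar>x\<bar> \<bar>y\<bar>) * B"
    proof (rule AE_I2, clarify)
      fix z r :: real
      have "\<bar>a * exp (a * z)\<bar> * \<bar>f r\<bar> \<le> \<bar>a\<bar> * exp (\<bar>a\<bar> * max \<bar>x\<bar> \<bar>y\<bar>) * B" if "x \<le> z" "z \<le> r" "r \<le> y"
      proof (intro mult_mono)
        have "a * z \<le> \<bar>a\<bar> * \<bar>z\<bar>" by (metis abs_ge_self abs_mult)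
        also have "\<dots> \<le> \<bar>a\<bar> * max \<bar>x\<bar> \<bar>y\<bar>" using that by (intro mult_left_mono) auto
        finally show "\<bar>a * exp (a * z)\<bar> \<le> \<bar>a\<bar> * exp (\<bar>a\<bar> * max \<bar>x\<bar> \<bar>y\<bar>)"
          by (simp add: abs_mult mult_left_mono)
      qed (use that B in auto)
      then show "norm (F z r) \<le> \<bar>a\<bar> * exp (\<bar>a\<bar> * max \<bar>x\<bar> \<bar>y\<bar>) * B"
        unfolding F_def by (auto simp: indicator_def abs_mult)
    qed
    show "AE p in lborel \<Otimes>\<^sub>M lborel. p \<notin> {x..y} \<times> {x..y} \<longrightarrow> case_prod F p = 0"
      unfolding F_def by (auto simp: indicator_def)
  qed simp
  have "(LINT z:{x..y}|lborel. a * exp (a * z) * (LINT r:{z..y}|lborel. f r)) = (\<integral>z. (\<integral>r. F z r \<partial>lborel) \<partial>lborel)"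
    unfolding set_lebesgue_integral_def F_def
    by (intro Bochner_Integration.integral_cong refl) (simp add: mult.assoc mult.left_commute flip: integral_mult_right_zero)
  also have "\<dots> = (\<integral>r. (\<integral>z. F z r \<partial>lborel) \<partial>lborel)"
    by (rule lborel_pair.Fubini_integral[OF int, symmetric])
  also have "\<dots> = (LINT r:{x..y}|lborel. f r * (exp (a * r) - exp (a * x)))"
    unfolding set_lebesgue_integral_def
  proof (intro Bochner_Integration.integral_cong refl)
    fix r :: real
    have F: "F z r = indicator {x..y} r * f r * (a * exp (a * z) * indicator {x..r} z)" for z
      unfolding F_def indicator_def by auto
    have "(\<integral>z. a * exp (a * z) * indicator {x..r} z \<partial>lborel) = exp (a * r) - exp (a * x)" if "x \<le> r"
      using that by (intro integral_FTC_Icc_real) (auto intro!: derivative_eq_intros continuous_intros)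
    then show "(\<integral>z. F z r \<partial>lborel) = indicator {x..y} r *\<^sub>R (f r * (exp (a * r) - exp (a * x)))"
      unfolding F by (auto simp: indicator_def)
  qed
  finally show ?thesis .
qed

text \<open>Turns an estimate that is discounted at the rate of killing at the next demand into one that is
  discounted at the financial rate only; \<open>a\<close> is the difference of the two rates per unit of level.\<close>

lemma discount_change:
  fixes f g :: "real \<Rightarrow> real"
  assumes f: "f \<in> borel_measurable borel" "\<And>z. x \<le> z \<Longrightarrow> z \<le> y \<Longrightarrow> \<bar>f z\<bar> \<le> B"
    and g: "g \<in> borel_measurable borel" "\<And>z. x \<le> z \<Longrightarrow> z \<le> y \<Longrightarrow> \<bar>g z\<bar> \<le> B"
    and "x \<le> y" "0 \<le> a"
    and le: "\<And>z. x \<le> z \<Longrightarrow> z \<le> y \<Longrightarrow> g z \<le> integral {z..y} f + g y"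
  shows "exp (a * x) * g x + integral {x..y} (\<lambda>z. a * exp (a * z) * g z)
       \<le> integral {x..y} (\<lambda>z. exp (a * z) * f z) + exp (a * y) * g y"
proof -
  have [measurable]: "f \<in> borel_measurable borel" "g \<in> borel_measurable borel" by fact+
  have B0: "0 \<le> B" using f(2)[of x] assms(5) by fastforce
  have si: "set_integrable lborel {x..y} (\<lambda>z. h z * k z)"
    if [measurable]: "k \<in> borel_measurable borel" "h \<in> borel_measurable borel"
      and k: "\<And>z. x \<le> z \<Longrightarrow> z \<le> y \<Longrightarrow> \<bar>k z\<bar> \<le> B"
      and h: "\<And>z. x \<le> z \<Longrightarrow> z \<le> y \<Longrightarrow> \<bar>h z\<bar> \<le> C" for h k C
  proof (rule set_integrable_bounded_real[where B = "C * B"])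
    fix z assume "x \<le> z" "z \<le> y"
    then show "\<bar>h z * k z\<bar> \<le> C * B" unfolding abs_mult using h[of z] k[of z] B0 by (intro mult_mono) auto
  qed simp
  have si2: "(\<lambda>z. h z * k z) integrable_on {x..y}"
    "integral {x..y} (\<lambda>z. h z * k z) = (LINT z:{x..y}|lborel. h z * k z)"
    if "k \<in> borel_measurable borel" "h \<in> borel_measurable borel"
      and "\<And>z. x \<le> z \<Longrightarrow> z \<le> y \<Longrightarrow> \<bar>k z\<bar> \<le> B"
      and "\<And>z. x \<le> z \<Longrightarrow> z \<le> y \<Longrightarrow> \<bar>h z\<bar> \<le> C" for h k C
    using set_borel_integral_eq_integral[OF si[OF that]] by simp_all
  have eb: "\<bar>exp (a * z)\<bar> \<le> exp (a * y)" if "z \<le> y" for z using that assms(6) by (simp add: mult_left_mono)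
  have aeb: "\<bar>a * exp (a * z)\<bar> \<le> a * exp (a * y)" if "z \<le> y" for z
    using eb[OF that] assms(6) by (simp add: mult_left_mono)
  have If: "f integrable_on {z..y}" "integral {z..y} f = (LINT r:{z..y}|lborel. f r)" if "x \<le> z" for z
    using set_borel_integral_eq_integral[OF set_integrable_bounded_real[OF f(1), of z y B]] f(2) that by auto
  have cont: "continuous_on {x..y} (\<lambda>z. integral {z..y} f)"
    by (rule indefinite_integral_continuous_1'[OF If(1)]) simp
  have iexp: "(\<lambda>z. a * exp (a * z)) integrable_on {x..y}" "integral {x..y} (\<lambda>z. a * exp (a * z)) = exp (a * y) - exp (a * x)"
  proof -
    have "((\<lambda>z. a * exp (a * z)) has_integral exp (a * y) - exp (a * x)) {x..y}"
      by (rule fundamental_theorem_of_calculus[OF assms(5)])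
        (auto intro!: derivative_eq_intros simp: has_real_derivative_iff_has_vector_derivative[symmetric])
    then show "(\<lambda>z. a * exp (a * z)) integrable_on {x..y}" "integral {x..y} (\<lambda>z. a * exp (a * z)) = exp (a * y) - exp (a * x)"
      by (rule has_integral_integrable, rule integral_unique)
  qed
  have i1: "(\<lambda>z. a * exp (a * z) * integral {z..y} f) integrable_on {x..y}"
    by (intro integrable_continuous_real continuous_intros cont)
  have i2: "(\<lambda>z. a * exp (a * z) * g y) integrable_on {x..y}"
    by (intro integrable_continuous_real continuous_intros)
  have tri: "integral {x..y} (\<lambda>z. a * exp (a * z) * integral {z..y} f)
        = integral {x..y} (\<lambda>r. exp (a * r) * f r) - exp (a * x) * integral {x..y} f"
  proof -
    have "set_integrable lborel {x..y} (\<lambda>z. a * exp (a * z) * integral {z..y} f)"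
      by (intro borel_integrable_atLeastAtMost' continuous_intros cont)
    from set_borel_integral_eq_integral(2)[OF this]
    have "integral {x..y} (\<lambda>z. a * exp (a * z) * integral {z..y} f)
        = (LINT z:{x..y}|lborel. a * exp (a * z) * integral {z..y} f)" by simp
    also have "\<dots> = (LINT z:{x..y}|lborel. a * exp (a * z) * (LINT r:{z..y}|lborel. f r))"
      by (intro set_lebesgue_integral_cong) (auto simp: If(2))
    also have "\<dots> = (LINT r:{x..y}|lborel. f r * (exp (a * r) - exp (a * x)))"
      by (rule triangle_integral[OF f assms(5)])
    also have "\<dots> = (LINT r:{x..y}|lborel. exp (a * r) * f r - exp (a * x) * f r)"
      by (simp add: algebra_simps)
    also have "\<dots> = (LINT r:{x..y}|lborel. exp (a * r) * f r) - (LINT r:{x..y}|lborel. exp (a * x) * f r)"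
      using f(2) eb assms(5) by (intro set_integral_diff si[where C = "exp (a * y)"]) auto
    also have "\<dots> = integral {x..y} (\<lambda>r. exp (a * r) * f r) - exp (a * x) * integral {x..y} f"
      using si2(2)[of f "\<lambda>r. exp (a * r)" "exp (a * y)"] f eb If(2)[of x] by simp
    finally show ?thesis .
  qed
  have "integral {x..y} (\<lambda>z. a * exp (a * z) * g z)
      \<le> integral {x..y} (\<lambda>z. a * exp (a * z) * integral {z..y} f + a * exp (a * z) * g y)"
  proof (rule integral_le)
    show "(\<lambda>z. a * exp (a * z) * g z) integrable_on {x..y}"
      using g aeb by (intro si2(1)[where C = "a * exp (a * y)"]) auto
    fix z assume "z \<in> {x..y}"
    then have "a * exp (a * z) * g z \<le> a * exp (a * z) * (integral {z..y} f + g y)"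
      using le[of z] assms(6) by (intro mult_left_mono) auto
    then show "a * exp (a * z) * g z \<le> a * exp (a * z) * integral {z..y} f + a * exp (a * z) * g y"
      by (simp add: algebra_simps)
  qed (intro integrable_add i1 i2)
  also have "\<dots> = integral {x..y} (\<lambda>r. exp (a * r) * f r) - exp (a * x) * integral {x..y} f + (exp (a * y) - exp (a * x)) * g y"
    using integral_add[OF i1 i2] tri iexp(2) by simp
  finally have 1: "integral {x..y} (\<lambda>z. a * exp (a * z) * g z)
    \<le> integral {x..y} (\<lambda>r. exp (a * r) * f r) - exp (a * x) * integral {x..y} f + (exp (a * y) - exp (a * x)) * g y" .
  \<comment> \<open>The hypothesis has been integrated against \<open>a * exp (a * z)\<close>.
    Adding it once more at \<open>z = x\<close>, with weight \<open>exp (a * x)\<close>, cancels the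
    boundary term that \<open>tri\<close> has left.\<close>
  have "exp (a * x) * g x \<le> exp (a * x) * (integral {x..y} f + g y)"
    using le[of x] assms(5) by (intro mult_left_mono) auto
  then show ?thesis using 1 by (simp add: algebra_simps)
qed

context production_inventory
begin

text \<open>Maximality tested by raising \<open>val i\<close> on \<open>[x, r]\<close> to
  \<open>h\<close>, the cost of staying in phase \<open>i\<close> up to \<open>r\<close>. The
  assumed gap absorbs the variation of \<open>h\<close> between \<open>y\<close> and
  \<open>r\<close>, of \<open>val i\<close> between \<open>x\<close> and \<open>r\<close>, and of
  \<open>val j\<close> between \<open>x\<close> and \<open>y\<close>, so \<open>h\<close> respects
  the switching inequality, and \<open>val\<close> cannot lie below it.\<close>

lemma val_follow:
  assumes ij: "i \<in> {1, 2}" "j \<in> {1, 2}" "i \<noteq> j" and xr: "lo \<le> x" "x \<le> r" "r \<le> hi"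
    and gap: "val i x + 3 * lip * (r - x) \<le> val j x + switch m i j"
  shows "dsc i x * val i x = along val i x r + dsc i r * val i r"
proof -
  note s = subvalD[OF val_subval] and vb = val_bnd
  note nn = bndD(1)[OF val_bnd]
  \<comment> \<open>The cost to go is stated at level 0 and divided by the discount factor at
    \<open>y\<close>. Truncation at \<open>r\<close> and at the end points only serves to make
    \<open>h\<close> a measurable function on the whole line.\<close>
  define h where "h y = (along val i (min r (clip y)) r + dsc i r * val i r) / dsc i (min r (clip y))" for y
  define v where "v c y = (if c = i \<and> x \<le> y \<and> y \<le> r then h y else val c y)" for c y
  have h: "dsc i y * h y = along val i y r + dsc i r * val i r" if "x \<le> y" "y \<le> r" for y
    using that xr unfolding h_def by (simp add: min_absorb2 less_imp_neq[OF dsc_pos, symmetric])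
  have cl: "lo \<le> min r (clip y)" "min r (clip y) \<le> r" for y using xr by auto
  have "mono (\<lambda>y. - along val i (min r (clip y)) r)"
  proof (rule monoI)
    fix y z :: real assume "y \<le> z"
    then have "min r (clip y) \<le> min r (clip z)" using clip(4)[of y z] by linarith
    from along_combine[OF vb ij(1) cl(1) this cl(2)] along_bounds(1)[OF vb ij(1) cl(1) this]
    show "- along val i (min r (clip y)) r \<le> - along val i (min r (clip z)) r" by linarith
  qed
  then have "(\<lambda>y. - (- along val i (min r (clip y)) r)) \<in> borel_measurable borel"
    by (intro borel_measurable_uminus borel_measurable_mono)
  then have [measurable]: "(\<lambda>y. along val i (min r (clip y)) r) \<in> borel_measurable borel" by simp
  have [measurable]: "h \<in> borel_measurable borel" unfolding h_def by measurable
  have hle: "h y \<le> val_max" "0 \<le> h y" "h y \<le> val i r + lip * (r - y)" "val i y \<le> h y" if y: "x \<le> y" "y \<le> r" for y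
  proof -
    have ly: "lo \<le> y" using y xr by simp
    have "gain_max * ((dsc i y - dsc i r) / tot) = gain_max / tot * (dsc i y - dsc i r)" by simp
    also have "\<dots> \<le> val_max * (dsc i y - dsc i r)"
      using gain_max_le tot_pos dsc_anti[OF ij(1) y(2)] by (intro mult_right_mono) (auto simp: field_simps)
    finally have "along val i y r \<le> val_max * (dsc i y - dsc i r)"
      using along_bounds(2)[OF vb ij(1) ly y(2)] by simp
    moreover have "dsc i r * val i r \<le> dsc i r * val_max"
      using bndD(2)[OF vb ij(1)] by (intro mult_left_mono) (auto simp: less_imp_le[OF dsc_pos])
    ultimately have "dsc i y * h y \<le> val_max * (dsc i y - dsc i r) + dsc i r * val_max"
      unfolding h[OF y] by linarith
    also have "\<dots> = dsc i y * val_max" by (simp add: algebra_simps)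
    finally have "dsc i y * h y \<le> dsc i y * val_max" .
    then show "h y \<le> val_max" by simp
    have "0 \<le> dsc i y * h y"
      unfolding h[OF y] using along_bounds(1)[OF vb ij(1) ly y(2)] nn[OF ij(1)]
      by (intro add_nonneg_nonneg mult_nonneg_nonneg) (auto simp: less_imp_le[OF dsc_pos])
    then show "0 \<le> h y" using dsc_pos[of i y] by (metis mult_pos_neg not_le)
    have "gain_max / rate m 2 * (r - y) \<le> lip * (r - y)"
      unfolding lip_def using gain_max_le rates y by (intro mult_right_mono divide_right_mono) auto
    then have "dsc i y * (gain_max / rate m 2 * (r - y)) \<le> dsc i y * (lip * (r - y))"
      by (intro mult_left_mono) (auto simp: less_imp_le[OF dsc_pos])
    moreover have "dsc i r * val i r \<le> dsc i y * val i r"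
      by (intro mult_right_mono dsc_anti ij y nn)
    ultimately have "dsc i y * h y \<le> dsc i y * (lip * (r - y)) + dsc i y * val i r"
      unfolding h[OF y] using along_le[OF vb ij(1) ly y(2)] by linarith
    also have "\<dots> = dsc i y * (val i r + lip * (r - y))" by (simp add: algebra_simps)
    finally have "dsc i y * h y \<le> dsc i y * (val i r + lip * (r - y))" .
    then show "h y \<le> val i r + lip * (r - y)" by simp
    have "dsc i y * val i y \<le> dsc i y * h y"
      unfolding h[OF y] using y xr by (intro s(2) ij) auto
    then show "val i y \<le> h y" by simp
  qed
  have ge: "val c y \<le> v c y" for c y unfolding v_def using hle by auto
  have "bnd v"
    unfolding bnd_def
  proof (intro ballI conjI allI)
    fix c :: nat and y assume c: "c \<in> {1, 2}"
    have [measurable]: "val c \<in> borel_measurable borel" by (rule bndD(3)[OF val_bnd c])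
    show "v c \<in> borel_measurable borel" unfolding v_def[abs_def] by measurable
    show "0 \<le> v c y" "v c y \<le> val_max" using hle(1,2) bndD(1,2)[OF vb c] unfolding v_def by auto
  qed
  then have "v i x = val i x"
  proof (rule val_maximal)
    show "v i' y \<le> v j' y + switch m i' j'" if "i' \<in> {1, 2}" "j' \<in> {1, 2}" "i' \<noteq> j'" "y \<in> {lo..hi}" for i' j' y
    proof (cases "i' = i \<and> x \<le> y \<and> y \<le> r")
      case True
      then have "j' = j" "v j' y = val j y" using that ij by (auto simp: v_def)
      moreover have "h y \<le> val j y + switch m i j"
      proof -
        have "val i r \<le> val i x + lip * (r - x)" "val j x \<le> val j y + lip * (y - x)"
          using val_lipschitz[OF ij(1), of r x] val_lipschitz[OF ij(2), of y x] True xr by auto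
        moreover have "h y \<le> val i r + lip * (r - y)" using hle True by auto
        moreover have "lip * (r - y) \<le> lip * (r - x)" "lip * (y - x) \<le> lip * (r - x)"
          using True lip_nonneg by (auto intro!: mult_left_mono)
        ultimately show ?thesis using gap by linarith
      qed
      ultimately show ?thesis using True by (simp add: v_def)
    next
      case False
      then show ?thesis using s(1)[OF that] ge[of j' y] unfolding v_def by auto
    qed
    show "dsc i' y * v i' y \<le> along val i' y z + dsc i' z * v i' z"
      if "i' \<in> {1, 2}" "lo \<le> y" "y \<le> z" "z \<le> hi" for i' y z
    proof (cases "i' = i \<and> x \<le> y \<and> y \<le> r")
      case True
      then have 1: "dsc i' y * v i' y = along val i y r + dsc i r * val i r" using h by (simp add: v_def)
      show ?thesis
      proof (cases "z \<le> r")
        case z: True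
        then have "dsc i z * v i z = along val i z r + dsc i r * val i r"
          using True that h by (simp add: v_def)
        then show ?thesis using 1 True along_combine[OF vb ij(1) that(2,3) z] by simp
      next
        case z: False
        then have "along val i y z = along val i y r + along val i r z"
          using True that by (intro along_combine vb ij) auto
        moreover have "dsc i r * val i r \<le> along val i r z + dsc i z * val i z"
          using z xr that by (intro s(2) ij) auto
        ultimately show ?thesis using 1 z True by (simp add: v_def)
      qed
    next
      case False
      then have "v i' y = val i' y" by (auto simp: v_def)
      then have "dsc i' y * v i' y \<le> along val i' y z + dsc i' z * val i' z"
        using s(2)[OF that] by simp
      also have "\<dots> \<le> along val i' y z + dsc i' z * v i' z"
        using ge by (intro add_left_mono mult_left_mono) (auto simp: less_imp_le[OF dsc_pos])
      finally show ?thesis .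
    qed
    show "v i' hi \<le> switch m i' 0 + idle val" if "i' \<in> {1, 2}" for i'
    proof -
      have "h hi = val i hi" if "hi \<le> r"
      proof -
        have "r = hi" using that xr by simp
        then have "dsc i hi * h hi = dsc i hi * val i hi" using h[of hi] xr by simp
        then show ?thesis using dsc_pos[of i hi] by simp
      qed
      then show ?thesis using s(3)[OF that] unfolding v_def by auto
    qed
  qed (use ge ij xr in auto)
  then have "h x = val i x" using xr by (simp add: v_def)
  then show ?thesis using h[of x] xr by simp
qed

definition fdsc :: "nat \<Rightarrow> real \<Rightarrow> real" where
  "fdsc c z = exp (- (disc m * z / rate m c))"

text \<open>Identifies the constant \<open>a\<close> of \<open>discount_change\<close> as
  \<open>intensity m / rate m c\<close>.\<close>

lemma fdsc_eq: "fdsc c z = exp (intensity m / rate m c * z) * dsc c z"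
  unfolding fdsc_def dsc_def exp_add[symmetric] by (simp add: algebra_simps add_divide_distrib)

lemma fdsc_pos [simp]: "0 < fdsc c z"
  by (simp add: fdsc_def)

lemma level_bounded:
  assumes "c \<in> {1, 2}" "lo \<le> x"
  shows "\<exists>B. \<forall>z\<ge>x. \<bar>dsc c z * gain val c z / rate m c\<bar> \<le> B \<and> \<bar>dsc c z * val c z\<bar> \<le> B"
proof (intro exI[of _ "max (dsc c x * gain_max / rate m c) (dsc c x * val_max)"] allI impI conjI)
  fix z assume z: "x \<le> z"
  have c: "c \<in> {0, 1, 2}" using assms by auto
  show "\<bar>dsc c z * gain val c z / rate m c\<bar> \<le> max (dsc c x * gain_max / rate m c) (dsc c x * val_max)"
    using gain_bounds[OF val_bnd c, of z] dsc_anti[OF assms(1) z] rate_pos[OF assms(1)] assms z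
    by (intro max.coboundedI1) (auto simp: abs_mult less_imp_le[OF dsc_pos] intro!: divide_right_mono mult_mono)
  show "\<bar>dsc c z * val c z\<bar> \<le> max (dsc c x * gain_max / rate m c) (dsc c x * val_max)"
    using bndD(1,2)[OF val_bnd assms(1), of z] dsc_anti[OF assms(1) z] assms z
    by (intro max.coboundedI2) (auto simp: abs_mult less_imp_le[OF dsc_pos] intro!: mult_mono)
qed

text \<open>The drift inequality under interest alone: the killing by the next demand, which used to
  sit in the discount factor, reappears as the running term with
  \<open>intensity m * val\<close>.\<close>

lemma val_drift:
  assumes c: "c \<in> {1, 2}" and xy: "lo \<le> x" "x \<le> y" "y \<le> hi"
  shows "fdsc c x * val c x + integral {x..y} (\<lambda>z. fdsc c z * (intensity m * val c z) / rate m c)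
       \<le> integral {x..y} (\<lambda>z. fdsc c z * gain val c z / rate m c) + fdsc c y * val c y"
proof -
  obtain B where B: "\<And>z. x \<le> z \<Longrightarrow> \<bar>dsc c z * gain val c z / rate m c\<bar> \<le> B" "\<And>z. x \<le> z \<Longrightarrow> \<bar>dsc c z * val c z\<bar> \<le> B"
    using level_bounded[OF c xy(1)] by blast
  have [measurable]: "gain val c \<in> borel_measurable borel" "val c \<in> borel_measurable borel"
    using c by (auto intro!: gain_measurable val_bnd bndD(3)[OF val_bnd])
  define a where "a = intensity m / rate m c"
  have "exp (a * x) * (dsc c x * val c x) + integral {x..y} (\<lambda>z. a * exp (a * z) * (dsc c z * val c z))
      \<le> integral {x..y} (\<lambda>z. exp (a * z) * (dsc c z * gain val c z / rate m c)) + exp (a * y) * (dsc c y * val c y)"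
  proof (rule discount_change)
    show "dsc c z * val c z \<le> integral {z..y} (\<lambda>z. dsc c z * gain val c z / rate m c) + dsc c y * val c y" if "x \<le> z" "z \<le> y" for z
      using subvalD(2)[OF val_subval c, of z y] that xy unfolding along_def by auto
  qed (use B xy intensity_pos rate_pos[OF c] in \<open>auto simp: a_def\<close>)
  then show ?thesis unfolding fdsc_eq a_def by (simp add: mult_ac)
qed

text \<open>The factor 5 lets \<open>val_follow\<close> start at any \<open>z\<close> in
  \<open>[x, y]\<close>: it requires a gap of 3 times \<open>lip\<close> times the remaining
  distance, and the variation of \<open>val i\<close> and \<open>val j\<close> from \<open>x\<close>
  to \<open>z\<close> uses up 2 more.\<close>

lemma val_drift_eq:
  assumes ij: "i \<in> {1, 2}" "j \<in> {1, 2}" "i \<noteq> j" and xy: "lo \<le> x" "x \<le> y" "y \<le> hi"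
    and gap: "val i x + 5 * lip * (y - x) \<le> val j x + switch m i j"
  shows "fdsc i x * val i x + integral {x..y} (\<lambda>z. fdsc i z * (intensity m * val i z) / rate m i)
       = integral {x..y} (\<lambda>z. fdsc i z * gain val i z / rate m i) + fdsc i y * val i y"
proof (rule antisym)
  obtain B where B: "\<And>z. x \<le> z \<Longrightarrow> \<bar>dsc i z * gain val i z / rate m i\<bar> \<le> B" "\<And>z. x \<le> z \<Longrightarrow> \<bar>dsc i z * val i z\<bar> \<le> B"
    using level_bounded[OF ij(1) xy(1)] by blast
  have [measurable]: "gain val i \<in> borel_measurable borel" "val i \<in> borel_measurable borel"
    using ij by (auto intro!: gain_measurable val_bnd bndD(3)[OF val_bnd])
  define a where "a = intensity m / rate m i"
  have eq: "dsc i z * val i z = along val i z y + dsc i y * val i y" if z: "x \<le> z" "z \<le> y" for z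
  proof (rule val_follow[OF ij])
    have "val i z \<le> val i x + lip * (z - x)" "val j x \<le> val j z + lip * (z - x)"
      using val_lipschitz[OF ij(1), of z x] val_lipschitz[OF ij(2), of z x] z by auto
    moreover have "3 * lip * (y - z) + 2 * (lip * (z - x)) \<le> 5 * lip * (y - x)"
    proof -
      have "3 * lip * (y - z) \<le> 3 * lip * (y - x)" "2 * (lip * (z - x)) \<le> 2 * (lip * (y - x))"
        using z lip_nonneg by (auto intro!: mult_left_mono)
      then show ?thesis by linarith
    qed
    ultimately show "val i z + 3 * lip * (y - z) \<le> val j z + switch m i j" using gap by linarith
  qed (use z xy in auto)
  \<comment> \<open>The inequality opposite to \<open>val_drift\<close> comes from applying
    \<open>discount_change\<close> to the negated functions.\<close>
  have "exp (a * x) * (- (dsc i x * val i x)) + integral {x..y} (\<lambda>z. a * exp (a * z) * (- (dsc i z * val i z)))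
      \<le> integral {x..y} (\<lambda>z. exp (a * z) * (- (dsc i z * gain val i z / rate m i))) + exp (a * y) * (- (dsc i y * val i y))"
  proof (rule discount_change)
    show "- (dsc i z * val i z) \<le> integral {z..y} (\<lambda>z. - (dsc i z * gain val i z / rate m i)) + - (dsc i y * val i y)" if "x \<le> z" "z \<le> y" for z
      using eq[OF that] unfolding along_def by simp
  qed (use B xy intensity_pos rate_pos[OF ij(1)] in \<open>auto simp: a_def\<close>)
  then show "integral {x..y} (\<lambda>z. fdsc i z * gain val i z / rate m i) + fdsc i y * val i y
    \<le> fdsc i x * val i x + integral {x..y} (\<lambda>z. fdsc i z * (intensity m * val i z) / rate m i)"
    unfolding fdsc_eq a_def by (simp add: mult_ac)
qed (rule val_drift[OF ij(1) xy])

section \<open>Arrival times and the information at the demands\<close>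

abbreviation Om where "Om \<equiv> space (sample m)"
abbreviation arr where "arr \<equiv> arrival m"

definition gap :: "nat \<Rightarrow> 'a \<Rightarrow> real" where
  "gap n \<omega> = arr (Suc n) \<omega> - arr n \<omega>"

definition obs :: "nat + nat \<Rightarrow> 'a \<Rightarrow> real" where
  "obs k = (case k of Inl n \<Rightarrow> gap n | Inr n \<Rightarrow> demand m (Suc n))"

definition past :: "nat \<Rightarrow> (nat + nat) set" where
  "past n = Inl ` {..<n} \<union> Inr ` {..<n}"

text \<open>The information at the \<open>n\<close>-th demand, generated by the first
  \<open>n\<close> gaps and the first \<open>n\<close> demands. What comes next,
  \<open>gap n\<close> and \<open>demand m (Suc n)\<close>, is independent of it.\<close>

definition hist :: "nat \<Rightarrow> 'a measure" where
  "hist n = vimage_algebra Om (\<lambda>\<omega>. restrict (\<lambda>k. obs k \<omega>) (past n)) (PiM (past n) (\<lambda>_. borel))"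

lemma gap_rv [measurable]: "gap n \<in> borel_measurable (sample m)"
  unfolding gap_def[abs_def] by (rule gap_measurable)

lemma obs_rv [measurable]: "obs k \<in> borel_measurable (sample m)"
  unfolding obs_def by (cases k) simp_all

lemma obs_indep: "P.indep_vars (\<lambda>_. borel) obs UNIV"
proof -
  have "obs = (\<lambda>k. case k of Inl n \<Rightarrow> \<lambda>\<omega>. arr (Suc n) \<omega> - arr n \<omega> | Inr n \<Rightarrow> demand m (Suc n))"
    by (auto simp: obs_def gap_def fun_eq_iff split: sum.split)
  then show ?thesis using independent by simp
qed

lemma arr_0: "\<omega> \<in> Om \<Longrightarrow> arr 0 \<omega> = 0"
  and arr_strict: "\<omega> \<in> Om \<Longrightarrow> strict_mono (\<lambda>n. arr n \<omega>)"
  and arr_tendsto: "\<omega> \<in> Om \<Longrightarrow> filterlim (\<lambda>n. arr n \<omega>) at_top sequentially"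
  using arrival_paths by auto

lemma arr_less: "\<omega> \<in> Om \<Longrightarrow> k < n \<Longrightarrow> arr k \<omega> < arr n \<omega>"
  using arr_strict by (auto simp: strict_mono_def)

lemma arr_le: "\<omega> \<in> Om \<Longrightarrow> k \<le> n \<Longrightarrow> arr k \<omega> \<le> arr n \<omega>"
  using arr_less[of \<omega> k n] by (cases "k = n") auto

lemma arr_nonneg: "\<omega> \<in> Om \<Longrightarrow> 0 \<le> arr n \<omega>"
  using arr_le[of \<omega> 0 n] arr_0 by simp

lemma gap_pos: "\<omega> \<in> Om \<Longrightarrow> 0 < gap n \<omega>"
  unfolding gap_def using arr_less[of \<omega> n "Suc n"] by simp

lemma arr_Suc: "arr (Suc n) \<omega> = arr n \<omega> + gap n \<omega>"
  unfolding gap_def by simp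

lemma arr_sum: "\<omega> \<in> Om \<Longrightarrow> arr n \<omega> = (\<Sum>k<n. gap k \<omega>)"
  by (induction n) (auto simp: arr_0 arr_Suc)

lemma space_hist [simp]: "space (hist n) = Om"
  by (simp add: hist_def)

lemma restrict_obs_measurable: "(\<lambda>\<omega>. restrict (\<lambda>k. obs k \<omega>) K) \<in> sample m \<rightarrow>\<^sub>M PiM K (\<lambda>_. borel)"
  by (intro measurable_restrict) simp

lemma sets_hist: "sets (hist n) =
    {(\<lambda>\<omega>. restrict (\<lambda>k. obs k \<omega>) (past n)) -` A \<inter> Om | A. A \<in> sets (PiM (past n) (\<lambda>_. borel))}"
  unfolding hist_def
  using measurable_space[OF restrict_obs_measurable] by (intro sets_vimage_algebra2) auto

lemma sets_hist_le: "sets (hist n) \<subseteq> sets (sample m)"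
  unfolding sets_hist using measurable_sets[OF restrict_obs_measurable] by auto

lemma measurable_from_hist: "f \<in> hist n \<rightarrow>\<^sub>M N \<Longrightarrow> f \<in> sample m \<rightarrow>\<^sub>M N"
  using sets_hist_le[of n] by (auto simp: measurable_def)

lemma id_hist: "(\<lambda>\<omega>. \<omega>) \<in> sample m \<rightarrow>\<^sub>M hist n"
  by (rule measurable_from_hist[OF measurable_ident_sets[OF refl]])

lemma obs_hist: "k \<in> past n \<Longrightarrow> obs k \<in> borel_measurable (hist n)"
proof -
  assume k: "k \<in> past n"
  have "(\<lambda>\<omega>. restrict (\<lambda>k. obs k \<omega>) (past n)) \<in> hist n \<rightarrow>\<^sub>M PiM (past n) (\<lambda>_. borel)"
    unfolding hist_def using measurable_space[OF restrict_obs_measurable] by (intro measurable_vimage_algebra1) auto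
  then have "(\<lambda>\<omega>. restrict (\<lambda>k. obs k \<omega>) (past n) k) \<in> borel_measurable (hist n)"
    using k by (rule measurable_compose[OF _ measurable_component_singleton])
  then show ?thesis using k by (simp add: restrict_def)
qed

lemma gap_hist: "k < n \<Longrightarrow> gap k \<in> borel_measurable (hist n)"
  and demand_hist: "k < n \<Longrightarrow> demand m (Suc k) \<in> borel_measurable (hist n)"
  using obs_hist[of "Inl k" n] obs_hist[of "Inr k" n] by (auto simp: obs_def past_def)

lemma arr_hist [measurable (raw)]: "k \<le> n \<Longrightarrow> arr k \<in> borel_measurable (hist n)"
proof -
  assume "k \<le> n"
  then have "(\<lambda>\<omega>. \<Sum>j<k. gap j \<omega>) \<in> borel_measurable (hist n)"
    by (intro borel_measurable_sum gap_hist) auto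
  then show ?thesis
    by (rule measurable_cong[THEN iffD1, rotated]) (simp add: arr_sum)
qed

lemma hist_mono: "k \<le> n \<Longrightarrow> sets (hist k) \<subseteq> sets (hist n)"
proof
  fix B assume "k \<le> n" "B \<in> sets (hist k)"
  then obtain A where A: "A \<in> sets (PiM (past k) (\<lambda>_. borel))"
    "B = (\<lambda>\<omega>. restrict (\<lambda>k. obs k \<omega>) (past k)) -` A \<inter> Om" unfolding sets_hist by auto
  have "past k \<subseteq> past n" using \<open>k \<le> n\<close> by (auto simp: past_def)
  then have "(\<lambda>\<omega>. restrict (\<lambda>k. obs k \<omega>) (past k)) \<in> hist n \<rightarrow>\<^sub>M PiM (past k) (\<lambda>_. borel)"
    by (intro measurable_restrict obs_hist) auto
  from measurable_sets[OF this A(1)] show "B \<in> sets (hist n)" using A(2) by simp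
qed

lemma measurable_hist_mono: "f \<in> hist k \<rightarrow>\<^sub>M N \<Longrightarrow> k \<le> n \<Longrightarrow> f \<in> hist n \<rightarrow>\<^sub>M N"
  using hist_mono[of k n] by (auto simp: measurable_def)

lemma arr_rv [measurable]: "arr k \<in> borel_measurable (sample m)"
  by (rule measurable_from_hist[OF arr_hist[OF order.refl]])

subsection \<open>The next demand is independent of the past\<close>

definition expd :: "real measure" where
  "expd = density lborel (\<lambda>s. ennreal (exponential_density (intensity m) s))"

lemma sets_expd [measurable_cong, simp]: "sets expd = sets borel" "space expd = UNIV"
  by (auto simp: expd_def)

lemma prob_space_expd: "prob_space expd"
  unfolding expd_def by (rule prob_space_exponential_density[OF intensity_pos])

lemma distr_gap: "distr (sample m) borel (gap n) = expd"
proof -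
  have "distr (sample m) lborel (gap n) = expd"
    using interarrival_exponential unfolding distributed_def expd_def gap_def[abs_def] by auto
  then show ?thesis by (metis distr_cong sets_lborel)
qed

text \<open>Independence in integrated form: the joint law of the past, the gap and the demand is a
  product measure, which needs checking on rectangles only. The sample itself, equipped with the
  smaller sigma-algebra \<open>hist n\<close>, plays the role of the past.\<close>

lemma nn_integral_hist:
  assumes [measurable]: "\<phi> \<in> borel_measurable (hist n \<Otimes>\<^sub>M (borel \<Otimes>\<^sub>M borel))"
  shows "(\<integral>\<^sup>+\<omega>. \<phi> (\<omega>, gap n \<omega>, demand m (Suc n) \<omega>) \<partial>sample m)
       = (\<integral>\<^sup>+\<omega>. (\<integral>\<^sup>+s. (\<integral>\<^sup>+y. \<phi> (\<omega>, s, y) \<partial>dlaw) \<partial>expd) \<partial>sample m)"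
proof -
  interpret ex: prob_space expd by (rule prob_space_expd)
  interpret pr: pair_prob_space expd dlaw ..
  let ?Z = "\<lambda>\<omega>. (gap n \<omega>, demand m (Suc n) \<omega>)"
  let ?B = "{Inl n, Inr n} :: (nat + nat) set"
  have Z [measurable]: "?Z \<in> sample m \<rightarrow>\<^sub>M borel \<Otimes>\<^sub>M borel" by measurable
  have 1: "P.indep_var (PiM (past n) (\<lambda>_. borel)) (\<lambda>\<omega>. restrict (\<lambda>k. obs k \<omega>) (past n))
         (PiM ?B (\<lambda>_. borel)) (\<lambda>\<omega>. restrict (\<lambda>k. obs k \<omega>) ?B)"
    by (rule P.indep_var_restrict[OF obs_indep]) (auto simp: past_def)
  have 3: "distr (sample m) (hist n) (\<lambda>\<omega>. \<omega>) \<Otimes>\<^sub>M distr (sample m) (borel \<Otimes>\<^sub>M borel) ?Z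
      = distr (sample m) (hist n \<Otimes>\<^sub>M (borel \<Otimes>\<^sub>M borel)) (\<lambda>\<omega>. (\<omega>, ?Z \<omega>))"
  proof (rule pair_measure_eqI)
    show "sigma_finite_measure (distr (sample m) (hist n) (\<lambda>\<omega>. \<omega>))"
      using P.prob_space_distr[OF id_hist] by (rule prob_space_imp_sigma_finite)
    show "sigma_finite_measure (distr (sample m) (borel \<Otimes>\<^sub>M borel) ?Z)"
      using P.prob_space_distr[OF Z] by (rule prob_space_imp_sigma_finite)
    fix A C assume "A \<in> sets (distr (sample m) (hist n) (\<lambda>\<omega>. \<omega>))" "C \<in> sets (distr (sample m) (borel \<Otimes>\<^sub>M borel) ?Z)"
    then have A: "A \<in> sets (hist n)" and C: "C \<in> sets (borel \<Otimes>\<^sub>M borel)" by simp_all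
    obtain A' where A': "A' \<in> sets (PiM (past n) (\<lambda>_. borel))" "A = (\<lambda>\<omega>. restrict (\<lambda>k. obs k \<omega>) (past n)) -` A' \<inter> Om"
      using A unfolding sets_hist by auto
    define C' where "C' = (\<lambda>f. (f (Inl n), f (Inr n))) -` C \<inter> space (PiM ?B (\<lambda>_. borel :: real measure))"
    have C': "C' \<in> sets (PiM ?B (\<lambda>_. borel))"
      unfolding C'_def using C
      by (intro measurable_sets[of _ _ "borel \<Otimes>\<^sub>M borel"] measurable_Pair measurable_component_singleton) auto
    have ZC: "(\<lambda>\<omega>. restrict (\<lambda>k. obs k \<omega>) ?B) -` C' \<inter> Om = ?Z -` C \<inter> Om"
      unfolding C'_def by (auto simp: space_PiM obs_def)
    have Am: "A \<in> sets (sample m)" using A sets_hist_le by auto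
    have Zm: "?Z -` C \<inter> Om \<in> sets (sample m)" by (rule measurable_sets[OF Z C])
    have AC: "A \<inter> (?Z -` C \<inter> Om) = (\<lambda>\<omega>. (\<omega>, ?Z \<omega>)) -` (A \<times> C) \<inter> Om"
      using sets.sets_into_space[OF Am] by auto
    have "P.prob (A \<inter> (?Z -` C \<inter> Om)) = P.prob A * P.prob (?Z -` C \<inter> Om)"
    proof -
      have "A \<inter> (?Z -` C \<inter> Om) = (\<lambda>\<omega>. (restrict (\<lambda>k. obs k \<omega>) (past n), restrict (\<lambda>k. obs k \<omega>) ?B)) -` (A' \<times> C') \<inter> Om"
        using ZC A'(2) by auto
      then show ?thesis
        using P.indep_varD[OF 1 A'(1) C'] ZC A'(2) by simp
    qed
    then have "emeasure (sample m) (A \<inter> (?Z -` C \<inter> Om)) = emeasure (sample m) A * emeasure (sample m) (?Z -` C \<inter> Om)"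
      by (simp add: P.emeasure_eq_measure ennreal_mult)
    then show "emeasure (distr (sample m) (hist n) (\<lambda>\<omega>. \<omega>)) A * emeasure (distr (sample m) (borel \<Otimes>\<^sub>M borel) ?Z) C
      = emeasure (distr (sample m) (hist n \<Otimes>\<^sub>M (borel \<Otimes>\<^sub>M borel)) (\<lambda>\<omega>. (\<omega>, ?Z \<omega>))) (A \<times> C)"
      using A C AC id_hist[of n] sets.sets_into_space[OF Am]
      by (subst (1 2 3) emeasure_distr) (auto simp: Int_absorb2 vimage_def)
  qed simp
  have "P.indep_var borel (obs (Inl n)) borel (obs (Inr n))"
  proof -
    have *: "P.indep_var (PiM {Inl n} (\<lambda>_. borel)) (\<lambda>\<omega>. restrict (\<lambda>k. obs k \<omega>) {Inl n})
         (PiM {Inr n} (\<lambda>_. borel)) (\<lambda>\<omega>. restrict (\<lambda>k. obs k \<omega>) {Inr n})"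
      by (rule P.indep_var_restrict[OF obs_indep]) auto
    have "P.indep_var borel ((\<lambda>f. f (Inl n)) \<circ> (\<lambda>\<omega>. restrict (\<lambda>k. obs k \<omega>) {Inl n}))
         borel ((\<lambda>f. f (Inr n)) \<circ> (\<lambda>\<omega>. restrict (\<lambda>k. obs k \<omega>) {Inr n}))"
      by (rule P.indep_var_compose[OF *]) (auto intro!: measurable_component_singleton)
    then show ?thesis by (simp add: comp_def)
  qed
  then have 4: "distr (sample m) (borel \<Otimes>\<^sub>M borel) ?Z = expd \<Otimes>\<^sub>M dlaw"
    unfolding P.indep_var_distribution_eq obs_def
    using distr_gap demand_identically_distributed by simp
  have "(\<integral>\<^sup>+\<omega>. \<phi> (\<omega>, ?Z \<omega>) \<partial>sample m)
      = (\<integral>\<^sup>+p. \<phi> p \<partial>distr (sample m) (hist n \<Otimes>\<^sub>M (borel \<Otimes>\<^sub>M borel)) (\<lambda>\<omega>. (\<omega>, ?Z \<omega>)))"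
    using id_hist[of n] by (subst nn_integral_distr) (auto intro!: measurable_Pair)
  also have "\<dots> = (\<integral>\<^sup>+p. \<phi> p \<partial>(distr (sample m) (hist n) (\<lambda>\<omega>. \<omega>) \<Otimes>\<^sub>M (expd \<Otimes>\<^sub>M dlaw)))"
    using 3 4 by simp
  also have "\<dots> = (\<integral>\<^sup>+\<omega>. (\<integral>\<^sup>+z. \<phi> (\<omega>, z) \<partial>(expd \<Otimes>\<^sub>M dlaw)) \<partial>distr (sample m) (hist n) (\<lambda>\<omega>. \<omega>))"
    by (rule pr.nn_integral_fst[symmetric]) simp
  also have "\<dots> = (\<integral>\<^sup>+\<omega>. (\<integral>\<^sup>+z. \<phi> (\<omega>, z) \<partial>(expd \<Otimes>\<^sub>M dlaw)) \<partial>sample m)"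
    using id_hist[of n] by (intro nn_integral_distr) (auto intro!: pr.borel_measurable_nn_integral_fst)
  also have "\<dots> = (\<integral>\<^sup>+\<omega>. (\<integral>\<^sup>+s. (\<integral>\<^sup>+y. \<phi> (\<omega>, s, y) \<partial>dlaw) \<partial>expd) \<partial>sample m)"
  proof (intro nn_integral_cong)
    fix \<omega> assume "\<omega> \<in> Om"
    then have "(\<lambda>z. \<phi> (\<omega>, z)) \<in> borel_measurable (borel \<Otimes>\<^sub>M borel)" by simp
    then show "(\<integral>\<^sup>+z. \<phi> (\<omega>, z) \<partial>(expd \<Otimes>\<^sub>M dlaw)) = (\<integral>\<^sup>+s. (\<integral>\<^sup>+y. \<phi> (\<omega>, s, y) \<partial>dlaw) \<partial>expd)"
      by (intro law.nn_integral_fst[symmetric]) simp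
  qed
  finally show ?thesis .
qed

lemma nn_integral_hist_gap:
  assumes [measurable]: "f \<in> borel_measurable (hist n \<Otimes>\<^sub>M borel)"
  shows "(\<integral>\<^sup>+\<omega>. f (\<omega>, gap n \<omega>) \<partial>sample m) = (\<integral>\<^sup>+\<omega>. (\<integral>\<^sup>+s. f (\<omega>, s) \<partial>expd) \<partial>sample m)"
  using nn_integral_hist[of "\<lambda>p. f (fst p, fst (snd p))" n] law.emeasure_space_1 by simp

lemma expd_tail: "0 \<le> s \<Longrightarrow> (\<integral>\<^sup>+e. indicator {s..} e \<partial>expd) = ennreal (exp (- intensity m * s))"
proof -
  assume s: "0 \<le> s"
  have "(\<integral>\<^sup>+e. indicator {s..} e \<partial>expd) = (\<integral>\<^sup>+e. ennreal (intensity m * exp (- intensity m * e)) * indicator {s..} e \<partial>lborel)"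
    unfolding expd_def using s
    by (subst nn_integral_density) (auto intro!: nn_integral_cong simp: exponential_density_def indicator_def mult_ac)
  also have "\<dots> = ennreal (0 - (- exp (- intensity m * s)))"
  proof (rule nn_integral_FTC_atLeast)
    show "((\<lambda>e. - exp (- intensity m * e)) \<longlongrightarrow> 0) at_top"
    proof -
      have "filterlim (\<lambda>e. - intensity m * e) at_bot at_top"
        using intensity_pos by (intro filterlim_tendsto_neg_mult_at_bot[OF tendsto_const _ filterlim_ident]) auto
      from tendsto_minus[OF filterlim_compose[OF exp_at_bot this]] show ?thesis by simp
    qed
  qed (use intensity_pos in \<open>auto intro!: derivative_eq_intros\<close>)
  finally show ?thesis by simp
qed

lemma elapsed_measurable:
  fixes f :: "'a \<times> real \<Rightarrow> ennreal"
  assumes [measurable]: "f \<in> borel_measurable (hist n \<Otimes>\<^sub>M borel)"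
  shows "(\<lambda>p. \<integral>\<^sup>+s. f (fst p, s) * indicator {0..snd p} s \<partial>lborel) \<in> borel_measurable (hist n \<Otimes>\<^sub>M borel)"
proof -
  have i: "(\<lambda>q. indicator {0..snd (fst q)} (snd q :: real) :: ennreal) \<in> borel_measurable ((hist n \<Otimes>\<^sub>M borel) \<Otimes>\<^sub>M borel)"
  proof -
    have "(\<lambda>q. if 0 \<le> snd q \<and> (snd q :: real) \<le> snd (fst q) then 1 else 0 :: ennreal) \<in> borel_measurable ((hist n \<Otimes>\<^sub>M borel) \<Otimes>\<^sub>M borel)"
      by measurable
    then show ?thesis by (rule measurable_cong[THEN iffD1, rotated]) (auto simp: indicator_def)
  qed
  have [measurable]: "(\<lambda>q. f (fst (fst q), snd q) * indicator {0..snd (fst q)} (snd q)) \<in> borel_measurable ((hist n \<Otimes>\<^sub>M borel) \<Otimes>\<^sub>M borel)"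
    using i by measurable
  have "(\<lambda>q. f (fst (fst q), snd q) * indicator {0..snd (fst q)} (snd q)) \<in> borel_measurable ((hist n \<Otimes>\<^sub>M borel) \<Otimes>\<^sub>M lborel)"
    by (subst measurable_cong_sets[OF sets_pair_measure_cong[OF refl sets_lborel] refl]) simp
  from lborel.borel_measurable_nn_integral_fst[OF this] show ?thesis by simp
qed

text \<open>The compensator formula: conditionally on the past, demands arrive at the constant rate
  \<open>intensity m\<close>.\<close>

lemma compensator:
  assumes [measurable]: "f \<in> borel_measurable (hist n \<Otimes>\<^sub>M borel)"
  shows "(\<integral>\<^sup>+\<omega>. f (\<omega>, gap n \<omega>) \<partial>sample m)
       = ennreal (intensity m) * (\<integral>\<^sup>+\<omega>. (\<integral>\<^sup>+s. f (\<omega>, s) * indicator {0..gap n \<omega>} s \<partial>lborel) \<partial>sample m)"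
proof -
  interpret ex: prob_space expd by (rule prob_space_expd)
  interpret pr: pair_sigma_finite lborel expd ..
  have [measurable]: "(\<lambda>p. f (fst p, snd p)) \<in> borel_measurable (hist n \<Otimes>\<^sub>M borel)" by simp
  define g where "g p = (\<integral>\<^sup>+s. f (fst p, s) * indicator {0..snd p} s \<partial>lborel)" for p
  have [measurable]: "g \<in> borel_measurable (hist n \<Otimes>\<^sub>M borel)"
    unfolding g_def[abs_def] by (rule elapsed_measurable) simp
  have "(\<integral>\<^sup>+\<omega>. (\<integral>\<^sup>+s. f (\<omega>, s) * indicator {0..gap n \<omega>} s \<partial>lborel) \<partial>sample m) = (\<integral>\<^sup>+\<omega>. (\<integral>\<^sup>+e. g (\<omega>, e) \<partial>expd) \<partial>sample m)"
    using nn_integral_hist_gap[of g n] by (simp add: g_def)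
  \<comment> \<open>Both sides of the claim reduce to \<open>f (\<omega>, s)\<close> integrated
    against \<open>exp (- intensity m * s)\<close> over \<open>s \<ge> 0\<close>: here because that
    is the probability of a gap of at least \<open>s\<close>, on the left because it is the density
    of the gap up to the factor \<open>intensity m\<close>.\<close>
  also have "\<dots> = (\<integral>\<^sup>+\<omega>. (\<integral>\<^sup>+s. f (\<omega>, s) * indicator {0..} s * ennreal (exp (- intensity m * s)) \<partial>lborel) \<partial>sample m)"
  proof (intro nn_integral_cong)
    fix \<omega> assume "\<omega> \<in> Om"
    then have [measurable]: "(\<lambda>s. f (\<omega>, s)) \<in> borel_measurable borel" by simp
    have [measurable]: "(\<lambda>q. indicator {0..snd q} (fst q :: real) :: ennreal) \<in> borel_measurable (borel \<Otimes>\<^sub>M borel)"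
    proof -
      have "(\<lambda>q. if 0 \<le> fst q \<and> (fst q :: real) \<le> snd q then 1 else 0 :: ennreal) \<in> borel_measurable (borel \<Otimes>\<^sub>M borel)"
        by measurable
      then show ?thesis by (rule measurable_cong[THEN iffD1, rotated]) (auto simp: indicator_def)
    qed
    have "(\<integral>\<^sup>+e. g (\<omega>, e) \<partial>expd) = (\<integral>\<^sup>+e. \<integral>\<^sup>+s. f (\<omega>, s) * indicator {0..e} s \<partial>lborel \<partial>expd)"
      by (simp add: g_def)
    also have "\<dots> = (\<integral>\<^sup>+s. \<integral>\<^sup>+e. f (\<omega>, s) * indicator {0..e} s \<partial>expd \<partial>lborel)"
      by (rule pr.Fubini') (simp add: split_beta')
    also have "\<dots> = (\<integral>\<^sup>+s. f (\<omega>, s) * indicator {0..} s * ennreal (exp (- intensity m * s)) \<partial>lborel)"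
    proof (intro nn_integral_cong)
      fix s :: real
      have "indicator {0..e} s = (indicator {0..} s * indicator {s..} e :: ennreal)" for e
        by (auto simp: indicator_def)
      then have "(\<integral>\<^sup>+e. f (\<omega>, s) * indicator {0..e} s \<partial>expd) = (\<integral>\<^sup>+e. (f (\<omega>, s) * indicator {0..} s) * indicator {s..} e \<partial>expd)"
        by (simp add: mult.assoc)
      also have "\<dots> = f (\<omega>, s) * indicator {0..} s * (\<integral>\<^sup>+e. indicator {s..} e \<partial>expd)"
        by (rule nn_integral_cmult) simp
      also have "\<dots> = f (\<omega>, s) * indicator {0..} s * ennreal (exp (- intensity m * s))"
        using expd_tail[of s] by (cases "0 \<le> s") auto
      finally show "(\<integral>\<^sup>+e. f (\<omega>, s) * indicator {0..e} s \<partial>expd) = f (\<omega>, s) * indicator {0..} s * ennreal (exp (- intensity m * s))" .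
    qed
    finally show "(\<integral>\<^sup>+e. g (\<omega>, e) \<partial>expd) = (\<integral>\<^sup>+s. f (\<omega>, s) * indicator {0..} s * ennreal (exp (- intensity m * s)) \<partial>lborel)" .
  qed
  finally have r: "(\<integral>\<^sup>+\<omega>. (\<integral>\<^sup>+s. f (\<omega>, s) * indicator {0..gap n \<omega>} s \<partial>lborel) \<partial>sample m)
    = (\<integral>\<^sup>+\<omega>. (\<integral>\<^sup>+s. f (\<omega>, s) * indicator {0..} s * ennreal (exp (- intensity m * s)) \<partial>lborel) \<partial>sample m)" .
  define h where "h p = f p * indicator {0..} (snd p) * ennreal (exp (- intensity m * snd p))" for p
  have [measurable]: "h \<in> borel_measurable (hist n \<Otimes>\<^sub>M borel)"
    unfolding h_def by measurable
  have hm: "(\<lambda>\<omega>. \<integral>\<^sup>+s. h (\<omega>, s) \<partial>lborel) \<in> borel_measurable (hist n)"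
    by (rule lborel.borel_measurable_nn_integral_fst) simp
  have "(\<integral>\<^sup>+\<omega>. f (\<omega>, gap n \<omega>) \<partial>sample m) = (\<integral>\<^sup>+\<omega>. (\<integral>\<^sup>+s. f (\<omega>, s) \<partial>expd) \<partial>sample m)"
    by (rule nn_integral_hist_gap) simp
  also have "\<dots> = (\<integral>\<^sup>+\<omega>. ennreal (intensity m) * (\<integral>\<^sup>+s. h (\<omega>, s) \<partial>lborel) \<partial>sample m)"
  proof (intro nn_integral_cong)
    fix \<omega> assume "\<omega> \<in> Om"
    then have [measurable]: "(\<lambda>s. f (\<omega>, s)) \<in> borel_measurable borel" "(\<lambda>s. h (\<omega>, s)) \<in> borel_measurable borel" by simp_all
    have "(\<integral>\<^sup>+s. f (\<omega>, s) \<partial>expd) = (\<integral>\<^sup>+s. ennreal (exponential_density (intensity m) s) * f (\<omega>, s) \<partial>lborel)"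
      unfolding expd_def by (rule nn_integral_density) auto
    also have "\<dots> = (\<integral>\<^sup>+s. ennreal (intensity m) * h (\<omega>, s) \<partial>lborel)"
      using intensity_pos
      by (intro nn_integral_cong) (auto simp: h_def exponential_density_def ennreal_mult' mult_ac indicator_def)
    also have "\<dots> = ennreal (intensity m) * (\<integral>\<^sup>+s. h (\<omega>, s) \<partial>lborel)"
      by (rule nn_integral_cmult) simp
    finally show "(\<integral>\<^sup>+s. f (\<omega>, s) \<partial>expd) = ennreal (intensity m) * (\<integral>\<^sup>+s. h (\<omega>, s) \<partial>lborel)" .
  qed
  also have "\<dots> = ennreal (intensity m) * (\<integral>\<^sup>+\<omega>. (\<integral>\<^sup>+s. h (\<omega>, s) \<partial>lborel) \<partial>sample m)"
    by (rule nn_integral_cmult[OF measurable_from_hist[OF hm]])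
  finally show ?thesis unfolding r by (simp add: h_def)
qed

subsection \<open>The demand filtration\<close>

abbreviation filt where "filt \<equiv> demand_filtration m"

lemma arr_interval: "\<omega> \<in> Om \<Longrightarrow> 0 \<le> t \<Longrightarrow> \<exists>n. arr n \<omega> \<le> t \<and> t < arr (Suc n) \<omega>"
proof -
  assume \<omega>: "\<omega> \<in> Om" and t: "0 \<le> t"
  have "\<exists>k. t < arr k \<omega>"
    using arr_tendsto[OF \<omega>] unfolding filterlim_at_top_dense eventually_sequentially by blast
  then have k: "t < arr (LEAST k. t < arr k \<omega>) \<omega>" by (rule LeastI_ex)
  then obtain n where n: "(LEAST k. t < arr k \<omega>) = Suc n"
    using arr_0[OF \<omega>] t by (cases "LEAST k. t < arr k \<omega>") auto
  have "\<not> t < arr n \<omega>" by (rule not_less_Least) (simp add: n)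
  then show ?thesis using k n by (auto intro!: exI[of _ n])
qed

lemma arr_le_iff: "\<omega> \<in> Om \<Longrightarrow> arr n \<omega> \<le> t \<Longrightarrow> t < arr (Suc n) \<omega> \<Longrightarrow> arr k \<omega> \<le> t \<longleftrightarrow> k \<le> n"
  using arr_le[of \<omega> k n] arr_le[of \<omega> "Suc n" k] by (cases "k \<le> n") auto

lemma demand_count_eq:
  assumes "\<omega> \<in> Om" "arr n \<omega> \<le> t" "t < arr (Suc n) \<omega>"
  shows "demand_count m t \<omega> = n"
proof -
  have "{k. 1 \<le> k \<and> arr k \<omega> \<le> t} = {1..n}" by (auto simp: arr_le_iff[OF assms])
  then show ?thesis unfolding demand_count_def by simp
qed

lemma demand_count_ge: "\<omega> \<in> Om \<Longrightarrow> 0 \<le> t \<Longrightarrow> n \<le> demand_count m t \<omega> \<longleftrightarrow> arr n \<omega> \<le> t"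
proof -
  assume \<omega>: "\<omega> \<in> Om" and "0 \<le> t"
  then obtain N where N: "arr N \<omega> \<le> t" "t < arr (Suc N) \<omega>" using arr_interval by blast
  show ?thesis using demand_count_eq[OF \<omega> N] arr_le_iff[OF \<omega> N, of n] by simp
qed

text \<open>Before demand \<open>Suc n\<close> at most \<open>n\<close> demands have been counted,
  which turns the process into a function of the variables that generate
  \<open>hist n\<close>.\<close>

lemma demand_process_alt:
  assumes \<omega>: "\<omega> \<in> Om" and s: "0 \<le> s" "s < arr (Suc n) \<omega>"
  shows "demand_process m s \<omega> = (\<Sum>k=1..n. if arr k \<omega> \<le> s then demand m k \<omega> else 0)"
proof -
  obtain N where N: "arr N \<omega> \<le> s" "s < arr (Suc N) \<omega>" using arr_interval[OF \<omega> s(1)] by blast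
  have c: "demand_count m s \<omega> = N" by (rule demand_count_eq[OF \<omega> N])
  have "N \<le> n" using arr_le_iff[OF \<omega> N, of "Suc n"] s(2) by auto
  have "(\<Sum>k=1..n. if arr k \<omega> \<le> s then demand m k \<omega> else 0) = (\<Sum>k\<in>{1..n} \<inter> {k. arr k \<omega> \<le> s}. demand m k \<omega>)"
    by (simp add: sum.inter_restrict)
  also have "{1..n} \<inter> {k. arr k \<omega> \<le> s} = {1..N}" using \<open>N \<le> n\<close> by (auto simp: arr_le_iff[OF \<omega> N])
  finally show ?thesis unfolding demand_process_def c by simp
qed

lemma demand_sum_measurable:
  assumes "\<And>k. k < n \<Longrightarrow> demand m (Suc k) \<in> borel_measurable M"
  shows "(\<lambda>\<omega>. \<Sum>k=1..n. demand m k \<omega>) \<in> borel_measurable M"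
proof (rule borel_measurable_sum)
  fix k assume "k \<in> {1..n}"
  then show "demand m k \<in> borel_measurable M" using assms[of "k - 1"] by auto
qed

lemma space_filt [simp]: "space (filt t) = Om"
  unfolding demand_filtration_def by (rule space_measure_of) auto

lemma sets_filt: "sets (filt t) = sigma_sets Om {demand_process m s -` B \<inter> Om | s B. 0 \<le> s \<and> ennreal s \<le> t \<and> B \<in> sets borel}"
  unfolding demand_filtration_def by (rule sets_measure_of) auto

sublocale filt: filtration Om filt
proof
  fix i j :: ennreal assume "i \<le> j"
  then show "sets (filt i) \<subseteq> sets (filt j)"
    unfolding sets_filt by (intro sigma_sets_mono') (blast intro: order.trans)
qed simp

lemma demand_process_filt: "0 \<le> s \<Longrightarrow> ennreal s \<le> t \<Longrightarrow> demand_process m s \<in> borel_measurable (filt t)"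
  unfolding measurable_def by (auto simp: sets_filt intro!: sigma_sets.Basic)

lemma demand_count_rv:
  assumes "0 \<le> t" shows "demand_count m t \<in> sample m \<rightarrow>\<^sub>M count_space UNIV"
proof (rule measurable_count_space_eq2_countable[THEN iffD2])
  show "demand_count m t \<in> Om \<rightarrow> UNIV \<and> (\<forall>n\<in>UNIV. demand_count m t -` {n} \<inter> Om \<in> sets (sample m))"
  proof (intro conjI ballI)
    fix n
    have "demand_count m t -` {n} \<inter> Om = {\<omega> \<in> Om. arr n \<omega> \<le> t \<and> \<not> arr (Suc n) \<omega> \<le> t}"
      using demand_count_ge[OF _ assms, of _ n] demand_count_ge[OF _ assms, of _ "Suc n"] by fastforce
    also have "\<dots> \<in> sets (sample m)" by measurable
    finally show "demand_count m t -` {n} \<inter> Om \<in> sets (sample m)" .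
  qed auto
qed

lemma demand_process_rv: "0 \<le> s \<Longrightarrow> demand_process m s \<in> borel_measurable (sample m)"
  unfolding demand_process_def[abs_def]
  by (rule measurable_compose_countable[OF _ demand_count_rv]) (auto intro: demand_sum_measurable)

lemma sets_filt_le: "sets (filt t) \<subseteq> sets (sample m)"
  unfolding sets_filt
  by (rule sets.sigma_sets_subset) (auto intro: measurable_sets[OF demand_process_rv])

text \<open>Between two demands nothing is learned.\<close>

lemma filt_trace:
  assumes "U \<in> sets (filt (ennreal t))"
  shows "\<exists>B\<in>sets (hist n). \<forall>\<omega>\<in>Om. arr n \<omega> \<le> t \<longrightarrow> t < arr (Suc n) \<omega> \<longrightarrow> (\<omega> \<in> U \<longleftrightarrow> \<omega> \<in> B)"
proof (cases "0 \<le> t")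
  case False
  then have "\<not> arr n \<omega> \<le> t" if "\<omega> \<in> Om" for \<omega> using arr_nonneg[OF that, of n] by linarith
  then show ?thesis by (intro bexI[of _ "{}"]) auto
next
  case t: True
  from assms have "U \<in> sigma_sets Om {demand_process m s -` B \<inter> Om | s B. 0 \<le> s \<and> ennreal s \<le> ennreal t \<and> B \<in> sets borel}"
    unfolding sets_filt .
  then show ?thesis
  proof (induction rule: sigma_sets.induct)
    case (Basic a)
    then obtain s C where a: "a = demand_process m s -` C \<inter> Om" "0 \<le> s" "s \<le> t" "C \<in> sets borel" using t by auto
    let ?D = "\<lambda>\<omega>. \<Sum>k=1..n. if arr k \<omega> \<le> s then demand m k \<omega> else 0"
    have "?D \<in> borel_measurable (hist n)"
    proof (rule borel_measurable_sum)
      fix k assume k: "k \<in> {1..n}"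
      have [measurable]: "arr k \<in> borel_measurable (hist n)" "demand m k \<in> borel_measurable (hist n)"
        using k arr_hist[of k n] demand_hist[of "k - 1" n] by auto
      show "(\<lambda>\<omega>. if arr k \<omega> \<le> s then demand m k \<omega> else 0) \<in> borel_measurable (hist n)" by measurable
    qed
    then have "?D -` C \<inter> Om \<in> sets (hist n)" using a(4) measurable_sets[of ?D "hist n" borel C] by simp
    moreover have "demand_process m s \<omega> = ?D \<omega>" if "\<omega> \<in> Om" "t < arr (Suc n) \<omega>" for \<omega>
      using demand_process_alt[OF that(1) a(2), of n] that a(3) by simp
    ultimately show ?case using a(1) by (intro bexI[of _ "?D -` C \<inter> Om"]) auto
  next
    case Empty
    show ?case by (intro bexI[of _ "{}"]) auto
  next
    case (Compl a)
    then obtain B where B: "B \<in> sets (hist n)" "\<forall>\<omega>\<in>Om. arr n \<omega> \<le> t \<longrightarrow> t < arr (Suc n) \<omega> \<longrightarrow> (\<omega> \<in> a \<longleftrightarrow> \<omega> \<in> B)" by blast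
    have "Om - B \<in> sets (hist n)" using sets.compl_sets[OF B(1)] by simp
    then show ?case using B(2) by (intro bexI[of _ "Om - B"]) auto
  next
    case (Union a)
    then have "\<forall>i. \<exists>B. B \<in> sets (hist n) \<and> (\<forall>\<omega>\<in>Om. arr n \<omega> \<le> t \<longrightarrow> t < arr (Suc n) \<omega> \<longrightarrow> (\<omega> \<in> a i \<longleftrightarrow> \<omega> \<in> B))" by blast
    then obtain B where B: "\<And>i. B i \<in> sets (hist n)"
      "\<And>i. \<forall>\<omega>\<in>Om. arr n \<omega> \<le> t \<longrightarrow> t < arr (Suc n) \<omega> \<longrightarrow> (\<omega> \<in> a i \<longleftrightarrow> \<omega> \<in> B i)" by metis
    then show ?case by (intro bexI[of _ "\<Union>i. B i"]) auto
  qed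
qed

lemma rational_between: "x < (y::real) \<Longrightarrow> \<exists>r\<in>\<rat>. x < r \<and> r < y"
  using Rats_dense_in_real by blast

text \<open>Hence an event of the form \<open>T < t\<close>, for a stopping time \<open>T\<close>, is predictable in the strong sense that
  up to the next demand it is a function of the past and of the time elapsed.\<close>

lemma predictable_version:
  fixes T :: "'a \<Rightarrow> ennreal"
  assumes T: "\<And>t. 0 \<le> t \<Longrightarrow> {\<omega>\<in>Om. T \<omega> \<le> ennreal t} \<in> sets (filt (ennreal t))"
  shows "\<exists>L\<in>sets (hist n \<Otimes>\<^sub>M borel). \<forall>\<omega>\<in>Om. \<forall>s. 0 < s \<longrightarrow> s \<le> gap n \<omega> \<longrightarrow>
    ((\<omega>, s) \<in> L \<longleftrightarrow> T \<omega> < ennreal (arr n \<omega> + s))"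
proof -
  have "\<forall>t. \<exists>B. 0 \<le> t \<longrightarrow> B \<in> sets (hist n) \<and> (\<forall>\<omega>\<in>Om. arr n \<omega> \<le> t \<longrightarrow> t < arr (Suc n) \<omega> \<longrightarrow> (T \<omega> \<le> ennreal t \<longleftrightarrow> \<omega> \<in> B))"
    using filt_trace[OF T, of _ n] by fastforce
  then obtain B where B: "\<And>t. 0 \<le> t \<Longrightarrow> B t \<in> sets (hist n)"
    "\<And>t \<omega>. 0 \<le> t \<Longrightarrow> \<omega> \<in> Om \<Longrightarrow> arr n \<omega> \<le> t \<Longrightarrow> t < arr (Suc n) \<omega> \<Longrightarrow> (T \<omega> \<le> ennreal t \<longleftrightarrow> \<omega> \<in> B t)"
    by metis
  \<comment> \<open>\<open>T < arr n + s\<close> holds exactly when \<open>T \<le> t\<close> for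
    some rational \<open>t\<close> in \<open>[arr n, arr n + s)\<close>. Such \<open>t\<close> lie
    between two consecutive demands, where \<open>filt_trace\<close> replaces the event
    \<open>T \<le> t\<close> by \<open>B t\<close>, and countably many of them suffice.\<close>
  define L where "L = (\<Union>t\<in>\<rat> \<inter> {0..}. {p\<in>space (hist n \<Otimes>\<^sub>M borel). arr n (fst p) \<le> t \<and> t < arr n (fst p) + snd p \<and> fst p \<in> B t})"
  have [measurable]: "arr n \<in> borel_measurable (hist n)" by (rule arr_hist) simp
  have "L \<in> sets (hist n \<Otimes>\<^sub>M borel)"
    unfolding L_def
  proof (rule sets.countable_UN'')
    show "countable (\<rat> \<inter> {0..} :: real set)" using countable_rat by (rule countable_subset[rotated]) auto
    show "{p\<in>space (hist n \<Otimes>\<^sub>M borel). arr n (fst p) \<le> t \<and> t < arr n (fst p) + snd p \<and> fst p \<in> B t} \<in> sets (hist n \<Otimes>\<^sub>M borel)"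
      if "t \<in> \<rat> \<inter> {0..}" for t
    proof -
      from that have [measurable]: "B t \<in> sets (hist n)" using B(1) by auto
      show "{p\<in>space (hist n \<Otimes>\<^sub>M borel). arr n (fst p) \<le> t \<and> t < arr n (fst p) + snd p \<and> fst p \<in> B t} \<in> sets (hist n \<Otimes>\<^sub>M borel)"
        by measurable
    qed
  qed
  moreover have "(\<omega>, s) \<in> L \<longleftrightarrow> T \<omega> < ennreal (arr n \<omega> + s)" if \<omega>: "\<omega> \<in> Om" and s: "0 < s" "s \<le> gap n \<omega>" for \<omega> s
  proof
    assume "(\<omega>, s) \<in> L"
    then obtain t where t: "0 \<le> t" "arr n \<omega> \<le> t" "t < arr n \<omega> + s" "\<omega> \<in> B t"
      unfolding L_def by auto
    then have "T \<omega> \<le> ennreal t" using B(2)[of t \<omega>] \<omega> s by (simp add: arr_Suc)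
    also have "\<dots> < ennreal (arr n \<omega> + s)" using t by (simp add: ennreal_less_iff)
    finally show "T \<omega> < ennreal (arr n \<omega> + s)" .
  next
    assume "T \<omega> < ennreal (arr n \<omega> + s)"
    then obtain r where r: "T \<omega> = ennreal r" "0 \<le> r" "r < arr n \<omega> + s"
      by (cases "T \<omega>") (auto simp: ennreal_less_iff)
    obtain t where t: "t \<in> \<rat>" "max r (arr n \<omega>) < t" "t < arr n \<omega> + s"
      using rational_between[of "max r (arr n \<omega>)" "arr n \<omega> + s"] r s by auto
    then have "\<omega> \<in> B t" using B(2)[of t \<omega>] \<omega> s r by (simp add: arr_Suc ennreal_leI)
    moreover have "t \<in> \<rat> \<inter> {0..}" using t r by auto
    ultimately show "(\<omega>, s) \<in> L" using t \<omega> unfolding L_def by (auto simp: space_pair_measure intro!: bexI[of _ t])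
  qed
  ultimately show ?thesis by blast
qed

text \<open>Demands are positive, so an arrival shows as a strict increase of the demand process
  between a rational time after \<open>arr n\<close> and time \<open>t\<close>.\<close>

lemma arr_filt: "0 \<le> t \<Longrightarrow> {\<omega>\<in>Om. arr n \<omega> \<le> t} \<in> sets (filt (ennreal t))"
proof (induction n arbitrary: t)
  case 0
  then have "{\<omega>\<in>Om. arr 0 \<omega> \<le> t} = space (filt (ennreal t))" using arr_0 by auto
  then show ?case using sets.top[of "filt (ennreal t)"] by simp
next
  case (Suc n)
  have "{\<omega>\<in>Om. arr (Suc n) \<omega> \<le> t} = (\<Union>s\<in>\<rat> \<inter> {0..t}. {\<omega>\<in>Om. arr n \<omega> \<le> s} \<inter> {\<omega>\<in>Om. demand_process m s \<omega> < demand_process m t \<omega>})"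
  proof (intro set_eqI iffI)
    fix \<omega> assume "\<omega> \<in> {\<omega>\<in>Om. arr (Suc n) \<omega> \<le> t}"
    then have \<omega>: "\<omega> \<in> Om" "arr (Suc n) \<omega> \<le> t" by auto
    obtain s where s: "s \<in> \<rat>" "arr n \<omega> < s" "s < arr (Suc n) \<omega>"
      using rational_between arr_less[OF \<omega>(1), of n "Suc n"] by blast
    have s0: "0 \<le> s" using arr_nonneg[OF \<omega>(1), of n] s by linarith
    have n: "demand_count m s \<omega> = n" by (rule demand_count_eq[OF \<omega>(1)]) (use s in auto)
    have N: "Suc n \<le> demand_count m t \<omega>" using demand_count_ge[OF \<omega>(1) Suc.prems] \<omega> by simp
    have "(\<Sum>k=1..n. demand m k \<omega>) < (\<Sum>k=1..demand_count m t \<omega>. demand m k \<omega>)"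
      using N demand_pos \<omega>(1) by (intro sum_strict_mono2[where b = "Suc n"]) (auto intro: less_imp_le)
    then show "\<omega> \<in> (\<Union>s\<in>\<rat> \<inter> {0..t}. {\<omega>\<in>Om. arr n \<omega> \<le> s} \<inter> {\<omega>\<in>Om. demand_process m s \<omega> < demand_process m t \<omega>})"
      using s s0 \<omega> n unfolding demand_process_def by (intro UN_I[of s]) auto
  next
    fix \<omega> assume "\<omega> \<in> (\<Union>s\<in>\<rat> \<inter> {0..t}. {\<omega>\<in>Om. arr n \<omega> \<le> s} \<inter> {\<omega>\<in>Om. demand_process m s \<omega> < demand_process m t \<omega>})"
    then obtain s where s: "0 \<le> s" "s \<le> t" "\<omega> \<in> Om" "arr n \<omega> \<le> s" "demand_process m s \<omega> < demand_process m t \<omega>" by auto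
    have "demand_count m s \<omega> \<noteq> demand_count m t \<omega>" using s(5) unfolding demand_process_def by auto
    moreover have "demand_count m s \<omega> \<le> demand_count m t \<omega>"
      using demand_count_ge[OF s(3), of t "demand_count m s \<omega>"] demand_count_ge[OF s(3,1), of "demand_count m s \<omega>"] s by auto
    moreover have "n \<le> demand_count m s \<omega>" using demand_count_ge[OF s(3,1)] s by simp
    ultimately have "Suc n \<le> demand_count m t \<omega>" by simp
    then show "\<omega> \<in> {\<omega>\<in>Om. arr (Suc n) \<omega> \<le> t}" using demand_count_ge[OF s(3) Suc.prems] s by simp
  qed
  also have "\<dots> \<in> sets (filt (ennreal t))"
  proof (rule sets.countable_UN'')
    show "countable (\<rat> \<inter> {0..t} :: real set)" using countable_rat by (rule countable_subset[rotated]) auto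
    show "{\<omega>\<in>Om. arr n \<omega> \<le> s} \<inter> {\<omega>\<in>Om. demand_process m s \<omega> < demand_process m t \<omega>} \<in> sets (filt (ennreal t))"
      if "s \<in> \<rat> \<inter> {0..t}" for s
    proof -
      from that have s: "0 \<le> s" "s \<le> t" by auto
      have 1: "{\<omega>\<in>Om. arr n \<omega> \<le> s} \<in> sets (filt (ennreal t))"
        using Suc.IH[OF s(1)] filt.sets_F_mono[of "ennreal s" "ennreal t"] s(2) by (auto simp: ennreal_leI)
      have [measurable]: "demand_process m s \<in> borel_measurable (filt (ennreal t))" "demand_process m t \<in> borel_measurable (filt (ennreal t))"
        using s Suc.prems by (auto intro!: demand_process_filt ennreal_leI)
      have "{\<omega>\<in>space (filt (ennreal t)). demand_process m s \<omega> < demand_process m t \<omega>} \<in> sets (filt (ennreal t))" by measurable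
      then show "{\<omega>\<in>Om. arr n \<omega> \<le> s} \<inter> {\<omega>\<in>Om. demand_process m s \<omega> < demand_process m t \<omega>} \<in> sets (filt (ennreal t))"
        using 1 by simp
    qed
  qed
  finally show ?case .
qed

lemma arr_stopping_time: "stopping_time filt (\<lambda>\<omega>. ennreal (arr n \<omega>))"
  unfolding stopping_time_def
proof
  fix t show "Measurable.pred (filt t) (\<lambda>\<omega>. ennreal (arr n \<omega>) \<le> t)"
  proof (cases t)
    case (real r)
    then have "{\<omega>\<in>Om. ennreal (arr n \<omega>) \<le> t} = {\<omega>\<in>Om. arr n \<omega> \<le> r}" by (auto simp: ennreal_le_iff)
    then show ?thesis using arr_filt[of r n] real unfolding pred_def by simp
  qed simp
qed

lemma demand_count_filt: "0 \<le> t \<Longrightarrow> {\<omega>\<in>Om. demand_count m t \<omega> = n} \<in> sets (filt (ennreal t))"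
proof -
  assume t: "0 \<le> t"
  have "{\<omega>\<in>Om. demand_count m t \<omega> = n} = {\<omega>\<in>Om. arr n \<omega> \<le> t} - {\<omega>\<in>Om. arr (Suc n) \<omega> \<le> t}"
    using demand_count_ge[OF _ t, of _ n] demand_count_ge[OF _ t, of _ "Suc n"] by fastforce
  then show ?thesis using arr_filt[OF t] by auto
qed

text \<open>At any time with exactly \<open>n\<close> demands so far the sum is the value of the
  demand process; a countable set of times is enough to find one such time up to
  \<open>t\<close>.\<close>

lemma demand_sum_pre_sigma: "(\<lambda>\<omega>. \<Sum>k=1..n. demand m k \<omega>) \<in> borel_measurable (filt.pre_sigma (\<lambda>\<omega>. ennreal (arr n \<omega>)))"
proof (rule measurableI)
  fix C :: "real set" assume C: "C \<in> sets borel"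
  let ?S = "\<lambda>\<omega>. \<Sum>k=1..n. demand m k \<omega>"
  show "?S -` C \<inter> space (filt.pre_sigma (\<lambda>\<omega>. ennreal (arr n \<omega>))) \<in> sets (filt.pre_sigma (\<lambda>\<omega>. ennreal (arr n \<omega>)))"
  proof (rule filt.sets_pre_sigmaI[OF arr_stopping_time])
    fix t
    have D: "{\<omega>\<in>Om. demand_count m s \<omega> = n} \<inter> (demand_process m s -` C \<inter> Om) \<in> sets (filt t)" if "0 \<le> s" "ennreal s \<le> t" for s
      using demand_count_filt[OF that(1), of n] filt.sets_F_mono[OF that(2)]
        measurable_sets[OF demand_process_filt[OF that] C] by auto
    have sD: "?S \<omega> = demand_process m s \<omega>" if "demand_count m s \<omega> = n" for s \<omega>
      using that unfolding demand_process_def by simp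
    have "{\<omega> \<in> ?S -` C \<inter> Om. ennreal (arr n \<omega>) \<le> t}
        = (\<Union>s\<in>{s\<in>insert (enn2real t) \<rat>. 0 \<le> s \<and> ennreal s \<le> t}. {\<omega>\<in>Om. demand_count m s \<omega> = n} \<inter> (demand_process m s -` C \<inter> Om))" (is "?L = ?R")
    proof (intro set_eqI iffI)
      fix \<omega> assume "\<omega> \<in> ?L"
      then have \<omega>: "\<omega> \<in> Om" "?S \<omega> \<in> C" "ennreal (arr n \<omega>) \<le> t" by auto
      have "\<exists>s\<in>insert (enn2real t) \<rat>. 0 \<le> s \<and> ennreal s \<le> t \<and> arr n \<omega> \<le> s \<and> s < arr (Suc n) \<omega>"
      proof (cases "t < ennreal (arr (Suc n) \<omega>)")
        case True
        then obtain r where "t = ennreal r" "0 \<le> r" by (cases t) auto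
        then show ?thesis using True \<omega>(3) arr_nonneg[OF \<omega>(1)]
          by (intro bexI[of _ "enn2real t"]) (auto simp: ennreal_less_iff)
      next
        case False
        obtain s where s: "s \<in> \<rat>" "arr n \<omega> < s" "s < arr (Suc n) \<omega>"
          using rational_between arr_less[OF \<omega>(1), of n "Suc n"] by blast
        moreover have "0 \<le> s" using arr_nonneg[OF \<omega>(1), of n] s by linarith
        moreover have "ennreal s \<le> t" using False s(3) ennreal_leI[of s "arr (Suc n) \<omega>"] by (auto simp: not_less)
        ultimately show ?thesis by (intro bexI[of _ s]) auto
      qed
      then obtain s where s: "s \<in> insert (enn2real t) \<rat>" "0 \<le> s" "ennreal s \<le> t" "arr n \<omega> \<le> s" "s < arr (Suc n) \<omega>" by blast
      then have "demand_count m s \<omega> = n" using demand_count_eq[OF \<omega>(1)] by blast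
      then show "\<omega> \<in> ?R" using s \<omega> sD[of s \<omega>] by (intro UN_I[of s]) auto
    next
      fix \<omega> assume "\<omega> \<in> ?R"
      then obtain s where s: "0 \<le> s" "ennreal s \<le> t" "\<omega> \<in> Om" "demand_count m s \<omega> = n" "demand_process m s \<omega> \<in> C" by auto
      then have "arr n \<omega> \<le> s" using demand_count_ge[OF s(3,1), of n] by simp
      then have "ennreal (arr n \<omega>) \<le> t" using s(2) ennreal_leI order.trans by blast
      then show "\<omega> \<in> ?L" using s sD[of s \<omega>] by simp
    qed
    also have "\<dots> \<in> sets (filt t)"
    proof (rule sets.countable_UN'')
      show "countable {s \<in> insert (enn2real t) \<rat>. 0 \<le> s \<and> ennreal s \<le> t}"
        using countable_insert[OF countable_rat, of "enn2real t"] by (rule countable_subset[rotated]) auto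
    qed (use D in auto)
    finally show "{\<omega> \<in> ?S -` C \<inter> space (filt.pre_sigma (\<lambda>\<omega>. ennreal (arr n \<omega>))). ennreal (arr n \<omega>) \<le> t} \<in> sets (filt t)"
      by (simp add: filt.space_pre_sigma)
  qed
qed simp

text \<open>Arrival times are stopping times, and single demands are differences of consecutive
  sums, so everything that generates \<open>hist n\<close> is known at the \<open>n\<close>-th
  arrival. The feedback strategy owes its adaptedness to this.\<close>

lemma hist_pre_sigma: "sets (hist n) \<subseteq> sets (filt.pre_sigma (\<lambda>\<omega>. ennreal (arr n \<omega>)))" (is "_ \<subseteq> sets ?G")
proof -
  have mono: "f \<in> borel_measurable ?G" if "f \<in> borel_measurable (filt.pre_sigma (\<lambda>\<omega>. ennreal (arr k \<omega>)))" "k \<le> n" for k and f :: "'a \<Rightarrow> 'b::topological_space"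
    using that(1) filt.mono_pre_sigma[OF arr_stopping_time arr_stopping_time, of k n] arr_le[of _ k n] that(2)
    by (auto simp: measurable_def filt.space_pre_sigma ennreal_leI)
  have arr: "arr k \<in> borel_measurable ?G" if "k \<le> n" for k
  proof -
    have "(\<lambda>\<omega>. ennreal (arr k \<omega>)) \<in> borel_measurable ?G"
      by (rule mono[OF filt.measurable_stopping_time_pre_sigma[OF arr_stopping_time] that])
    then have "(\<lambda>\<omega>. enn2real (ennreal (arr k \<omega>))) \<in> borel_measurable ?G" by measurable
    then show ?thesis by (rule measurable_cong[THEN iffD1, rotated]) (simp add: filt.space_pre_sigma arr_nonneg)
  qed
  have S: "(\<lambda>\<omega>. \<Sum>j=1..k. demand m j \<omega>) \<in> borel_measurable ?G" if "k \<le> n" for k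
    by (rule mono[OF demand_sum_pre_sigma that])
  have "obs k \<in> borel_measurable ?G" if "k \<in> past n" for k
  proof (cases k)
    case (Inl j)
    then show ?thesis using arr[of j] arr[of "Suc j"] that
      unfolding obs_def gap_def[abs_def] past_def by auto
  next
    case (Inr j)
    then have "(\<lambda>\<omega>. (\<Sum>j=1..Suc j. demand m j \<omega>) - (\<Sum>j=1..j. demand m j \<omega>)) \<in> borel_measurable ?G"
      using that unfolding past_def by (intro borel_measurable_diff S) auto
    then show ?thesis using Inr unfolding obs_def by simp
  qed
  then have "(\<lambda>\<omega>. restrict (\<lambda>k. obs k \<omega>) (past n)) \<in> ?G \<rightarrow>\<^sub>M PiM (past n) (\<lambda>_. borel)"
    by (intro measurable_restrict)
  from measurable_sets[OF this] show ?thesis unfolding sets_hist filt.space_pre_sigma by auto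
qed

lemma hist_filt:
  assumes "B \<in> sets (hist n)" "0 \<le> t"
  shows "{\<omega>\<in>B. arr n \<omega> \<le> t} \<in> sets (filt (ennreal t))"
proof -
  have "{\<omega>\<in>B. ennreal (arr n \<omega>) \<le> ennreal t} \<in> sets (filt (ennreal t))"
    using hist_pre_sigma assms(1) by (intro filt.sets_pre_sigmaD[OF arr_stopping_time]) auto
  then show ?thesis using assms(2) by (simp add: ennreal_le_iff)
qed

subsection \<open>Paths of a strategy\<close>

text \<open>The left-continuous version of the phase process.\<close>

definition phL :: "'a strategy \<Rightarrow> 'a \<Rightarrow> real \<Rightarrow> nat" where
  "phL \<pi> \<omega> t = (if 0 < t
     then sphase \<pi> (THE k. stime \<pi> k \<omega> < ennreal t \<and> ennreal t \<le> stime \<pi> (Suc k) \<omega>) \<omega> else 0)"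

text \<open>In contrast to \<open>level\<close>, the formula of stage \<open>n\<close> is kept up to
  and including the next demand, so the value at \<open>arr (Suc n)\<close> is the left limit
  \<open>level_before\<close>.\<close>

definition lev :: "real \<Rightarrow> 'a strategy \<Rightarrow> 'a \<Rightarrow> nat \<Rightarrow> real \<Rightarrow> real" where
  "lev x \<pi> \<omega> n t = level_after m x \<pi> \<omega> n + produced m \<pi> \<omega> (arr n \<omega>) t"

definition spath :: "nat \<Rightarrow> 'a strategy \<Rightarrow> 'a \<Rightarrow> bool" where
  "spath i \<pi> \<omega> \<longleftrightarrow> \<omega> \<in> Om \<and> strategy_path i \<pi> \<omega> \<and> (\<forall>k. sphase \<pi> k \<omega> \<in> {0, 1, 2})"

lemma level_before_lev: "level_before m x \<pi> \<omega> n = lev x \<pi> \<omega> n (arr (Suc n) \<omega>)"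
  unfolding level_before_def lev_def ..

lemma level_after_Suc: "level_after m x \<pi> \<omega> (Suc n) = max lo (lev x \<pi> \<omega> n (arr (Suc n) \<omega>) - demand m (Suc n) \<omega>)"
  unfolding lev_def by (auto simp: Let_def min_def max_def)

lemma level_lev: "\<omega> \<in> Om \<Longrightarrow> arr n \<omega> \<le> t \<Longrightarrow> t < arr (Suc n) \<omega> \<Longrightarrow> level m x \<pi> \<omega> t = lev x \<pi> \<omega> n t"
  unfolding level_def lev_def using demand_count_eq[of \<omega> n t] by simp

context
  fixes \<pi> :: "'a strategy" and \<omega> :: 'a and i :: nat
  assumes sp: "spath i \<pi> \<omega>"
begin

lemma path_Om: "\<omega> \<in> Om"
  and stime_0: "stime \<pi> 0 \<omega> = 0"
  and sphase_0: "sphase \<pi> 0 \<omega> = i"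
  and stime_Suc: "stime \<pi> k \<omega> \<le> stime \<pi> (Suc k) \<omega>"
  and stime_strict: "1 \<le> k \<Longrightarrow> stime \<pi> k \<omega> < \<infinity> \<Longrightarrow> stime \<pi> k \<omega> < stime \<pi> (Suc k) \<omega>"
  and stime_finite: "finite {k. stime \<pi> k \<omega> \<le> ennreal t}"
  and sphase_range: "sphase \<pi> k \<omega> \<in> {0, 1, 2}"
  and sphase_neq: "stime \<pi> (Suc k) \<omega> < \<infinity> \<Longrightarrow> sphase \<pi> (Suc k) \<omega> \<noteq> sphase \<pi> k \<omega>"
  using sp unfolding spath_def strategy_path_def by blast+

lemma stime_mono: "k \<le> l \<Longrightarrow> stime \<pi> k \<omega> \<le> stime \<pi> l \<omega>"
  using stime_Suc by (rule lift_Suc_mono_le)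

lemma stime_ex: "\<exists>k. \<not> stime \<pi> k \<omega> \<le> ennreal t"
proof (rule ccontr)
  assume "\<nexists>k. \<not> stime \<pi> k \<omega> \<le> ennreal t"
  then have "{k. stime \<pi> k \<omega> \<le> ennreal t} = UNIV" by auto
  then show False using stime_finite[of t] by simp
qed

lemma seg_right_ex: "\<exists>k. stime \<pi> k \<omega> \<le> ennreal t \<and> ennreal t < stime \<pi> (Suc k) \<omega>"
proof -
  let ?P = "\<lambda>k. \<not> stime \<pi> k \<omega> \<le> ennreal t"
  have L: "?P (LEAST k. ?P k)" using stime_ex by (rule LeastI_ex)
  then obtain k where k: "(LEAST k. ?P k) = Suc k" using stime_0 by (cases "LEAST k. ?P k") auto
  have "\<not> ?P k" by (rule not_less_Least) (simp add: k)
  then show ?thesis using L k by (auto simp: not_le intro!: exI[of _ k])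
qed

lemma seg_left_ex: "0 < t \<Longrightarrow> \<exists>k. stime \<pi> k \<omega> < ennreal t \<and> ennreal t \<le> stime \<pi> (Suc k) \<omega>"
proof -
  assume t: "0 < t"
  let ?P = "\<lambda>k. ennreal t \<le> stime \<pi> k \<omega>"
  have "\<exists>k. ?P k" using stime_ex[of t] by (auto simp: not_le intro: less_imp_le)
  then have L: "?P (LEAST k. ?P k)" by (rule LeastI_ex)
  then obtain k where k: "(LEAST k. ?P k) = Suc k" using stime_0 t by (cases "LEAST k. ?P k") auto
  have "\<not> ?P k" by (rule not_less_Least) (simp add: k)
  then show ?thesis using L k by (auto simp: not_le intro!: exI[of _ k])
qed

lemma seg_right_unique:
  assumes "stime \<pi> k \<omega> \<le> t" "t < stime \<pi> (Suc k) \<omega>" "stime \<pi> l \<omega> \<le> t" "t < stime \<pi> (Suc l) \<omega>"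
  shows "k = l"
proof (rule ccontr)
  assume "k \<noteq> l"
  then consider "Suc k \<le> l" | "Suc l \<le> k" by linarith
  then show False using stime_mono[of "Suc k" l] stime_mono[of "Suc l" k] assms by cases (meson leD order.trans)+
qed

lemma seg_left_unique:
  assumes "stime \<pi> k \<omega> < t" "t \<le> stime \<pi> (Suc k) \<omega>" "stime \<pi> l \<omega> < t" "t \<le> stime \<pi> (Suc l) \<omega>"
  shows "k = l"
proof (rule ccontr)
  assume "k \<noteq> l"
  then consider "Suc k \<le> l" | "Suc l \<le> k" by linarith
  then show False using stime_mono[of "Suc k" l] stime_mono[of "Suc l" k] assms by cases (meson leD order.trans)+
qed

lemma phase_at_eq:
  assumes "stime \<pi> k \<omega> \<le> ennreal t" "ennreal t < stime \<pi> (Suc k) \<omega>"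
  shows "phase_at \<pi> \<omega> t = sphase \<pi> k \<omega>"
proof -
  have "(THE k. stime \<pi> k \<omega> \<le> ennreal t \<and> ennreal t < stime \<pi> (Suc k) \<omega>) = k"
    using assms seg_right_unique by (intro the_equality) blast+
  then show ?thesis unfolding phase_at_def by simp
qed

lemma phL_eq:
  assumes "stime \<pi> k \<omega> < ennreal t" "ennreal t \<le> stime \<pi> (Suc k) \<omega>"
  shows "phL \<pi> \<omega> t = sphase \<pi> k \<omega>"
proof -
  have "(THE k. stime \<pi> k \<omega> < ennreal t \<and> ennreal t \<le> stime \<pi> (Suc k) \<omega>) = k"
    using assms seg_left_unique by (intro the_equality) blast+
  moreover have "0 < t" using assms(1) by (cases "0 < t") (auto simp: ennreal_neg not_less)
  ultimately show ?thesis unfolding phL_def by simp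
qed

lemma phase_at_range: "phase_at \<pi> \<omega> t \<in> {0, 1, 2}"
  using seg_right_ex[of t] phase_at_eq sphase_range by metis

lemma phL_range: "phL \<pi> \<omega> t \<in> {0, 1, 2}"
proof (cases "0 < t")
  case True
  then show ?thesis using seg_left_ex[of t] phL_eq sphase_range by metis
qed (simp add: phL_def)

lemma phL_phase_at: "0 < t \<Longrightarrow> (\<And>k. stime \<pi> k \<omega> \<noteq> ennreal t) \<Longrightarrow> phase_at \<pi> \<omega> t = phL \<pi> \<omega> t"
proof -
  assume t: "0 < t" and neq: "\<And>k. stime \<pi> k \<omega> \<noteq> ennreal t"
  obtain k where k: "stime \<pi> k \<omega> < ennreal t" "ennreal t \<le> stime \<pi> (Suc k) \<omega>" using seg_left_ex[OF t] by blast
  then have "ennreal t < stime \<pi> (Suc k) \<omega>" using neq[of "Suc k"] by (simp add: less_le)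
  then show ?thesis using phase_at_eq[of k t] phL_eq[of k t] k by simp
qed

text \<open>Away from time 0 the two versions of the phase differ at most at switching times, of
  which there are countably many.\<close>

lemma AE_phL: "AE u in lborel. 0 \<le> u \<longrightarrow> phase_at \<pi> \<omega> u = phL \<pi> \<omega> u"
proof -
  let ?N = "insert 0 (range (\<lambda>k. enn2real (stime \<pi> k \<omega>)))"
  have "AE u in lborel. u \<notin> ?N"
    by (rule AE_not_in) (intro countable_imp_null_set_lborel; simp)
  then show ?thesis
  proof eventually_elim
    case (elim u)
    show ?case
    proof
      assume "0 \<le> u"
      then have u: "0 < u" using elim by (cases "u = 0") auto
      show "phase_at \<pi> \<omega> u = phL \<pi> \<omega> u"
      proof (rule phL_phase_at[OF u])
        fix k
        have "enn2real (stime \<pi> k \<omega>) \<noteq> u" using elim by auto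
        then show "stime \<pi> k \<omega> \<noteq> ennreal u" using u by auto
      qed
    qed
  qed
qed

lemma phL_measurable: "phL \<pi> \<omega> \<in> borel \<rightarrow>\<^sub>M count_space UNIV"
proof (rule measurable_count_space_eq2_countable[THEN iffD2], intro conjI ballI)
  fix c
  let ?A = "\<lambda>k. {u. 0 < u \<and> stime \<pi> k \<omega> < ennreal u \<and> ennreal u \<le> stime \<pi> (Suc k) \<omega> \<and> sphase \<pi> k \<omega> = c}"
  have "phL \<pi> \<omega> -` {c} \<inter> space borel = (\<Union>k. ?A k) \<union> {u. u \<le> 0 \<and> c = 0}"
  proof (intro set_eqI iffI)
    fix u :: real assume u: "u \<in> phL \<pi> \<omega> -` {c} \<inter> space borel"
    show "u \<in> (\<Union>k. ?A k) \<union> {u. u \<le> 0 \<and> c = 0}"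
    proof (cases "0 < u")
      case True
      then obtain k where "stime \<pi> k \<omega> < ennreal u" "ennreal u \<le> stime \<pi> (Suc k) \<omega>" using seg_left_ex by blast
      then show ?thesis using u True phL_eq[of k u] by auto
    qed (use u in \<open>auto simp: phL_def\<close>)
  next
    fix u :: real assume "u \<in> (\<Union>k. ?A k) \<union> {u. u \<le> 0 \<and> c = 0}"
    then consider k where "u \<in> ?A k" | "u \<le> 0" "c = 0" by auto
    then show "u \<in> phL \<pi> \<omega> -` {c} \<inter> space borel"
    proof cases
      case (1 k)
      then show ?thesis using phL_eq[of k u] by simp
    qed (simp add: phL_def)
  qed
  also have "\<dots> \<in> sets borel" by measurable
  finally show "phL \<pi> \<omega> -` {c} \<inter> space borel \<in> sets borel" .
qed auto

lemma rate_phL_measurable [measurable]: "(\<lambda>u. rate m (phL \<pi> \<omega> u)) \<in> borel_measurable borel"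
  using phL_measurable by measurable

lemma rate_phL_bound: "\<bar>rate m (phL \<pi> \<omega> u)\<bar> \<le> rate m 1" "0 \<le> rate m (phL \<pi> \<omega> u)"
  using phL_range[of u] rates by auto

lemma rate_phL_integrable: "set_integrable lborel {s..t} (\<lambda>u. rate m (phL \<pi> \<omega> u))"
  by (rule set_integrable_bounded_real) (auto intro: rate_phL_bound)

lemma produced_phL: "0 \<le> s \<Longrightarrow> produced m \<pi> \<omega> s t = (LINT u:{s..t}|lborel. rate m (phL \<pi> \<omega> u))"
proof -
  assume s: "0 \<le> s"
  have ae: "AE u in lborel. indicator {s..t} u *\<^sub>R rate m (phL \<pi> \<omega> u) = indicator {s..t} u *\<^sub>R rate m (phase_at \<pi> \<omega> u)"
    using AE_phL by eventually_elim (use s in \<open>auto simp: indicator_def\<close>)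
  show ?thesis unfolding produced_def set_lebesgue_integral_def
  proof (rule integral_cong_AE)
    let ?f = "\<lambda>u. indicator {s..t} u *\<^sub>R rate m (phase_at \<pi> \<omega> u)"
    have idx: "(\<lambda>u. indicator {s..t} u *\<^sub>R rate m (phase_at \<pi> \<omega> u)) = (\<lambda>u. \<Sum>c\<in>{0, 1, 2}. indicator {u\<in>{s..t}. phase_at \<pi> \<omega> u = c} u * rate m c)"
    proof
      fix u show "indicator {s..t} u *\<^sub>R rate m (phase_at \<pi> \<omega> u) = (\<Sum>c\<in>{0, 1, 2}. indicator {u\<in>{s..t}. phase_at \<pi> \<omega> u = c} u * rate m c)"
        using phase_at_range[of u] by (auto simp: indicator_def)
    qed
    have "{u\<in>{s..t}. phase_at \<pi> \<omega> u = c} \<in> sets borel" for c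
    proof -
      have "{u\<in>{s..t}. phase_at \<pi> \<omega> u = c} = (\<Union>k. {u\<in>{s..t}. stime \<pi> k \<omega> \<le> ennreal u \<and> ennreal u < stime \<pi> (Suc k) \<omega> \<and> sphase \<pi> k \<omega> = c})"
        using seg_right_ex phase_at_eq by fastforce
      also have "\<dots> \<in> sets borel" by measurable
      finally show ?thesis .
    qed
    then show "?f \<in> borel_measurable lborel" unfolding idx by measurable
    show "(\<lambda>u. indicator {s..t} u *\<^sub>R rate m (phL \<pi> \<omega> u)) \<in> borel_measurable lborel" by measurable
    show "AE u in lborel. ?f u = indicator {s..t} u *\<^sub>R rate m (phL \<pi> \<omega> u)" using ae by eventually_elim (rule sym)
  qed
qed

lemma produced_combine: "0 \<le> s \<Longrightarrow> s \<le> t \<Longrightarrow> t \<le> u \<Longrightarrow> produced m \<pi> \<omega> s u = produced m \<pi> \<omega> s t + produced m \<pi> \<omega> t u"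
proof -
  assume a: "0 \<le> s" "s \<le> t" "t \<le> u"
  have "integral {s..u} (\<lambda>u. rate m (phL \<pi> \<omega> u)) = integral {s..t} (\<lambda>u. rate m (phL \<pi> \<omega> u)) + integral {t..u} (\<lambda>u. rate m (phL \<pi> \<omega> u))"
    by (rule Henstock_Kurzweil_Integration.integral_combine[symmetric, OF a(2,3) set_borel_integral_eq_integral(1)[OF rate_phL_integrable]])
  then show ?thesis
    using a produced_phL set_borel_integral_eq_integral(2)[OF rate_phL_integrable] by simp
qed

lemma produced_seg:
  assumes "0 \<le> s" "s \<le> t" "stime \<pi> k \<omega> \<le> ennreal s" "ennreal t \<le> stime \<pi> (Suc k) \<omega>"
  shows "produced m \<pi> \<omega> s t = rate m (sphase \<pi> k \<omega>) * (t - s)"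
proof -
  have "(LINT u:{s..t}|lborel. rate m (phL \<pi> \<omega> u)) = (LINT u:{s..t}|lborel. rate m (sphase \<pi> k \<omega>))"
    unfolding set_lebesgue_integral_def
  proof (rule integral_cong_AE)
    have "AE u in lborel. u \<noteq> s" by (rule AE_lborel_singleton)
    then show "AE u in lborel. indicator {s..t} u *\<^sub>R rate m (phL \<pi> \<omega> u) = indicator {s..t} u *\<^sub>R rate m (sphase \<pi> k \<omega>)"
    proof eventually_elim
      case (elim u)
      show ?case
      proof (cases "u \<in> {s..t}")
        case True
        then have "s < u" "u \<le> t" using elim by auto
        then have "stime \<pi> k \<omega> < ennreal u" "ennreal u \<le> stime \<pi> (Suc k) \<omega>"
          using assms by (auto intro: le_less_trans ennreal_lessI order.trans[OF ennreal_leI])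
        then show ?thesis using phL_eq[of k u] by simp
      qed simp
    qed
  qed simp_all
  also have "\<dots> = rate m (sphase \<pi> k \<omega>) * (t - s)"
    using assms(2) by (simp add: set_lebesgue_integral_def)
  finally show ?thesis using produced_phL[OF assms(1)] by simp
qed

lemma produced_nonneg: "0 \<le> s \<Longrightarrow> 0 \<le> produced m \<pi> \<omega> s t"
  using produced_phL rate_phL_bound(2) unfolding set_lebesgue_integral_def
  by (auto intro!: integral_nonneg_AE)

lemma lev_arr: "lev x \<pi> \<omega> n (arr n \<omega>) = level_after m x \<pi> \<omega> n"
proof -
  have "(LINT u:{arr n \<omega>..arr n \<omega>}|lborel. rate m (phL \<pi> \<omega> u)) = 0"
    using set_borel_integral_eq_integral(2)[OF rate_phL_integrable, of "arr n \<omega>" "arr n \<omega>"] by simp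
  then show ?thesis unfolding lev_def using produced_phL[of "arr n \<omega>" "arr n \<omega>"] arr_nonneg[OF path_Om] by simp
qed

lemma lev_combine: "arr n \<omega> \<le> s \<Longrightarrow> s \<le> t \<Longrightarrow> lev x \<pi> \<omega> n t = lev x \<pi> \<omega> n s + produced m \<pi> \<omega> s t"
  unfolding lev_def using produced_combine[of "arr n \<omega>" s t] arr_nonneg[OF path_Om] by simp

lemma lev_seg:
  assumes "arr n \<omega> \<le> s" "s \<le> t" "stime \<pi> k \<omega> \<le> ennreal s" "ennreal t \<le> stime \<pi> (Suc k) \<omega>"
  shows "lev x \<pi> \<omega> n t = lev x \<pi> \<omega> n s + rate m (sphase \<pi> k \<omega>) * (t - s)"
proof -
  have "0 \<le> s" using arr_nonneg[OF path_Om, of n] assms(1) by linarith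
  then show ?thesis using lev_combine[OF assms(1,2)] produced_seg[OF _ assms(2-4)] by simp
qed

lemma lev_mono: "mono (lev x \<pi> \<omega> n)"
proof (rule monoI)
  fix s t :: real assume st: "s \<le> t"
  have nn: "0 \<le> arr n \<omega>" by (rule arr_nonneg[OF path_Om])
  show "lev x \<pi> \<omega> n s \<le> lev x \<pi> \<omega> n t"
  proof (cases "arr n \<omega> \<le> s")
    case True
    then show ?thesis using lev_combine[OF True st, of x] produced_nonneg[of s t] nn by simp
  next
    case False
    then have "produced m \<pi> \<omega> (arr n \<omega>) s = 0" unfolding produced_def by (simp add: set_lebesgue_integral_def)
    then show ?thesis using produced_nonneg[OF nn, of t] unfolding lev_def by simp
  qed
qed

lemma lev_measurable [measurable]: "lev x \<pi> \<omega> n \<in> borel_measurable borel"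
  by (rule borel_measurable_mono[OF lev_mono])

end

end

lemma nn_integral_greaterThanAtMost_split:
  fixes h :: "real \<Rightarrow> ennreal"
  assumes "a \<le> s" "s \<le> t" "h \<in> borel_measurable borel"
  shows "(\<integral>\<^sup>+u\<in>{a<..t}. h u \<partial>lborel) = (\<integral>\<^sup>+u\<in>{a<..s}. h u \<partial>lborel) + (\<integral>\<^sup>+u\<in>{s<..t}. h u \<partial>lborel)"
proof -
  have "{a<..t} = {a<..s} \<union> {s<..t}" using assms by auto
  then show ?thesis using assms(3) by (simp add: nn_integral_disjoint_pair)
qed

lemma nn_integral_greaterThanAtMost:
  fixes h :: "real \<Rightarrow> real"
  assumes [measurable]: "h \<in> borel_measurable borel" and h: "\<And>z. s \<le> z \<Longrightarrow> z \<le> t \<Longrightarrow> 0 \<le> h z \<and> h z \<le> B"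
  shows "(\<integral>\<^sup>+z\<in>{s<..t}. ennreal (h z) \<partial>lborel) = ennreal (integral {s..t} h)"
proof -
  have si: "set_integrable lborel {s..t} h"
    by (rule set_integrable_bounded_real[where B = B]) (use h in auto)
  have "(\<integral>\<^sup>+z\<in>{s<..t}. ennreal (h z) \<partial>lborel) = (\<integral>\<^sup>+z. ennreal (indicator {s..t} z *\<^sub>R h z) \<partial>lborel)"
  proof (rule nn_integral_cong_AE)
    have "AE z in lborel. z \<noteq> s" by (rule AE_lborel_singleton)
    then show "AE z in lborel. ennreal (h z) * indicator {s<..t} z = ennreal (indicator {s..t} z *\<^sub>R h z)"
      by eventually_elim (auto simp: indicator_def)
  qed
  also have "\<dots> = ennreal (LINT z:{s..t}|lborel. h z)"
    unfolding set_lebesgue_integral_def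
    by (rule nn_integral_eq_integral[OF si[unfolded set_integrable_def]]) (use h in \<open>auto simp: indicator_def\<close>)
  finally show ?thesis using set_borel_integral_eq_integral(2)[OF si] by simp
qed

context production_inventory
begin

subsection \<open>The lower bound\<close>

text \<open>Extends \<open>val\<close> to phase 0. On an admissible path that phase occurs only at
  level \<open>hi\<close>, so a constant suffices.\<close>

definition vv :: "nat \<Rightarrow> real \<Rightarrow> real" where
  "vv c y = (if c = 0 then idle val else val c y)"

lemma vv_bounds: "c \<in> {0, 1, 2} \<Longrightarrow> 0 \<le> vv c y" "c \<in> {0, 1, 2} \<Longrightarrow> vv c y \<le> val_max"
proof -
  have "gain_max / tot \<le> val_max" using gain_max_le tot_pos by (simp add: field_simps)
  then show "c \<in> {0, 1, 2} \<Longrightarrow> 0 \<le> vv c y" "c \<in> {0, 1, 2} \<Longrightarrow> vv c y \<le> val_max"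
    using idle_bounds[OF val_bnd] bndD(1,2)[OF val_bnd, of c] unfolding vv_def by auto
qed

lemma vv_measurable: "c \<in> {0, 1, 2} \<Longrightarrow> vv c \<in> borel_measurable borel"
  unfolding vv_def[abs_def] using bndD(3)[OF val_bnd, of c] by (cases "c = 0") auto

text \<open>The affine substitution \<open>z = y + rate m c * (u - s)\<close> from time to level;
  the prefactor moves the origin of discounting from level 0 to time 0.\<close>

lemma drift_time:
  assumes c: "c \<in> {1, 2}" and st: "s \<le> t"
    and w [measurable]: "w \<in> borel_measurable borel"
    and wb: "\<And>z. y \<le> z \<Longrightarrow> z \<le> y + rate m c * (t - s) \<Longrightarrow> 0 \<le> w z \<and> w z \<le> B"
  shows "(\<integral>\<^sup>+u\<in>{s<..t}. ennreal (exp (- disc m * u) * w (y + rate m c * (u - s))) \<partial>lborel)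
    = ennreal (exp (- disc m * s) / fdsc c y * integral {y..y + rate m c * (t - s)} (\<lambda>z. fdsc c z * w z / rate m c))"
proof -
  let ?r = "rate m c"
  have r: "0 < ?r" using rate_pos[OF c] .
  define k where "k = exp (- disc m * s) / fdsc c y"
  have k: "0 < k" unfolding k_def by simp
  have e: "exp (- disc m * u) = k * fdsc c (y + ?r * (u - s))" for u
    unfolding k_def fdsc_def exp_diff[symmetric] exp_add[symmetric] using r by (simp add: field_simps)
  have "(\<integral>\<^sup>+z\<in>{y<..y + ?r * (t - s)}. ennreal (k * (fdsc c z * w z / ?r)) \<partial>lborel)
      = ?r * (\<integral>\<^sup>+u. ennreal (k * (fdsc c ((y - ?r * s) + ?r * u) * w ((y - ?r * s) + ?r * u) / ?r)) * indicator {y<..y + ?r * (t - s)} ((y - ?r * s) + ?r * u) \<partial>lborel)"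
    using r unfolding fdsc_def by (subst nn_integral_real_affine[of _ ?r "y - ?r * s"]) auto
  also have "\<dots> = (\<integral>\<^sup>+u. ?r * (ennreal (k * (fdsc c ((y - ?r * s) + ?r * u) * w ((y - ?r * s) + ?r * u) / ?r)) * indicator {y<..y + ?r * (t - s)} ((y - ?r * s) + ?r * u)) \<partial>lborel)"
    unfolding fdsc_def by (rule nn_integral_cmult[symmetric]) simp
  also have "\<dots> = (\<integral>\<^sup>+u\<in>{s<..t}. ennreal (exp (- disc m * u) * w (y + ?r * (u - s))) \<partial>lborel)"
  proof (intro nn_integral_cong)
    fix u :: real
    have z: "(y - ?r * s) + ?r * u = y + ?r * (u - s)" by (simp add: algebra_simps)
    have "(y + ?r * (u - s) \<in> {y<..y + ?r * (t - s)}) = (u \<in> {s<..t})" using r by (simp add: zero_less_mult_iff)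
    then show "?r * (ennreal (k * (fdsc c ((y - ?r * s) + ?r * u) * w ((y - ?r * s) + ?r * u) / ?r)) * indicator {y<..y + ?r * (t - s)} ((y - ?r * s) + ?r * u))
      = ennreal (exp (- disc m * u) * w (y + ?r * (u - s))) * indicator {s<..t} u"
      unfolding z e using r by (auto simp: indicator_def ennreal_mult'[symmetric] mult.assoc)
  qed
  finally have "(\<integral>\<^sup>+u\<in>{s<..t}. ennreal (exp (- disc m * u) * w (y + ?r * (u - s))) \<partial>lborel)
      = (\<integral>\<^sup>+z\<in>{y<..y + ?r * (t - s)}. ennreal (k * (fdsc c z * w z / ?r)) \<partial>lborel)" by simp
  also have "\<dots> = ennreal (integral {y..y + ?r * (t - s)} (\<lambda>z. k * (fdsc c z * w z / ?r)))"
  proof (rule nn_integral_greaterThanAtMost[where B = "k * (fdsc c y * B / ?r)"])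
    show "(\<lambda>z. k * (fdsc c z * w z / ?r)) \<in> borel_measurable borel" unfolding fdsc_def by measurable
    fix z assume z: "y \<le> z" "z \<le> y + ?r * (t - s)"
    have "fdsc c z \<le> fdsc c y" unfolding fdsc_def using z r disc_pos by (simp add: divide_right_mono)
    then have "fdsc c z * w z \<le> fdsc c y * B" using wb[OF z] by (intro mult_mono) (auto simp: less_imp_le[OF fdsc_pos])
    then show "0 \<le> k * (fdsc c z * w z / ?r) \<and> k * (fdsc c z * w z / ?r) \<le> k * (fdsc c y * B / ?r)"
      using wb[OF z] k r by (auto intro!: mult_left_mono divide_right_mono mult_nonneg_nonneg divide_nonneg_pos simp: less_imp_le[OF fdsc_pos] less_imp_le)
  qed
  finally show ?thesis unfolding k_def by simp
qed

lemma lam_val_integral_bound: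
  assumes "c \<in> {1, 2}" "lo \<le> z"
  shows "0 \<le> intensity m * val c z \<and> intensity m * val c z \<le> intensity m * val_max + gain_max"
    and "0 \<le> gain val c z \<and> gain val c z \<le> intensity m * val_max + gain_max"
proof -
  have c: "c \<in> {0, 1, 2}" using assms by auto
  have "0 \<le> intensity m * val c z" "intensity m * val c z \<le> intensity m * val_max"
    using bndD(1,2)[OF val_bnd assms(1), of z] intensity_pos by (auto intro: mult_left_mono)
  then show "0 \<le> intensity m * val c z \<and> intensity m * val c z \<le> intensity m * val_max + gain_max"
    "0 \<le> gain val c z \<and> gain val c z \<le> intensity m * val_max + gain_max"
    using gain_bounds[OF val_bnd c, of z] gain_max_nonneg assms(2) by linarith+
qed

lemma seg_integral_nonneg:
  assumes "c \<in> {1, 2}" "lo \<le> y" "\<And>z. lo \<le> z \<Longrightarrow> 0 \<le> w z \<and> w z \<le> B" "w \<in> borel_measurable borel"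
  shows "0 \<le> integral {y..y'} (\<lambda>z. fdsc c z * w z / rate m c)"
proof (cases "(\<lambda>z. fdsc c z * w z / rate m c) integrable_on {y..y'}")
  case True
  then show ?thesis using assms rate_pos[OF assms(1)]
    by (intro integral_nonneg) (auto intro!: divide_nonneg_pos mult_nonneg_nonneg simp: less_imp_le[OF fdsc_pos])
next
  case False
  then show ?thesis by (subst not_integrable_integral) auto
qed

text \<open>\<open>val_drift\<close> and \<open>val_drift_eq\<close> in time instead of level, after
  multiplication by \<open>k\<close>, which turns \<open>fdsc c\<close> at the two ends into the
  discount factors at times \<open>s\<close> and \<open>t\<close>.\<close>

lemma seg_val:
  assumes c: "c \<in> {1, 2}" and y: "lo \<le> y" "y + rate m c * (t - s) \<le> hi" and st: "s \<le> t"
  shows "ennreal (exp (- disc m * s) * val c y) + (\<integral>\<^sup>+u\<in>{s<..t}. ennreal (exp (- disc m * u) * (intensity m * val c (y + rate m c * (u - s)))) \<partial>lborel)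
      \<le> (\<integral>\<^sup>+u\<in>{s<..t}. ennreal (exp (- disc m * u) * gain val c (y + rate m c * (u - s))) \<partial>lborel)
        + ennreal (exp (- disc m * t) * val c (y + rate m c * (t - s)))" (is "?l1 + ?l2 \<le> ?r1 + ?r2")
    and "j \<in> {1, 2} \<Longrightarrow> c \<noteq> j \<Longrightarrow> val c y + 5 * lip * (rate m c * (t - s)) \<le> val j y + switch m c j \<Longrightarrow>
      ennreal (exp (- disc m * s) * val c y) + (\<integral>\<^sup>+u\<in>{s<..t}. ennreal (exp (- disc m * u) * (intensity m * val c (y + rate m c * (u - s)))) \<partial>lborel)
      = (\<integral>\<^sup>+u\<in>{s<..t}. ennreal (exp (- disc m * u) * gain val c (y + rate m c * (u - s))) \<partial>lborel)
        + ennreal (exp (- disc m * t) * val c (y + rate m c * (t - s)))"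
proof -
  let ?r = "rate m c" and ?B = "intensity m * val_max + gain_max"
  define y' where "y' = y + ?r * (t - s)"
  have r: "0 < ?r" using rate_pos[OF c] .
  have yy: "y \<le> y'" unfolding y'_def using r st by simp
  have [measurable]: "gain val c \<in> borel_measurable borel" "val c \<in> borel_measurable borel"
    using c by (auto intro!: gain_measurable val_bnd bndD(3)[OF val_bnd])
  define k where "k = exp (- disc m * s) / fdsc c y"
  have k: "0 < k" unfolding k_def by simp
  have k1: "k * fdsc c y = exp (- disc m * s)" unfolding k_def by (simp add: less_imp_neq[OF fdsc_pos, symmetric])
  have k2: "k * fdsc c y' = exp (- disc m * t)"
    unfolding k_def y'_def fdsc_def exp_diff[symmetric] exp_add[symmetric] using r by (simp add: field_simps)
  define I1 where "I1 = integral {y..y'} (\<lambda>z. fdsc c z * (intensity m * val c z) / ?r)"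
  define I2 where "I2 = integral {y..y'} (\<lambda>z. fdsc c z * gain val c z / ?r)"
  have I: "0 \<le> I1" "0 \<le> I2"
    unfolding I1_def I2_def using lam_val_integral_bound[OF c]
    by (intro seg_integral_nonneg[OF c y(1)]; measurable)+
  have l2: "?l2 = ennreal (k * I1)"
    unfolding k_def I1_def y'_def
    by (rule drift_time[OF c st, where B = "?B"], measurable, rule lam_val_integral_bound(1)[OF c order.trans[OF y(1)]])
  have r1: "?r1 = ennreal (k * I2)"
    unfolding k_def I2_def y'_def
    by (rule drift_time[OF c st, where B = "?B"], measurable, rule lam_val_integral_bound(2)[OF c order.trans[OF y(1)]])
  have v: "0 \<le> val c z" for z using bndD(1)[OF val_bnd c] .
  have L: "?l1 + ?l2 = ennreal (k * (fdsc c y * val c y + I1))"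
    unfolding l2 k1[symmetric] using k I v by (subst ennreal_plus[symmetric]) (auto simp: algebra_simps less_imp_le[OF fdsc_pos])
  have R: "?r1 + ?r2 = ennreal (k * (I2 + fdsc c y' * val c y'))"
    unfolding r1 y'_def[symmetric] k2[symmetric] using k I v by (subst ennreal_plus[symmetric]) (auto simp: algebra_simps less_imp_le[OF fdsc_pos])
  show "?l1 + ?l2 \<le> ?r1 + ?r2"
    unfolding L R I1_def I2_def using k val_drift[OF c y(1) yy] y(2)
    by (intro ennreal_leI mult_left_mono) (auto simp: y'_def)
  assume j: "j \<in> {1, 2}" "c \<noteq> j" "val c y + 5 * lip * (rate m c * (t - s)) \<le> val j y + switch m c j"
  show "?l1 + ?l2 = ?r1 + ?r2"
    unfolding L R I1_def I2_def using val_drift_eq[OF c j(1,2) y(1) yy] j(3) y(2) by (simp add: y'_def)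
qed

lemma discount_integral:
  assumes "0 \<le> s" "s \<le> t" "0 \<le> a"
  shows "(\<integral>\<^sup>+u\<in>{s<..t}. ennreal (exp (- disc m * u) * a) \<partial>lborel) = ennreal ((exp (- disc m * s) - exp (- disc m * t)) / disc m * a)"
proof -
  have "((\<lambda>u. exp (- disc m * u) * a) has_integral (- exp (- disc m * t) / disc m * a) - (- exp (- disc m * s) / disc m * a)) {s..t}"
    using disc_pos
    by (intro fundamental_theorem_of_calculus[OF assms(2)])
      (auto intro!: derivative_eq_intros simp: has_real_derivative_iff_has_vector_derivative[symmetric])
  from integral_unique[OF this]
  have "integral {s..t} (\<lambda>u. exp (- disc m * u) * a) = (exp (- disc m * s) - exp (- disc m * t)) / disc m * a"
    by (simp only: diff_divide_distrib left_diff_distrib)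
  moreover have "(\<integral>\<^sup>+u\<in>{s<..t}. ennreal (exp (- disc m * u) * a) \<partial>lborel) = ennreal (integral {s..t} (\<lambda>u. exp (- disc m * u) * a))"
    using assms disc_pos
    by (intro nn_integral_greaterThanAtMost[where B = "1 * a"]) (auto intro!: mult_left_le_one_le)
  ultimately show ?thesis by simp
qed

text \<open>At capacity the balance is always exact, because \<open>gain val 0 hi\<close> is
  \<open>tot * idle val\<close> by definition of \<open>idle\<close>.\<close>

lemma seg_idle:
  assumes st: "0 \<le> s" "s \<le> t"
  shows "ennreal (exp (- disc m * s) * idle val) + (\<integral>\<^sup>+u\<in>{s<..t}. ennreal (exp (- disc m * u) * (intensity m * idle val)) \<partial>lborel)
      = (\<integral>\<^sup>+u\<in>{s<..t}. ennreal (exp (- disc m * u) * gain val 0 hi) \<partial>lborel) + ennreal (exp (- disc m * t) * idle val)"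
proof -
  have i: "0 \<le> idle val" by (rule idle_bounds(1)[OF val_bnd])
  have g: "gain val 0 hi = tot * idle val" unfolding idle_def using tot_pos by simp
  have e: "exp (- disc m * t) \<le> exp (- disc m * s)" using st disc_pos by simp
  have "0 \<le> (exp (- disc m * s) - exp (- disc m * t)) / disc m * (intensity m * idle val)"
    "0 \<le> (exp (- disc m * s) - exp (- disc m * t)) / disc m * gain val 0 hi"
    using e i disc_pos intensity_pos tot_pos unfolding g by (auto intro!: mult_nonneg_nonneg divide_nonneg_pos)
  moreover have "exp (- disc m * s) * idle val + (exp (- disc m * s) - exp (- disc m * t)) / disc m * (intensity m * idle val)
    = (exp (- disc m * s) - exp (- disc m * t)) / disc m * gain val 0 hi + exp (- disc m * t) * idle val"
    unfolding g using disc_pos by (simp add: field_simps)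
  ultimately show ?thesis
    using i intensity_pos discount_integral[OF st, of "intensity m * idle val"] discount_integral[OF st, of "gain val 0 hi"] gain_bounds(1)[OF val_bnd, of 0 hi]
    by (simp add: ennreal_plus[symmetric] del: ennreal_plus)
qed

section \<open>Telescoping over switches, and the cost of switching in one stage\<close>

context
  fixes \<pi> :: "'a strategy" and \<omega> :: 'a and i :: nat
  assumes sp: "spath i \<pi> \<omega>"
begin

lemma switch_index:
  assumes "0 \<le> a" "a < b"
  obtains k l where "stime \<pi> k \<omega> \<le> ennreal a" "ennreal a < stime \<pi> (Suc k) \<omega>"
    "stime \<pi> l \<omega> < ennreal b" "ennreal b \<le> stime \<pi> (Suc l) \<omega>" "k \<le> l"
proof -
  obtain k where k: "stime \<pi> k \<omega> \<le> ennreal a" "ennreal a < stime \<pi> (Suc k) \<omega>" using seg_right_ex[OF sp] by blast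
  obtain l where l: "stime \<pi> l \<omega> < ennreal b" "ennreal b \<le> stime \<pi> (Suc l) \<omega>" using seg_left_ex[OF sp, of b] assms by auto
  have "k \<le> l"
  proof (rule ccontr)
    assume "\<not> k \<le> l"
    then have "stime \<pi> (Suc l) \<omega> \<le> stime \<pi> k \<omega>" using stime_mono[OF sp] by simp
    then have "ennreal b \<le> ennreal a" using k l by (meson order.trans)
    then show False using assms by (simp add: ennreal_le_iff)
  qed
  then show ?thesis using that k l by blast
qed

text \<open>Telescoping over the switching times in \<open>(a, b)\<close>; \<open>R\<close> will be \<open>\<le>\<close> for an arbitrary strategy and
  \<open>\<ge>\<close> for a nearly optimal one.\<close>

lemma telescope:
  fixes \<Phi> :: "nat \<Rightarrow> real \<Rightarrow> ennreal" and f g :: "real \<Rightarrow> ennreal" and R :: "ennreal \<Rightarrow> ennreal \<Rightarrow> bool"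
  assumes R: "\<And>p. R p p" "\<And>p q r. R p q \<Longrightarrow> R q r \<Longrightarrow> R p r" "\<And>p q r. R p q \<Longrightarrow> R (p + r) (q + r)"
    and [measurable]: "f \<in> borel_measurable borel" "g \<in> borel_measurable borel"
    and ab: "0 \<le> a" "a < b"
    and seg: "\<And>k s t. a \<le> s \<Longrightarrow> s < t \<Longrightarrow> t \<le> b \<Longrightarrow> stime \<pi> k \<omega> \<le> ennreal s \<Longrightarrow> ennreal t \<le> stime \<pi> (Suc k) \<omega> \<Longrightarrow>
      R (\<Phi> k s + (\<integral>\<^sup>+u\<in>{s<..t}. f u \<partial>lborel)) ((\<integral>\<^sup>+u\<in>{s<..t}. g u \<partial>lborel) + \<Phi> k t)"
    and sw: "\<And>k t. a < t \<Longrightarrow> t < b \<Longrightarrow> stime \<pi> (Suc k) \<omega> = ennreal t \<Longrightarrow> R (\<Phi> k t) (w (Suc k) + \<Phi> (Suc k) t)"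
    and k: "stime \<pi> k \<omega> \<le> ennreal a" "ennreal a < stime \<pi> (Suc k) \<omega>"
    and l: "stime \<pi> l \<omega> < ennreal b" "ennreal b \<le> stime \<pi> (Suc l) \<omega>" and kl: "k \<le> l"
  shows "R (\<Phi> k a + (\<integral>\<^sup>+u\<in>{a<..b}. f u \<partial>lborel)) ((\<integral>\<^sup>+u\<in>{a<..b}. g u \<partial>lborel) + (\<Sum>j\<in>{k<..l}. w j) + \<Phi> l b)"
proof -
  have b0: "0 \<le> b" using l(1) by (cases "0 \<le> b") (auto simp: ennreal_neg not_le)
  \<comment> \<open>The end of the \<open>j\<close>-th segment inside \<open>(a, b]\<close>: the
    next switching time, or \<open>b\<close> for the last segment.\<close>
  define e where "e j = (if j = l then b else enn2real (stime \<pi> (Suc j) \<omega>))" for j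
  have fin: "stime \<pi> (Suc j) \<omega> = ennreal (enn2real (stime \<pi> (Suc j) \<omega>))" "stime \<pi> (Suc j) \<omega> < ennreal b" if "j < l" for j
  proof -
    have "stime \<pi> (Suc j) \<omega> \<le> stime \<pi> l \<omega>" using stime_mono[OF sp] that by simp
    then show "stime \<pi> (Suc j) \<omega> < ennreal b" using l(1) by simp
    then have "stime \<pi> (Suc j) \<omega> < \<infinity>" using less_trans[OF _ ennreal_less_top] by simp
    then show "stime \<pi> (Suc j) \<omega> = ennreal (enn2real (stime \<pi> (Suc j) \<omega>))" by simp
  qed
  have ele: "e j \<le> b" "ennreal (e j) \<le> stime \<pi> (Suc j) \<omega>" if "j \<le> l" for j
    using fin[of j] that l b0 unfolding e_def by (auto intro: enn2real_leI less_imp_le)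
  note split = nn_integral_greaterThanAtMost_split
  have "R (\<Phi> k a + (\<integral>\<^sup>+u\<in>{a<..e (k + d)}. f u \<partial>lborel)) ((\<integral>\<^sup>+u\<in>{a<..e (k + d)}. g u \<partial>lborel) + (\<Sum>j\<in>{k<..k + d}. w j) + \<Phi> (k + d) (e (k + d)))"
    if "k + d \<le> l" for d
    using that
  proof (induction d)
    case 0
    have "a < e k"
    proof (cases "k = l")
      case True
      then show ?thesis using ab by (simp add: e_def)
    next
      case False
      then have "ennreal a < ennreal (e k)" using k(2) fin[of k] 0 by (simp add: e_def)
      then show ?thesis using ab by (simp add: ennreal_less_iff)
    qed
    then have "R (\<Phi> k a + (\<integral>\<^sup>+u\<in>{a<..e k}. f u \<partial>lborel)) ((\<integral>\<^sup>+u\<in>{a<..e k}. g u \<partial>lborel) + \<Phi> k (e k))"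
      using k(1) ele[of k] 0 by (intro seg) auto
    then show ?case by (simp only: add_0_right greaterThanAtMost_empty[OF order.refl] sum.empty)
  next
    case (Suc d)
    let ?j = "k + d"
    have jl: "?j < l" using Suc.prems by simp
    have IH: "R (\<Phi> k a + (\<integral>\<^sup>+u\<in>{a<..e ?j}. f u \<partial>lborel)) ((\<integral>\<^sup>+u\<in>{a<..e ?j}. g u \<partial>lborel) + (\<Sum>j\<in>{k<..?j}. w j) + \<Phi> ?j (e ?j))"
      using Suc.IH jl by simp
    have ej: "stime \<pi> (Suc ?j) \<omega> = ennreal (e ?j)" using fin(1)[OF jl] jl by (simp add: e_def)
    have "ennreal a < ennreal (e ?j)" using k(2) stime_mono[OF sp, of "Suc k" "Suc ?j"] ej by simp
    then have aj: "a < e ?j" using ab by (simp add: ennreal_less_iff)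
    have jb: "e ?j < b" using fin(2)[OF jl] ej aj ab by (simp add: ennreal_less_iff)
    have "ennreal (e ?j) < ennreal (e (Suc ?j))"
    proof (cases "Suc ?j = l")
      case True
      then show ?thesis using jb aj ab by (simp add: e_def ennreal_less_iff)
    next
      case False
      then have "stime \<pi> (Suc ?j) \<omega> < stime \<pi> (Suc (Suc ?j)) \<omega>" using ej by (intro stime_strict[OF sp]) auto
      moreover have "ennreal (e (Suc ?j)) = stime \<pi> (Suc (Suc ?j)) \<omega>"
        using False jl fin(1)[of "Suc ?j", symmetric] by (simp add: e_def)
      ultimately show ?thesis using ej by simp
    qed
    then have jj: "e ?j < e (Suc ?j)" using aj ab by (simp add: ennreal_less_iff)
    let ?F = "\<integral>\<^sup>+u\<in>{e ?j<..e (Suc ?j)}. f u \<partial>lborel" and ?G = "\<integral>\<^sup>+u\<in>{e ?j<..e (Suc ?j)}. g u \<partial>lborel"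
    let ?FA = "\<integral>\<^sup>+u\<in>{a<..e ?j}. f u \<partial>lborel" and ?GA = "\<integral>\<^sup>+u\<in>{a<..e ?j}. g u \<partial>lborel"
    let ?S = "\<Sum>j\<in>{k<..?j}. w j"
    have 1: "R (\<Phi> k a + ?FA + ?F) (?GA + ?S + \<Phi> ?j (e ?j) + ?F)" by (rule R(3)[OF IH])
    have "R (\<Phi> ?j (e ?j)) (w (Suc ?j) + \<Phi> (Suc ?j) (e ?j))" by (rule sw[OF aj jb ej])
    from R(3)[OF this, of "?GA + ?S + ?F"]
    have 2: "R (?GA + ?S + \<Phi> ?j (e ?j) + ?F) (?GA + ?S + w (Suc ?j) + (\<Phi> (Suc ?j) (e ?j) + ?F))"
      by (simp only: add.assoc add.commute add.left_commute)
    have "R (\<Phi> (Suc ?j) (e ?j) + ?F) (?G + \<Phi> (Suc ?j) (e (Suc ?j)))"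
      using aj jj ej ele[of "Suc ?j"] jl by (intro seg) auto
    from R(3)[OF this, of "?GA + ?S + w (Suc ?j)"]
    have 3: "R (?GA + ?S + w (Suc ?j) + (\<Phi> (Suc ?j) (e ?j) + ?F)) (?GA + ?G + (?S + w (Suc ?j)) + \<Phi> (Suc ?j) (e (Suc ?j)))"
      by (simp only: add.assoc add.commute add.left_commute)
    have S: "?S + w (Suc ?j) = (\<Sum>j\<in>{k<..k + Suc d}. w j)"
    proof -
      have "{k<..k + Suc d} = insert (Suc ?j) {k<..?j}" by auto
      then show ?thesis by (simp add: add.commute)
    qed
    have f: "(\<integral>\<^sup>+u\<in>{a<..e (Suc ?j)}. f u \<partial>lborel) = ?FA + ?F" and g: "(\<integral>\<^sup>+u\<in>{a<..e (Suc ?j)}. g u \<partial>lborel) = ?GA + ?G"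
      using aj jj by (auto intro!: split)
    have "R (\<Phi> k a + (?FA + ?F)) (?GA + ?G + (?S + w (Suc ?j)) + \<Phi> (Suc ?j) (e (Suc ?j)))"
      using R(2)[OF R(2)[OF 1 2] 3] by (simp only: add.assoc)
    then show ?case by (simp only: f g S add_Suc_right)
  qed
  from this[of "l - k"] kl have "R (\<Phi> k a + (\<integral>\<^sup>+u\<in>{a<..e l}. f u \<partial>lborel)) ((\<integral>\<^sup>+u\<in>{a<..e l}. g u \<partial>lborel) + (\<Sum>j\<in>{k<..l}. w j) + \<Phi> l (e l))"
    by (simp only: le_add_diff_inverse)
  moreover have "e l = b" by (simp add: e_def)
  ultimately show ?thesis by simp
qed

end

definition sterm :: "'a strategy \<Rightarrow> 'a \<Rightarrow> nat \<Rightarrow> ennreal" where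
  "sterm \<pi> \<omega> k = ennreal (discount m (stime \<pi> (Suc k) \<omega>) * switch m (sphase \<pi> k \<omega>) (sphase \<pi> (Suc k) \<omega>))"

text \<open>A series over all switches with an indicator, because the indices of the switches
  between two given demands are random. Switches at a demand are booked apart, in
  \<open>swa\<close>, since they may react to that demand.\<close>

definition swi :: "'a strategy \<Rightarrow> nat \<Rightarrow> 'a \<Rightarrow> ennreal" where
  "swi \<pi> n \<omega> = (\<Sum>k. sterm \<pi> \<omega> k * indicator {k. ennreal (arr n \<omega>) < stime \<pi> (Suc k) \<omega> \<and> stime \<pi> (Suc k) \<omega> < ennreal (arr (Suc n) \<omega>)} k)"

text \<open>As \<open>arr 0\<close> is 0, index 0 collects a switch at the initial time.\<close>

definition swa :: "'a strategy \<Rightarrow> nat \<Rightarrow> 'a \<Rightarrow> ennreal" where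
  "swa \<pi> n \<omega> = (\<Sum>k. sterm \<pi> \<omega> k * indicator {k. stime \<pi> (Suc k) \<omega> = ennreal (arr n \<omega>)} k)"

definition good :: "nat \<Rightarrow> real \<Rightarrow> 'a strategy \<Rightarrow> 'a \<Rightarrow> bool" where
  "good i x \<pi> \<omega> \<longleftrightarrow> spath i \<pi> \<omega> \<and> admissible_path m x \<pi> \<omega>"

context
  fixes \<pi> :: "'a strategy" and \<omega> :: 'a and i :: nat
  assumes sp: "spath i \<pi> \<omega>"
begin

lemma discount_eq: "discount m (ennreal t) = exp (- disc m * t)" if "0 \<le> t"
  using that by (simp add: discount_def)

lemma ennreal_suminf_single: "(\<Sum>k. f k * indicator A k) = f j" if "A = {j}" for f :: "nat \<Rightarrow> ennreal"
proof -
  have "(\<Sum>k. f k * indicator A k) = (\<Sum>k\<in>{j}. f k * indicator A k)"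
    using that by (intro suminf_finite) auto
  then show ?thesis using that by simp
qed

text \<open>Switching times increase strictly from index 1 on, so a demand at a positive time
  coincides with at most one switch, and the only candidate is the one after
  \<open>l\<close>.\<close>

lemma swa_eq:
  assumes t: "0 < arr n \<omega>" and l: "stime \<pi> l \<omega> < ennreal (arr n \<omega>)" "ennreal (arr n \<omega>) \<le> stime \<pi> (Suc l) \<omega>"
  shows "swa \<pi> n \<omega> = (if stime \<pi> (Suc l) \<omega> = ennreal (arr n \<omega>) then sterm \<pi> \<omega> l else 0)"
proof -
  have *: "k = l" if k: "stime \<pi> (Suc k) \<omega> = ennreal (arr n \<omega>)" for k
  proof (rule ccontr)
    assume "k \<noteq> l"
    then consider "Suc k \<le> l" | "Suc l \<le> k" by linarith
    then show False
    proof cases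
      case 1
      from le_less_trans[OF stime_mono[OF sp 1] l(1)] show ?thesis by (simp only: k less_irrefl)
    next
      case 2
      then have "stime \<pi> (Suc l) \<omega> \<le> stime \<pi> k \<omega>" by (rule stime_mono[OF sp])
      from order.trans[OF l(2) this] have "stime \<pi> k \<omega> = ennreal (arr n \<omega>)"
        using stime_Suc[OF sp, of k] unfolding k by (rule antisym[rotated])
      moreover have "stime \<pi> k \<omega> < stime \<pi> (Suc k) \<omega>"
        using 2 calculation by (intro stime_strict[OF sp]) auto
      ultimately show ?thesis by (simp only: k less_irrefl)
    qed
  qed
  show ?thesis
  proof (cases "stime \<pi> (Suc l) \<omega> = ennreal (arr n \<omega>)")
    case True
    then have "{k. stime \<pi> (Suc k) \<omega> = ennreal (arr n \<omega>)} = {l}" by (blast dest: *)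
    then show ?thesis unfolding swa_def using True ennreal_suminf_single[of _ l] by simp
  next
    case False
    then have "{k. stime \<pi> (Suc k) \<omega> = ennreal (arr n \<omega>)} = {}" by (blast dest: *)
    then show ?thesis unfolding swa_def using False by simp
  qed
qed

text \<open>The term \<open>sterm \<pi> \<omega> k\<close> belongs to switch number
  \<open>Suc k\<close>; hence the shift of the index.\<close>

lemma swi_eq:
  assumes k: "stime \<pi> k \<omega> \<le> ennreal (arr n \<omega>)" "ennreal (arr n \<omega>) < stime \<pi> (Suc k) \<omega>"
    and l: "stime \<pi> l \<omega> < ennreal (arr (Suc n) \<omega>)" "ennreal (arr (Suc n) \<omega>) \<le> stime \<pi> (Suc l) \<omega>"
  shows "swi \<pi> n \<omega> = (\<Sum>j\<in>{k<..l}. sterm \<pi> \<omega> (j - 1))"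
proof -
  have A: "{j. ennreal (arr n \<omega>) < stime \<pi> (Suc j) \<omega> \<and> stime \<pi> (Suc j) \<omega> < ennreal (arr (Suc n) \<omega>)} = {k..<l}"
  proof (intro set_eqI iffI)
    fix j assume "j \<in> {j. ennreal (arr n \<omega>) < stime \<pi> (Suc j) \<omega> \<and> stime \<pi> (Suc j) \<omega> < ennreal (arr (Suc n) \<omega>)}"
    then have j: "ennreal (arr n \<omega>) < stime \<pi> (Suc j) \<omega>" "stime \<pi> (Suc j) \<omega> < ennreal (arr (Suc n) \<omega>)" by auto
    have "k \<le> j"
    proof (rule ccontr)
      assume "\<not> k \<le> j"
      then have "stime \<pi> (Suc j) \<omega> \<le> stime \<pi> k \<omega>" using stime_mono[OF sp] by simp
      from le_less_trans[OF order.trans[OF this k(1)] j(1)] show False by simp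
    qed
    moreover have "j < l"
    proof (rule ccontr)
      assume "\<not> j < l"
      then have "stime \<pi> (Suc l) \<omega> \<le> stime \<pi> (Suc j) \<omega>" using stime_mono[OF sp] by simp
      from less_le_trans[OF j(2) order.trans[OF l(2) this]] show False by simp
    qed
    ultimately show "j \<in> {k..<l}" by simp
  next
    fix j assume "j \<in> {k..<l}"
    then have "stime \<pi> (Suc k) \<omega> \<le> stime \<pi> (Suc j) \<omega>" "stime \<pi> (Suc j) \<omega> \<le> stime \<pi> l \<omega>" using stime_mono[OF sp] by simp_all
    then show "j \<in> {j. ennreal (arr n \<omega>) < stime \<pi> (Suc j) \<omega> \<and> stime \<pi> (Suc j) \<omega> < ennreal (arr (Suc n) \<omega>)}"
      using k l by (auto intro: less_le_trans le_less_trans)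
  qed
  have "swi \<pi> n \<omega> = (\<Sum>j\<in>{k..<l}. sterm \<pi> \<omega> j * indicator {k..<l} j)"
    unfolding swi_def A by (rule suminf_finite) auto
  also have "\<dots> = (\<Sum>j\<in>{k..<l}. sterm \<pi> \<omega> j)" by simp
  also have "\<dots> = (\<Sum>j\<in>{Suc k..<Suc l}. sterm \<pi> \<omega> (j - 1))"
    by (subst sum.shift_bounds_Suc_ivl) simp
  also have "{Suc k..<Suc l} = {k<..l}" by auto
  finally show ?thesis .
qed

end

section \<open>Level and phase on an admissible path\<close>

context
  fixes \<pi> :: "'a strategy" and \<omega> :: 'a and i :: nat and x :: real
  assumes g: "good i x \<pi> \<omega>" and x: "x \<in> {lo..hi}"
begin

lemma sp: "spath i \<pi> \<omega>"
  using g unfolding good_def by simp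

lemma path_cases:
  assumes "0 \<le> t"
  shows "level m x \<pi> \<omega> t < hi \<Longrightarrow> phase_at \<pi> \<omega> t \<in> {1, 2}" "level m x \<pi> \<omega> t = hi \<Longrightarrow> phase_at \<pi> \<omega> t = 0"
  using g assms unfolding good_def admissible_path_def by blast+

lemma path_leave:
  assumes "stime \<pi> k \<omega> < \<infinity>" "sphase \<pi> k \<omega> = 0"
  shows "stime \<pi> (Suc k) \<omega> = ennreal (arr (Suc (demand_count m (enn2real (stime \<pi> k \<omega>)) \<omega>)) \<omega>)" "sphase \<pi> (Suc k) \<omega> \<in> {1, 2}"
  using g assms unfolding good_def admissible_path_def by blast+

text \<open>A segment in phase 1 or 2 that ended above \<open>hi\<close> would reach
  \<open>hi\<close> at an earlier time inside it, where admissibility demands phase 0.\<close>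

lemma lev_cap_seg:
  assumes s: "arr n \<omega> \<le> s" "s \<le> t" "t \<le> arr (Suc n) \<omega>" and k: "stime \<pi> k \<omega> \<le> ennreal s" "ennreal t \<le> stime \<pi> (Suc k) \<omega>"
    and le: "lev x \<pi> \<omega> n s \<le> hi"
  shows "lev x \<pi> \<omega> n t \<le> hi"
proof (cases "sphase \<pi> k \<omega> = 0")
  case True
  then show ?thesis using lev_seg[OF sp s(1,2) k, of x] le rates by simp
next
  case False
  then have c: "sphase \<pi> k \<omega> \<in> {1, 2}" using sphase_range[OF sp, of k] by auto
  let ?r = "rate m (sphase \<pi> k \<omega>)"
  have r: "0 < ?r" by (rule rate_pos[OF c])
  have s0: "0 \<le> s" using arr_nonneg[OF path_Om[OF sp], of n] s by linarith
  show ?thesis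
  proof (rule ccontr)
    assume gt: "\<not> lev x \<pi> \<omega> n t \<le> hi"
    define u where "u = s + (hi - lev x \<pi> \<omega> n s) / ?r"
    have lt: "lev x \<pi> \<omega> n t = lev x \<pi> \<omega> n s + ?r * (t - s)" by (rule lev_seg[OF sp s(1,2) k])
    have u: "s \<le> u" "u < t" using le r gt lt unfolding u_def by (auto simp: field_simps)
    have "ennreal u < ennreal t" using u s0 by (simp add: ennreal_less_iff)
    then have ku: "ennreal u < stime \<pi> (Suc k) \<omega>" using k(2) by (rule less_le_trans)
    have "lev x \<pi> \<omega> n u = lev x \<pi> \<omega> n s + ?r * (u - s)"
      using s u k ku by (intro lev_seg[OF sp]) (auto intro: less_imp_le)
    then have "lev x \<pi> \<omega> n u = hi" unfolding u_def using r by simp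
    then have "level m x \<pi> \<omega> u = hi" using level_lev[OF path_Om[OF sp], of n u x \<pi>] s u by simp
    then have "phase_at \<pi> \<omega> u = 0" using path_cases(2) s0 u by simp
    moreover have "phase_at \<pi> \<omega> u = sphase \<pi> k \<omega>"
      using k u ku by (intro phase_at_eq[OF sp]) (auto intro: order.trans ennreal_leI)
    ultimately show False using False by simp
  qed
qed

lemma lev_cap:
  assumes a: "level_after m x \<pi> \<omega> n \<le> hi"
  shows "arr n \<omega> \<le> t \<Longrightarrow> t \<le> arr (Suc n) \<omega> \<Longrightarrow> lev x \<pi> \<omega> n t \<le> hi"
proof -
  have n0: "0 \<le> arr n \<omega>" by (rule arr_nonneg[OF path_Om[OF sp]])
  have base: "lev x \<pi> \<omega> n t \<le> hi"
    if "stime \<pi> k \<omega> \<le> ennreal (arr n \<omega>)" "arr n \<omega> \<le> t" "t \<le> arr (Suc n) \<omega>" "ennreal t \<le> stime \<pi> (Suc k) \<omega>" for k t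
    using that a lev_arr[OF sp, of x n] by (intro lev_cap_seg[of n "arr n \<omega>" t k]) auto
  have "\<forall>t. arr n \<omega> \<le> t \<longrightarrow> t \<le> arr (Suc n) \<omega> \<longrightarrow> ennreal t \<le> stime \<pi> (Suc k) \<omega> \<longrightarrow> stime \<pi> k \<omega> \<le> ennreal t \<longrightarrow> lev x \<pi> \<omega> n t \<le> hi" for k
  proof (induction k)
    case 0
    then show ?case using base[of 0] stime_0[OF sp] by auto
  next
    case (Suc k)
    show ?case
    proof (intro allI impI)
      fix t assume t: "arr n \<omega> \<le> t" "t \<le> arr (Suc n) \<omega>" "ennreal t \<le> stime \<pi> (Suc (Suc k)) \<omega>" "stime \<pi> (Suc k) \<omega> \<le> ennreal t"
      show "lev x \<pi> \<omega> n t \<le> hi"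
      proof (cases "stime \<pi> (Suc k) \<omega> \<le> ennreal (arr n \<omega>)")
        case True
        then show ?thesis using base t by blast
      next
        case False
        obtain s where s: "stime \<pi> (Suc k) \<omega> = ennreal s" "0 \<le> s"
          using le_less_trans[OF t(4) ennreal_less_top] by (cases "stime \<pi> (Suc k) \<omega>") auto
        have ns: "arr n \<omega> \<le> s" "s \<le> t" using False s t n0 by (auto simp: ennreal_le_iff not_le ennreal_less_iff)
        have "lev x \<pi> \<omega> n s \<le> hi"
          using Suc.IH ns t s stime_Suc[OF sp, of k] by auto
        then show ?thesis using ns t s by (intro lev_cap_seg[of n s t "Suc k"]) auto
      qed
    qed
  qed
  moreover assume "arr n \<omega> \<le> t" "t \<le> arr (Suc n) \<omega>"
  moreover obtain k where "stime \<pi> k \<omega> \<le> ennreal t" "ennreal t < stime \<pi> (Suc k) \<omega>" using seg_right_ex[OF sp] by blast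
  ultimately show ?thesis by (auto intro: less_imp_le)
qed

lemma level_after_bounds: "level_after m x \<pi> \<omega> n \<in> {lo..hi}" "n \<noteq> 0 \<Longrightarrow> level_after m x \<pi> \<omega> n < hi"
proof -
  have *: "level_after m x \<pi> \<omega> n \<in> {lo..hi} \<and> (n \<noteq> 0 \<longrightarrow> level_after m x \<pi> \<omega> n < hi)" for n
  proof (induction n)
    case 0
    then show ?case using x by simp
  next
    case (Suc n)
    have "lev x \<pi> \<omega> n (arr (Suc n) \<omega>) \<le> hi" using Suc arr_less[OF path_Om[OF sp], of n "Suc n"] by (intro lev_cap) auto
    moreover have "0 < demand m (Suc n) \<omega>" using demand_pos path_Om[OF sp] by simp
    ultimately show ?case using lo_less_hi unfolding level_after_Suc by auto
  qed
  then show "level_after m x \<pi> \<omega> n \<in> {lo..hi}" "n \<noteq> 0 \<Longrightarrow> level_after m x \<pi> \<omega> n < hi" by auto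
qed

lemma lev_bounds: "arr n \<omega> \<le> t \<Longrightarrow> t \<le> arr (Suc n) \<omega> \<Longrightarrow> lev x \<pi> \<omega> n t \<in> {lo..hi}"
proof -
  assume t: "arr n \<omega> \<le> t" "t \<le> arr (Suc n) \<omega>"
  have "lev x \<pi> \<omega> n (arr n \<omega>) \<le> lev x \<pi> \<omega> n t" using t(1) by (rule monoD[OF lev_mono[OF sp]])
  then show ?thesis using t lev_cap level_after_bounds(1)[of n] lev_arr[OF sp, of x n] by auto
qed

lemma lev_phase:
  assumes "arr n \<omega> \<le> t" "t < arr (Suc n) \<omega>"
  shows "phase_at \<pi> \<omega> t \<in> {1, 2} \<and> lev x \<pi> \<omega> n t < hi \<or> phase_at \<pi> \<omega> t = 0 \<and> lev x \<pi> \<omega> n t = hi"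
proof -
  have "0 \<le> t" using arr_nonneg[OF path_Om[OF sp], of n] assms by linarith
  moreover have lv: "level m x \<pi> \<omega> t = lev x \<pi> \<omega> n t" by (rule level_lev[OF path_Om[OF sp] assms])
  moreover have "lev x \<pi> \<omega> n t \<in> {lo..hi}" using assms by (intro lev_bounds) auto
  ultimately show ?thesis
    using path_cases[of t] unfolding lv by (cases "lev x \<pi> \<omega> n t < hi") simp_all
qed

lemma seg_phase:
  assumes s: "arr n \<omega> \<le> s" "s < t" "t \<le> arr (Suc n) \<omega>" and k: "stime \<pi> k \<omega> \<le> ennreal s" "ennreal t \<le> stime \<pi> (Suc k) \<omega>"
  shows "sphase \<pi> k \<omega> \<in> {1, 2} \<or> sphase \<pi> k \<omega> = 0 \<and> lev x \<pi> \<omega> n s = hi \<and> lev x \<pi> \<omega> n t = hi"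
proof -
  have s0: "0 \<le> s" using arr_nonneg[OF path_Om[OF sp], of n] s by linarith
  have "ennreal s < ennreal t" using s s0 by (simp add: ennreal_less_iff)
  then have "ennreal s < stime \<pi> (Suc k) \<omega>" using k(2) by (rule less_le_trans)
  with k(1) have "phase_at \<pi> \<omega> s = sphase \<pi> k \<omega>" by (rule phase_at_eq[OF sp])
  moreover have "lev x \<pi> \<omega> n t = lev x \<pi> \<omega> n s + rate m (sphase \<pi> k \<omega>) * (t - s)"
    using s k by (intro lev_seg[OF sp]) auto
  ultimately show ?thesis using lev_phase[of n s] s rates by auto
qed

text \<open>Phase 0 is left only at a demand, so a switch strictly between demands starts from phase
  1 or 2; admissibility right after the switch ties a new phase 0 to the level
  \<open>hi\<close>.\<close>

lemma switch_inside:
  assumes t: "arr n \<omega> < t" "t < arr (Suc n) \<omega>" and k: "stime \<pi> (Suc k) \<omega> = ennreal t"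
  shows "sphase \<pi> k \<omega> \<in> {1, 2}" "sphase \<pi> (Suc k) \<omega> \<noteq> sphase \<pi> k \<omega>"
    "sphase \<pi> (Suc k) \<omega> \<in> {1, 2} \<or> sphase \<pi> (Suc k) \<omega> = 0 \<and> lev x \<pi> \<omega> n t = hi"
proof -
  have Om: "\<omega> \<in> Om" by (rule path_Om[OF sp])
  have t0: "0 < t" using arr_nonneg[OF Om, of n] t by linarith
  show "sphase \<pi> (Suc k) \<omega> \<noteq> sphase \<pi> k \<omega>" using sphase_neq[OF sp, of k] k by simp
  have "sphase \<pi> k \<omega> \<noteq> 0"
  proof
    assume 0: "sphase \<pi> k \<omega> = 0"
    have "stime \<pi> k \<omega> < \<infinity>" using stime_Suc[OF sp, of k] k by (metis ennreal_less_top infinity_ennreal_def le_less_trans)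
    then obtain j where "ennreal t = ennreal (arr j \<omega>)" using path_leave(1)[of k] 0 k by auto
    then have "t = arr j \<omega>" using t0 arr_nonneg[OF Om, of j] by simp
    then show False using t arr_le[OF Om, of j n] arr_le[OF Om, of "Suc n" j] by (cases "j \<le> n") auto
  qed
  then show "sphase \<pi> k \<omega> \<in> {1, 2}" using sphase_range[OF sp, of k] by auto
  have "stime \<pi> (Suc k) \<omega> < stime \<pi> (Suc (Suc k)) \<omega>" using k by (intro stime_strict[OF sp]) auto
  then have "phase_at \<pi> \<omega> t = sphase \<pi> (Suc k) \<omega>" using k by (intro phase_at_eq[OF sp]) auto
  then show "sphase \<pi> (Suc k) \<omega> \<in> {1, 2} \<or> sphase \<pi> (Suc k) \<omega> = 0 \<and> lev x \<pi> \<omega> n t = hi"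
    using lev_phase[of n t] t by auto
qed

text \<open>A positive demand pushes the level below \<open>hi\<close>, so the phase right after it
  is 1 or 2, whether or not a switch was made.\<close>

lemma switch_at_demand:
  assumes l: "stime \<pi> l \<omega> < ennreal (arr (Suc n) \<omega>)" "ennreal (arr (Suc n) \<omega>) \<le> stime \<pi> (Suc l) \<omega>"
  shows "stime \<pi> (Suc l) \<omega> = ennreal (arr (Suc n) \<omega>) \<and> phase_at \<pi> \<omega> (arr (Suc n) \<omega>) = sphase \<pi> (Suc l) \<omega>
      \<and> sphase \<pi> (Suc l) \<omega> \<in> {1, 2} \<and> sphase \<pi> (Suc l) \<omega> \<noteq> sphase \<pi> l \<omega>
    \<or> stime \<pi> (Suc l) \<omega> \<noteq> ennreal (arr (Suc n) \<omega>) \<and> phase_at \<pi> \<omega> (arr (Suc n) \<omega>) = sphase \<pi> l \<omega> \<and> sphase \<pi> l \<omega> \<in> {1, 2}"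
proof -
  have Om: "\<omega> \<in> Om" by (rule path_Om[OF sp])
  let ?B = "arr (Suc n) \<omega>"
  have "lev x \<pi> \<omega> (Suc n) ?B < hi" using level_after_bounds(2)[of "Suc n"] lev_arr[OF sp, of x "Suc n"] by simp
  then have ph: "phase_at \<pi> \<omega> ?B \<in> {1, 2}"
    using lev_phase[of "Suc n" ?B] arr_less[OF Om, of "Suc n" "Suc (Suc n)"] by auto
  show ?thesis
  proof (cases "stime \<pi> (Suc l) \<omega> = ennreal ?B")
    case True
    have "stime \<pi> (Suc l) \<omega> < stime \<pi> (Suc (Suc l)) \<omega>" using True by (intro stime_strict[OF sp]) auto
    then have "phase_at \<pi> \<omega> ?B = sphase \<pi> (Suc l) \<omega>" using True by (intro phase_at_eq[OF sp]) auto
    then show ?thesis using True ph sphase_neq[OF sp, of l] by auto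
  next
    case False
    then have "phase_at \<pi> \<omega> ?B = sphase \<pi> l \<omega>" using l by (intro phase_at_eq[OF sp]) (auto simp: less_le)
    then show ?thesis using False ph by auto
  qed
qed

end

section \<open>Quantities collected in one stage\<close>

definition occ :: "'a strategy \<Rightarrow> real \<Rightarrow> (nat \<Rightarrow> real \<Rightarrow> real) \<Rightarrow> nat \<Rightarrow> 'a \<Rightarrow> ennreal" where
  "occ \<pi> x f n \<omega> = (\<integral>\<^sup>+u\<in>{arr n \<omega><..arr (Suc n) \<omega>}.
     ennreal (exp (- disc m * u) * f (phL \<pi> \<omega> u) (lev x \<pi> \<omega> n u)) \<partial>lborel)"

text \<open>Discounted value at the start of stage \<open>n\<close>. The right-continuous phase is
  used, so a switch made at the demand itself is already accounted for.\<close>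

definition pot :: "'a strategy \<Rightarrow> real \<Rightarrow> nat \<Rightarrow> 'a \<Rightarrow> ennreal" where
  "pot \<pi> x n \<omega> = ennreal (exp (- disc m * arr n \<omega>) * vv (phase_at \<pi> \<omega> (arr n \<omega>)) (level_after m x \<pi> \<omega> n))"

text \<open>The state at the end of stage \<open>n\<close>, just before the next demand:
  left-continuous phase and left limit of the level. Only this version is predictable, as the
  compensator formula requires.\<close>

definition fin :: "'a strategy \<Rightarrow> real \<Rightarrow> (nat \<Rightarrow> real \<Rightarrow> real) \<Rightarrow> nat \<Rightarrow> 'a \<Rightarrow> ennreal" where
  "fin \<pi> x f n \<omega> = ennreal (exp (- disc m * arr (Suc n) \<omega>) * f (phL \<pi> \<omega> (arr (Suc n) \<omega>)) (level_before m x \<pi> \<omega> n))"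

text \<open>As \<open>fin\<close>, but the quantity may also depend on the size of the demand that
  ends the stage.\<close>

definition dem :: "'a strategy \<Rightarrow> real \<Rightarrow> (nat \<Rightarrow> real \<Rightarrow> real \<Rightarrow> real) \<Rightarrow> nat \<Rightarrow> 'a \<Rightarrow> ennreal" where
  "dem \<pi> x g n \<omega> = ennreal (exp (- disc m * arr (Suc n) \<omega>)
     * g (phL \<pi> \<omega> (arr (Suc n) \<omega>)) (level_before m x \<pi> \<omega> n) (demand m (Suc n) \<omega>))"

lemma compose_phase_measurable:
  fixes h :: "nat \<Rightarrow> real \<Rightarrow> 'c::topological_space"
  assumes p: "p \<in> M \<rightarrow>\<^sub>M count_space {0, 1, 2}" and h: "\<And>c. c \<in> {0, 1, 2} \<Longrightarrow> h c \<in> borel_measurable borel"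
    and y: "y \<in> borel_measurable M"
  shows "(\<lambda>u. h (p u) (y u)) \<in> borel_measurable M"
  by (rule measurable_compose_countable'[OF _ p]) (auto intro: measurable_compose[OF y h])

context
  fixes \<pi> :: "'a strategy" and \<omega> :: 'a and i :: nat
  assumes sp: "spath i \<pi> \<omega>"
begin

lemma phL_measurable3: "phL \<pi> \<omega> \<in> borel \<rightarrow>\<^sub>M count_space {0, 1, 2}"
proof (rule measurable_count_space_eq2[THEN iffD2])
  show "phL \<pi> \<omega> \<in> space borel \<rightarrow> {0, 1, 2} \<and> (\<forall>a\<in>{0, 1, 2}. phL \<pi> \<omega> -` {a} \<inter> space borel \<in> sets borel)"
    using phL_range[OF sp] measurable_sets[OF phL_measurable[OF sp]] by auto
qed simp

lemma phL_lev_measurable: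
  fixes h :: "nat \<Rightarrow> real \<Rightarrow> real"
  assumes "\<And>c. c \<in> {0, 1, 2} \<Longrightarrow> h c \<in> borel_measurable borel"
  shows "(\<lambda>u. ennreal (exp (- disc m * u) * h (phL \<pi> \<omega> u) (lev x \<pi> \<omega> n u))) \<in> borel_measurable borel"
proof -
  have [measurable]: "(\<lambda>u. h (phL \<pi> \<omega> u) (lev x \<pi> \<omega> n u)) \<in> borel_measurable borel"
    by (rule compose_phase_measurable[OF phL_measurable3 assms lev_measurable[OF sp]])
  show ?thesis by measurable
qed

lemma seg_cong:
  assumes s: "arr n \<omega> \<le> s" "s < t" and k: "stime \<pi> k \<omega> \<le> ennreal s" "ennreal t \<le> stime \<pi> (Suc k) \<omega>"
  shows "(\<integral>\<^sup>+u\<in>{s<..t}. ennreal (exp (- disc m * u) * h (phL \<pi> \<omega> u) (lev x \<pi> \<omega> n u)) \<partial>lborel)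
    = (\<integral>\<^sup>+u\<in>{s<..t}. ennreal (exp (- disc m * u) * h (sphase \<pi> k \<omega>) (lev x \<pi> \<omega> n s + rate m (sphase \<pi> k \<omega>) * (u - s))) \<partial>lborel)"
proof (intro nn_integral_cong)
  fix u :: real
  have s0: "0 \<le> s" using arr_nonneg[OF path_Om[OF sp], of n] s by linarith
  have "phL \<pi> \<omega> u = sphase \<pi> k \<omega>" "lev x \<pi> \<omega> n u = lev x \<pi> \<omega> n s + rate m (sphase \<pi> k \<omega>) * (u - s)" if u: "s < u" "u \<le> t"
  proof -
    have "ennreal s < ennreal u" using u s0 by (simp add: ennreal_less_iff)
    with k(1) have 1: "stime \<pi> k \<omega> < ennreal u" by (rule le_less_trans)
    have 2: "ennreal u \<le> stime \<pi> (Suc k) \<omega>" using ennreal_leI[OF u(2)] k(2) by (rule order.trans)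
    show "phL \<pi> \<omega> u = sphase \<pi> k \<omega>" by (rule phL_eq[OF sp 1 2])
    show "lev x \<pi> \<omega> n u = lev x \<pi> \<omega> n s + rate m (sphase \<pi> k \<omega>) * (u - s)"
      by (rule lev_seg[OF sp s(1) less_imp_le[OF u(1)] k(1) 2])
  qed
  then show "ennreal (exp (- disc m * u) * h (phL \<pi> \<omega> u) (lev x \<pi> \<omega> n u)) * indicator {s<..t} u
    = ennreal (exp (- disc m * u) * h (sphase \<pi> k \<omega>) (lev x \<pi> \<omega> n s + rate m (sphase \<pi> k \<omega>) * (u - s))) * indicator {s<..t} u"
    by (auto simp: indicator_def)
qed

end

context
  fixes \<pi> :: "'a strategy" and \<omega> :: 'a and i :: nat and x :: real
  assumes g: "good i x \<pi> \<omega>" and x: "x \<in> {lo..hi}"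
begin

text \<open>Reduces a balance on a segment to phases 1 and 2; in phase 0 it is an equality, so any
  reflexive relation holds. The abstract \<open>R\<close> allows the same argument for the
  inequality of arbitrary strategies and the equality of the feedback strategy.\<close>

lemma seg_relation:
  assumes R: "\<And>p. R p p"
    and s: "arr n \<omega> \<le> s" "s < t" "t \<le> arr (Suc n) \<omega>" and k: "stime \<pi> k \<omega> \<le> ennreal s" "ennreal t \<le> stime \<pi> (Suc k) \<omega>"
    and main: "sphase \<pi> k \<omega> \<in> {1, 2} \<Longrightarrow> lo \<le> lev x \<pi> \<omega> n s \<Longrightarrow> lev x \<pi> \<omega> n s + rate m (sphase \<pi> k \<omega>) * (t - s) \<le> hi \<Longrightarrow>
      R (ennreal (exp (- disc m * s) * val (sphase \<pi> k \<omega>) (lev x \<pi> \<omega> n s))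
        + (\<integral>\<^sup>+u\<in>{s<..t}. ennreal (exp (- disc m * u) * (intensity m * val (sphase \<pi> k \<omega>) (lev x \<pi> \<omega> n s + rate m (sphase \<pi> k \<omega>) * (u - s)))) \<partial>lborel))
      ((\<integral>\<^sup>+u\<in>{s<..t}. ennreal (exp (- disc m * u) * gain val (sphase \<pi> k \<omega>) (lev x \<pi> \<omega> n s + rate m (sphase \<pi> k \<omega>) * (u - s))) \<partial>lborel)
        + ennreal (exp (- disc m * t) * val (sphase \<pi> k \<omega>) (lev x \<pi> \<omega> n s + rate m (sphase \<pi> k \<omega>) * (t - s))))"
  shows "R (ennreal (exp (- disc m * s) * vv (sphase \<pi> k \<omega>) (lev x \<pi> \<omega> n s))
      + (\<integral>\<^sup>+u\<in>{s<..t}. ennreal (exp (- disc m * u) * (intensity m * vv (phL \<pi> \<omega> u) (lev x \<pi> \<omega> n u))) \<partial>lborel))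
    ((\<integral>\<^sup>+u\<in>{s<..t}. ennreal (exp (- disc m * u) * gain val (phL \<pi> \<omega> u) (lev x \<pi> \<omega> n u)) \<partial>lborel)
      + ennreal (exp (- disc m * t) * vv (sphase \<pi> k \<omega>) (lev x \<pi> \<omega> n t)))"
proof -
  note sp = sp[OF g x]
  have lt: "lev x \<pi> \<omega> n t = lev x \<pi> \<omega> n s + rate m (sphase \<pi> k \<omega>) * (t - s)"
    by (rule lev_seg[OF sp s(1) less_imp_le[OF s(2)] k])
  have lb: "lev x \<pi> \<omega> n s \<in> {lo..hi}" "lev x \<pi> \<omega> n t \<in> {lo..hi}" 
    using lev_bounds[OF g x, of n s] lev_bounds[OF g x, of n t] s by simp_all
  have s0: "0 \<le> s" using arr_nonneg[OF path_Om[OF sp], of n] s by linarith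
  note c1 = seg_cong[OF sp s(1,2) k, where x = x and h = "\<lambda>c y. intensity m * vv c y"]
  note c2 = seg_cong[OF sp s(1,2) k, where x = x and h = "gain val"]
  from seg_phase[OF g x s k] show ?thesis
  proof
    assume c: "sphase \<pi> k \<omega> \<in> {1, 2}"
    then have v: "vv (sphase \<pi> k \<omega>) = val (sphase \<pi> k \<omega>)" by (auto simp: vv_def fun_eq_iff)
    show ?thesis unfolding c1 c2 v lt using main c lb lt by simp
  next
    assume c: "sphase \<pi> k \<omega> = 0 \<and> lev x \<pi> \<omega> n s = hi \<and> lev x \<pi> \<omega> n t = hi"
    have v: "vv 0 = (\<lambda>y. idle val)" by (auto simp: vv_def)
    have z: "rate m 0 * z = 0" "hi + 0 = hi" for z using rates by auto
    show ?thesis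
      unfolding c1 c2 using c seg_idle[OF s0 less_imp_le[OF s(2)]] R unfolding v by (simp only: v z)
  qed
qed

lemma switch_val_le:
  assumes t: "arr n \<omega> < t" "t < arr (Suc n) \<omega>" and k: "stime \<pi> (Suc k) \<omega> = ennreal t"
  shows "vv (sphase \<pi> k \<omega>) (lev x \<pi> \<omega> n t) \<le> switch m (sphase \<pi> k \<omega>) (sphase \<pi> (Suc k) \<omega>) + vv (sphase \<pi> (Suc k) \<omega>) (lev x \<pi> \<omega> n t)"
proof -
  note si = switch_inside[OF g x t k]
  have y: "lev x \<pi> \<omega> n t \<in> {lo..hi}" using t by (intro lev_bounds[OF g x]) auto
  note s = subvalD[OF val_subval si(1)]
  from si(3) show ?thesis
  proof
    assume "sphase \<pi> (Suc k) \<omega> \<in> {1, 2}"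
    then show ?thesis using s(1)[OF _ si(2)[symmetric] y] si(1) by (auto simp: vv_def)
  next
    assume "sphase \<pi> (Suc k) \<omega> = 0 \<and> lev x \<pi> \<omega> n t = hi"
    then show ?thesis using s(3) si(1) by (auto simp: vv_def)
  qed
qed

lemma sterm_plus:
  assumes t: "0 \<le> t" and k: "stime \<pi> (Suc k) \<omega> = ennreal t" and c: "sphase \<pi> (Suc k) \<omega> \<noteq> sphase \<pi> k \<omega>" and v: "0 \<le> v"
  shows "sterm \<pi> \<omega> k + ennreal (exp (- disc m * t) * v) = ennreal (exp (- disc m * t) * (switch m (sphase \<pi> k \<omega>) (sphase \<pi> (Suc k) \<omega>) + v))"
proof -
  note sp = sp[OF g x]
  have "0 \<le> switch m (sphase \<pi> k \<omega>) (sphase \<pi> (Suc k) \<omega>)"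
    using sphase_range[OF sp] c by (intro switch_nn) auto
  then show ?thesis
    unfolding sterm_def k discount_eq[OF sp t] using v by (subst ennreal_plus[symmetric]) (auto simp: distrib_left)
qed

text \<open>Drift inequalities on the segments and switching inequalities between them, telescoped
  over stage \<open>n\<close>. In the mean, the running term on the left cancels against
  \<open>fin \<pi> x vv n\<close>.\<close>

lemma pot_le:
  "pot \<pi> x n \<omega> + occ \<pi> x (\<lambda>c y. intensity m * vv c y) n \<omega> \<le> occ \<pi> x (gain val) n \<omega> + swi \<pi> n \<omega> + fin \<pi> x vv n \<omega>"
proof -
  note sp = sp[OF g x]
  have Om: "\<omega> \<in> Om" by (rule path_Om[OF sp])
  have a: "0 \<le> arr n \<omega>" "arr n \<omega> < arr (Suc n) \<omega>" by (rule arr_nonneg[OF Om], rule arr_less[OF Om], simp)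
  obtain k l where kl: "stime \<pi> k \<omega> \<le> ennreal (arr n \<omega>)" "ennreal (arr n \<omega>) < stime \<pi> (Suc k) \<omega>"
    "stime \<pi> l \<omega> < ennreal (arr (Suc n) \<omega>)" "ennreal (arr (Suc n) \<omega>) \<le> stime \<pi> (Suc l) \<omega>" "k \<le> l"
    by (rule switch_index[OF sp a])
  let ?P = "\<lambda>k t. ennreal (exp (- disc m * t) * vv (sphase \<pi> k \<omega>) (lev x \<pi> \<omega> n t))"
  have "?P k (arr n \<omega>) + (\<integral>\<^sup>+u\<in>{arr n \<omega><..arr (Suc n) \<omega>}. ennreal (exp (- disc m * u) * (intensity m * vv (phL \<pi> \<omega> u) (lev x \<pi> \<omega> n u))) \<partial>lborel)
    \<le> (\<integral>\<^sup>+u\<in>{arr n \<omega><..arr (Suc n) \<omega>}. ennreal (exp (- disc m * u) * gain val (phL \<pi> \<omega> u) (lev x \<pi> \<omega> n u)) \<partial>lborel)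
      + (\<Sum>j\<in>{k<..l}. sterm \<pi> \<omega> (j - 1)) + ?P l (arr (Suc n) \<omega>)"
  proof (rule telescope[where R = "(\<le>)", OF sp _ _ _ _ _ a _ _ kl])
    show "(\<lambda>u. ennreal (exp (- disc m * u) * (intensity m * vv (phL \<pi> \<omega> u) (lev x \<pi> \<omega> n u)))) \<in> borel_measurable borel"
      by (rule phL_lev_measurable[OF sp, where h = "\<lambda>c y. intensity m * vv c y"]) (intro borel_measurable_times vv_measurable borel_measurable_const)
    show "(\<lambda>u. ennreal (exp (- disc m * u) * gain val (phL \<pi> \<omega> u) (lev x \<pi> \<omega> n u))) \<in> borel_measurable borel"
      by (rule phL_lev_measurable[OF sp]) (rule gain_measurable[OF val_bnd])
    fix k s t assume st: "arr n \<omega> \<le> s" "s < t" "t \<le> arr (Suc n) \<omega>" and k: "stime \<pi> k \<omega> \<le> ennreal s" "ennreal t \<le> stime \<pi> (Suc k) \<omega>"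
    show "?P k s + (\<integral>\<^sup>+u\<in>{s<..t}. ennreal (exp (- disc m * u) * (intensity m * vv (phL \<pi> \<omega> u) (lev x \<pi> \<omega> n u))) \<partial>lborel)
      \<le> (\<integral>\<^sup>+u\<in>{s<..t}. ennreal (exp (- disc m * u) * gain val (phL \<pi> \<omega> u) (lev x \<pi> \<omega> n u)) \<partial>lborel) + ?P k t"
      by (rule seg_relation[where R = "(\<le>)", OF _ st k], rule order.refl, rule seg_val(1)[OF _ _ _ less_imp_le[OF st(2)]])
  next
    fix k t assume t: "arr n \<omega> < t" "t < arr (Suc n) \<omega>" and k: "stime \<pi> (Suc k) \<omega> = ennreal t"
    have "0 \<le> t" using a t by linarith
    then have "sterm \<pi> \<omega> (Suc k - 1) + ?P (Suc k) t = ennreal (exp (- disc m * t) * (switch m (sphase \<pi> k \<omega>) (sphase \<pi> (Suc k) \<omega>) + vv (sphase \<pi> (Suc k) \<omega>) (lev x \<pi> \<omega> n t)))"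
      using sterm_plus[OF _ k switch_inside(2)[OF g x t k]] vv_bounds(1)[OF sphase_range[OF sp]] by simp
    then show "?P k t \<le> sterm \<pi> \<omega> (Suc k - 1) + ?P (Suc k) t"
      using switch_val_le[OF t k] by (auto intro!: ennreal_leI mult_left_mono)
  qed (auto intro: add_right_mono)
  moreover have "phase_at \<pi> \<omega> (arr n \<omega>) = sphase \<pi> k \<omega>" by (rule phase_at_eq[OF sp kl(1,2)])
  moreover have "phL \<pi> \<omega> (arr (Suc n) \<omega>) = sphase \<pi> l \<omega>" by (rule phL_eq[OF sp kl(3,4)])
  ultimately show ?thesis
    unfolding pot_def occ_def fin_def level_before_lev swi_eq[OF sp kl(1-4)] lev_arr[OF sp, symmetric] by simp
qed

text \<open>\<open>wt val\<close> is a lower bound for every admissible reaction to a demand: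
  keeping the phase is possible in phases 1 and 2 only, and leaving phase 0 costs at least the
  cheaper exit.\<close>

lemma demand_le:
  "dem \<pi> x (\<lambda>c y \<alpha>. wt val c (max lo (y - \<alpha>))) n \<omega> \<le> swa \<pi> (Suc n) \<omega> + pot \<pi> x (Suc n) \<omega>"
proof -
  note sp = sp[OF g x]
  have Om: "\<omega> \<in> Om" by (rule path_Om[OF sp])
  let ?B = "arr (Suc n) \<omega>"
  have B: "0 < ?B" using arr_less[OF Om, of 0 "Suc n"] arr_0[OF Om] by simp
  obtain l where l: "stime \<pi> l \<omega> < ennreal ?B" "ennreal ?B \<le> stime \<pi> (Suc l) \<omega>" using seg_left_ex[OF sp B] by blast
  have ph: "phL \<pi> \<omega> ?B = sphase \<pi> l \<omega>" by (rule phL_eq[OF sp l])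
  let ?X = "level_after m x \<pi> \<omega> (Suc n)"
  have X: "?X \<in> {lo..hi}" by (rule level_after_bounds(1)[OF g x])
  have J: "dem \<pi> x (\<lambda>c y \<alpha>. wt val c (max lo (y - \<alpha>))) n \<omega> = ennreal (exp (- disc m * ?B) * wt val (sphase \<pi> l \<omega>) ?X)"
    unfolding dem_def ph level_after_Suc level_before_lev by simp
  from switch_at_demand[OF g x l] show ?thesis
  proof
    assume a: "stime \<pi> (Suc l) \<omega> = ennreal ?B \<and> phase_at \<pi> \<omega> ?B = sphase \<pi> (Suc l) \<omega>
      \<and> sphase \<pi> (Suc l) \<omega> \<in> {1, 2} \<and> sphase \<pi> (Suc l) \<omega> \<noteq> sphase \<pi> l \<omega>"
    then have sw: "swa \<pi> (Suc n) \<omega> = sterm \<pi> \<omega> l" using swa_eq[OF sp B l] by simp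
    have v: "vv (sphase \<pi> (Suc l) \<omega>) = val (sphase \<pi> (Suc l) \<omega>)" using a by (auto simp: vv_def fun_eq_iff)
    have "wt val (sphase \<pi> l \<omega>) ?X \<le> switch m (sphase \<pi> l \<omega>) (sphase \<pi> (Suc l) \<omega>) + val (sphase \<pi> (Suc l) \<omega>) ?X"
    proof (cases "sphase \<pi> l \<omega> = 0")
      case True
      then show ?thesis using a unfolding wt_def by auto
    next
      case False
      then have "sphase \<pi> l \<omega> \<in> {1, 2}" using sphase_range[OF sp, of l] by auto
      then show ?thesis using subvalD(1)[OF val_subval, of "sphase \<pi> l \<omega>" "sphase \<pi> (Suc l) \<omega>" ?X] a X False by (auto simp: wt_def)
    qed
    then show ?thesis
      unfolding J sw pot_def using a sterm_plus[of ?B l "val (sphase \<pi> (Suc l) \<omega>) ?X"] B bndD(1)[OF val_bnd, of "sphase \<pi> (Suc l) \<omega>" ?X]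
      by (auto simp: v intro!: ennreal_leI mult_left_mono)
  next
    assume "stime \<pi> (Suc l) \<omega> \<noteq> ennreal ?B \<and> phase_at \<pi> \<omega> ?B = sphase \<pi> l \<omega> \<and> sphase \<pi> l \<omega> \<in> {1, 2}"
    then show ?thesis unfolding J pot_def by (auto simp: wt_def vv_def)
  qed
qed

end

lemma AE_good: "\<pi> \<in> admissible m x i \<Longrightarrow> AE \<omega> in sample m. good i x \<pi> \<omega>"
proof -
  assume a: "\<pi> \<in> admissible m x i"
  then have "AE \<omega> in sample m. strategy_path i \<pi> \<omega> \<and> admissible_path m x \<pi> \<omega>" unfolding admissible_def by simp
  then show ?thesis
  proof (rule AE_mp, intro AE_I2 impI)
    fix \<omega> assume \<omega>: "\<omega> \<in> Om" "strategy_path i \<pi> \<omega> \<and> admissible_path m x \<pi> \<omega>"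
    have "sphase \<pi> k \<omega> \<in> {0, 1, 2}" for k
    proof -
      have "sphase \<pi> k \<in> filt.pre_sigma (stime \<pi> k) \<rightarrow>\<^sub>M count_space {0, 1, 2}" using a unfolding admissible_def by simp
      from measurable_space[OF this, of \<omega>] show ?thesis using \<omega> by (simp add: filt.space_pre_sigma)
    qed
    then show "good i x \<pi> \<omega>" using \<omega> unfolding good_def spath_def by simp
  qed
qed

section \<open>Strategies as functions of the past and the elapsed time\<close>

context
  fixes \<pi> :: "'a strategy" and i :: nat and x :: real
  assumes adm: "\<pi> \<in> admissible m x i"
begin

lemma stopping: "stopping_time filt (stime \<pi> k)"
  and phase_pre: "sphase \<pi> k \<in> filt.pre_sigma (stime \<pi> k) \<rightarrow>\<^sub>M count_space {0, 1, 2}"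
  using adm unfolding admissible_def by simp_all

lemma stime_filt: "{\<omega>\<in>Om. stime \<pi> k \<omega> \<le> t} \<in> sets (filt t)"
  using stopping[of k] unfolding stopping_time_def pred_def by simp

lemma phase_filt: "{\<omega>\<in>Om. sphase \<pi> k \<omega> = c \<and> stime \<pi> k \<omega> \<le> t} \<in> sets (filt t)"
proof (cases "c \<in> {0, 1, 2}")
  case True
  have "sphase \<pi> k -` {c} \<inter> space (filt.pre_sigma (stime \<pi> k)) \<in> sets (filt.pre_sigma (stime \<pi> k))"
    by (rule measurable_sets[OF phase_pre]) (use True in auto)
  from filt.sets_pre_sigmaD[OF stopping this, of t]
  have "{\<omega> \<in> sphase \<pi> k -` {c} \<inter> Om. stime \<pi> k \<omega> \<le> t} \<in> sets (filt t)" by (simp only: filt.space_pre_sigma)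
  also have "{\<omega> \<in> sphase \<pi> k -` {c} \<inter> Om. stime \<pi> k \<omega> \<le> t} = {\<omega>\<in>Om. sphase \<pi> k \<omega> = c \<and> stime \<pi> k \<omega> \<le> t}" by auto
  finally show ?thesis .
next
  case False
  have "sphase \<pi> k \<omega> \<in> {0, 1, 2}" if "\<omega> \<in> Om" for \<omega>
    using measurable_space[OF phase_pre, of \<omega> k] that by (simp add: filt.space_pre_sigma)
  then have "{\<omega>\<in>Om. sphase \<pi> k \<omega> = c \<and> stime \<pi> k \<omega> \<le> t} = {}" using False by blast
  then show ?thesis by (simp only: sets.empty_sets)
qed

lemma stime_rv [measurable]: "stime \<pi> k \<in> borel_measurable (sample m)"
  by (rule measurable_stopping_time[OF stopping]) (auto simp: sets_filt_le[THEN subsetD])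

lemma sphase_rv [measurable]: "sphase \<pi> k \<in> sample m \<rightarrow>\<^sub>M count_space UNIV"
proof (rule measurable_count_space_eq2_countable[THEN iffD2], intro conjI ballI)
  fix c
  have "sphase \<pi> k -` {c} \<inter> Om = {\<omega>\<in>Om. sphase \<pi> k \<omega> = c \<and> stime \<pi> k \<omega> \<le> \<infinity>}" by auto
  then show "sphase \<pi> k -` {c} \<inter> Om \<in> sets (sample m)" using phase_filt[of k c \<infinity>] sets_filt_le by auto
qed auto

text \<open>The left-continuous phase equals \<open>c\<close> at a given time exactly if some switch
  to \<open>c\<close> lies strictly before that time and the following switch does not. Both events
  are of the form treated in \<open>predictable_version\<close>.\<close>

lemma phase_version:
  "\<exists>p \<in> (hist n \<Otimes>\<^sub>M borel) \<rightarrow>\<^sub>M count_space {0, 1, 2}. \<forall>\<omega>. spath i \<pi> \<omega> \<longrightarrow>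
    (\<forall>s. 0 < s \<longrightarrow> s \<le> gap n \<omega> \<longrightarrow> p (\<omega>, s) = phL \<pi> \<omega> (arr n \<omega> + s))"
proof -
  \<comment> \<open>Making the switching time infinite unless the new phase is \<open>c\<close>
    joins the two conditions in one time to which \<open>predictable_version\<close>
    applies.\<close>
  let ?T = "\<lambda>k c \<omega>. if sphase \<pi> k \<omega> = c then stime \<pi> k \<omega> else \<infinity>"
  have "\<exists>L\<in>sets (hist n \<Otimes>\<^sub>M borel). \<forall>\<omega>\<in>Om. \<forall>s. 0 < s \<longrightarrow> s \<le> gap n \<omega> \<longrightarrow>
    ((\<omega>, s) \<in> L \<longleftrightarrow> stime \<pi> k \<omega> < ennreal (arr n \<omega> + s))" for k
    by (rule predictable_version[OF stime_filt])
  then obtain L where L: "\<And>k. L k \<in> sets (hist n \<Otimes>\<^sub>M borel)" "\<And>k \<omega> s. \<omega> \<in> Om \<Longrightarrow> 0 < s \<Longrightarrow> s \<le> gap n \<omega> \<Longrightarrow>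
    ((\<omega>, s) \<in> L k \<longleftrightarrow> stime \<pi> k \<omega> < ennreal (arr n \<omega> + s))"
    by metis
  have "\<exists>L\<in>sets (hist n \<Otimes>\<^sub>M borel). \<forall>\<omega>\<in>Om. \<forall>s. 0 < s \<longrightarrow> s \<le> gap n \<omega> \<longrightarrow>
    ((\<omega>, s) \<in> L \<longleftrightarrow> ?T k c \<omega> < ennreal (arr n \<omega> + s))" for k c
  proof (rule predictable_version)
    fix t :: real
    have "{\<omega>\<in>Om. ?T k c \<omega> \<le> ennreal t} = {\<omega>\<in>Om. sphase \<pi> k \<omega> = c \<and> stime \<pi> k \<omega> \<le> ennreal t}" by (auto simp: top_unique)
    then show "{\<omega>\<in>Om. ?T k c \<omega> \<le> ennreal t} \<in> sets (filt (ennreal t))" using phase_filt by simp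
  qed
  then obtain C where C: "\<And>k c. C k c \<in> sets (hist n \<Otimes>\<^sub>M borel)" "\<And>k c \<omega> s. \<omega> \<in> Om \<Longrightarrow> 0 < s \<Longrightarrow> s \<le> gap n \<omega> \<Longrightarrow>
    ((\<omega>, s) \<in> C k c \<longleftrightarrow> ?T k c \<omega> < ennreal (arr n \<omega> + s))"
    by metis
  define Q where "Q c = (\<Union>k. C k c - L (Suc k))" for c
  have [measurable]: "Q c \<in> sets (hist n \<Otimes>\<^sub>M borel)" for c unfolding Q_def using L(1) C(1) by auto
  define p :: "'a \<times> real \<Rightarrow> nat" where "p z = (if z \<in> Q 1 then 1 else if z \<in> Q 2 then 2 else 0)" for z
  have "p \<in> (hist n \<Otimes>\<^sub>M borel) \<rightarrow>\<^sub>M count_space {0, 1, 2}" unfolding p_def by measurable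
  moreover have "p (\<omega>, s) = phL \<pi> \<omega> (arr n \<omega> + s)" if sp: "spath i \<pi> \<omega>" and s: "0 < s" "s \<le> gap n \<omega>" for \<omega> s
  proof -
    have Om: "\<omega> \<in> Om" by (rule path_Om[OF sp])
    have "0 < arr n \<omega> + s" using arr_nonneg[OF Om, of n] s by linarith
    then obtain k where k: "stime \<pi> k \<omega> < ennreal (arr n \<omega> + s)" "ennreal (arr n \<omega> + s) \<le> stime \<pi> (Suc k) \<omega>"
      using seg_left_ex[OF sp] by blast
    have Q: "(\<omega>, s) \<in> Q c \<longleftrightarrow> sphase \<pi> k \<omega> = c" for c
    proof
      assume "(\<omega>, s) \<in> Q c"
      then obtain j where "(\<omega>, s) \<in> C j c" "(\<omega>, s) \<notin> L (Suc j)" unfolding Q_def by auto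
      then have j: "sphase \<pi> j \<omega> = c" "stime \<pi> j \<omega> < ennreal (arr n \<omega> + s)" "ennreal (arr n \<omega> + s) \<le> stime \<pi> (Suc j) \<omega>"
        using C(2)[OF Om s] L(2)[OF Om s] by (auto simp: not_less split: if_splits)
      have "j = k" by (rule seg_left_unique[OF sp j(2,3) k])
      then show "sphase \<pi> k \<omega> = c" using j by simp
    next
      assume "sphase \<pi> k \<omega> = c"
      then have "(\<omega>, s) \<in> C k c" "(\<omega>, s) \<notin> L (Suc k)" using C(2)[OF Om s] L(2)[OF Om s] k by auto
      then show "(\<omega>, s) \<in> Q c" unfolding Q_def by auto
    qed
    show ?thesis unfolding phL_eq[OF sp k] p_def Q using sphase_range[OF sp, of k] by auto
  qed
  ultimately show ?thesis by blast
qed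

lemma produced_shift:
  assumes sp: "spath i \<pi> \<omega>" and s: "s \<le> gap n \<omega>"
    and p: "\<And>s. 0 < s \<Longrightarrow> s \<le> gap n \<omega> \<Longrightarrow> p (\<omega>, s) = phL \<pi> \<omega> (arr n \<omega> + s)"
    and pm: "p \<in> (hist n \<Otimes>\<^sub>M borel) \<rightarrow>\<^sub>M count_space {0, 1, 2}"
  shows "produced m \<pi> \<omega> (arr n \<omega>) (arr n \<omega> + s) = (\<integral>u. indicator {0..s} u * rate m (p (\<omega>, u)) \<partial>lborel)"
proof -
  have Om: "\<omega> \<in> Om" by (rule path_Om[OF sp])
  have [measurable]: "(\<lambda>u. rate m (phL \<pi> \<omega> u)) \<in> borel_measurable borel" by (rule rate_phL_measurable[OF sp])
  have "(\<lambda>u. (\<omega>, u)) \<in> borel \<rightarrow>\<^sub>M hist n \<Otimes>\<^sub>M borel" using Om by (intro measurable_Pair1') simp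
  from measurable_compose[OF measurable_compose[OF this pm], of "rate m" borel]
  have pm': "(\<lambda>u. rate m (p (\<omega>, u))) \<in> borel_measurable borel" by simp
  have "produced m \<pi> \<omega> (arr n \<omega>) (arr n \<omega> + s) = (\<integral>u. indicator {arr n \<omega>..arr n \<omega> + s} u * rate m (phL \<pi> \<omega> u) \<partial>lborel)"
    using produced_phL[OF sp arr_nonneg[OF Om]] by (simp add: set_lebesgue_integral_def)
  also have "\<dots> = (\<integral>u. indicator {arr n \<omega>..arr n \<omega> + s} (arr n \<omega> + 1 * u) * rate m (phL \<pi> \<omega> (arr n \<omega> + 1 * u)) \<partial>lborel)"
    by (subst lborel_integral_real_affine[where c = 1 and t = "arr n \<omega>"]) simp_all
  also have "\<dots> = (\<integral>u. indicator {0..s} u * rate m (p (\<omega>, u)) \<partial>lborel)"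
  proof (rule integral_cong_AE)
    have "AE u in lborel. u \<noteq> (0::real)" by (rule AE_lborel_singleton)
    then show "AE u in lborel. indicator {arr n \<omega>..arr n \<omega> + s} (arr n \<omega> + 1 * u) * rate m (phL \<pi> \<omega> (arr n \<omega> + 1 * u)) = indicator {0..s} u * rate m (p (\<omega>, u))"
      by eventually_elim (use p s in \<open>auto simp: indicator_def\<close>)
  qed (use pm' in simp_all)
  finally show ?thesis .
qed

text \<open>Induction over the demands: if the level after the \<open>n\<close>-th demand is a
  function of the past, so is the level up to the next one, by integrating the predictable phase;
  subtracting the demand gives the level at stage \<open>Suc n\<close>.\<close>

lemma state_version:
  "\<exists>p y lv. p \<in> (hist n \<Otimes>\<^sub>M borel) \<rightarrow>\<^sub>M count_space {0, 1, 2} \<and> y \<in> borel_measurable (hist n \<Otimes>\<^sub>M borel) \<and>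
    lv \<in> borel_measurable (hist n) \<and>
    (\<forall>\<omega>. spath i \<pi> \<omega> \<longrightarrow> lv \<omega> = level_after m x \<pi> \<omega> n \<and> (\<forall>s. 0 < s \<longrightarrow> s \<le> gap n \<omega> \<longrightarrow>
       p (\<omega>, s) = phL \<pi> \<omega> (arr n \<omega> + s) \<and> y (\<omega>, s) = lev x \<pi> \<omega> n (arr n \<omega> + s)))"
proof -
  have step: "\<exists>p y. p \<in> (hist n \<Otimes>\<^sub>M borel) \<rightarrow>\<^sub>M count_space {0, 1, 2} \<and> y \<in> borel_measurable (hist n \<Otimes>\<^sub>M borel) \<and>
    (\<forall>\<omega>. spath i \<pi> \<omega> \<longrightarrow> (\<forall>s. 0 < s \<longrightarrow> s \<le> gap n \<omega> \<longrightarrow>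
       p (\<omega>, s) = phL \<pi> \<omega> (arr n \<omega> + s) \<and> y (\<omega>, s) = lev x \<pi> \<omega> n (arr n \<omega> + s)))"
    if lv: "lv \<in> borel_measurable (hist n)" "\<And>\<omega>. spath i \<pi> \<omega> \<Longrightarrow> lv \<omega> = level_after m x \<pi> \<omega> n" for n lv
  proof -
    obtain p where p: "p \<in> (hist n \<Otimes>\<^sub>M borel) \<rightarrow>\<^sub>M count_space {0, 1, 2}"
      "\<And>\<omega> s. spath i \<pi> \<omega> \<Longrightarrow> 0 < s \<Longrightarrow> s \<le> gap n \<omega> \<Longrightarrow> p (\<omega>, s) = phL \<pi> \<omega> (arr n \<omega> + s)"
      using phase_version[of n] by blast
    define y where "y z = lv (fst z) + (\<integral>u. indicator {0..snd z} u * rate m (p (fst z, u)) \<partial>lborel)" for z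
    have rp: "(\<lambda>z. rate m (p z)) \<in> borel_measurable (hist n \<Otimes>\<^sub>M borel)"
      by (rule measurable_compose[OF p(1)]) simp
    have "(\<lambda>q. (fst (fst q), snd q)) \<in> ((hist n \<Otimes>\<^sub>M borel) \<Otimes>\<^sub>M borel) \<rightarrow>\<^sub>M hist n \<Otimes>\<^sub>M (borel :: real measure)" by measurable
    from measurable_compose[OF this rp]
    have [measurable]: "(\<lambda>q. rate m (p (fst (fst q), snd q))) \<in> borel_measurable ((hist n \<Otimes>\<^sub>M borel) \<Otimes>\<^sub>M borel)" by simp
    have "(\<lambda>q. if 0 \<le> snd q \<and> (snd q :: real) \<le> snd (fst q) then rate m (p (fst (fst q), snd q)) else 0) \<in> borel_measurable ((hist n \<Otimes>\<^sub>M borel) \<Otimes>\<^sub>M borel)"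
      by measurable
    also have "(\<lambda>q. if 0 \<le> snd q \<and> (snd q :: real) \<le> snd (fst q) then rate m (p (fst (fst q), snd q)) else 0)
      = (\<lambda>q. indicator {0..snd (fst q)} (snd q) * rate m (p (fst (fst q), snd q)))"
      by (auto simp: fun_eq_iff indicator_def)
    finally have "(\<lambda>q. indicator {0..snd (fst q)} (snd q) * rate m (p (fst (fst q), snd q))) \<in> borel_measurable ((hist n \<Otimes>\<^sub>M borel) \<Otimes>\<^sub>M lborel)"
      by (subst measurable_cong_sets[OF sets_pair_measure_cong[OF refl sets_lborel] refl])
    then have "(\<lambda>z. \<integral>u. indicator {0..snd z} u * rate m (p (fst z, u)) \<partial>lborel) \<in> borel_measurable (hist n \<Otimes>\<^sub>M borel)"
      by (intro lborel.borel_measurable_lebesgue_integral) (simp add: split_beta')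
    moreover have "(\<lambda>z. lv (fst z)) \<in> borel_measurable (hist n \<Otimes>\<^sub>M (borel :: real measure))"
      by (rule measurable_compose[OF measurable_fst lv(1)])
    ultimately have "y \<in> borel_measurable (hist n \<Otimes>\<^sub>M borel)" unfolding y_def[abs_def] by (rule borel_measurable_add[rotated])
    moreover have "y (\<omega>, s) = lev x \<pi> \<omega> n (arr n \<omega> + s)" if "spath i \<pi> \<omega>" "0 < s" "s \<le> gap n \<omega>" for \<omega> s
      using produced_shift[OF that(1,3) p(2)[OF that(1)] p(1)] lv(2)[OF that(1)] unfolding y_def lev_def by simp
    ultimately show ?thesis using p by blast
  qed
  have "\<exists>lv. lv \<in> borel_measurable (hist n) \<and> (\<forall>\<omega>. spath i \<pi> \<omega> \<longrightarrow> lv \<omega> = level_after m x \<pi> \<omega> n)"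
  proof (induction n)
    case 0
    then show ?case by (intro exI[of _ "\<lambda>_. x"]) simp
  next
    case (Suc n)
    then obtain lv where lv: "lv \<in> borel_measurable (hist n)" "\<And>\<omega>. spath i \<pi> \<omega> \<Longrightarrow> lv \<omega> = level_after m x \<pi> \<omega> n" by blast
    from step[OF this] obtain y where y: "y \<in> borel_measurable (hist n \<Otimes>\<^sub>M borel)"
      "\<And>\<omega> s. spath i \<pi> \<omega> \<Longrightarrow> 0 < s \<Longrightarrow> s \<le> gap n \<omega> \<Longrightarrow> y (\<omega>, s) = lev x \<pi> \<omega> n (arr n \<omega> + s)" by blast
    have "(\<lambda>\<omega>. \<omega>) \<in> hist (Suc n) \<rightarrow>\<^sub>M hist n" by (rule measurable_hist_mono[OF measurable_ident_sets[OF refl]]) simp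
    then have "(\<lambda>\<omega>. (\<omega>, gap n \<omega>)) \<in> hist (Suc n) \<rightarrow>\<^sub>M hist n \<Otimes>\<^sub>M borel" by (intro measurable_Pair gap_hist) auto
    from measurable_compose[OF this y(1)] have [measurable]: "(\<lambda>\<omega>. y (\<omega>, gap n \<omega>)) \<in> borel_measurable (hist (Suc n))" .
    have [measurable]: "demand m (Suc n) \<in> borel_measurable (hist (Suc n))" by (rule demand_hist) simp
    have "(\<lambda>\<omega>. max lo (y (\<omega>, gap n \<omega>) - demand m (Suc n) \<omega>)) \<in> borel_measurable (hist (Suc n))" by measurable
    moreover have "max lo (y (\<omega>, gap n \<omega>) - demand m (Suc n) \<omega>) = level_after m x \<pi> \<omega> (Suc n)" if sp: "spath i \<pi> \<omega>" for \<omega>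
      using y(2)[OF sp gap_pos[OF path_Om[OF sp]] order.refl] unfolding level_after_Suc by (simp add: arr_Suc)
    ultimately show ?case by blast
  qed
  then obtain lv where "lv \<in> borel_measurable (hist n)" "\<And>\<omega>. spath i \<pi> \<omega> \<Longrightarrow> lv \<omega> = level_after m x \<pi> \<omega> n" by blast
  with step[OF this] show ?thesis by blast
qed

lemma AE_spath: "AE \<omega> in sample m. spath i \<pi> \<omega>"
  using AE_good[OF adm] by eventually_elim (simp add: good_def)

text \<open>The point of the statement is that the same \<open>F\<close> represents the value at the
  end of the stage and, integrated over the elapsed time, the quantity collected during the stage.
  This is the form in which \<open>compensator\<close> applies.\<close>

lemma occ_fin_version:
  assumes f: "\<And>c. c \<in> {0, 1, 2} \<Longrightarrow> f c \<in> borel_measurable borel"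
  shows "\<exists>F\<in>borel_measurable (hist n \<Otimes>\<^sub>M borel). \<forall>\<omega>. spath i \<pi> \<omega> \<longrightarrow> fin \<pi> x f n \<omega> = F (\<omega>, gap n \<omega>) \<and>
      occ \<pi> x f n \<omega> = (\<integral>\<^sup>+s. F (\<omega>, s) * indicator {0..gap n \<omega>} s \<partial>lborel)"
proof -
  obtain p y lv where v: "p \<in> (hist n \<Otimes>\<^sub>M borel) \<rightarrow>\<^sub>M count_space {0, 1, 2}" "y \<in> borel_measurable (hist n \<Otimes>\<^sub>M borel)"
    "\<And>\<omega> s. spath i \<pi> \<omega> \<Longrightarrow> 0 < s \<Longrightarrow> s \<le> gap n \<omega> \<Longrightarrow> p (\<omega>, s) = phL \<pi> \<omega> (arr n \<omega> + s) \<and> y (\<omega>, s) = lev x \<pi> \<omega> n (arr n \<omega> + s)"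
    using state_version[of n] by blast
  define F where "F z = ennreal (exp (- disc m * (arr n (fst z) + snd z)) * f (p z) (y z))" for z
  have [measurable]: "arr n \<in> borel_measurable (hist n)" by (rule arr_hist) simp
  have [measurable]: "(\<lambda>z. f (p z) (y z)) \<in> borel_measurable (hist n \<Otimes>\<^sub>M borel)"
    by (rule compose_phase_measurable[OF v(1) f v(2)])
  have F: "F \<in> borel_measurable (hist n \<Otimes>\<^sub>M borel)" unfolding F_def by measurable
  moreover have "fin \<pi> x f n \<omega> = F (\<omega>, gap n \<omega>)" if sp: "spath i \<pi> \<omega>" for \<omega>
    using v(3)[OF sp gap_pos[OF path_Om[OF sp]] order.refl] unfolding fin_def F_def level_before_lev by (simp add: arr_Suc)
  moreover have "occ \<pi> x f n \<omega> = (\<integral>\<^sup>+s. F (\<omega>, s) * indicator {0..gap n \<omega>} s \<partial>lborel)" if sp: "spath i \<pi> \<omega>" for \<omega>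
  proof -
    have "(\<lambda>u. ennreal (exp (- disc m * u) * f (phL \<pi> \<omega> u) (lev x \<pi> \<omega> n u)) * indicator {arr n \<omega><..arr (Suc n) \<omega>} u) \<in> borel_measurable borel"
      by (rule borel_measurable_times_ennreal[OF phL_lev_measurable[OF sp f]]) simp_all
    note affine = nn_integral_real_affine[OF this, of 1 "arr n \<omega>"]
    have "occ \<pi> x f n \<omega> = (\<integral>\<^sup>+s. ennreal (exp (- disc m * (arr n \<omega> + 1 * s)) * f (phL \<pi> \<omega> (arr n \<omega> + 1 * s)) (lev x \<pi> \<omega> n (arr n \<omega> + 1 * s)))
        * indicator {arr n \<omega><..arr (Suc n) \<omega>} (arr n \<omega> + 1 * s) \<partial>lborel)"
      unfolding occ_def using affine by simp
    also have "\<dots> = (\<integral>\<^sup>+s. F (\<omega>, s) * indicator {0..gap n \<omega>} s \<partial>lborel)"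
    proof (rule nn_integral_cong_AE)
      have "AE s in lborel. s \<noteq> (0::real)" by (rule AE_lborel_singleton)
      then show "AE s in lborel. ennreal (exp (- disc m * (arr n \<omega> + 1 * s)) * f (phL \<pi> \<omega> (arr n \<omega> + 1 * s)) (lev x \<pi> \<omega> n (arr n \<omega> + 1 * s)))
        * indicator {arr n \<omega><..arr (Suc n) \<omega>} (arr n \<omega> + 1 * s) = F (\<omega>, s) * indicator {0..gap n \<omega>} s"
      proof eventually_elim
        case (elim s)
        then show ?case using v(3)[OF sp, of s] unfolding F_def by (auto simp: indicator_def arr_Suc)
      qed
    qed
    finally show ?thesis .
  qed
  ultimately show ?thesis by blast
qed

text \<open>As strategies behave well only almost surely, their costs need not be measurable but are so up to a
  null set.\<close>

definition aem :: "('a \<Rightarrow> ennreal) \<Rightarrow> bool" where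
  "aem X \<longleftrightarrow> (\<exists>X'\<in>borel_measurable (sample m). AE \<omega> in sample m. X \<omega> = X' \<omega>)"

lemma aemI: "X' \<in> borel_measurable (sample m) \<Longrightarrow> (\<And>\<omega>. spath i \<pi> \<omega> \<Longrightarrow> X \<omega> = X' \<omega>) \<Longrightarrow> aem X"
  unfolding aem_def using AE_spath by (intro bexI[of _ X']) (auto elim: eventually_mono)

lemma aem_measurable: "X \<in> borel_measurable (sample m) \<Longrightarrow> aem X"
  unfolding aem_def by blast

lemma aem_add: "aem X \<Longrightarrow> aem Y \<Longrightarrow> aem (\<lambda>\<omega>. X \<omega> + Y \<omega>)"
  unfolding aem_def
proof (elim bexE)
  fix X' Y' assume "X' \<in> borel_measurable (sample m)" "Y' \<in> borel_measurable (sample m)"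
    "AE \<omega> in sample m. X \<omega> = X' \<omega>" "AE \<omega> in sample m. Y \<omega> = Y' \<omega>"
  then show "\<exists>Z\<in>borel_measurable (sample m). AE \<omega> in sample m. X \<omega> + Y \<omega> = Z \<omega>"
    by (intro bexI[of _ "\<lambda>\<omega>. X' \<omega> + Y' \<omega>"]) auto
qed

lemma nn_add: "aem X \<Longrightarrow> aem Y \<Longrightarrow> (\<integral>\<^sup>+\<omega>. X \<omega> + Y \<omega> \<partial>sample m) = (\<integral>\<^sup>+\<omega>. X \<omega> \<partial>sample m) + (\<integral>\<^sup>+\<omega>. Y \<omega> \<partial>sample m)"
  unfolding aem_def
proof (elim bexE)
  fix X' Y' assume m: "X' \<in> borel_measurable (sample m)" "Y' \<in> borel_measurable (sample m)"
    and e: "AE \<omega> in sample m. X \<omega> = X' \<omega>" "AE \<omega> in sample m. Y \<omega> = Y' \<omega>"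
  have "(\<integral>\<^sup>+\<omega>. X \<omega> + Y \<omega> \<partial>sample m) = (\<integral>\<^sup>+\<omega>. X' \<omega> + Y' \<omega> \<partial>sample m)" using e by (intro nn_integral_cong_AE) auto
  also have "\<dots> = (\<integral>\<^sup>+\<omega>. X' \<omega> \<partial>sample m) + (\<integral>\<^sup>+\<omega>. Y' \<omega> \<partial>sample m)" by (rule nn_integral_add[OF m])
  finally show ?thesis using nn_integral_cong_AE[OF e(1)] nn_integral_cong_AE[OF e(2)] by simp
qed

lemma nn_cmult: "aem X \<Longrightarrow> (\<integral>\<^sup>+\<omega>. c * X \<omega> \<partial>sample m) = c * (\<integral>\<^sup>+\<omega>. X \<omega> \<partial>sample m)"
  unfolding aem_def
proof (elim bexE)
  fix X' assume m: "X' \<in> borel_measurable (sample m)" and e: "AE \<omega> in sample m. X \<omega> = X' \<omega>"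
  have "(\<integral>\<^sup>+\<omega>. c * X \<omega> \<partial>sample m) = (\<integral>\<^sup>+\<omega>. c * X' \<omega> \<partial>sample m)" using e by (intro nn_integral_cong_AE) auto
  then show ?thesis using nn_integral_cong_AE[OF e] nn_integral_cmult[OF m] by simp
qed

lemma nn_suminf: "(\<And>n. aem (X n)) \<Longrightarrow> (\<integral>\<^sup>+\<omega>. (\<Sum>n. X n \<omega>) \<partial>sample m) = (\<Sum>n. \<integral>\<^sup>+\<omega>. X n \<omega> \<partial>sample m)"
proof -
  assume "\<And>n. aem (X n)"
  then obtain X' where X': "\<And>n. X' n \<in> borel_measurable (sample m)" "\<And>n. AE \<omega> in sample m. X n \<omega> = X' n \<omega>"
    unfolding aem_def by metis
  have "AE \<omega> in sample m. \<forall>n. X n \<omega> = X' n \<omega>" unfolding AE_all_countable using X'(2) by (rule allI)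
  then have "AE \<omega> in sample m. (\<Sum>n. X n \<omega>) = (\<Sum>n. X' n \<omega>)"
    by eventually_elim (rule suminf_cong, rule spec)
  then have "(\<integral>\<^sup>+\<omega>. (\<Sum>n. X n \<omega>) \<partial>sample m) = (\<integral>\<^sup>+\<omega>. (\<Sum>n. X' n \<omega>) \<partial>sample m)"
    by (rule nn_integral_cong_AE)
  also have "\<dots> = (\<Sum>n. \<integral>\<^sup>+\<omega>. X' n \<omega> \<partial>sample m)" by (rule nn_integral_suminf[OF X'(1)])
  finally show ?thesis by (simp only: nn_integral_cong_AE[OF X'(2)])
qed

context
  fixes f :: "nat \<Rightarrow> real \<Rightarrow> real"
  assumes f: "\<And>c. c \<in> {0, 1, 2} \<Longrightarrow> f c \<in> borel_measurable borel"
begin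

lemma fin_occ_version: "\<exists>F\<in>borel_measurable (hist n \<Otimes>\<^sub>M borel). \<forall>\<omega>. spath i \<pi> \<omega> \<longrightarrow> fin \<pi> x f n \<omega> = F (\<omega>, gap n \<omega>) \<and>
      occ \<pi> x f n \<omega> = (\<integral>\<^sup>+s. F (\<omega>, s) * indicator {0..gap n \<omega>} s \<partial>lborel)"
  by (rule occ_fin_version) (rule f)

text \<open>The compensator formula for a strategy, available because the state before the demand is
  predictable.\<close>

lemma fin_occ: "(\<integral>\<^sup>+\<omega>. fin \<pi> x f n \<omega> \<partial>sample m) = ennreal (intensity m) * (\<integral>\<^sup>+\<omega>. occ \<pi> x f n \<omega> \<partial>sample m)"
proof -
  obtain F where F: "F \<in> borel_measurable (hist n \<Otimes>\<^sub>M borel)" "\<And>\<omega>. spath i \<pi> \<omega> \<Longrightarrow> fin \<pi> x f n \<omega> = F (\<omega>, gap n \<omega>)"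
    "\<And>\<omega>. spath i \<pi> \<omega> \<Longrightarrow> occ \<pi> x f n \<omega> = (\<integral>\<^sup>+s. F (\<omega>, s) * indicator {0..gap n \<omega>} s \<partial>lborel)"
    using fin_occ_version[of n] by blast
  have "(\<integral>\<^sup>+\<omega>. fin \<pi> x f n \<omega> \<partial>sample m) = (\<integral>\<^sup>+\<omega>. F (\<omega>, gap n \<omega>) \<partial>sample m)"
    using AE_spath by (intro nn_integral_cong_AE) (auto elim!: eventually_mono simp: F)
  also have "\<dots> = ennreal (intensity m) * (\<integral>\<^sup>+\<omega>. (\<integral>\<^sup>+s. F (\<omega>, s) * indicator {0..gap n \<omega>} s \<partial>lborel) \<partial>sample m)"
    by (rule compensator[OF F(1)])
  also have "(\<integral>\<^sup>+\<omega>. (\<integral>\<^sup>+s. F (\<omega>, s) * indicator {0..gap n \<omega>} s \<partial>lborel) \<partial>sample m) = (\<integral>\<^sup>+\<omega>. occ \<pi> x f n \<omega> \<partial>sample m)"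
    using AE_spath by (intro nn_integral_cong_AE) (auto elim!: eventually_mono simp: F)
  finally show ?thesis .
qed

lemma gap_pair: "(\<lambda>\<omega>. (\<omega>, gap n \<omega>)) \<in> sample m \<rightarrow>\<^sub>M hist n \<Otimes>\<^sub>M borel"
  by (intro measurable_Pair id_hist) simp

lemma aem_fin: "aem (fin \<pi> x f n)" and aem_occ: "aem (occ \<pi> x f n)"
proof -
  obtain F where F: "F \<in> borel_measurable (hist n \<Otimes>\<^sub>M borel)" "\<And>\<omega>. spath i \<pi> \<omega> \<Longrightarrow> fin \<pi> x f n \<omega> = F (\<omega>, gap n \<omega>)"
    "\<And>\<omega>. spath i \<pi> \<omega> \<Longrightarrow> occ \<pi> x f n \<omega> = (\<integral>\<^sup>+s. F (\<omega>, s) * indicator {0..gap n \<omega>} s \<partial>lborel)"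
    using fin_occ_version[of n] by blast
  show "aem (fin \<pi> x f n)" by (rule aemI[OF measurable_compose[OF gap_pair F(1)]]) (simp add: F)
  show "aem (occ \<pi> x f n)" by (rule aemI[OF measurable_compose[OF gap_pair elapsed_measurable[OF F(1)]]]) (simp add: F)
qed

end

text \<open>The size of the next demand is independent of the past and of the waiting time, so it
  can be averaged out, which replaces \<open>g\<close> by its mean \<open>h\<close>. The factor
  \<open>e\<close> in the assumption stands for the discount.\<close>

lemma dem_fin:
  assumes g: "\<And>c. c \<in> {0, 1, 2} \<Longrightarrow> case_prod (g c) \<in> borel_measurable (borel \<Otimes>\<^sub>M borel)"
    and h: "\<And>c. c \<in> {0, 1, 2} \<Longrightarrow> h c \<in> borel_measurable borel"
    and gh: "\<And>c z e. c \<in> {0, 1, 2} \<Longrightarrow> z \<in> {lo..hi} \<Longrightarrow> 0 < e \<Longrightarrow> (\<integral>\<^sup>+\<alpha>. ennreal (e * g c z \<alpha>) \<partial>dlaw) = ennreal (e * h c z)"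
    and x: "x \<in> {lo..hi}"
  shows "(\<integral>\<^sup>+\<omega>. dem \<pi> x g n \<omega> \<partial>sample m) = (\<integral>\<^sup>+\<omega>. fin \<pi> x h n \<omega> \<partial>sample m)" "aem (dem \<pi> x g n)"
proof -
  obtain p y lv where v: "p \<in> (hist n \<Otimes>\<^sub>M borel) \<rightarrow>\<^sub>M count_space {0, 1, 2}" "y \<in> borel_measurable (hist n \<Otimes>\<^sub>M borel)"
    "\<And>\<omega> s. spath i \<pi> \<omega> \<Longrightarrow> 0 < s \<Longrightarrow> s \<le> gap n \<omega> \<Longrightarrow> p (\<omega>, s) = phL \<pi> \<omega> (arr n \<omega> + s) \<and> y (\<omega>, s) = lev x \<pi> \<omega> n (arr n \<omega> + s)"
    using state_version[of n] by blast
  have [measurable]: "arr n \<in> borel_measurable (hist n)" by (rule arr_hist) simp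
  define G where "G z = ennreal (exp (- disc m * (arr n (fst z) + fst (snd z))) * g (p (fst z, fst (snd z))) (y (fst z, fst (snd z))) (snd (snd z)))" for z
  have pr: "(\<lambda>z. (fst z, fst (snd z))) \<in> hist n \<Otimes>\<^sub>M (borel \<Otimes>\<^sub>M borel) \<rightarrow>\<^sub>M hist n \<Otimes>\<^sub>M (borel :: real measure)" by measurable
  have "(\<lambda>z. g (p (fst z, fst (snd z))) (y (fst z, fst (snd z))) (snd (snd z))) \<in> borel_measurable (hist n \<Otimes>\<^sub>M (borel \<Otimes>\<^sub>M borel))"
  proof (rule measurable_compose_countable'[OF _ measurable_compose[OF pr v(1)]])
    fix c :: nat assume c: "c \<in> {0, 1, 2}"
    have "(\<lambda>z. (y (fst z, fst (snd z)), snd (snd z))) \<in> hist n \<Otimes>\<^sub>M (borel \<Otimes>\<^sub>M borel) \<rightarrow>\<^sub>M borel \<Otimes>\<^sub>M borel"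
      by (intro measurable_Pair measurable_compose[OF pr v(2)]) simp
    from measurable_compose[OF this g[OF c]]
    show "(\<lambda>z. g c (y (fst z, fst (snd z))) (snd (snd z))) \<in> borel_measurable (hist n \<Otimes>\<^sub>M (borel \<Otimes>\<^sub>M borel))" by simp
  qed simp
  then have G: "G \<in> borel_measurable (hist n \<Otimes>\<^sub>M (borel \<Otimes>\<^sub>M borel))" unfolding G_def by measurable
  define K where "K z = (\<integral>\<^sup>+\<alpha>. G (fst z, snd z, \<alpha>) \<partial>dlaw)" for z
  have K: "K \<in> borel_measurable (hist n \<Otimes>\<^sub>M borel)"
  proof -
    have "(\<lambda>q. (fst (fst q), snd (fst q), snd q)) \<in> (hist n \<Otimes>\<^sub>M (borel :: real measure)) \<Otimes>\<^sub>M dlaw \<rightarrow>\<^sub>M hist n \<Otimes>\<^sub>M (borel \<Otimes>\<^sub>M borel)"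
      by measurable
    from law.borel_measurable_nn_integral_fst[OF measurable_compose[OF this G]] show ?thesis unfolding K_def by simp
  qed
  have d: "dem \<pi> x g n \<omega> = G (\<omega>, gap n \<omega>, demand m (Suc n) \<omega>)" if sp: "spath i \<pi> \<omega>" for \<omega>
    using v(3)[OF sp gap_pos[OF path_Om[OF sp]] order.refl] unfolding dem_def G_def level_before_lev by (simp add: arr_Suc)
  have f: "fin \<pi> x h n \<omega> = K (\<omega>, gap n \<omega>)" if gd: "good i x \<pi> \<omega>" for \<omega>
  proof -
    have sp: "spath i \<pi> \<omega>" using gd by (simp add: good_def)
    have "lev x \<pi> \<omega> n (arr n \<omega> + gap n \<omega>) \<in> {lo..hi}"
      using arr_less[OF path_Om[OF sp], of n "Suc n"] lev_bounds[OF gd x, of n "arr (Suc n) \<omega>"] by (simp add: arr_Suc)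
    then show ?thesis
      using v(3)[OF sp gap_pos[OF path_Om[OF sp]] order.refl] gh[OF phL_range[OF sp]]
      unfolding fin_def K_def G_def level_before_lev by (simp add: arr_Suc)
  qed
  have m: "(\<lambda>\<omega>. (\<omega>, gap n \<omega>, demand m (Suc n) \<omega>)) \<in> sample m \<rightarrow>\<^sub>M hist n \<Otimes>\<^sub>M (borel \<Otimes>\<^sub>M borel)"
    by (intro measurable_Pair id_hist) simp_all
  show "aem (dem \<pi> x g n)" by (rule aemI[OF measurable_compose[OF m G]]) (simp add: d)
  have "(\<integral>\<^sup>+\<omega>. dem \<pi> x g n \<omega> \<partial>sample m) = (\<integral>\<^sup>+\<omega>. G (\<omega>, gap n \<omega>, demand m (Suc n) \<omega>) \<partial>sample m)"
    using AE_spath by (intro nn_integral_cong_AE) (auto elim!: eventually_mono simp: d)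
  also have "\<dots> = (\<integral>\<^sup>+\<omega>. (\<integral>\<^sup>+s. K (\<omega>, s) \<partial>expd) \<partial>sample m)" unfolding nn_integral_hist[OF G] K_def by simp
  also have "\<dots> = (\<integral>\<^sup>+\<omega>. K (\<omega>, gap n \<omega>) \<partial>sample m)" by (rule nn_integral_hist_gap[OF K, symmetric])
  also have "\<dots> = (\<integral>\<^sup>+\<omega>. fin \<pi> x h n \<omega> \<partial>sample m)"
    using AE_good[OF adm] by (intro nn_integral_cong_AE) (auto elim!: eventually_mono simp: f)
  finally show "(\<integral>\<^sup>+\<omega>. dem \<pi> x g n \<omega> \<partial>sample m) = (\<integral>\<^sup>+\<omega>. fin \<pi> x h n \<omega> \<partial>sample m)" .
qed

end

end

section \<open>Decomposition of the cost into stages\<close>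

lemma suminf_ennreal_swap:
  fixes f :: "nat \<Rightarrow> nat \<Rightarrow> ennreal"
  shows "(\<Sum>k. \<Sum>n. f k n) = (\<Sum>n. \<Sum>k. f k n)"
proof -
  have "(\<Sum>k. \<Sum>n. f k n) = (\<integral>\<^sup>+k. (\<Sum>n. f k n) \<partial>count_space UNIV)" by (simp add: nn_integral_count_space_nat)
  also have "\<dots> = (\<Sum>n. \<integral>\<^sup>+k. f k n \<partial>count_space UNIV)" by (rule nn_integral_suminf) simp
  finally show ?thesis by (simp add: nn_integral_count_space_nat)
qed

context production_inventory
begin

text \<open>The mean discount over one interarrival time, that is, the Laplace transform of the
  exponential law at \<open>disc m\<close>. It turns remainders and losses into geometric
  series.\<close>

definition ratio :: real where
  "ratio = intensity m / tot"

lemma ratio: "0 \<le> ratio" "ratio < 1"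
  unfolding ratio_def using intensity_pos disc_pos by auto

lemma expd_laplace: "(\<integral>\<^sup>+s. ennreal (exp (- disc m * s)) \<partial>expd) = ennreal ratio"
proof -
  interpret e: prob_space "density lborel (\<lambda>s. ennreal (exponential_density tot s))"
    by (rule prob_space_exponential_density[OF tot_pos])
  have "(\<integral>\<^sup>+s. ennreal (exp (- disc m * s)) \<partial>expd)
    = (\<integral>\<^sup>+s. ennreal (exponential_density (intensity m) s) * ennreal (exp (- disc m * s)) \<partial>lborel)"
    unfolding expd_def by (rule nn_integral_density) auto
  also have "\<dots> = (\<integral>\<^sup>+s. ennreal ratio * ennreal (exponential_density tot s) \<partial>lborel)"
  proof (rule nn_integral_cong)
    fix s :: real
    have "ratio * tot = intensity m" unfolding ratio_def using tot_pos by simp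
    then have "intensity m * exp (- s * intensity m) * exp (- disc m * s) = (ratio * tot) * (exp (- s * intensity m) * exp (- disc m * s))"
      by simp
    also have "exp (- s * intensity m) * exp (- disc m * s) = exp (- s * tot)"
      unfolding exp_add[symmetric] by (simp add: distrib_left mult.commute)
    finally have e: "intensity m * exp (- s * intensity m) * exp (- disc m * s) = ratio * tot * exp (- s * tot)" .
    show "ennreal (exponential_density (intensity m) s) * ennreal (exp (- disc m * s)) = ennreal ratio * ennreal (exponential_density tot s)"
    proof (cases "s < 0")
      case False
      have "ennreal (exponential_density (intensity m) s) * ennreal (exp (- disc m * s)) = ennreal (ratio * tot * exp (- s * tot))"
        unfolding e[symmetric] using False intensity_pos by (subst ennreal_mult) (auto simp: exponential_density_def)
      also have "\<dots> = ennreal ratio * ennreal (exponential_density tot s)"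
        unfolding mult.assoc using False ratio tot_pos by (subst ennreal_mult) (auto simp: exponential_density_def)
      finally show ?thesis .
    qed (simp add: exponential_density_def)
  qed
  also have "\<dots> = ennreal ratio * (\<integral>\<^sup>+s. ennreal (exponential_density tot s) \<partial>lborel)"
    by (rule nn_integral_cmult) simp
  also have "(\<integral>\<^sup>+s. ennreal (exponential_density tot s) \<partial>lborel) = 1"
    using e.emeasure_space_1 by (simp add: emeasure_density)
  finally show ?thesis by simp
qed

lemma arr_laplace: "(\<integral>\<^sup>+\<omega>. ennreal (exp (- disc m * arr n \<omega>)) \<partial>sample m) = ennreal (ratio ^ n)"
proof (induction n)
  case 0
  have "(\<integral>\<^sup>+\<omega>. ennreal (exp (- disc m * arr 0 \<omega>)) \<partial>sample m) = (\<integral>\<^sup>+\<omega>. 1 \<partial>sample m)"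
    by (intro nn_integral_cong) (simp add: arr_0)
  then show ?case using P.emeasure_space_1 by simp
next
  case (Suc n)
  have [measurable]: "arr n \<in> borel_measurable (hist n)" by (rule arr_hist) simp
  have "(\<lambda>p. ennreal (exp (- disc m * (arr n (fst p) + snd p)))) \<in> borel_measurable (hist n \<Otimes>\<^sub>M borel)" by measurable
  from nn_integral_hist_gap[OF this]
  have "(\<integral>\<^sup>+\<omega>. ennreal (exp (- disc m * arr (Suc n) \<omega>)) \<partial>sample m)
    = (\<integral>\<^sup>+\<omega>. (\<integral>\<^sup>+s. ennreal (exp (- disc m * (arr n \<omega> + s))) \<partial>expd) \<partial>sample m)"
    by (simp add: arr_Suc)
  also have "\<dots> = (\<integral>\<^sup>+\<omega>. ennreal ratio * ennreal (exp (- disc m * arr n \<omega>)) \<partial>sample m)"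
  proof (rule nn_integral_cong)
    fix \<omega>
    have "ennreal (exp (- disc m * (arr n \<omega> + s))) = ennreal (exp (- disc m * arr n \<omega>)) * ennreal (exp (- disc m * s))" for s
      by (simp add: ennreal_mult'[symmetric] exp_add[symmetric] algebra_simps)
    then show "(\<integral>\<^sup>+s. ennreal (exp (- disc m * (arr n \<omega> + s))) \<partial>expd) = ennreal ratio * ennreal (exp (- disc m * arr n \<omega>))"
      using nn_integral_cmult[of "\<lambda>s. ennreal (exp (- disc m * s))" expd "ennreal (exp (- disc m * arr n \<omega>))"] expd_laplace
      by (simp add: mult.commute)
  qed
  also have "\<dots> = ennreal ratio * ennreal (ratio ^ n)"
    using Suc by (subst nn_integral_cmult) simp_all
  finally show ?case using ratio by (simp add: ennreal_mult'[symmetric])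
qed

lemma discount_measurable [measurable]: "discount m \<in> borel_measurable borel"
  unfolding discount_def[abs_def] by measurable

abbreviation short :: "'a strategy \<Rightarrow> real \<Rightarrow> nat \<Rightarrow> 'a \<Rightarrow> ennreal" where
  "short \<pi> x \<equiv> dem \<pi> x (\<lambda>c. shortage)"

abbreviation resume :: "'a strategy \<Rightarrow> real \<Rightarrow> nat \<Rightarrow> 'a \<Rightarrow> ennreal" where
  "resume \<pi> x \<equiv> dem \<pi> x (\<lambda>c y \<alpha>. wt val c (max lo (y - \<alpha>)))"

abbreviation lamval :: "nat \<Rightarrow> real \<Rightarrow> real" where
  "lamval \<equiv> \<lambda>c y. intensity m * vv c y"

lemma lamval_measurable: "c \<in> {0, 1, 2} \<Longrightarrow> lamval c \<in> borel_measurable borel"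
  by (intro borel_measurable_times vv_measurable borel_measurable_const)

lemma short_eq: "ennreal (exp (- disc m * arrival m (Suc n) \<omega>)
          * (if level_before m x \<pi> \<omega> n - low m < demand m (Suc n) \<omega>
             then penalty m (demand m (Suc n) \<omega> - level_before m x \<pi> \<omega> n + low m)
             else 0)) = short \<pi> x n \<omega>"
  unfolding dem_def shortage_def pen_def by (auto simp: max_def)

lemma phL_lev_lborel:
  fixes h :: "nat \<Rightarrow> real \<Rightarrow> real"
  assumes "spath i \<pi> \<omega>" "\<And>c. c \<in> {0, 1, 2} \<Longrightarrow> h c \<in> borel_measurable borel"
  shows "(\<lambda>u. ennreal (exp (- disc m * u) * h (phL \<pi> \<omega> u) (lev x \<pi> \<omega> n u)) * indicator {a<..b} u) \<in> borel_measurable lborel"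
  by (rule borel_measurable_times_ennreal, simp only: measurable_lborel2, rule phL_lev_measurable[OF assms(1)], erule assms(2), simp)

text \<open>Time is cut at the demands. Almost every instant lies in the interior of exactly one
  stage, and there the left-continuous phase and \<open>lev\<close> may replace
  \<open>phase_at\<close> and \<open>level\<close>.\<close>

lemma hold_eq:
  assumes g: "good i x \<pi> \<omega>" and x: "x \<in> {lo..hi}"
  shows "(\<integral>\<^sup>+t\<in>{0..}. ennreal (exp (- disc m * t) * hold m (phase_at \<pi> \<omega> t) (level m x \<pi> \<omega> t)) \<partial>lborel) = (\<Sum>n. occ \<pi> x run n \<omega>)"
proof -
  have sp: "spath i \<pi> \<omega>" using g by (simp add: good_def)
  have Om: "\<omega> \<in> Om" by (rule path_Om[OF sp])
  let ?f = "\<lambda>n t. ennreal (exp (- disc m * t) * run (phL \<pi> \<omega> t) (lev x \<pi> \<omega> n t)) * indicator {arr n \<omega><..arr (Suc n) \<omega>} t"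
  have ae: "AE t in lborel. t \<notin> range (\<lambda>n. arr n \<omega>)"
    by (rule AE_not_in) (intro countable_imp_null_set_lborel; simp)
  have "(\<integral>\<^sup>+t\<in>{0..}. ennreal (exp (- disc m * t) * hold m (phase_at \<pi> \<omega> t) (level m x \<pi> \<omega> t)) \<partial>lborel)
      = (\<integral>\<^sup>+t. (\<Sum>n. ?f n t) \<partial>lborel)"
  proof (rule nn_integral_cong_AE)
    show "AE t in lborel. ennreal (exp (- disc m * t) * hold m (phase_at \<pi> \<omega> t) (level m x \<pi> \<omega> t)) * indicator {0..} t = (\<Sum>n. ?f n t)"
      using ae AE_phL[OF sp]
    proof eventually_elim
      case (elim t)
      show ?case
      proof (cases "0 \<le> t")
        case False
        have "?f n t = 0" for n
          using False arr_nonneg[OF Om, of n] by (auto simp: indicator_def)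
        then have "(\<Sum>n. ?f n t) = (\<Sum>n. 0)" by (rule suminf_cong)
        then show ?thesis using False by simp
      next
        case True
        obtain n where n: "arr n \<omega> \<le> t" "t < arr (Suc n) \<omega>" using arr_interval[OF Om True] by blast
        then have nt: "arr n \<omega> < t" using elim(1) by (cases "arr n \<omega> = t") auto
        have "?f k t = 0" if "k \<noteq> n" for k
        proof (cases "k < n")
          case True
          then have "arr (Suc k) \<omega> \<le> arr n \<omega>" by (intro arr_le[OF Om]) simp
          then show ?thesis using nt by (simp add: indicator_def)
        next
          case False
          then have "arr (Suc n) \<omega> \<le> arr k \<omega>" using that by (intro arr_le[OF Om]) simp
          then show ?thesis using n by (simp add: indicator_def)
        qed
        then have "(\<Sum>k. ?f k t) = (\<Sum>k\<in>{n}. ?f k t)" by (intro suminf_finite) auto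
        also have "\<dots> = ennreal (exp (- disc m * t) * run (phL \<pi> \<omega> t) (lev x \<pi> \<omega> n t))" using nt n by simp
        also have "run (phL \<pi> \<omega> t) (lev x \<pi> \<omega> n t) = hold m (phase_at \<pi> \<omega> t) (level m x \<pi> \<omega> t)"
          using lev_phase[OF g x n] elim(2) True level_lev[OF Om n, of x \<pi>] lev_bounds[OF g x n(1) less_imp_le[OF n(2)]]
          by (auto simp: run_def)
        finally show ?thesis using True by simp
      qed
    qed
  qed
  also have "\<dots> = (\<Sum>n. occ \<pi> x run n \<omega>)"
    unfolding occ_def
    by (rule nn_integral_suminf, rule phL_lev_lborel[OF sp], rule run_measurable)
  finally show ?thesis .
qed

text \<open>Every finite switching time is 0, or lies strictly between two consecutive demands, or
  is a later demand time. Switches at infinity have discount 0.\<close>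

lemma switch_eq:
  assumes sp: "spath i \<pi> \<omega>"
  shows "(\<Sum>k. sterm \<pi> \<omega> k) = swa \<pi> 0 \<omega> + (\<Sum>n. swi \<pi> n \<omega> + swa \<pi> (Suc n) \<omega>)"
proof -
  have Om: "\<omega> \<in> Om" by (rule path_Om[OF sp])
  let ?a = "\<lambda>n k. sterm \<pi> \<omega> k * indicator {k. stime \<pi> (Suc k) \<omega> = ennreal (arr n \<omega>)} k"
  let ?i = "\<lambda>n k. sterm \<pi> \<omega> k * indicator {k. ennreal (arr n \<omega>) < stime \<pi> (Suc k) \<omega> \<and> stime \<pi> (Suc k) \<omega> < ennreal (arr (Suc n) \<omega>)} k"
  have k: "sterm \<pi> \<omega> k = ?a 0 k + (\<Sum>n. ?i n k + ?a (Suc n) k)" for k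
  proof (cases "stime \<pi> (Suc k) \<omega>")
    case top
    then have "sterm \<pi> \<omega> k = 0" unfolding sterm_def discount_def by simp
    then show ?thesis by simp
  next
    case (real t)
    have lt: "ennreal a < ennreal t \<longleftrightarrow> a < t" "ennreal t < ennreal a \<longleftrightarrow> t < a" "ennreal t = ennreal a \<longleftrightarrow> t = a" if "0 \<le> a" for a
      using that real by (auto simp: ennreal_less_iff)
    note lt = lt[OF arr_nonneg[OF Om]]
    show ?thesis
    proof (cases "t = 0")
      case True
      have "?i n k + ?a (Suc n) k = 0" for n
        using True arr_less[OF Om, of 0 "Suc n"] arr_0[OF Om] arr_nonneg[OF Om, of n] by (simp add: indicator_def real(2) lt)
      then have "(\<Sum>n. ?i n k + ?a (Suc n) k) = (\<Sum>n. 0)" by (rule suminf_cong)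
      moreover have "?a 0 k = sterm \<pi> \<omega> k" using True arr_0[OF Om] real by (simp add: indicator_def)
      ultimately show ?thesis by simp
    next
      case False
      obtain n where n: "arr n \<omega> < t" "t \<le> arr (Suc n) \<omega>"
      proof -
        obtain j where j: "arr j \<omega> \<le> t" "t < arr (Suc j) \<omega>" using arr_interval[OF Om] real by blast
        show thesis
        proof (cases "arr j \<omega> = t")
          case True
          then obtain j' where "j = Suc j'" using False arr_0[OF Om] by (cases j) auto
          then show ?thesis using that[of j'] True arr_less[OF Om, of j' j] by simp
        qed (use that[of j] j in auto)
      qed
      have z: "?i j k + ?a (Suc j) k = 0" if "j \<noteq> n" for j
      proof (cases "j < n")
        case True
        then have "arr (Suc j) \<omega> \<le> arr n \<omega>" by (intro arr_le[OF Om]) simp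
        then show ?thesis using n by (simp add: indicator_def real(2) lt)
      next
        case False
        then have "arr (Suc n) \<omega> \<le> arr j \<omega>" "arr j \<omega> < arr (Suc j) \<omega>" using that by (auto intro!: arr_le[OF Om] arr_less[OF Om])
        then show ?thesis using n by (simp add: indicator_def real(2) lt)
      qed
      have "(\<Sum>j. ?i j k + ?a (Suc j) k) = (\<Sum>j\<in>{n}. ?i j k + ?a (Suc j) k)" using z by (intro suminf_finite) auto
      also have "\<dots> = sterm \<pi> \<omega> k" using n by (auto simp: indicator_def real(2) lt)
      moreover have "?a 0 k = 0" using False arr_0[OF Om] real by (simp add: indicator_def)
      ultimately show ?thesis by simp
    qed
  qed
  have "(\<Sum>k. sterm \<pi> \<omega> k) = (\<Sum>k. ?a 0 k + (\<Sum>n. ?i n k + ?a (Suc n) k))" by (rule suminf_cong) (rule k)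
  also have "\<dots> = (\<Sum>k. ?a 0 k) + (\<Sum>k. \<Sum>n. ?i n k + ?a (Suc n) k)" by (rule suminf_add[symmetric]) auto
  also have "(\<Sum>k. \<Sum>n. ?i n k + ?a (Suc n) k) = (\<Sum>n. \<Sum>k. ?i n k + ?a (Suc n) k)" by (rule suminf_ennreal_swap)
  also have "\<dots> = (\<Sum>n. (\<Sum>k. ?i n k) + (\<Sum>k. ?a (Suc n) k))" by (intro suminf_cong suminf_add[symmetric]) auto
  finally show ?thesis unfolding swa_def swi_def .
qed

context
  fixes \<pi> :: "'a strategy" and i :: nat and x :: real
  assumes adm: "\<pi> \<in> admissible m x i" and x: "x \<in> {lo..hi}"
begin

lemmas AE_good' = AE_good[OF adm]

lemma sterm_measurable [measurable]: "(\<lambda>\<omega>. sterm \<pi> \<omega> k) \<in> borel_measurable (sample m)"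
proof -
  have [measurable]: "stime \<pi> k \<in> borel_measurable (sample m)" "sphase \<pi> k \<in> sample m \<rightarrow>\<^sub>M count_space UNIV" for k
    by (rule stime_rv[OF adm], rule sphase_rv[OF adm])
  have [measurable]: "(\<lambda>\<omega>. switch m (sphase \<pi> k \<omega>) (sphase \<pi> (Suc k) \<omega>)) \<in> borel_measurable (sample m)"
    by (rule measurable_compose_countable[OF _ sphase_rv[OF adm, of k]], rule measurable_compose[OF sphase_rv[OF adm]]) simp
  show ?thesis unfolding sterm_def by measurable
qed

lemma swi_measurable: "swi \<pi> n \<in> borel_measurable (sample m)" and swa_measurable: "swa \<pi> n \<in> borel_measurable (sample m)"
proof -
  have [measurable]: "stime \<pi> k \<in> borel_measurable (sample m)" for k by (rule stime_rv[OF adm])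
  have 1: "swi \<pi> n = (\<lambda>\<omega>. \<Sum>k. if ennreal (arr n \<omega>) < stime \<pi> (Suc k) \<omega> \<and> stime \<pi> (Suc k) \<omega> < ennreal (arr (Suc n) \<omega>) then sterm \<pi> \<omega> k else 0)"
    by (auto simp: fun_eq_iff swi_def indicator_def intro!: suminf_cong)
  have 2: "swa \<pi> n = (\<lambda>\<omega>. \<Sum>k. if stime \<pi> (Suc k) \<omega> = ennreal (arr n \<omega>) then sterm \<pi> \<omega> k else 0)"
    by (auto simp: fun_eq_iff swa_def indicator_def intro!: suminf_cong)
  show "swi \<pi> n \<in> borel_measurable (sample m)" unfolding 1 by measurable
  show "swa \<pi> n \<in> borel_measurable (sample m)" unfolding 2 by measurable
qed

lemmas aem_swi = aem_measurable[OF adm swi_measurable]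
lemmas aem_swa = aem_measurable[OF adm swa_measurable]
lemma aem_run: "aem (occ \<pi> x run n)"
  by (rule aem_occ[OF adm]) (rule run_measurable)

lemma aem_jmp: "aem (occ \<pi> x (jmp val) n)"
  by (rule aem_occ[OF adm]) (rule jmp_measurable[OF val_bnd])

lemma aem_vv: "aem (occ \<pi> x vv n)" "aem (occ \<pi> x lamval n)" "aem (fin \<pi> x vv n)"
  by (rule aem_occ[OF adm] aem_fin[OF adm], erule vv_measurable lamval_measurable)+

lemma aem_gain: "aem (occ \<pi> x (gain val) n)"
  by (rule aem_occ[OF adm]) (rule gain_measurable[OF val_bnd])

lemma phase_arr_measurable:
  "\<exists>p\<in>sample m \<rightarrow>\<^sub>M count_space {0, 1, 2}. \<forall>\<omega>. spath i \<pi> \<omega> \<longrightarrow> p \<omega> = phase_at \<pi> \<omega> (arr n \<omega>)"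
proof -
  have [measurable]: "stime \<pi> k \<in> borel_measurable (sample m)" "sphase \<pi> k \<in> sample m \<rightarrow>\<^sub>M count_space UNIV" for k
    by (rule stime_rv[OF adm], rule sphase_rv[OF adm])
  let ?P = "\<lambda>c \<omega>. \<exists>k. stime \<pi> k \<omega> \<le> ennreal (arr n \<omega>) \<and> ennreal (arr n \<omega>) < stime \<pi> (Suc k) \<omega> \<and> sphase \<pi> k \<omega> = c"
  have 1: "(\<lambda>\<omega>. if ?P 1 \<omega> then 1 else if ?P 2 \<omega> then 2 else 0 :: nat) \<in> sample m \<rightarrow>\<^sub>M count_space {0, 1, 2}"
    by measurable
  have 2: "(if ?P 1 \<omega> then 1 else if ?P 2 \<omega> then 2 else 0) = phase_at \<pi> \<omega> (arr n \<omega>)" if sp: "spath i \<pi> \<omega>" for \<omega>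
  proof -
    obtain k where k: "stime \<pi> k \<omega> \<le> ennreal (arr n \<omega>)" "ennreal (arr n \<omega>) < stime \<pi> (Suc k) \<omega>"
      using seg_right_ex[OF sp] by blast
    have "?P c \<omega> \<longleftrightarrow> phase_at \<pi> \<omega> (arr n \<omega>) = c" for c
    proof
      show "?P c \<omega> \<Longrightarrow> phase_at \<pi> \<omega> (arr n \<omega>) = c" by (elim exE conjE) (simp only: phase_at_eq[OF sp])
    next
      assume "phase_at \<pi> \<omega> (arr n \<omega>) = c"
      then show "?P c \<omega>" using k phase_at_eq[OF sp k] by (intro exI[of _ k]) simp
    qed
    then show ?thesis using phase_at_range[OF sp, of "arr n \<omega>"] by (simp only:) auto
  qed
  show ?thesis by (rule bexI[OF _ 1], intro allI impI, rule 2)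
qed

lemma aem_pot: "aem (pot \<pi> x n)"
proof -
  obtain lv where lv: "lv \<in> borel_measurable (hist n)" "\<And>\<omega>. spath i \<pi> \<omega> \<Longrightarrow> lv \<omega> = level_after m x \<pi> \<omega> n"
    using state_version[OF adm, of n] by blast
  obtain p where p: "p \<in> sample m \<rightarrow>\<^sub>M count_space {0, 1, 2}" "\<And>\<omega>. spath i \<pi> \<omega> \<Longrightarrow> p \<omega> = phase_at \<pi> \<omega> (arr n \<omega>)"
    using phase_arr_measurable[of n] by blast
  have [measurable]: "(\<lambda>\<omega>. vv (p \<omega>) (lv \<omega>)) \<in> borel_measurable (sample m)"
    by (rule compose_phase_measurable[OF p(1) vv_measurable measurable_from_hist[OF lv(1)]])
  have "(\<lambda>\<omega>. ennreal (exp (- disc m * arr n \<omega>) * vv (p \<omega>) (lv \<omega>))) \<in> borel_measurable (sample m)" by measurable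
  then show ?thesis by (rule aemI[OF adm]) (simp add: pot_def p lv)
qed

text \<open>Penalty and cost to go at the demand together have the conditional mean
  \<open>jmp val\<close> given the state before it; the compensator turns this into a time
  integral.\<close>

lemma jmp_dem:
  shows "(\<integral>\<^sup>+\<omega>. short \<pi> x n \<omega> \<partial>sample m) + (\<integral>\<^sup>+\<omega>. resume \<pi> x n \<omega> \<partial>sample m)
    = ennreal (intensity m) * (\<integral>\<^sup>+\<omega>. occ \<pi> x (jmp val) n \<omega> \<partial>sample m)"
    and "aem (short \<pi> x n)" and "aem (resume \<pi> x n)"
proof -
  have wm: "wt val c \<in> borel_measurable borel" if "c \<in> {0, 1, 2}" for c by (rule wt_bounds(3)[OF val_bnd that])
  have wp: "(\<lambda>p. wt val c (max lo (fst p - snd p))) \<in> borel_measurable (borel \<Otimes>\<^sub>M borel)" if "c \<in> {0, 1, 2}" for c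
    by (rule measurable_compose[OF _ wm[OF that]]) measurable
  have wn: "0 \<le> wt val c z" if "c \<in> {0, 1, 2}" for c z by (rule wt_bounds(1)[OF val_bnd that])
  let ?w = "\<lambda>c y \<alpha>. wt val c (max lo (y - \<alpha>))"
  let ?g = "\<lambda>c y \<alpha>. shortage y \<alpha> + ?w c y \<alpha>"
  show s: "aem (short \<pi> x n)"
  proof (rule dem_fin(2)[OF adm _ _ _ x, where h = "\<lambda>c. expected_penalty m"])
    fix c z e :: real and c' :: nat assume "z \<in> {lo..hi}" "0 < e"
    then show "(\<integral>\<^sup>+\<alpha>. ennreal (e * shortage z \<alpha>) \<partial>dlaw) = ennreal (e * expected_penalty m z)"
      unfolding expected_penalty_eq
      by (subst nn_integral_eq_integral) (auto simp: shortage_nonneg intro!: integrable_mult_right shortage_integrable)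
  qed simp_all
  show r: "aem (resume \<pi> x n)"
  proof (rule dem_fin(2)[OF adm _ _ _ x, where h = "\<lambda>c z. \<integral>\<alpha>. ?w c z \<alpha> \<partial>dlaw"])
    fix c :: nat assume c: "c \<in> {0, 1, 2}"
    show "case_prod (?w c) \<in> borel_measurable (borel \<Otimes>\<^sub>M borel)" using wp[OF c] by (simp add: split_beta')
    show "(\<lambda>z. \<integral>\<alpha>. ?w c z \<alpha> \<partial>dlaw) \<in> borel_measurable borel"
      using wp[OF c] by (intro law.borel_measurable_lebesgue_integral) (simp add: split_beta')
    fix z e :: real assume "0 < e"
    then show "(\<integral>\<^sup>+\<alpha>. ennreal (e * ?w c z \<alpha>) \<partial>dlaw) = ennreal (e * (\<integral>\<alpha>. ?w c z \<alpha> \<partial>dlaw))"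
      by (subst nn_integral_eq_integral) (auto simp: wn[OF c] intro!: integrable_mult_right wt_integrable[OF val_bnd c])
  qed
  have "(\<integral>\<^sup>+\<omega>. short \<pi> x n \<omega> \<partial>sample m) + (\<integral>\<^sup>+\<omega>. resume \<pi> x n \<omega> \<partial>sample m)
    = (\<integral>\<^sup>+\<omega>. short \<pi> x n \<omega> + resume \<pi> x n \<omega> \<partial>sample m)" by (rule nn_add[OF adm s r, symmetric])
  also have "\<dots> = (\<integral>\<^sup>+\<omega>. dem \<pi> x ?g n \<omega> \<partial>sample m)"
  proof (rule nn_integral_cong_AE)
    show "AE \<omega> in sample m. short \<pi> x n \<omega> + resume \<pi> x n \<omega> = dem \<pi> x ?g n \<omega>"
      using AE_spath[OF adm]
    proof eventually_elim
      case (elim \<omega>)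
      show ?case unfolding dem_def distrib_left
        using shortage_nonneg wn[OF phL_range[OF elim]] by (intro ennreal_plus[symmetric]) auto
    qed
  qed
  also have "\<dots> = (\<integral>\<^sup>+\<omega>. fin \<pi> x (jmp val) n \<omega> \<partial>sample m)"
  proof (rule dem_fin(1)[OF adm _ _ _ x])
    fix c :: nat assume c: "c \<in> {0, 1, 2}"
    show "case_prod (?g c) \<in> borel_measurable (borel \<Otimes>\<^sub>M borel)"
      using borel_measurable_add[OF shortage_measurable, of "\<lambda>p. wt val c (max lo (fst p - snd p))"] wp[OF c] by (simp add: split_beta')
    show "jmp val c \<in> borel_measurable borel" by (rule jmp_measurable[OF val_bnd c])
    fix z e :: real assume z: "z \<in> {lo..hi}" and e: "0 < e"
    have "(\<integral>\<^sup>+\<alpha>. ennreal (e * ?g c z \<alpha>) \<partial>dlaw) = ennreal (\<integral>\<alpha>. e * ?g c z \<alpha> \<partial>dlaw)"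
      using z e by (intro nn_integral_eq_integral)
        (auto simp: wn[OF c] shortage_nonneg intro!: integrable_mult_right Bochner_Integration.integrable_add shortage_integrable wt_integrable[OF val_bnd c])
    also have "(\<integral>\<alpha>. e * ?g c z \<alpha> \<partial>dlaw) = e * jmp val c z"
      unfolding jmp_def expected_penalty_eq using z
      by (simp add: Bochner_Integration.integral_add[OF shortage_integrable wt_integrable[OF val_bnd c]])
    finally show "(\<integral>\<^sup>+\<alpha>. ennreal (e * ?g c z \<alpha>) \<partial>dlaw) = ennreal (e * jmp val c z)" .
  qed
  also have "\<dots> = ennreal (intensity m) * (\<integral>\<^sup>+\<omega>. occ \<pi> x (jmp val) n \<omega> \<partial>sample m)"
    by (rule fin_occ[OF adm]) (rule jmp_measurable[OF val_bnd])
  finally show "(\<integral>\<^sup>+\<omega>. short \<pi> x n \<omega> \<partial>sample m) + (\<integral>\<^sup>+\<omega>. resume \<pi> x n \<omega> \<partial>sample m)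
    = ennreal (intensity m) * (\<integral>\<^sup>+\<omega>. occ \<pi> x (jmp val) n \<omega> \<partial>sample m)" .
qed

text \<open>Explains the name of \<open>gain\<close>: integrated over a stage it has the same mean
  as the holding cost of the stage, the penalty at its end and the cost to go from there.\<close>

lemma occ_gain: "(\<integral>\<^sup>+\<omega>. occ \<pi> x (gain val) n \<omega> \<partial>sample m)
    = (\<integral>\<^sup>+\<omega>. occ \<pi> x run n \<omega> \<partial>sample m) + (\<integral>\<^sup>+\<omega>. short \<pi> x n \<omega> \<partial>sample m) + (\<integral>\<^sup>+\<omega>. resume \<pi> x n \<omega> \<partial>sample m)"
proof -
  have "(\<integral>\<^sup>+\<omega>. occ \<pi> x (gain val) n \<omega> \<partial>sample m)
    = (\<integral>\<^sup>+\<omega>. occ \<pi> x run n \<omega> + ennreal (intensity m) * occ \<pi> x (jmp val) n \<omega> \<partial>sample m)"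
  proof (rule nn_integral_cong_AE)
    show "AE \<omega> in sample m. occ \<pi> x (gain val) n \<omega> = occ \<pi> x run n \<omega> + ennreal (intensity m) * occ \<pi> x (jmp val) n \<omega>"
      using AE_spath[OF adm]
    proof eventually_elim
      case (elim \<omega>)
      let ?I = "indicator {arr n \<omega><..arr (Suc n) \<omega>} :: real \<Rightarrow> ennreal"
      let ?r = "\<lambda>u. ennreal (exp (- disc m * u) * run (phL \<pi> \<omega> u) (lev x \<pi> \<omega> n u)) * ?I u"
      let ?j = "\<lambda>u. ennreal (exp (- disc m * u) * jmp val (phL \<pi> \<omega> u) (lev x \<pi> \<omega> n u)) * ?I u"
      have m: "?r \<in> borel_measurable lborel" "?j \<in> borel_measurable lborel"
        by (rule phL_lev_lborel[OF elim], erule run_measurable jmp_measurable[OF val_bnd])+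
      have "occ \<pi> x (gain val) n \<omega> = (\<integral>\<^sup>+u. ?r u + ennreal (intensity m) * ?j u \<partial>lborel)"
        unfolding occ_def
      proof (rule nn_integral_cong)
        fix u
        have "0 \<le> run (phL \<pi> \<omega> u) (lev x \<pi> \<omega> n u)" "0 \<le> jmp val (phL \<pi> \<omega> u) (lev x \<pi> \<omega> n u)"
          using run_nonneg[OF phL_range[OF elim]] jmp_bounds(1)[OF val_bnd phL_range[OF elim]] by auto
        then show "ennreal (exp (- disc m * u) * gain val (phL \<pi> \<omega> u) (lev x \<pi> \<omega> n u)) * ?I u = ?r u + ennreal (intensity m) * ?j u"
          unfolding gain_def using intensity_pos
          by (auto simp: indicator_def ennreal_mult'[symmetric] ennreal_plus[symmetric] distrib_left mult.left_commute simp del: ennreal_plus)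
      qed
      also have "\<dots> = (\<integral>\<^sup>+u. ?r u \<partial>lborel) + (\<integral>\<^sup>+u. ennreal (intensity m) * ?j u \<partial>lborel)"
        using m by (intro nn_integral_add) auto
      also have "(\<integral>\<^sup>+u. ennreal (intensity m) * ?j u \<partial>lborel) = ennreal (intensity m) * (\<integral>\<^sup>+u. ?j u \<partial>lborel)"
        by (rule nn_integral_cmult[OF m(2)])
      finally show ?case unfolding occ_def .
    qed
  qed
  also have "\<dots> = (\<integral>\<^sup>+\<omega>. occ \<pi> x run n \<omega> \<partial>sample m) + (\<integral>\<^sup>+\<omega>. ennreal (intensity m) * occ \<pi> x (jmp val) n \<omega> \<partial>sample m)"
  proof (rule nn_add[OF adm aem_run])
    obtain X where "X \<in> borel_measurable (sample m)" "AE \<omega> in sample m. occ \<pi> x (jmp val) n \<omega> = X \<omega>"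
      using aem_jmp[of n] unfolding aem_def[OF adm] by blast
    then show "aem (\<lambda>\<omega>. ennreal (intensity m) * occ \<pi> x (jmp val) n \<omega>)"
      unfolding aem_def[OF adm] by (intro bexI[of _ "\<lambda>\<omega>. ennreal (intensity m) * X \<omega>"]) (auto elim: eventually_mono)
  qed
  also have "(\<integral>\<^sup>+\<omega>. ennreal (intensity m) * occ \<pi> x (jmp val) n \<omega> \<partial>sample m) = (\<integral>\<^sup>+\<omega>. short \<pi> x n \<omega> \<partial>sample m) + (\<integral>\<^sup>+\<omega>. resume \<pi> x n \<omega> \<partial>sample m)"
    unfolding jmp_dem(1) by (rule nn_cmult[OF adm aem_jmp])
  finally show ?thesis by (simp only: add.assoc)
qed

lemma pot_bound: "(\<integral>\<^sup>+\<omega>. pot \<pi> x n \<omega> \<partial>sample m) \<le> ennreal (val_max * ratio ^ n)"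
proof -
  have "(\<integral>\<^sup>+\<omega>. pot \<pi> x n \<omega> \<partial>sample m) \<le> (\<integral>\<^sup>+\<omega>. ennreal val_max * ennreal (exp (- disc m * arr n \<omega>)) \<partial>sample m)"
  proof (rule nn_integral_mono_AE)
    show "AE \<omega> in sample m. pot \<pi> x n \<omega> \<le> ennreal val_max * ennreal (exp (- disc m * arr n \<omega>))"
      using AE_spath[OF adm]
    proof eventually_elim
      case (elim \<omega>)
      show ?case
        unfolding pot_def using vv_bounds[OF phase_at_range[OF elim]] val_max_nonneg
        by (simp add: ennreal_mult'[symmetric] mult.commute[of val_max])
    qed
  qed
  also have "\<dots> = ennreal val_max * ennreal (ratio ^ n)" using arr_laplace[of n] by (subst nn_integral_cmult) simp_all
  finally show ?thesis using val_max_nonneg by (simp add: ennreal_mult')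
qed

text \<open>The cancellation behind the whole comparison: the running term produced by the change of
  discount has the mean of the value just before the next demand.\<close>

lemma fin_vv: "(\<integral>\<^sup>+\<omega>. occ \<pi> x lamval n \<omega> \<partial>sample m) = (\<integral>\<^sup>+\<omega>. fin \<pi> x vv n \<omega> \<partial>sample m)"
proof -
  have "occ \<pi> x lamval n \<omega> = ennreal (intensity m) * occ \<pi> x vv n \<omega>" if sp: "spath i \<pi> \<omega>" for \<omega>
  proof -
    have "(\<integral>\<^sup>+u. ennreal (intensity m) * (ennreal (exp (- disc m * u) * vv (phL \<pi> \<omega> u) (lev x \<pi> \<omega> n u)) * indicator {arr n \<omega><..arr (Suc n) \<omega>} u) \<partial>lborel)
        = ennreal (intensity m) * occ \<pi> x vv n \<omega>"
      unfolding occ_def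
      by (rule nn_integral_cmult, rule phL_lev_lborel[OF sp], rule vv_measurable)
    moreover have "occ \<pi> x lamval n \<omega> = (\<integral>\<^sup>+u. ennreal (intensity m) * (ennreal (exp (- disc m * u) * vv (phL \<pi> \<omega> u) (lev x \<pi> \<omega> n u)) * indicator {arr n \<omega><..arr (Suc n) \<omega>} u) \<partial>lborel)"
      unfolding occ_def using intensity_pos by (intro nn_integral_cong) (auto simp: indicator_def ennreal_mult'[symmetric] mult.left_commute)
    ultimately show ?thesis by simp
  qed
  then have "(\<integral>\<^sup>+\<omega>. occ \<pi> x lamval n \<omega> \<partial>sample m) = (\<integral>\<^sup>+\<omega>. ennreal (intensity m) * occ \<pi> x vv n \<omega> \<partial>sample m)"
    using AE_spath[OF adm] by (intro nn_integral_cong_AE) (auto elim: eventually_mono)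
  also have "\<dots> = ennreal (intensity m) * (\<integral>\<^sup>+\<omega>. occ \<pi> x vv n \<omega> \<partial>sample m)" by (rule nn_cmult[OF adm aem_vv(1)])
  also have "\<dots> = (\<integral>\<^sup>+\<omega>. fin \<pi> x vv n \<omega> \<partial>sample m)" by (rule fin_occ[OF adm, symmetric]) (rule vv_measurable)
  finally show ?thesis .
qed

text \<open>Cancelling a summand in \<open>ennreal\<close> is legitimate only if it is
  finite.\<close>

lemma fin_finite: "(\<integral>\<^sup>+\<omega>. fin \<pi> x vv n \<omega> \<partial>sample m) \<noteq> \<infinity>"
proof -
  have "(\<integral>\<^sup>+\<omega>. fin \<pi> x vv n \<omega> \<partial>sample m) \<le> (\<integral>\<^sup>+\<omega>. ennreal val_max \<partial>sample m)"
  proof (rule nn_integral_mono_AE)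
    show "AE \<omega> in sample m. fin \<pi> x vv n \<omega> \<le> ennreal val_max"
      using AE_spath[OF adm]
    proof eventually_elim
      case (elim \<omega>)
      have "exp (- disc m * arr (Suc n) \<omega>) \<le> 1" using arr_nonneg[OF path_Om[OF elim], of "Suc n"] disc_pos by simp
      then have "exp (- disc m * arr (Suc n) \<omega>) * vv (phL \<pi> \<omega> (arr (Suc n) \<omega>)) (level_before m x \<pi> \<omega> n) \<le> 1 * val_max"
        using vv_bounds[OF phL_range[OF elim]] by (intro mult_mono) auto
      then show ?case unfolding fin_def by (intro ennreal_leI) simp
    qed
  qed
  then show ?thesis using P.emeasure_space_1 by (auto simp: top_unique)
qed

text \<open>A stage pays for the switch at the demand that ends it, not for one at its beginning; a
  switch at time 0 therefore remains outside.\<close>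

definition stage :: "nat \<Rightarrow> ennreal" where
  "stage n = (\<integral>\<^sup>+\<omega>. occ \<pi> x run n \<omega> \<partial>sample m) + ((\<integral>\<^sup>+\<omega>. swi \<pi> n \<omega> \<partial>sample m) + (\<integral>\<^sup>+\<omega>. swa \<pi> (Suc n) \<omega> \<partial>sample m))
     + (\<integral>\<^sup>+\<omega>. short \<pi> x n \<omega> \<partial>sample m)"

lemma cost_stages: "cost m x \<pi> = (\<integral>\<^sup>+\<omega>. swa \<pi> 0 \<omega> \<partial>sample m) + (\<Sum>n. stage n)"
proof -
  have 1: "(\<integral>\<^sup>+\<omega>. (\<integral>\<^sup>+t\<in>{0..}. ennreal (exp (- disc m * t)
          * hold m (phase_at \<pi> \<omega> t) (level m x \<pi> \<omega> t)) \<partial>lborel) \<partial>sample m) = (\<Sum>n. \<integral>\<^sup>+\<omega>. occ \<pi> x run n \<omega> \<partial>sample m)"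
  proof -
    have "(\<integral>\<^sup>+\<omega>. (\<integral>\<^sup>+t\<in>{0..}. ennreal (exp (- disc m * t) * hold m (phase_at \<pi> \<omega> t) (level m x \<pi> \<omega> t)) \<partial>lborel) \<partial>sample m)
      = (\<integral>\<^sup>+\<omega>. (\<Sum>n. occ \<pi> x run n \<omega>) \<partial>sample m)"
      by (rule nn_integral_cong_AE, rule eventually_mono[OF AE_good'], rule hold_eq[OF _ x])
    also have "\<dots> = (\<Sum>n. \<integral>\<^sup>+\<omega>. occ \<pi> x run n \<omega> \<partial>sample m)" by (rule nn_suminf[OF adm]) (rule aem_run)
    finally show ?thesis .
  qed
  have 2: "(\<integral>\<^sup>+\<omega>. (\<Sum>k. ennreal (discount m (stime \<pi> (Suc k) \<omega>) * switch m (sphase \<pi> k \<omega>) (sphase \<pi> (Suc k) \<omega>))) \<partial>sample m)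
    = (\<integral>\<^sup>+\<omega>. swa \<pi> 0 \<omega> \<partial>sample m) + (\<Sum>n. (\<integral>\<^sup>+\<omega>. swi \<pi> n \<omega> \<partial>sample m) + (\<integral>\<^sup>+\<omega>. swa \<pi> (Suc n) \<omega> \<partial>sample m))"
  proof -
    have "(\<integral>\<^sup>+\<omega>. (\<Sum>k. sterm \<pi> \<omega> k) \<partial>sample m) = (\<integral>\<^sup>+\<omega>. swa \<pi> 0 \<omega> + (\<Sum>n. swi \<pi> n \<omega> + swa \<pi> (Suc n) \<omega>) \<partial>sample m)"
      by (rule nn_integral_cong_AE, rule eventually_mono[OF AE_spath[OF adm]], rule switch_eq)
    also have "\<dots> = (\<integral>\<^sup>+\<omega>. swa \<pi> 0 \<omega> \<partial>sample m) + (\<integral>\<^sup>+\<omega>. (\<Sum>n. swi \<pi> n \<omega> + swa \<pi> (Suc n) \<omega>) \<partial>sample m)"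
      using swi_measurable swa_measurable by (intro nn_integral_add) auto
    also have "(\<integral>\<^sup>+\<omega>. (\<Sum>n. swi \<pi> n \<omega> + swa \<pi> (Suc n) \<omega>) \<partial>sample m) = (\<Sum>n. \<integral>\<^sup>+\<omega>. swi \<pi> n \<omega> + swa \<pi> (Suc n) \<omega> \<partial>sample m)"
      using swi_measurable swa_measurable by (intro nn_integral_suminf) auto
    also have "\<dots> = (\<Sum>n. (\<integral>\<^sup>+\<omega>. swi \<pi> n \<omega> \<partial>sample m) + (\<integral>\<^sup>+\<omega>. swa \<pi> (Suc n) \<omega> \<partial>sample m))"
      using swi_measurable swa_measurable by (intro suminf_cong nn_integral_add) auto
    finally show ?thesis unfolding sterm_def .
  qed
  have 3: "(\<integral>\<^sup>+\<omega>. (\<Sum>n. short \<pi> x n \<omega>) \<partial>sample m) = (\<Sum>n. \<integral>\<^sup>+\<omega>. short \<pi> x n \<omega> \<partial>sample m)"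
    by (rule nn_suminf[OF adm]) (rule jmp_dem(2))
  have 4: "(\<Sum>n. stage n) = (\<Sum>n. \<integral>\<^sup>+\<omega>. occ \<pi> x run n \<omega> \<partial>sample m)
     + (\<Sum>n. (\<integral>\<^sup>+\<omega>. swi \<pi> n \<omega> \<partial>sample m) + (\<integral>\<^sup>+\<omega>. swa \<pi> (Suc n) \<omega> \<partial>sample m)) + (\<Sum>n. \<integral>\<^sup>+\<omega>. short \<pi> x n \<omega> \<partial>sample m)"
    unfolding stage_def by (simp only: suminf_add[OF summableI summableI])
  show ?thesis unfolding cost_def short_eq 1 2 3 4 by (simp only: add.assoc add.commute add.left_commute)
qed

text \<open>The submartingale inequality: \<open>pot_le\<close> and \<open>demand_le\<close> in
  expectation, after the running term has been cancelled.\<close>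

lemma pot_step: "(\<integral>\<^sup>+\<omega>. pot \<pi> x n \<omega> \<partial>sample m) \<le> stage n + (\<integral>\<^sup>+\<omega>. pot \<pi> x (Suc n) \<omega> \<partial>sample m)"
proof -
  let ?E = "\<lambda>X. \<integral>\<^sup>+\<omega>. X \<omega> \<partial>sample m"
  have "?E (pot \<pi> x n) + ?E (occ \<pi> x lamval n) = ?E (\<lambda>\<omega>. pot \<pi> x n \<omega> + occ \<pi> x lamval n \<omega>)"
    by (rule nn_add[OF adm aem_pot aem_vv(2), symmetric])
  also have "\<dots> \<le> ?E (\<lambda>\<omega>. occ \<pi> x (gain val) n \<omega> + swi \<pi> n \<omega> + fin \<pi> x vv n \<omega>)"
    by (rule nn_integral_mono_AE, rule eventually_mono[OF AE_good'], rule pot_le[OF _ x])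
  also have "\<dots> = ?E (occ \<pi> x (gain val) n) + ?E (swi \<pi> n) + ?E (fin \<pi> x vv n)"
    by (simp only: nn_add[OF adm aem_add[OF adm aem_gain aem_swi] aem_vv(3)] nn_add[OF adm aem_gain aem_swi])
  finally have "?E (pot \<pi> x n) + ?E (fin \<pi> x vv n) \<le> (?E (occ \<pi> x (gain val) n) + ?E (swi \<pi> n)) + ?E (fin \<pi> x vv n)"
    unfolding fin_vv .
  then have 1: "?E (pot \<pi> x n) \<le> ?E (occ \<pi> x (gain val) n) + ?E (swi \<pi> n)"
    using fin_finite[of n] by (simp add: ennreal_add_left_cancel_le add.commute[of _ "?E (fin \<pi> x vv n)"])
  have "?E (resume \<pi> x n) \<le> ?E (\<lambda>\<omega>. swa \<pi> (Suc n) \<omega> + pot \<pi> x (Suc n) \<omega>)"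
    by (rule nn_integral_mono_AE, rule eventually_mono[OF AE_good'], rule demand_le[OF _ x])
  also have "\<dots> = ?E (swa \<pi> (Suc n)) + ?E (pot \<pi> x (Suc n))" by (rule nn_add[OF adm aem_swa aem_pot])
  finally have 2: "?E (resume \<pi> x n) \<le> ?E (swa \<pi> (Suc n)) + ?E (pot \<pi> x (Suc n))" .
  have "?E (pot \<pi> x n) \<le> ?E (occ \<pi> x run n) + ?E (short \<pi> x n) + (?E (swa \<pi> (Suc n)) + ?E (pot \<pi> x (Suc n))) + ?E (swi \<pi> n)"
    using 1 unfolding occ_gain by (rule order.trans) (intro add_mono order.refl 2)
  then show ?thesis unfolding stage_def by (simp only: add.assoc add.commute add.left_commute)
qed

lemma pot_sum: "(\<integral>\<^sup>+\<omega>. pot \<pi> x 0 \<omega> \<partial>sample m) \<le> (\<Sum>n<N. stage n) + (\<integral>\<^sup>+\<omega>. pot \<pi> x N \<omega> \<partial>sample m)"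
proof (induction N)
  case (Suc N)
  also have "(\<Sum>n<N. stage n) + (\<integral>\<^sup>+\<omega>. pot \<pi> x N \<omega> \<partial>sample m) \<le> (\<Sum>n<N. stage n) + (stage N + (\<integral>\<^sup>+\<omega>. pot \<pi> x (Suc N) \<omega> \<partial>sample m))"
    by (intro add_left_mono pot_step)
  finally show ?case by (simp add: add.assoc)
qed simp

text \<open>The potential left after \<open>N\<close> stages vanishes geometrically because
  \<open>val\<close> is bounded.\<close>

lemma pot_le_stages: "(\<integral>\<^sup>+\<omega>. pot \<pi> x 0 \<omega> \<partial>sample m) \<le> (\<Sum>n. stage n)"
proof (rule LIMSEQ_le_const)
  have "(\<lambda>N. val_max * ratio ^ N) \<longlonglongrightarrow> val_max * 0"
    using ratio by (intro tendsto_mult tendsto_const LIMSEQ_realpow_zero)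
  then have "(\<lambda>N. ennreal (val_max * ratio ^ N)) \<longlonglongrightarrow> 0" using tendsto_ennrealI by fastforce
  then show "(\<lambda>N. (\<Sum>n. stage n) + ennreal (val_max * ratio ^ N)) \<longlonglongrightarrow> (\<Sum>n. stage n)"
    using tendsto_add[OF tendsto_const, of "\<lambda>N. ennreal (val_max * ratio ^ N)" 0 sequentially "\<Sum>n. stage n"] by simp
  show "\<exists>N. \<forall>n\<ge>N. (\<integral>\<^sup>+\<omega>. pot \<pi> x 0 \<omega> \<partial>sample m) \<le> (\<Sum>n. stage n) + ennreal (val_max * ratio ^ n)"
  proof (intro exI allI impI)
    fix N :: nat
    show "(\<integral>\<^sup>+\<omega>. pot \<pi> x 0 \<omega> \<partial>sample m) \<le> (\<Sum>n. stage n) + ennreal (val_max * ratio ^ N)"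
      using pot_sum[of N] by (rule order.trans) (intro add_mono pot_bound sum_le_suminf; simp)
  qed
qed

end

text \<open>The initial phase may be left at time 0, so \<open>pot\<close> may refer to a different
  phase; the switching inequality pays for the difference.\<close>

lemma init_le:
  assumes g: "good i x \<pi> \<omega>" and x: "x \<in> {lo..<hi}" and i: "i \<in> {1, 2}"
  shows "ennreal (val i x) \<le> swa \<pi> 0 \<omega> + pot \<pi> x 0 \<omega>"
proof -
  have sp: "spath i \<pi> \<omega>" using g by (simp add: good_def)
  have Om: "\<omega> \<in> Om" by (rule path_Om[OF sp])
  have xx: "x \<in> {lo..hi}" using x by auto
  have a0: "arr 0 \<omega> = 0" by (rule arr_0[OF Om])
  obtain k where k: "stime \<pi> k \<omega> \<le> ennreal 0" "ennreal 0 < stime \<pi> (Suc k) \<omega>" using seg_right_ex[OF sp] by blast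
  have ph: "phase_at \<pi> \<omega> 0 = sphase \<pi> k \<omega>" by (rule phase_at_eq[OF sp k])
  have "lev x \<pi> \<omega> 0 0 = x" using lev_arr[OF sp, of x 0] a0 by simp
  then have c: "sphase \<pi> k \<omega> \<in> {1, 2}"
    using lev_phase[OF g xx, of 0 0] a0 x arr_less[OF Om, of 0 "Suc 0"] ph by auto
  have P: "pot \<pi> x 0 \<omega> = ennreal (val (sphase \<pi> k \<omega>) x)" unfolding pot_def a0 ph using c by (auto simp: vv_def)
  show ?thesis
  proof (cases k)
    case 0
    then show ?thesis using P sphase_0[OF sp] by simp
  next
    case (Suc j)
    \<comment> \<open>Only switching times 0 and 1 may coincide, so at most one switch takes place
      at time 0.\<close>
    have "j = 0"
    proof (rule ccontr)
      assume "j \<noteq> 0"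
      have "stime \<pi> j \<omega> \<le> stime \<pi> (Suc j) \<omega>" by (rule stime_Suc[OF sp])
      then have "stime \<pi> j \<omega> = 0" using k(1) Suc by simp
      then show False using stime_strict[OF sp, of j] \<open>j \<noteq> 0\<close> k(1) Suc by simp
    qed
    then have s0: "stime \<pi> (Suc 0) \<omega> = ennreal 0" and k1: "k = Suc 0" using k(1) Suc by simp_all
    have ne: "sphase \<pi> (Suc 0) \<omega> \<noteq> sphase \<pi> 0 \<omega>" using sphase_neq[OF sp, of 0] s0 by simp
    have "sterm \<pi> \<omega> 0 \<le> swa \<pi> 0 \<omega>"
      using sum_le_suminf[OF summableI, of "{0}" "\<lambda>k. sterm \<pi> \<omega> k * indicator {k. stime \<pi> (Suc k) \<omega> = ennreal (arr 0 \<omega>)} k"] s0 a0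
      unfolding swa_def by simp
    moreover have "ennreal (val i x) \<le> sterm \<pi> \<omega> 0 + pot \<pi> x 0 \<omega>"
    proof -
      have "val i x \<le> switch m i (sphase \<pi> (Suc 0) \<omega>) + val (sphase \<pi> (Suc 0) \<omega>) x"
        using subvalD(1)[OF val_subval i, of "sphase \<pi> (Suc 0) \<omega>" x] c ne sphase_0[OF sp] k1 xx by auto
      then show ?thesis
        using sterm_plus[OF g xx order.refl s0 ne bndD(1)[OF val_bnd, of "sphase \<pi> (Suc 0) \<omega>" x]] c P k1 sphase_0[OF sp]
        by (simp add: ennreal_leI)
    qed
    ultimately show ?thesis by (meson add_right_mono order.trans)
  qed
qed

theorem val_le_cost:
  assumes adm: "\<pi> \<in> admissible m x i" and x: "x \<in> {lo..<hi}" and i: "i \<in> {1, 2}"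
  shows "ennreal (val i x) \<le> cost m x \<pi>"
proof -
  have xx: "x \<in> {lo..hi}" using x by auto
  have "ennreal (val i x) = (\<integral>\<^sup>+\<omega>. ennreal (val i x) \<partial>sample m)" using P.emeasure_space_1 by simp
  also have "\<dots> \<le> (\<integral>\<^sup>+\<omega>. swa \<pi> 0 \<omega> + pot \<pi> x 0 \<omega> \<partial>sample m)"
    by (rule nn_integral_mono_AE, rule eventually_mono[OF AE_good[OF adm]], rule init_le[OF _ x i])
  also have "\<dots> = (\<integral>\<^sup>+\<omega>. swa \<pi> 0 \<omega> \<partial>sample m) + (\<integral>\<^sup>+\<omega>. pot \<pi> x 0 \<omega> \<partial>sample m)"
    by (rule nn_add[OF adm aem_swa[OF adm xx] aem_pot[OF adm xx]])
  also have "\<dots> \<le> cost m x \<pi>"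
    unfolding cost_stages[OF adm xx] by (intro add_left_mono pot_le_stages[OF adm xx])
  finally show ?thesis .
qed

end

subsection \<open>Nearly optimal feedback strategies\<close>

text \<open>The slacks of the two phases at a level add up to
  \<open>switch m 1 2 + switch m 2 1\<close>. With \<open>e\<close> at most a quarter of this sum,
  the bands in which phase 1 and phase 2 are given up are disjoint, with a wide zone between
  them.\<close>

locale feedback = production_inventory m for m :: "'a inventory" +
  fixes e :: real and i :: nat and x :: real
  assumes e: "0 < e" "4 * e \<le> switch m 1 2 + switch m 2 1"
    and i: "i \<in> {1, 2}" and x: "x \<in> {low m..<cap m}"
begin

text \<open>The loss from switching at once instead of continuing optimally; \<open>3 - c\<close> is
  the other one of phases 1 and 2.\<close>

definition slack :: "nat \<Rightarrow> real \<Rightarrow> real" where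
  "slack c y = val (3 - c) y + switch m c (3 - c) - val c y"

abbreviation kap where "kap \<equiv> switch m 1 2 + switch m 2 1"

lemma other: "c \<in> {1, 2} \<Longrightarrow> 3 - c \<in> {1, 2 :: nat}" "c \<in> {1, 2} \<Longrightarrow> 3 - (3 - c) = (c :: nat)" "c \<in> {1, 2} \<Longrightarrow> c \<noteq> 3 - c"
  by (auto simp: One_nat_def)

lemma slack_other: "c \<in> {1, 2} \<Longrightarrow> slack (3 - c) y = kap - slack c y"
  unfolding slack_def by (auto simp: One_nat_def)

lemma slack_nonneg: "c \<in> {1, 2} \<Longrightarrow> y \<in> {lo..hi} \<Longrightarrow> 0 \<le> slack c y"
  using subvalD(1)[OF val_subval, of c "3 - c" y] other[of c] unfolding slack_def by auto

lemma slack_lipschitz: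
  assumes "c \<in> {1, 2}" shows "\<bar>slack c y - slack c z\<bar> \<le> 2 * lip * \<bar>y - z\<bar>"
  using val_lipschitz[OF assms, of y z] val_lipschitz[OF other(1)[OF assms], of y z] unfolding slack_def by linarith

lemma slack_continuous: "c \<in> {1, 2} \<Longrightarrow> continuous_on A (slack c)"
  unfolding slack_def[abs_def] using val_continuous[of c A] val_continuous[of "3 - c" A] other(1)[of c]
  by (intro continuous_intros) auto

lemma slack_measurable: "c \<in> {1, 2} \<Longrightarrow> slack c \<in> borel_measurable borel"
  by (intro borel_measurable_continuous_onI slack_continuous)

text \<open>The first level at which phase \<open>c\<close> is given up. Inserting \<open>hi\<close>
  makes capacity the default; the set is closed, so the infimum is attained.\<close>

definition next_level :: "nat \<Rightarrow> real \<Rightarrow> real" where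
  "next_level c y = Inf (insert hi {z\<in>{y..hi}. slack c z \<le> e})"

lemma next_level_in: "c \<in> {1, 2} \<Longrightarrow> next_level c y \<in> insert hi {z\<in>{y..hi}. slack c z \<le> e}"
proof -
  assume c: "c \<in> {1, 2}"
  have "closed {z\<in>{y..hi}. slack c z \<le> e}"
    by (intro continuous_on_closed_Collect_le slack_continuous[OF c]) auto
  then have "closed (insert hi {z\<in>{y..hi}. slack c z \<le> e})" by simp
  then show ?thesis
    unfolding next_level_def by (intro closed_contains_Inf) (auto intro!: bdd_belowI[of _ "min y hi"])
qed

lemma next_level_le: "next_level c y \<le> hi" "z \<in> {y..hi} \<Longrightarrow> slack c z \<le> e \<Longrightarrow> next_level c y \<le> z"
  unfolding next_level_def by (auto intro!: cInf_lower bdd_belowI[of _ "min y hi"])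

lemma next_level_ge: "c \<in> {1, 2} \<Longrightarrow> y \<le> hi \<Longrightarrow> y \<le> next_level c y"
  using next_level_in[of c y] by auto

lemma next_level_slack:
  assumes "c \<in> {1, 2}" shows "next_level c y < hi \<Longrightarrow> slack c (next_level c y) \<le> e"
    and "y \<le> z \<Longrightarrow> z < next_level c y \<Longrightarrow> e < slack c z"
  using next_level_in[OF assms, of y] next_level_le[of c y] next_level_le(2)[of z y c] by (auto simp: not_le[symmetric])

lemma next_level_mono: "mono (next_level c)"
proof (rule monoI)
  fix y z :: real assume "y \<le> z"
  then show "next_level c y \<le> next_level c z"
    unfolding next_level_def by (intro cInf_superset_mono) (auto intro!: bdd_belowI[of _ "min y hi"])
qed

lemma next_level_measurable [measurable]: "next_level c \<in> borel_measurable borel"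
  by (rule borel_measurable_mono[OF next_level_mono])

text \<open>A state is a pair of phase and level. Between two demands the controlled state moves along the
  deterministic sequence \<open>traj\<close>; \<open>hold_time\<close> is the time it stays in a state.\<close>

definition settled :: "nat \<times> real \<Rightarrow> bool" where
  "settled p \<longleftrightarrow> (case p of (c, y) \<Rightarrow> c \<in> {1, 2} \<and> y \<in> {lo..<hi} \<and> e < slack c y \<or> c = 0 \<and> y = hi)"

text \<open>When the giving-up level is \<open>hi\<close>, the mandatory switch to phase 0 takes
  precedence. Phase 0 is absorbing here: it is left only at a demand, which is handled
  elsewhere.\<close>

definition hop :: "nat \<times> real \<Rightarrow> nat \<times> real" where
  "hop p = (case p of (c, y) \<Rightarrow> if c = 0 then p else (if next_level c y < hi then 3 - c else 0, next_level c y))"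

definition hold_time :: "nat \<times> real \<Rightarrow> ennreal" where
  "hold_time p = (case p of (c, y) \<Rightarrow> if c = 0 then \<infinity> else ennreal ((next_level c y - y) / rate m c))"

primrec traj :: "nat \<times> real \<Rightarrow> nat \<Rightarrow> nat \<times> real" where
  "traj p 0 = p"
| "traj p (Suc j) = hop (traj p j)"

definition elapsed :: "nat \<times> real \<Rightarrow> nat \<Rightarrow> ennreal" where
  "elapsed p j = (\<Sum>k<j. hold_time (traj p k))"

lemma elapsed_0 [simp]: "elapsed p 0 = 0"
  and elapsed_Suc: "elapsed p (Suc j) = elapsed p j + hold_time (traj p j)"
  by (simp_all add: elapsed_def)

text \<open>Where phase \<open>c\<close> is given up, the other phase has slack at least
  \<open>kap - e\<close>, which is at least \<open>3 * e\<close>, so it is not given up at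
  once.\<close>

lemma settled_hop:
  assumes "settled p" shows "settled (hop p)"
proof -
  obtain c y where p: "p = (c, y)" by (cases p)
  show ?thesis
  proof (cases "c = 0")
    case True
    then show ?thesis using assms unfolding hop_def p by simp
  next
    case False
    then have c: "c \<in> {1, 2}" "y \<in> {lo..<hi}" using assms unfolding settled_def p by auto
    have "e < slack (3 - c) (next_level c y)" if "next_level c y < hi"
      using next_level_slack(1)[OF c(1) that] e unfolding slack_other[OF c(1)] by linarith
    then show ?thesis
      using False other(1)[OF c(1)] next_level_ge[OF c(1), of y] next_level_le(1)[of c y] c(2)
      unfolding p hop_def settled_def by auto
  qed
qed

lemma settled_traj: "settled p \<Longrightarrow> settled (traj p j)"
  by (induction j) (auto intro: settled_hop)

lemma settled_cases:
  assumes "settled p"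
  obtains c y where "p = (c, y)" "c \<in> {1, 2}" "lo \<le> y" "y < hi" "e < slack c y" "y < next_level c y" "next_level c y \<le> hi" 
    "0 < (next_level c y - y) / rate m c" "hold_time p = ennreal ((next_level c y - y) / rate m c)"
    "hop p = (if next_level c y < hi then 3 - c else 0, next_level c y)"
  | "p = (0, hi)" "hold_time p = \<infinity>" "hop p = (0, hi)"
proof -
  obtain c y where p: "p = (c, y)" by (cases p)
  show ?thesis
  proof (cases "c = 0")
    case True
    then show ?thesis using that(2) assms unfolding p settled_def hold_time_def hop_def by simp
  next
    case False
    then have c: "c \<in> {1, 2}" "y \<in> {lo..<hi}" "e < slack c y" using assms unfolding settled_def p by auto
    have "y \<noteq> next_level c y" using next_level_slack(1)[OF c(1), of y] c by auto
    then have "y < next_level c y" using next_level_ge[OF c(1), of y] c by auto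
    then show ?thesis
      using that(1)[OF p c(1)] c False rate_pos[OF c(1)] next_level_le(1)[of c y] unfolding p hold_time_def hop_def by auto
  qed
qed

lemma hold_time_pos: "settled p \<Longrightarrow> 0 < hold_time p"
  by (erule settled_cases) auto

lemma elapsed_strict: "settled p \<Longrightarrow> elapsed p j < \<infinity> \<Longrightarrow> elapsed p j < elapsed p (Suc j)"
  unfolding elapsed_Suc using hold_time_pos[OF settled_traj, of p j] by (simp add: ennreal_add_left_cancel_less[of _ 0, simplified])

lemma elapsed_mono: "j \<le> k \<Longrightarrow> elapsed p j \<le> elapsed p k"
  unfolding elapsed_def by (intro sum_mono2) auto

lemma traj_phase0: "fst (traj p j) = 0 \<Longrightarrow> elapsed p (Suc j) = \<infinity>"
  unfolding elapsed_Suc hold_time_def by (auto simp: split_beta)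

text \<open>A lower bound for the rise of the level between two switches among phases 1 and 2. The
  denominator comes from the Lipschitz constant \<open>2 * lip\<close> of \<open>slack\<close>;
  adding 1 keeps it positive.\<close>

definition theta :: real where
  "theta = e / (2 * (lip + 1))"

lemma theta_pos: "0 < theta"
  unfolding theta_def using e lip_nonneg by simp

text \<open>Between the two switches the slack of the intermediate phase falls from at least
  \<open>kap - e\<close> to at most \<open>e\<close>, hence by more than \<open>e\<close>, and
  \<open>slack\<close> is Lipschitz.\<close>

lemma hop_far:
  assumes p: "settled p" and c: "fst (hop p) \<noteq> 0" and s: "fst (hop (hop p)) \<noteq> 0"
  shows "snd (hop p) + theta \<le> snd (hop (hop p))"
proof -
  have "fst p \<noteq> 0" using c by (auto simp: hop_def split_beta split: if_splits)
  then obtain c y where c': "p = (c, y)" "c \<in> {1, 2}" "hop p = (if next_level c y < hi then 3 - c else 0, next_level c y)"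
    using p by (elim settled_cases) auto
  let ?d = "3 - c" and ?z = "next_level c y"
  have hp: "hop p = (?d, ?z)" "?z < hi" using c c'(3) by (auto split: if_splits)
  have d: "?d \<in> {1, 2}" by (rule other(1)[OF c'(2)])
  have hh: "hop (hop p) = (if next_level ?d ?z < hi then 3 - ?d else 0, next_level ?d ?z)" unfolding hp(1) using d by (auto simp: hop_def)
  then have lt: "next_level ?d ?z < hi" using s by (auto split: if_splits)
  have "slack ?d (next_level ?d ?z) \<le> e" by (rule next_level_slack(1)[OF d lt])
  moreover have "slack c ?z \<le> e" by (rule next_level_slack(1)[OF c'(2) hp(2)])
  ultimately have "e \<le> slack ?d ?z - slack ?d (next_level ?d ?z)" using e unfolding slack_other[OF c'(2)] by linarith
  also have "\<dots> \<le> 2 * lip * \<bar>?z - next_level ?d ?z\<bar>" using slack_lipschitz[OF d, of ?z "next_level ?d ?z"] by linarith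
  also have "\<bar>?z - next_level ?d ?z\<bar> = next_level ?d ?z - ?z" using next_level_ge[OF d, of ?z] hp by auto
  also have "2 * lip * (next_level ?d ?z - ?z) \<le> 2 * (lip + 1) * (next_level ?d ?z - ?z)"
    using next_level_ge[OF d, of ?z] hp by (intro mult_right_mono) auto
  finally have "theta \<le> next_level ?d ?z - ?z" unfolding theta_def using lip_nonneg by (simp add: field_simps)
  then show ?thesis using hp(1) hh by simp
qed

text \<open>Otherwise the level would rise by at least \<open>theta\<close> with each further switch
  and exceed \<open>hi\<close>. This excludes an accumulation of switches.\<close>

lemma traj_stops:
  assumes "settled p" shows "\<exists>j. fst (traj p j) = 0"
proof (rule ccontr)
  assume "\<nexists>j. fst (traj p j) = 0"
  then have nz: "fst (traj p j) \<noteq> 0" for j by simp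
  have "lo + real j * theta \<le> snd (traj p (Suc j))" for j
  proof (induction j)
    case 0
    have "settled (traj p 1)" by (rule settled_traj[OF assms])
    then show ?case using lo_less_hi by (auto elim!: settled_cases simp: One_nat_def)
  next
    case (Suc j)
    have "snd (hop (traj p j)) + theta \<le> snd (hop (hop (traj p j)))"
      by (rule hop_far[OF settled_traj[OF assms]]) (use nz[of "Suc j"] nz[of "Suc (Suc j)"] in auto)
    then show ?case using Suc by (simp add: algebra_simps)
  qed
  moreover have "snd (traj p j) \<le> hi" for j
    using settled_traj[OF assms, of j] by (auto elim!: settled_cases)
  ultimately have "lo + real j * theta \<le> hi" for j by (rule order.trans)
  moreover obtain j where "hi - lo < real j * theta" using reals_Archimedean3[OF theta_pos] by blast
  ultimately show False by (smt (verit))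
qed

section \<open>The decision taken at a demand\<close>

definition decide :: "nat \<Rightarrow> real \<Rightarrow> nat" where
  "decide c y = (if e < slack c y then c else 3 - c)"

text \<open>From phase 0 the exit that attains \<open>wt\<close> may lead into a phase that would be
  given up immediately; \<open>decide\<close> corrects it within the same single switch.\<close>

definition aim :: "nat \<Rightarrow> real \<Rightarrow> nat" where
  "aim c y = decide (if c = 0 then (if switch m 0 1 + val 1 y \<le> switch m 0 2 + val 2 y then 1 else 2) else if c = 1 then 1 else 2) y"

lemma decide_settled:
  assumes "c \<in> {1, 2}" "y \<in> {lo..<hi}" shows "settled (decide c y, y)"
  using assms e other(1)[OF assms(1)] slack_other[OF assms(1), of y] unfolding decide_def settled_def by auto

lemma aim_settled: "c \<in> {0, 1, 2} \<Longrightarrow> y \<in> {lo..<hi} \<Longrightarrow> settled (aim c y, y)"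
  unfolding aim_def by (rule decide_settled) auto

lemma aim_range: "c \<in> {0, 1, 2} \<Longrightarrow> aim c y \<in> {1, 2}"
  unfolding aim_def decide_def by (auto simp: One_nat_def)

text \<open>Correcting the exit from phase 0 amounts to two switches at the price of the direct one;
  the triangle inequality for the switching costs makes the direct one no more expensive. The
  correction itself loses at most \<open>e\<close>, the width of the band.\<close>

lemma aim_loss:
  assumes c: "c \<in> {0, 1, 2}" and a: "aim c y \<noteq> c"
  shows "switch m c (aim c y) + val (aim c y) y \<le> wt val c y + e"
proof -
  have d: "switch m c (decide c y) + val (decide c y) y \<le> val c y + e" if "c \<in> {1, 2}" "decide c y \<noteq> c" for c
    using that unfolding decide_def slack_def by (auto split: if_splits)
  show ?thesis
  proof (cases "c = 0")
    case False
    then show ?thesis using d[of c] c a unfolding aim_def wt_def by auto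
  next
    case True
    define j :: nat where "j = (if switch m 0 1 + val 1 y \<le> switch m 0 2 + val 2 y then 1 else 2)"
    have j: "j \<in> {1, 2}" "wt val c y = switch m 0 j + val j y" "aim c y = decide j y"
      using True unfolding j_def wt_def aim_def by (auto simp: min_def)
    show ?thesis
    proof (cases "decide j y = j")
      case True
      then show ?thesis using j \<open>c = 0\<close> e by simp
    next
      case False
      then have dj: "decide j y = 3 - j" unfolding decide_def by (auto split: if_splits)
      have "{3 - j, j} = {1, 2}" using j(1) by (auto simp: One_nat_def)
      then have "switch m 0 (3 - j) \<le> switch m 0 j + switch m j (3 - j)" using switch_triangle by blast
      then show ?thesis using d[OF j(1) False] j dj \<open>c = 0\<close> by simp
    qed
  qed
qed

abbreviation states :: "(nat \<times> real) measure" where "states \<equiv> count_space UNIV \<Otimes>\<^sub>M borel"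

lemma state_measurable:
  assumes "\<And>c. (\<lambda>y. f (c, y)) \<in> borel \<rightarrow>\<^sub>M M" shows "f \<in> states \<rightarrow>\<^sub>M M"
proof -
  have "(\<lambda>p. (\<lambda>c p. f (c, snd p)) (fst p) p) \<in> states \<rightarrow>\<^sub>M M"
    by (rule measurable_compose_countable) (auto intro: measurable_compose[OF measurable_snd assms])
  then show ?thesis by simp
qed

lemma hop_measurable [measurable]: "hop \<in> states \<rightarrow>\<^sub>M states"
  by (rule state_measurable) (simp add: hop_def)

lemma hold_time_measurable [measurable]: "hold_time \<in> borel_measurable states"
  by (rule state_measurable) (simp add: hold_time_def)

lemma traj_measurable [measurable]: "(\<lambda>p. traj p j) \<in> states \<rightarrow>\<^sub>M states"
  by (induction j) (auto intro: measurable_compose[OF _ hop_measurable])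

lemma elapsed_measurable' [measurable]: "(\<lambda>p. elapsed p j) \<in> borel_measurable states"
  unfolding elapsed_def by measurable

lemma aim_measurable [measurable]: "(\<lambda>p. aim (fst p) (snd p)) \<in> states \<rightarrow>\<^sub>M count_space UNIV"
proof -
  have [measurable]: "val 1 \<in> borel_measurable borel" "val 2 \<in> borel_measurable borel" using bndD(3)[OF val_bnd] by auto
  have d: "decide c \<in> borel \<rightarrow>\<^sub>M count_space UNIV" if "c \<in> {1, 2}" for c
    using slack_measurable[OF that] unfolding decide_def[abs_def] by measurable
  have [measurable]: "decide 1 \<in> borel \<rightarrow>\<^sub>M count_space UNIV" "decide 2 \<in> borel \<rightarrow>\<^sub>M count_space UNIV"
    by (simp_all add: d)
  show ?thesis
  proof (rule state_measurable)
    fix c :: nat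
    have "(\<lambda>y. decide (if c = 0 then (if switch m 0 1 + val 1 y \<le> switch m 0 2 + val 2 y then 1 else 2) else if c = 1 then 1 else 2) y)
        = (\<lambda>y. if (c = 0 \<and> switch m 0 1 + val 1 y \<le> switch m 0 2 + val 2 y) \<or> c = 1 then decide 1 y else decide 2 y)"
      by (auto simp: fun_eq_iff)
    also have "\<dots> \<in> borel \<rightarrow>\<^sub>M count_space UNIV" by measurable
    finally show "(\<lambda>y. aim (fst (c, y)) (snd (c, y))) \<in> borel \<rightarrow>\<^sub>M count_space UNIV"
      by (simp only: aim_def fst_conv snd_conv)
  qed
qed


text \<open>\<open>pre n\<close> and \<open>post n\<close> are the states before and after the decision taken at the \<open>n\<close>-th demand, \<open>cnt n\<close>
  and \<open>base n\<close> the numbers of switches before and after it, and \<open>hops n\<close> is the number of switches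
  strictly between the \<open>n\<close>-th and the next demand.\<close>

primrec stage_state :: "nat \<Rightarrow> 'a \<Rightarrow> (nat \<times> real) \<times> nat" where
  "stage_state 0 \<omega> = ((i, x), 0)"
| "stage_state (Suc n) \<omega> =
     (let p = fst (stage_state n \<omega>); p' = (aim (fst p) (snd p), snd p);
          q = (LEAST j. ennreal (gap n \<omega>) \<le> elapsed p' (Suc j));
          s = traj p' q
      in ((fst s, max lo (snd s + rate m (fst s) * (gap n \<omega> - enn2real (elapsed p' q)) - demand m (Suc n) \<omega>)),
          snd (stage_state n \<omega>) + (if fst p' = fst p then 0 else 1) + q))"

definition pre :: "nat \<Rightarrow> 'a \<Rightarrow> nat \<times> real" where
  "pre n \<omega> = fst (stage_state n \<omega>)"

definition cnt :: "nat \<Rightarrow> 'a \<Rightarrow> nat" where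
  "cnt n \<omega> = snd (stage_state n \<omega>)"

definition post :: "nat \<Rightarrow> 'a \<Rightarrow> nat \<times> real" where
  "post n \<omega> = (aim (fst (pre n \<omega>)) (snd (pre n \<omega>)), snd (pre n \<omega>))"

definition base :: "nat \<Rightarrow> 'a \<Rightarrow> nat" where
  "base n \<omega> = cnt n \<omega> + (if fst (post n \<omega>) = fst (pre n \<omega>) then 0 else 1)"

definition hops :: "nat \<Rightarrow> 'a \<Rightarrow> nat" where
  "hops n \<omega> = (LEAST j. ennreal (gap n \<omega>) \<le> elapsed (post n \<omega>) (Suc j))"

lemma stage_0: "pre 0 \<omega> = (i, x)" "cnt 0 \<omega> = 0"
  unfolding pre_def cnt_def by simp_all

lemma pre_Suc: "pre (Suc n) \<omega> = (let s = traj (post n \<omega>) (hops n \<omega>) in (fst s,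
    max lo (snd s + rate m (fst s) * (gap n \<omega> - enn2real (elapsed (post n \<omega>) (hops n \<omega>))) - demand m (Suc n) \<omega>)))"
  and cnt_Suc: "cnt (Suc n) \<omega> = base n \<omega> + hops n \<omega>"
  unfolding base_def hops_def cnt_def post_def pre_def by (simp_all add: Let_def)

lemma elapsed_reaches: "settled p \<Longrightarrow> \<exists>j. ennreal s \<le> elapsed p (Suc j)"
proof -
  assume "settled p"
  then obtain j where "fst (traj p j) = 0" using traj_stops by blast
  then have "elapsed p (Suc j) = \<infinity>" by (rule traj_phase0)
  then show ?thesis by (intro exI[of _ j]) simp
qed

lemma least_elapsed:
  assumes p: "settled p" and s: "0 < s" and q: "q = (LEAST j. ennreal s \<le> elapsed p (Suc j))"
  shows "ennreal s \<le> elapsed p (Suc q)" "j \<le> q \<Longrightarrow> elapsed p j < ennreal s"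
proof -
  show "ennreal s \<le> elapsed p (Suc q)" unfolding q by (rule LeastI_ex[OF elapsed_reaches[OF p]])
  show "j \<le> q \<Longrightarrow> elapsed p j < ennreal s"
  proof (cases j)
    case 0
    then show ?thesis using s by simp
  next
    case (Suc k)
    moreover assume "j \<le> q"
    ultimately have "k < (LEAST j. ennreal s \<le> elapsed p (Suc j))" unfolding q by simp
    then have "\<not> ennreal s \<le> elapsed p (Suc k)" by (rule not_less_Least)
    then show ?thesis using Suc by simp
  qed
qed

text \<open>Within a stage the level does not exceed the next giving-up level, hence not
  \<open>hi\<close>; the positive demand then brings it strictly below capacity, where
  \<open>aim\<close> yields a settled state.\<close>

lemma stage_invariant:
  assumes \<omega>: "\<omega> \<in> Om"
  shows "fst (pre n \<omega>) \<in> {0, 1, 2}" "snd (pre n \<omega>) \<in> {lo..<hi}" "settled (post n \<omega>)"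
proof -
  have *: "fst (pre n \<omega>) \<in> {0, 1, 2} \<and> snd (pre n \<omega>) \<in> {lo..<hi}" for n
  proof (induction n)
    case 0
    then show ?case using i x by (simp add: stage_0)
  next
    case (Suc n)
    have s: "settled (post n \<omega>)" unfolding post_def by (rule aim_settled) (use Suc in auto)
    note q = least_elapsed[OF s gap_pos[OF \<omega>] hops_def]
    let ?e = "elapsed (post n \<omega>) (hops n \<omega>)"
    have d: "0 < demand m (Suc n) \<omega>" using demand_pos \<omega> by simp
    have lt: "?e < ennreal (gap n \<omega>)" by (rule q(2)) simp
    from settled_traj[OF s, of "hops n \<omega>"] show ?case
    proof (cases rule: settled_cases)
      case (1 c y)
      have f: "?e = ennreal (enn2real ?e)" using less_trans[OF lt ennreal_less_top] by simp
      have "ennreal (gap n \<omega>) \<le> ?e + ennreal ((next_level c y - y) / rate m c)"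
        using q(1) unfolding elapsed_Suc 1(9) .
      then have "ennreal (gap n \<omega>) \<le> ennreal (enn2real ?e + (next_level c y - y) / rate m c)"
        by (subst ennreal_plus) (use 1(8) f in simp_all)
      then have "gap n \<omega> \<le> enn2real ?e + (next_level c y - y) / rate m c"
        by (subst (asm) ennreal_le_iff) (use 1(8) in \<open>simp_all add: add_nonneg_nonneg\<close>)
      then have "rate m c * (gap n \<omega> - enn2real ?e) \<le> next_level c y - y"
        using rate_pos[OF 1(2)] by (simp add: field_simps)
      then have "y + rate m c * (gap n \<omega> - enn2real ?e) \<le> hi" using 1(7) by linarith
      then show ?thesis using 1(1,2) d lo_less_hi unfolding pre_Suc by auto
    next
      case 2
      then show ?thesis using d lo_less_hi rates unfolding pre_Suc by auto
    qed
  qed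
  then show "fst (pre n \<omega>) \<in> {0, 1, 2}" "snd (pre n \<omega>) \<in> {lo..<hi}" by auto
  then show "settled (post n \<omega>)" unfolding post_def by (rule aim_settled)
qed

lemma hops_elapsed:
  assumes "\<omega> \<in> Om"
  shows "ennreal (gap n \<omega>) \<le> elapsed (post n \<omega>) (Suc (hops n \<omega>))"
    and "j \<le> hops n \<omega> \<Longrightarrow> elapsed (post n \<omega>) j < ennreal (gap n \<omega>)"
  using least_elapsed[OF stage_invariant(3)[OF assms] gap_pos[OF assms] hops_def] by auto

text \<open>The time of the \<open>j\<close>-th switch after the \<open>n\<close>-th demand, if no further demand came before.\<close>

definition offset :: "nat \<Rightarrow> 'a \<Rightarrow> nat \<Rightarrow> ennreal" where
  "offset n \<omega> j = ennreal (arr n \<omega>) + elapsed (post n \<omega>) j"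

lemma arr_Suc_ennreal: "\<omega> \<in> Om \<Longrightarrow> ennreal (arr (Suc n) \<omega>) = ennreal (arr n \<omega>) + ennreal (gap n \<omega>)"
  using arr_nonneg[of \<omega> n] gap_pos[of \<omega> n] unfolding arr_Suc by (subst ennreal_plus) auto

lemma offset_hops:
  assumes \<omega>: "\<omega> \<in> Om"
  shows "ennreal (arr (Suc n) \<omega>) \<le> offset n \<omega> (Suc (hops n \<omega>))"
    and "j \<le> hops n \<omega> \<Longrightarrow> offset n \<omega> j < ennreal (arr (Suc n) \<omega>)"
    and "ennreal (arr n \<omega>) \<le> offset n \<omega> j" "offset n \<omega> 0 = ennreal (arr n \<omega>)"
    and "j \<le> hops n \<omega> \<Longrightarrow> offset n \<omega> j < offset n \<omega> (Suc j)"
    and "k \<le> hops n \<omega> \<longleftrightarrow> offset n \<omega> k < ennreal (arr (Suc n) \<omega>)"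
proof -
  note s = stage_invariant(3)[OF \<omega>, of n]
  show 1: "ennreal (arr (Suc n) \<omega>) \<le> offset n \<omega> (Suc (hops n \<omega>))"
    unfolding offset_def arr_Suc_ennreal[OF \<omega>] by (intro add_left_mono hops_elapsed(1)[OF \<omega>])
  show 2: "offset n \<omega> j < ennreal (arr (Suc n) \<omega>)" if "j \<le> hops n \<omega>" for j
    unfolding offset_def arr_Suc_ennreal[OF \<omega>] using hops_elapsed(2)[OF \<omega> that] by (simp add: ennreal_add_left_cancel_less)
  show "ennreal (arr n \<omega>) \<le> offset n \<omega> j" "offset n \<omega> 0 = ennreal (arr n \<omega>)"
    unfolding offset_def by simp_all
  show "j \<le> hops n \<omega> \<Longrightarrow> offset n \<omega> j < offset n \<omega> (Suc j)"
    unfolding offset_def using elapsed_strict[OF s, of j] hops_elapsed(2)[OF \<omega>, of j n]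
    by (simp add: ennreal_add_left_cancel_less less_trans[OF _ ennreal_less_top])
  show "k \<le> hops n \<omega> \<longleftrightarrow> offset n \<omega> k < ennreal (arr (Suc n) \<omega>)"
  proof
    assume "offset n \<omega> k < ennreal (arr (Suc n) \<omega>)"
    then have "offset n \<omega> k < offset n \<omega> (Suc (hops n \<omega>))" using 1 by (rule less_le_trans)
    then have "\<not> Suc (hops n \<omega>) \<le> k" unfolding offset_def using elapsed_mono[of "Suc (hops n \<omega>)" k "post n \<omega>"]
      by (meson add_left_mono leD)
    then show "k \<le> hops n \<omega>" by simp
  qed (rule 2)
qed

lemma cnt_base: "cnt n \<omega> \<le> base n \<omega>" "base n \<omega> \<le> Suc (cnt n \<omega>)" "base n \<omega> \<le> cnt (Suc n) \<omega>"
  unfolding base_def cnt_Suc by simp_all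

lemma cnt_mono: "n \<le> n' \<Longrightarrow> cnt n \<omega> \<le> cnt n' \<omega>"
  by (rule lift_Suc_mono_le[of "\<lambda>n. cnt n \<omega>"]) (rule order.trans[OF cnt_base(1,3)])

section \<open>The feedback strategy as a sequence of switches\<close>

definition stage_of :: "nat \<Rightarrow> 'a \<Rightarrow> nat" where
  "stage_of k \<omega> = (LEAST n. k \<le> cnt (Suc n) \<omega>)"

lemma stage_ofI: "cnt n \<omega> < k \<Longrightarrow> k \<le> cnt (Suc n) \<omega> \<Longrightarrow> stage_of k \<omega> = n"
  unfolding stage_of_def
proof (rule Least_equality)
  fix n' assume "cnt n \<omega> < k" "k \<le> cnt (Suc n') \<omega>"
  then show "n \<le> n'" using cnt_mono[of "Suc n'" n \<omega>] by (cases "n \<le> n'") auto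
qed

lemma stage_of_ex: "0 < k \<Longrightarrow> k \<le> cnt N \<omega> \<Longrightarrow> \<exists>n<N. cnt n \<omega> < k \<and> k \<le> cnt (Suc n) \<omega>"
  by (induction N) (auto simp: stage_0 less_Suc_eq not_less[symmetric])

text \<open>Switch \<open>k\<close> belongs to the stage \<open>n\<close> with
  \<open>cnt n < k \<le> cnt (Suc n)\<close>, and \<open>k - base n\<close> is its position there.
  Position 0 is the decision at the demand; it occurs only if \<open>base n\<close> exceeds
  \<open>cnt n\<close>. If there are fewer than \<open>k\<close> switches, the time is infinite and
  the phase has the default value 0.\<close>

definition plan :: "'a strategy" where
  "plan = \<lparr>stime = \<lambda>k \<omega>. if k = 0 then 0 else if \<exists>n. k \<le> cnt n \<omega>
        then offset (stage_of k \<omega>) \<omega> (k - base (stage_of k \<omega>) \<omega>) else \<infinity>,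
     sphase = \<lambda>k \<omega>. if k = 0 then i else if \<exists>n. k \<le> cnt n \<omega>
        then fst (traj (post (stage_of k \<omega>) \<omega>) (k - base (stage_of k \<omega>) \<omega>)) else 0\<rparr>"

lemma plan_0: "stime plan 0 \<omega> = 0" "sphase plan 0 \<omega> = i"
  unfolding plan_def by simp_all

lemma plan_stage:
  assumes "cnt n \<omega> < k" "k \<le> cnt (Suc n) \<omega>"
  shows "stime plan k \<omega> = offset n \<omega> (k - base n \<omega>)" "sphase plan k \<omega> = fst (traj (post n \<omega>) (k - base n \<omega>))"
    "k - base n \<omega> \<le> hops n \<omega>" "base n \<omega> \<le> k"
proof -
  have "k \<noteq> 0" "\<exists>n. k \<le> cnt n \<omega>" using assms by auto
  then show "stime plan k \<omega> = offset n \<omega> (k - base n \<omega>)" "sphase plan k \<omega> = fst (traj (post n \<omega>) (k - base n \<omega>))"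
    unfolding plan_def using stage_ofI[OF assms] by simp_all
  show "k - base n \<omega> \<le> hops n \<omega>" using assms(2) unfolding cnt_Suc by simp
  show "base n \<omega> \<le> k" using assms(1) cnt_base(2)[of n \<omega>] by simp
qed

lemma plan_never: "\<not> (\<exists>n. k \<le> cnt n \<omega>) \<Longrightarrow> stime plan k \<omega> = \<infinity>"
  unfolding plan_def by (cases "k = 0") auto

lemma plan_late:
  assumes \<omega>: "\<omega> \<in> Om" and k: "cnt n \<omega> < k"
  shows "ennreal (arr n \<omega>) \<le> stime plan k \<omega>"
proof (cases "\<exists>n. k \<le> cnt n \<omega>")
  case True
  then obtain N where N: "cnt N \<omega> < k" "k \<le> cnt (Suc N) \<omega>" using stage_of_ex[of k] k by (metis gr0I not_less_zero)
  have "n \<le> N" using cnt_mono[of "Suc N" n \<omega>] N k by (cases "n \<le> N") auto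
  then have "ennreal (arr n \<omega>) \<le> ennreal (arr N \<omega>)" by (intro ennreal_leI arr_le[OF \<omega>])
  also have "\<dots> \<le> stime plan k \<omega>" unfolding plan_stage(1)[OF N] by (rule offset_hops(3)[OF \<omega>])
  finally show ?thesis .
qed (simp add: plan_never)

text \<open>Position 0 carries no switch when the decision at the demand keeps the phase; the switch
  with that index then happened in an earlier stage, or is the formal one at time 0, so in general
  its time is only bounded. Likewise the switch after the last hop of a stage is known only not to
  precede the next demand.\<close>

lemma plan_inside:
  assumes \<omega>: "\<omega> \<in> Om" and j: "j \<le> hops n \<omega>"
  shows "sphase plan (base n \<omega> + j) \<omega> = fst (traj (post n \<omega>) j)" "stime plan (base n \<omega> + j) \<omega> \<le> offset n \<omega> j"
    "0 < j \<Longrightarrow> stime plan (base n \<omega> + j) \<omega> = offset n \<omega> j"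
    "min (offset n \<omega> (Suc j)) (ennreal (arr (Suc n) \<omega>)) \<le> stime plan (Suc (base n \<omega> + j)) \<omega>"
    "base n \<omega> \<noteq> cnt n \<omega> \<Longrightarrow> stime plan (base n \<omega>) \<omega> = ennreal (arr n \<omega>)"
proof -
  have *: "sphase plan (base n \<omega> + j) \<omega> = fst (traj (post n \<omega>) j) \<and> stime plan (base n \<omega> + j) \<omega> \<le> offset n \<omega> j
      \<and> (0 < j \<or> base n \<omega> \<noteq> cnt n \<omega> \<longrightarrow> stime plan (base n \<omega> + j) \<omega> = offset n \<omega> j)"
    if "j \<le> hops n \<omega>" for j n
    using that
  proof (induction n arbitrary: j)
    case 0
    show ?case
    proof (cases "0 < base 0 \<omega> + j")
      case True
      then show ?thesis using plan_stage[of 0 \<omega> "base 0 \<omega> + j"] 0 by (auto simp: stage_0 cnt_Suc)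
    next
      case False
      then have "base 0 \<omega> = 0" "j = 0" by simp_all
      then show ?thesis using plan_0 by (auto simp: base_def stage_0 post_def split: if_splits)
    qed
  next
    case (Suc n)
    show ?case
    proof (cases "cnt (Suc n) \<omega> < base (Suc n) \<omega> + j")
      case True
      then show ?thesis using plan_stage[of "Suc n" \<omega> "base (Suc n) \<omega> + j"] Suc.prems cnt_Suc[of "Suc n" \<omega>] by auto
    next
      case False
      then have j: "j = 0" "base (Suc n) \<omega> = cnt (Suc n) \<omega>" using cnt_base(1)[of "Suc n" \<omega>] by auto
      have "fst (post (Suc n) \<omega>) = fst (pre (Suc n) \<omega>)" using j(2) unfolding base_def by (auto split: if_splits)
      moreover have "fst (pre (Suc n) \<omega>) = fst (traj (post n \<omega>) (hops n \<omega>))" unfolding pre_Suc by (simp add: Let_def)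
      moreover have "stime plan (base n \<omega> + hops n \<omega>) \<omega> \<le> ennreal (arr (Suc n) \<omega>)"
        using Suc.IH[of "hops n \<omega>"] offset_hops(2)[OF \<omega>, of "hops n \<omega>" n] by (auto intro: order.trans less_imp_le)
      ultimately show ?thesis using Suc.IH[of "hops n \<omega>"] j offset_hops(4)[OF \<omega>] by (simp add: cnt_Suc)
    qed
  qed
  show "sphase plan (base n \<omega> + j) \<omega> = fst (traj (post n \<omega>) j)" "stime plan (base n \<omega> + j) \<omega> \<le> offset n \<omega> j"
    "0 < j \<Longrightarrow> stime plan (base n \<omega> + j) \<omega> = offset n \<omega> j"
    using *[OF j] by auto
  show "base n \<omega> \<noteq> cnt n \<omega> \<Longrightarrow> stime plan (base n \<omega>) \<omega> = ennreal (arr n \<omega>)"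
    using *[of 0 n] offset_hops(4)[OF \<omega>] by simp
  show "min (offset n \<omega> (Suc j)) (ennreal (arr (Suc n) \<omega>)) \<le> stime plan (Suc (base n \<omega> + j)) \<omega>"
  proof (cases "Suc j \<le> hops n \<omega>")
    case True
    then show ?thesis using *[of "Suc j" n] by simp
  next
    case False
    then have "cnt (Suc n) \<omega> < Suc (base n \<omega> + j)" using j unfolding cnt_Suc by simp
    from plan_late[OF \<omega> this] show ?thesis by (simp add: min.coboundedI2)
  qed
qed


lemma plan_at_stage_start: "\<omega> \<in> Om \<Longrightarrow> sphase plan (cnt n \<omega>) \<omega> = fst (pre n \<omega>)"
proof (cases n)
  case 0
  then show ?thesis by (simp add: stage_0 plan_0)
next
  case (Suc n')
  moreover assume "\<omega> \<in> Om"
  ultimately show ?thesis using plan_inside(1)[of \<omega> "hops n' \<omega>" n'] by (simp add: cnt_Suc pre_Suc Let_def)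
qed

lemma plan_step:
  assumes \<omega>: "\<omega> \<in> Om" and fin: "stime plan (Suc k) \<omega> < \<infinity>"
  obtains n j where "k = base n \<omega> + j" "Suc j \<le> hops n \<omega>" "stime plan (Suc k) \<omega> = offset n \<omega> (Suc j)"
      "sphase plan k \<omega> = fst (traj (post n \<omega>) j)" "sphase plan (Suc k) \<omega> = fst (traj (post n \<omega>) (Suc j))"
  | n where "k = cnt n \<omega>" "base n \<omega> = Suc k" "stime plan (Suc k) \<omega> = ennreal (arr n \<omega>)"
      "sphase plan k \<omega> = fst (pre n \<omega>)" "sphase plan (Suc k) \<omega> = fst (post n \<omega>)" "fst (post n \<omega>) \<noteq> fst (pre n \<omega>)"
proof -
  obtain N where "Suc k \<le> cnt N \<omega>" using plan_never[of "Suc k" \<omega>] fin by fastforce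
  then obtain n where n: "cnt n \<omega> < Suc k" "Suc k \<le> cnt (Suc n) \<omega>" using stage_of_ex[of "Suc k"] by blast
  show thesis
  proof (cases "base n \<omega> \<le> k")
    case True
    then obtain j where j: "k = base n \<omega> + j" by (auto simp: le_iff_add)
    then have "Suc j \<le> hops n \<omega>" using n(2) unfolding cnt_Suc by simp
    then show ?thesis using that(1)[of n j] plan_inside(1)[OF \<omega>, of j n] plan_inside(1,3)[OF \<omega>, of "Suc j" n] j by simp
  next
    case False
    then have b: "base n \<omega> = Suc k" "k = cnt n \<omega>" using n(1) cnt_base(2)[of n \<omega>] by auto
    then have "fst (post n \<omega>) \<noteq> fst (pre n \<omega>)" unfolding base_def by (auto split: if_splits)
    then show ?thesis
      using that(2)[of n] b plan_at_stage_start[OF \<omega>, of n] plan_inside(1,5)[OF \<omega>, of 0 n] by simp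
  qed
qed

lemma traj_change: "settled p \<Longrightarrow> elapsed p (Suc j) < \<infinity> \<Longrightarrow> fst (traj p (Suc j)) \<noteq> fst (traj p j)"
proof -
  assume p: "settled p" and fin: "elapsed p (Suc j) < \<infinity>"
  from settled_traj[OF p, of j] show ?thesis
  proof (cases rule: settled_cases)
    case (1 c y)
    then show ?thesis using other(3)[OF 1(2)] by auto
  next
    case 2
    then show ?thesis using traj_phase0[of p j] fin by simp
  qed
qed

lemma plan_spath:
  assumes \<omega>: "\<omega> \<in> Om" shows "spath i plan \<omega>"
proof -
  \<comment> \<open>The exception \<open>k = 0\<close> admits a decision at time 0, which makes the
    first two switching times equal.\<close>
  have lt: "stime plan k \<omega> < stime plan (Suc k) \<omega> \<or> k = 0" if fin: "stime plan (Suc k) \<omega> < \<infinity>" for k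
    using \<omega> fin
  proof (cases rule: plan_step)
    case (1 n j)
    then show ?thesis using plan_inside(2)[OF \<omega>, of j n] offset_hops(5)[OF \<omega>, of j n] by auto
  next
    case (2 n)
    show ?thesis
    proof (cases n)
      case 0
      then show ?thesis using 2 stage_0 by simp
    next
      case (Suc n')
      then have "stime plan k \<omega> \<le> offset n' \<omega> (hops n' \<omega>)" using plan_inside(2)[OF \<omega>, of "hops n' \<omega>" n'] 2(1) by (simp add: cnt_Suc)
      also have "\<dots> < ennreal (arr n \<omega>)" using offset_hops(2)[OF \<omega>, of "hops n' \<omega>" n'] Suc by simp
      finally show ?thesis using 2(3) by simp
    qed
  qed
  have range: "sphase plan k \<omega> \<in> {0, 1, 2}" for k
  proof -
    have "fst (traj (post n \<omega>) j) \<in> {0, 1, 2}" for n j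
      using settled_traj[OF stage_invariant(3)[OF \<omega>, of n], of j] by (auto elim!: settled_cases)
    then show ?thesis using i unfolding plan_def by auto
  qed
  have "finite {k. stime plan k \<omega> \<le> ennreal t}" for t
  proof -
    obtain N where N: "max t 0 < arr (Suc N) \<omega>" using arr_interval[OF \<omega>, of "max t 0"] by auto
    have "\<not> stime plan k \<omega> \<le> ennreal t" if "cnt (Suc N) \<omega> < k" for k
    proof -
      have "ennreal t < ennreal (arr (Suc N) \<omega>)" using N by (simp add: ennreal_lessI)
      also have "\<dots> \<le> stime plan k \<omega>" by (rule plan_late[OF \<omega> that])
      finally show ?thesis by simp
    qed
    then have "{k. stime plan k \<omega> \<le> ennreal t} \<subseteq> {..cnt (Suc N) \<omega>}" by (auto simp: not_less[symmetric])
    then show ?thesis by (rule finite_subset) simp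
  qed
  moreover have "stime plan k \<omega> \<le> stime plan (Suc k) \<omega>" for k
    using lt[of k] plan_0[of \<omega>] by (cases "stime plan (Suc k) \<omega> < \<infinity>") (auto simp: not_less top_unique)
  moreover have "1 \<le> k \<Longrightarrow> stime plan k \<omega> < \<infinity> \<Longrightarrow> stime plan k \<omega> < stime plan (Suc k) \<omega>" for k
    using lt[of k] by (cases "stime plan (Suc k) \<omega> < \<infinity>") (auto simp: not_less top_unique)
  moreover have "sphase plan (Suc k) \<omega> \<noteq> sphase plan k \<omega>" if fin: "stime plan (Suc k) \<omega> < \<infinity>" for k
    using \<omega> fin
  proof (cases rule: plan_step)
    case (1 n j)
    have "elapsed (post n \<omega>) (Suc j) < \<infinity>" using hops_elapsed(2)[OF \<omega> 1(2)] by (rule less_trans) simp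
    then show ?thesis using traj_change[OF stage_invariant(3)[OF \<omega>]] 1 by simp
  qed simp
  ultimately show ?thesis using range plan_0[of \<omega>] \<omega> unfolding spath_def strategy_path_def by blast
qed

lemma offset_real:
  assumes \<omega>: "\<omega> \<in> Om" and j: "j \<le> hops n \<omega>"
  shows "offset n \<omega> j = ennreal (enn2real (offset n \<omega> j))" "enn2real (offset n \<omega> j) = arr n \<omega> + enn2real (elapsed (post n \<omega>) j)"
proof -
  show "offset n \<omega> j = ennreal (enn2real (offset n \<omega> j))"
    using less_trans[OF offset_hops(2)[OF \<omega> j] ennreal_less_top] by simp
  have "elapsed (post n \<omega>) j < top" using less_trans[OF hops_elapsed(2)[OF \<omega> j] ennreal_less_top] .
  then show "enn2real (offset n \<omega> j) = arr n \<omega> + enn2real (elapsed (post n \<omega>) j)"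
    unfolding offset_def using arr_nonneg[OF \<omega>, of n] by (subst enn2real_plus) auto
qed

lemma hop_level:
  assumes p: "settled p" and fin: "elapsed p (Suc j) < \<infinity>"
  shows "snd (traj p (Suc j)) = snd (traj p j) + rate m (fst (traj p j)) * (enn2real (elapsed p (Suc j)) - enn2real (elapsed p j))"
  using settled_traj[OF p, of j]
proof (cases rule: settled_cases)
  case (1 c y)
  have "elapsed p j < \<infinity>" using fin elapsed_mono[of j "Suc j" p] by (auto intro: le_less_trans)
  then have "enn2real (elapsed p (Suc j)) = enn2real (elapsed p j) + (next_level c y - y) / rate m c"
    unfolding elapsed_Suc 1(9) using 1(8) by (subst enn2real_plus) auto
  then show ?thesis using 1 rate_pos[OF 1(2)] by simp
next
  case 2
  then show ?thesis using rates by simp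
qed

lemma plan_level_seg:
  assumes \<omega>: "\<omega> \<in> Om" and la: "level_after m x plan \<omega> n = snd (pre n \<omega>)"
  shows "j \<le> hops n \<omega> \<Longrightarrow> arr n \<omega> \<le> t \<Longrightarrow> offset n \<omega> j \<le> ennreal t \<Longrightarrow> ennreal t \<le> offset n \<omega> (Suc j) \<Longrightarrow> t \<le> arr (Suc n) \<omega> \<Longrightarrow>
    lev x plan \<omega> n t = snd (traj (post n \<omega>) j) + rate m (fst (traj (post n \<omega>) j)) * (t - enn2real (offset n \<omega> j))"
proof -
  note sp = plan_spath[OF \<omega>]
  have step: "lev x plan \<omega> n t = lev x plan \<omega> n (enn2real (offset n \<omega> j)) + rate m (fst (traj (post n \<omega>) j)) * (t - enn2real (offset n \<omega> j))"
    if j: "j \<le> hops n \<omega>" and ta: "arr n \<omega> \<le> t" and t: "offset n \<omega> j \<le> ennreal t" "ennreal t \<le> offset n \<omega> (Suc j)" "t \<le> arr (Suc n) \<omega>" for j t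
  proof -
    note r = offset_real[OF \<omega> j]
    have a: "0 \<le> arr n \<omega>" "arr n \<omega> \<le> enn2real (offset n \<omega> j)" using arr_nonneg[OF \<omega>] unfolding r(2) by simp_all
    have "ennreal (enn2real (offset n \<omega> j)) \<le> ennreal t" using t(1) r(1) by simp
    then have st: "enn2real (offset n \<omega> j) \<le> t" using a ta by (simp add: ennreal_le_iff)
    have "ennreal t \<le> min (offset n \<omega> (Suc j)) (ennreal (arr (Suc n) \<omega>))" using t by (simp add: ennreal_leI)
    then have "ennreal t \<le> stime plan (Suc (base n \<omega> + j)) \<omega>" using plan_inside(4)[OF \<omega> j] by (rule order.trans)
    then show ?thesis
      using lev_seg[OF sp a(2) st, of "base n \<omega> + j" x] plan_inside(1,2)[OF \<omega> j] r(1) by simp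
  qed
  show "j \<le> hops n \<omega> \<Longrightarrow> arr n \<omega> \<le> t \<Longrightarrow> offset n \<omega> j \<le> ennreal t \<Longrightarrow> ennreal t \<le> offset n \<omega> (Suc j) \<Longrightarrow> t \<le> arr (Suc n) \<omega> \<Longrightarrow>
    lev x plan \<omega> n t = snd (traj (post n \<omega>) j) + rate m (fst (traj (post n \<omega>) j)) * (t - enn2real (offset n \<omega> j))"
  proof (induction j arbitrary: t)
    case 0
    have "enn2real (offset n \<omega> 0) = arr n \<omega>" using offset_hops(4)[OF \<omega>] arr_nonneg[OF \<omega>] by simp
    then show ?case using step[OF 0] lev_arr[OF sp, of x n] la by (simp add: post_def)
  next
    case (Suc j)
    let ?s = "enn2real (offset n \<omega> (Suc j))"
    note r = offset_real[OF \<omega> Suc.prems(1)]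
    have j: "j \<le> hops n \<omega>" using Suc.prems(1) by simp
    have fin: "elapsed (post n \<omega>) (Suc j) < \<infinity>" using less_trans[OF hops_elapsed(2)[OF \<omega> Suc.prems(1)] ennreal_less_top] by simp
    have "?s \<le> arr (Suc n) \<omega>"
      using offset_hops(2)[OF \<omega> Suc.prems(1)] arr_nonneg[OF \<omega>, of "Suc n"] by (subst (asm) r(1)) (simp add: ennreal_less_iff)
    then have "lev x plan \<omega> n ?s = snd (traj (post n \<omega>) j) + rate m (fst (traj (post n \<omega>) j)) * (?s - enn2real (offset n \<omega> j))"
      using Suc.IH[OF j, of ?s] offset_hops(5)[OF \<omega> j] r by simp
    also have "\<dots> = snd (traj (post n \<omega>) (Suc j))"
      unfolding hop_level[OF stage_invariant(3)[OF \<omega>] fin] r(2) offset_real(2)[OF \<omega> j] by simp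
    finally show ?case using step[OF Suc.prems] by simp
  qed
qed

lemma plan_level_after: "\<omega> \<in> Om \<Longrightarrow> level_after m x plan \<omega> n = snd (pre n \<omega>)"
proof (induction n)
  case 0
  then show ?case by (simp add: stage_0)
next
  case (Suc n)
  let ?p = "traj (post n \<omega>) (hops n \<omega>)"
  have "lev x plan \<omega> n (arr (Suc n) \<omega>) = snd ?p + rate m (fst ?p) * (arr (Suc n) \<omega> - enn2real (offset n \<omega> (hops n \<omega>)))"
    using offset_hops(2)[OF Suc.prems, of "hops n \<omega>" n] offset_hops(1)[OF Suc.prems] arr_less[OF Suc.prems, of n "Suc n"]
    by (intro plan_level_seg Suc.prems Suc.IH) auto
  also have "arr (Suc n) \<omega> - enn2real (offset n \<omega> (hops n \<omega>)) = gap n \<omega> - enn2real (elapsed (post n \<omega>) (hops n \<omega>))"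
    unfolding offset_real(2)[OF Suc.prems order.refl] arr_Suc by simp
  finally show ?case unfolding level_after_Suc pre_Suc by (simp add: Let_def)
qed

lemma plan_locate:
  assumes \<omega>: "\<omega> \<in> Om" and t: "arr n \<omega> \<le> t" "t < arr (Suc n) \<omega>"
  obtains j where "j \<le> hops n \<omega>" "offset n \<omega> j \<le> ennreal t" "ennreal t < offset n \<omega> (Suc j)" "phase_at plan \<omega> t = fst (traj (post n \<omega>) j)"
    "lev x plan \<omega> n t = snd (traj (post n \<omega>) j) + rate m (fst (traj (post n \<omega>) j)) * (t - enn2real (offset n \<omega> j))"
proof -
  define j where "j = (LEAST j. ennreal t < offset n \<omega> (Suc j))"
  have t0: "0 \<le> t" using arr_nonneg[OF \<omega>, of n] t by linarith
  have tt: "ennreal t < ennreal (arr (Suc n) \<omega>)" using t t0 by (simp add: ennreal_less_iff)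
  have ex: "ennreal t < offset n \<omega> (Suc (hops n \<omega>))" using tt offset_hops(1)[OF \<omega>, of n] by (rule less_le_trans)
  have j1: "ennreal t < offset n \<omega> (Suc j)" unfolding j_def using ex by (rule LeastI)
  have j2: "j \<le> hops n \<omega>" unfolding j_def using ex by (rule Least_le)
  have j3: "offset n \<omega> j \<le> ennreal t"
  proof (cases j)
    case 0
    then show ?thesis using offset_hops(4)[OF \<omega>, of n] t by (simp add: ennreal_leI)
  next
    case (Suc k)
    then have "k < (LEAST j. ennreal t < offset n \<omega> (Suc j))" unfolding j_def by simp
    then have "\<not> ennreal t < offset n \<omega> (Suc k)" by (rule not_less_Least)
    then show ?thesis using Suc by simp
  qed
  have "ennreal t < min (offset n \<omega> (Suc j)) (ennreal (arr (Suc n) \<omega>))" using j1 tt by simp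
  then have "ennreal t < stime plan (Suc (base n \<omega> + j)) \<omega>" using plan_inside(4)[OF \<omega> j2] by (rule less_le_trans)
  then have "phase_at plan \<omega> t = sphase plan (base n \<omega> + j) \<omega>"
    using order.trans[OF plan_inside(2)[OF \<omega> j2] j3] by (intro phase_at_eq[OF plan_spath[OF \<omega>]])
  then have "phase_at plan \<omega> t = fst (traj (post n \<omega>) j)" using plan_inside(1)[OF \<omega> j2] by simp
  then show ?thesis
    using that[OF j2 j3 j1] plan_level_seg[OF \<omega> plan_level_after[OF \<omega>] j2 t(1) j3 less_imp_le[OF j1]] t by simp
qed

text \<open>What the construction is for: in phases 1 and 2 the state remains in the zone where
  switching is strictly suboptimal, so that the drift balance of \<open>val\<close> is an
  equality.\<close>

lemma plan_state:
  assumes \<omega>: "\<omega> \<in> Om" and t: "arr n \<omega> \<le> t" "t < arr (Suc n) \<omega>"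
  shows "phase_at plan \<omega> t \<in> {1, 2} \<and> lev x plan \<omega> n t < hi \<and> e < slack (phase_at plan \<omega> t) (lev x plan \<omega> n t)
    \<or> phase_at plan \<omega> t = 0 \<and> lev x plan \<omega> n t = hi"
proof -
  obtain j where j: "j \<le> hops n \<omega>" "offset n \<omega> j \<le> ennreal t" "ennreal t < offset n \<omega> (Suc j)" "phase_at plan \<omega> t = fst (traj (post n \<omega>) j)"
    "lev x plan \<omega> n t = snd (traj (post n \<omega>) j) + rate m (fst (traj (post n \<omega>) j)) * (t - enn2real (offset n \<omega> j))"
    using plan_locate[OF assms] by blast
  note s = stage_invariant(3)[OF \<omega>, of n]
  note r = offset_real[OF \<omega> j(1)]
  have t0: "0 \<le> t" using arr_nonneg[OF \<omega>, of n] t by linarith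
  have le: "enn2real (offset n \<omega> j) \<le> t" using j(2) t0 by (subst (asm) r(1)) simp
  from settled_traj[OF s, of j] show ?thesis
  proof (cases rule: settled_cases)
    case (1 c y)
    have "offset n \<omega> (Suc j) = offset n \<omega> j + ennreal ((next_level c y - y) / rate m c)"
      unfolding offset_def elapsed_Suc 1(9) by (simp add: add.assoc)
    also have "\<dots> = ennreal (enn2real (offset n \<omega> j) + (next_level c y - y) / rate m c)"
      using 1(8) by (subst ennreal_plus) (use r(1) in simp_all)
    finally have "t < enn2real (offset n \<omega> j) + (next_level c y - y) / rate m c"
      using j(3) t0 by (simp add: ennreal_less_iff)
    then have "rate m c * (t - enn2real (offset n \<omega> j)) < next_level c y - y"
      using rate_pos[OF 1(2)] by (simp add: field_simps)
    moreover have "0 \<le> rate m c * (t - enn2real (offset n \<omega> j))" using rate_pos[OF 1(2)] le by simp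
    ultimately have "y \<le> lev x plan \<omega> n t" "lev x plan \<omega> n t < next_level c y" using j(5) 1(1) by simp_all
    then show ?thesis using next_level_slack(2)[OF 1(2)] 1(1,2,7) j(4) by simp
  next
    case 2
    then show ?thesis using j rates by simp
  qed
qed

lemma plan_good:
  assumes \<omega>: "\<omega> \<in> Om" shows "good i x plan \<omega>"
proof -
  note sp = plan_spath[OF \<omega>]
  have A: "(level m x plan \<omega> t < hi \<longrightarrow> phase_at plan \<omega> t \<in> {1, 2}) \<and> (level m x plan \<omega> t = hi \<longrightarrow> phase_at plan \<omega> t = 0)" if t: "0 \<le> t" for t
  proof -
    obtain n where n: "arr n \<omega> \<le> t" "t < arr (Suc n) \<omega>" using arr_interval[OF \<omega> t] by blast
    then show ?thesis using plan_state[OF \<omega> n] level_lev[OF \<omega> n, of x plan] by auto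
  qed
  have B: "stime plan (Suc k) \<omega> = ennreal (arr (Suc (demand_count m (enn2real (stime plan k \<omega>)) \<omega>)) \<omega>) \<and> sphase plan (Suc k) \<omega> \<in> {1, 2}"
    if k: "stime plan k \<omega> < \<infinity>" "sphase plan k \<omega> = 0" for k
  proof -
    have "k \<noteq> 0" using k(2) plan_0 i by (intro notI) auto
    obtain N where "k \<le> cnt N \<omega>" using plan_never[of k \<omega>] k(1) by fastforce
    then obtain n where n: "cnt n \<omega> < k" "k \<le> cnt (Suc n) \<omega>" using stage_of_ex[of k] \<open>k \<noteq> 0\<close> by blast
    define j where "j = k - base n \<omega>"
    have j: "stime plan k \<omega> = offset n \<omega> j" "fst (traj (post n \<omega>) j) = 0" "j \<le> hops n \<omega>" "k = base n \<omega> + j"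
      using plan_stage[OF n] k(2) unfolding j_def by auto
    \<comment> \<open>Phase 0 is held for an infinite time, so it ends the hops of the stage. The
      next switch is the decision at the following demand, and it leaves phase 0 because
      \<open>aim\<close> takes values 1 and 2 only.\<close>
    have "offset n \<omega> (Suc j) = \<infinity>" unfolding offset_def using traj_phase0[OF j(2)] by simp
    then have "\<not> Suc j \<le> hops n \<omega>" using offset_hops(6)[OF \<omega>, of "Suc j" n] by simp
    then have jh: "j = hops n \<omega>" using j(3) by simp
    have kc: "k = cnt (Suc n) \<omega>" unfolding cnt_Suc using j(4) jh by simp
    have "fst (pre (Suc n) \<omega>) = 0" unfolding pre_Suc using j(2) jh by (simp add: Let_def)
    then have ps: "fst (post (Suc n) \<omega>) \<in> {1, 2}" unfolding post_def using aim_range[of 0] by simp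
    then have b: "base (Suc n) \<omega> = Suc k" unfolding base_def kc using \<open>fst (pre (Suc n) \<omega>) = 0\<close> by auto
    have "stime plan (Suc k) \<omega> = ennreal (arr (Suc n) \<omega>)" "sphase plan (Suc k) \<omega> = fst (post (Suc n) \<omega>)"
      using plan_inside(5)[OF \<omega>, of 0 "Suc n"] plan_inside(1)[OF \<omega>, of 0 "Suc n"] b kc by simp_all
    moreover have "demand_count m (enn2real (stime plan k \<omega>)) \<omega> = n"
    proof (rule demand_count_eq[OF \<omega>])
      show "arr n \<omega> \<le> enn2real (stime plan k \<omega>)" unfolding j(1) offset_real(2)[OF \<omega> j(3)] by simp
      have "ennreal (enn2real (stime plan k \<omega>)) < ennreal (arr (Suc n) \<omega>)"
        using offset_hops(2)[OF \<omega> j(3)] offset_real(1)[OF \<omega> j(3)] unfolding j(1) by simp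
      then show "enn2real (stime plan k \<omega>) < arr (Suc n) \<omega>" by (simp add: ennreal_less_iff)
    qed
    ultimately show ?thesis using ps by simp
  qed
  show ?thesis using sp A B unfolding good_def admissible_path_def by blast
qed


section \<open>Adaptedness of the feedback strategy\<close>

lemma stage_measurable:
  "pre n \<in> hist n \<rightarrow>\<^sub>M states" "cnt n \<in> hist n \<rightarrow>\<^sub>M count_space UNIV"
  "post n \<in> hist n \<rightarrow>\<^sub>M states" "base n \<in> hist n \<rightarrow>\<^sub>M count_space UNIV"
proof -
  have post: "post n \<in> hist n \<rightarrow>\<^sub>M states" if [measurable]: "pre n \<in> hist n \<rightarrow>\<^sub>M states" for n
    unfolding post_def[abs_def] using measurable_compose[OF that aim_measurable] by measurable
  have base: "base n \<in> hist n \<rightarrow>\<^sub>M count_space UNIV"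
    if [measurable]: "pre n \<in> hist n \<rightarrow>\<^sub>M states" "cnt n \<in> hist n \<rightarrow>\<^sub>M count_space UNIV" for n
  proof -
    note [measurable] = post[OF that(1)]
    show ?thesis unfolding base_def[abs_def] by measurable
  qed
  have "pre n \<in> hist n \<rightarrow>\<^sub>M states \<and> cnt n \<in> hist n \<rightarrow>\<^sub>M count_space UNIV"
  proof (induction n)
    case 0
    have "pre 0 = (\<lambda>\<omega>. (i, x))" "cnt 0 = (\<lambda>\<omega>. 0)" by (auto simp: stage_0)
    then show ?case by simp
  next
    case (Suc n)
    let ?H = "hist (Suc n)"
    have [measurable]: "post n \<in> ?H \<rightarrow>\<^sub>M states" "base n \<in> ?H \<rightarrow>\<^sub>M count_space UNIV"
      "gap n \<in> borel_measurable ?H" "demand m (Suc n) \<in> borel_measurable ?H"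
      using measurable_hist_mono[OF post, of n "Suc n"] measurable_hist_mono[OF base, of n "Suc n"] Suc gap_hist[of n "Suc n"] demand_hist[of n "Suc n"]
      by auto
    have [measurable]: "hops n \<in> ?H \<rightarrow>\<^sub>M count_space UNIV"
      unfolding hops_def[abs_def] by measurable
    have [measurable]: "(\<lambda>\<omega>. traj (post n \<omega>) (hops n \<omega>)) \<in> ?H \<rightarrow>\<^sub>M states"
      "(\<lambda>\<omega>. elapsed (post n \<omega>) (hops n \<omega>)) \<in> borel_measurable ?H"
      by (rule measurable_compose_countable; measurable)+
    have "(\<lambda>\<omega>. rate m (fst (traj (post n \<omega>) (hops n \<omega>)))) \<in> borel_measurable ?H" by measurable
    then have "pre (Suc n) \<in> ?H \<rightarrow>\<^sub>M states"
      unfolding pre_Suc[abs_def] Let_def by measurable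
    moreover have "cnt (Suc n) \<in> ?H \<rightarrow>\<^sub>M count_space UNIV" unfolding cnt_Suc[abs_def] by measurable
    ultimately show ?case by blast
  qed
  then show "pre n \<in> hist n \<rightarrow>\<^sub>M states" "cnt n \<in> hist n \<rightarrow>\<^sub>M count_space UNIV" by auto
  then show "post n \<in> hist n \<rightarrow>\<^sub>M states" "base n \<in> hist n \<rightarrow>\<^sub>M count_space UNIV" using post base by auto
qed

text \<open>Whether switch \<open>k\<close> is due in stage \<open>n\<close>, when, and to which
  phase is known at the \<open>n\<close>-th demand; this is \<open>B n\<close>. It fails to happen
  if the next demand comes first, and \<open>D n\<close> tests this once that demand has arrived.
  \<open>hist_filt\<close> places both events, restricted to arrivals up to \<open>t\<close>, in the
  filtration at \<open>t\<close>.\<close>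

lemma plan_event_finite:
  assumes k: "0 < k" and t: "0 \<le> t"
  shows "{\<omega>\<in>Om. sphase plan k \<omega> = c \<and> stime plan k \<omega> \<le> ennreal t} \<in> sets (filt (ennreal t))"
proof -
  define B where "B n = {\<omega>\<in>space (hist n). cnt n \<omega> < k \<and> fst (traj (post n \<omega>) (k - base n \<omega>)) = c \<and> offset n \<omega> (k - base n \<omega>) \<le> ennreal t}" for n
  define D where "D n = {\<omega>\<in>space (hist (Suc n)). ennreal (arr (Suc n) \<omega>) \<le> offset n \<omega> (k - base n \<omega>)}" for n
  have tr: "(\<lambda>\<omega>. traj (post n \<omega>) (k - base n \<omega>)) \<in> hist n \<rightarrow>\<^sub>M states"
    and off: "(\<lambda>\<omega>. offset n \<omega> (k - base n \<omega>)) \<in> borel_measurable (hist n)" for n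
  proof -
    note [measurable] = stage_measurable[of n]
    have [measurable]: "arr n \<in> borel_measurable (hist n)" by (rule arr_hist) simp
    have [measurable]: "(\<lambda>\<omega>. k - base n \<omega>) \<in> hist n \<rightarrow>\<^sub>M count_space UNIV" by measurable
    show "(\<lambda>\<omega>. traj (post n \<omega>) (k - base n \<omega>)) \<in> hist n \<rightarrow>\<^sub>M states"
      by (rule measurable_compose_countable; measurable)
    have "(\<lambda>\<omega>. elapsed (post n \<omega>) (k - base n \<omega>)) \<in> borel_measurable (hist n)"
      by (rule measurable_compose_countable; measurable)
    then show "(\<lambda>\<omega>. offset n \<omega> (k - base n \<omega>)) \<in> borel_measurable (hist n)"
      unfolding offset_def by measurable
  qed
  have Bm: "B n \<in> sets (hist n)" for n
  proof -
    note [measurable] = stage_measurable[of n] tr[of n] off[of n]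
    show ?thesis unfolding B_def by measurable
  qed
  have Dm: "D n \<in> sets (hist (Suc n))" for n
  proof -
    have [measurable]: "(\<lambda>\<omega>. offset n \<omega> (k - base n \<omega>)) \<in> borel_measurable (hist (Suc n))"
      by (rule measurable_hist_mono[OF off]) simp
    have [measurable]: "arr (Suc n) \<in> borel_measurable (hist (Suc n))" by (rule arr_hist) simp
    show ?thesis unfolding D_def by measurable
  qed
  have "{\<omega>\<in>Om. sphase plan k \<omega> = c \<and> stime plan k \<omega> \<le> ennreal t} = (\<Union>n. {\<omega>\<in>B n. arr n \<omega> \<le> t} - {\<omega>\<in>D n. arr (Suc n) \<omega> \<le> t})"
  proof (intro set_eqI iffI)
    fix \<omega> assume "\<omega> \<in> {\<omega>\<in>Om. sphase plan k \<omega> = c \<and> stime plan k \<omega> \<le> ennreal t}"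
    then have \<omega>: "\<omega> \<in> Om" "sphase plan k \<omega> = c" "stime plan k \<omega> \<le> ennreal t" by auto
    obtain N where "k \<le> cnt N \<omega>" using plan_never[of k \<omega>] \<omega>(3) by (fastforce simp: top_unique)
    then obtain n where n: "cnt n \<omega> < k" "k \<le> cnt (Suc n) \<omega>" using stage_of_ex[OF k] by blast
    note p = plan_stage[OF n]
    have "ennreal (arr n \<omega>) \<le> ennreal t"
      using offset_hops(3)[OF \<omega>(1), of n "k - base n \<omega>"] \<omega>(3) unfolding p(1) by (rule order.trans)
    then have "arr n \<omega> \<le> t" using t by simp
    moreover have "\<omega> \<in> B n" unfolding B_def using n \<omega> p by simp
    moreover have "\<omega> \<notin> D n" unfolding D_def using offset_hops(2)[OF \<omega>(1) p(3)] by (auto simp: not_le)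
    ultimately show "\<omega> \<in> (\<Union>n. {\<omega>\<in>B n. arr n \<omega> \<le> t} - {\<omega>\<in>D n. arr (Suc n) \<omega> \<le> t})" by blast
  next
    fix \<omega> assume "\<omega> \<in> (\<Union>n. {\<omega>\<in>B n. arr n \<omega> \<le> t} - {\<omega>\<in>D n. arr (Suc n) \<omega> \<le> t})"
    then obtain n where n: "\<omega> \<in> B n" "\<omega> \<notin> D n \<or> \<not> arr (Suc n) \<omega> \<le> t" by blast
    from n(1) have b: "\<omega> \<in> Om" "cnt n \<omega> < k" "fst (traj (post n \<omega>) (k - base n \<omega>)) = c" "offset n \<omega> (k - base n \<omega>) \<le> ennreal t"
      unfolding B_def by auto
    have "offset n \<omega> (k - base n \<omega>) < ennreal (arr (Suc n) \<omega>)"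
    proof (rule ccontr)
      assume "\<not> offset n \<omega> (k - base n \<omega>) < ennreal (arr (Suc n) \<omega>)"
      then have le: "ennreal (arr (Suc n) \<omega>) \<le> offset n \<omega> (k - base n \<omega>)" by simp
      then have "\<omega> \<in> D n" unfolding D_def using b(1) by simp
      moreover have "arr (Suc n) \<omega> \<le> t" using order.trans[OF le b(4)] t by simp
      ultimately show False using n(2) by blast
    qed
    then have "k - base n \<omega> \<le> hops n \<omega>" using offset_hops(6)[OF b(1)] by blast
    then have "k \<le> cnt (Suc n) \<omega>" unfolding cnt_Suc by simp
    from plan_stage[OF b(2) this] show "\<omega> \<in> {\<omega>\<in>Om. sphase plan k \<omega> = c \<and> stime plan k \<omega> \<le> ennreal t}"
      using b by simp
  qed
  also have "\<dots> \<in> sets (filt (ennreal t))"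
    using hist_filt[OF Bm t] hist_filt[OF Dm t] by blast
  finally show ?thesis .
qed

text \<open>For infinite \<open>t\<close> the event also contains the paths with fewer than
  \<open>k\<close> switches. Their phase is 0 by default, and they form the complement of the events
  with a finite switching time.\<close>

lemma plan_event: "{\<omega>\<in>Om. sphase plan k \<omega> = c \<and> stime plan k \<omega> \<le> t} \<in> sets (filt t)"
proof (cases "k = 0")
  case True
  have "{\<omega>\<in>Om. sphase plan k \<omega> = c \<and> stime plan k \<omega> \<le> t} = (if c = i then Om else {})" using True plan_0 by auto
  then show ?thesis using sets.top[of "filt t"] by simp
next
  case False
  show ?thesis
  proof (cases t)
    case (real r)
    then show ?thesis using plan_event_finite[of k r c] False by simp
  next
    case top
    define G where "G c = (\<Union>N. {\<omega>\<in>Om. sphase plan k \<omega> = c \<and> stime plan k \<omega> \<le> ennreal (real N)})" for c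
    have G: "G c \<in> sets (filt t)" for c
    proof -
      have "{\<omega>\<in>Om. sphase plan k \<omega> = c \<and> stime plan k \<omega> \<le> ennreal (real N)} \<in> sets (filt t)" for N
        using plan_event_finite[of k "real N" c] False filt.sets_F_mono[of "ennreal (real N)" t] top by auto
      then show ?thesis unfolding G_def by blast
    qed
    have fin: "(\<exists>N. stime plan k \<omega> \<le> ennreal (real N)) \<longleftrightarrow> (\<exists>n. k \<le> cnt n \<omega>)" if \<omega>: "\<omega> \<in> Om" for \<omega>
    proof
      assume "\<exists>n. k \<le> cnt n \<omega>"
      then obtain n where n: "cnt n \<omega> < k" "k \<le> cnt (Suc n) \<omega>" using stage_of_ex[of k] False by blast
      have "stime plan k \<omega> \<le> ennreal (arr (Suc n) \<omega>)"
        using offset_hops(2)[OF \<omega> plan_stage(3)[OF n]] unfolding plan_stage(1)[OF n] by (rule less_imp_le)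
      also have "\<dots> \<le> ennreal (real (nat \<lceil>arr (Suc n) \<omega>\<rceil>))" by (intro ennreal_leI) linarith
      finally show "\<exists>N. stime plan k \<omega> \<le> ennreal (real N)" by blast
    next
      assume "\<exists>N. stime plan k \<omega> \<le> ennreal (real N)"
      then have "stime plan k \<omega> \<noteq> \<infinity>" by (auto simp: top_unique)
      then show "\<exists>n. k \<le> cnt n \<omega>" using plan_never[of k \<omega>] by blast
    qed
    have ph: "sphase plan k \<omega> = 0" if "\<not> (\<exists>n. k \<le> cnt n \<omega>)" for \<omega> using that False unfolding plan_def by auto
    have rg: "sphase plan k \<omega> \<in> {0, 1, 2}" if "\<omega> \<in> Om" for \<omega> using sphase_range[OF plan_spath[OF that]] .
    have Gi: "\<omega> \<in> G c' \<longleftrightarrow> \<omega> \<in> Om \<and> sphase plan k \<omega> = c' \<and> (\<exists>n. k \<le> cnt n \<omega>)" for \<omega> c'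
      unfolding G_def using fin[of \<omega>] by blast
    have "{\<omega>\<in>Om. sphase plan k \<omega> = c \<and> stime plan k \<omega> \<le> t} = G c \<union> (if c = 0 then Om - (G 0 \<union> G 1 \<union> G 2) else {})"
    proof (rule set_eqI)
      fix \<omega>
      show "\<omega> \<in> {\<omega>\<in>Om. sphase plan k \<omega> = c \<and> stime plan k \<omega> \<le> t} \<longleftrightarrow> \<omega> \<in> G c \<union> (if c = 0 then Om - (G 0 \<union> G 1 \<union> G 2) else {})"
        using ph[of \<omega>] rg[of \<omega>] top by (cases "\<exists>n. k \<le> cnt n \<omega>") (auto simp: Gi)
    qed
    moreover have "Om \<in> sets (filt t)" using sets.top[of "filt t"] by simp
    ultimately show ?thesis using G by auto
  qed
qed

lemma plan_admissible: "plan \<in> admissible m x i"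
proof -
  have st: "stopping_time filt (stime plan k)" for k
    unfolding stopping_time_def
  proof
    fix t
    have "{\<omega>\<in>Om. stime plan k \<omega> \<le> t} = (\<Union>c\<in>{0, 1, 2}. {\<omega>\<in>Om. sphase plan k \<omega> = c \<and> stime plan k \<omega> \<le> t})"
      using sphase_range[OF plan_spath] by blast
    also have "\<dots> \<in> sets (filt t)" using plan_event by blast
    finally show "Measurable.pred (filt t) (\<lambda>\<omega>. stime plan k \<omega> \<le> t)" unfolding pred_def by simp
  qed
  have "sphase plan k \<in> filt.pre_sigma (stime plan k) \<rightarrow>\<^sub>M count_space {0, 1, 2}" for k
  proof (rule measurable_count_space_eq2[THEN iffD2], simp, intro conjI ballI)
    show "sphase plan k \<in> space (filt.pre_sigma (stime plan k)) \<rightarrow> {0, 1, 2}"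
      using sphase_range[OF plan_spath] by (auto simp: filt.space_pre_sigma)
    fix c :: nat
    show "sphase plan k -` {c} \<inter> space (filt.pre_sigma (stime plan k)) \<in> sets (filt.pre_sigma (stime plan k))"
    proof (rule filt.sets_pre_sigmaI[OF st])
      fix t
      have "{\<omega> \<in> sphase plan k -` {c} \<inter> space (filt.pre_sigma (stime plan k)). stime plan k \<omega> \<le> t}
          = {\<omega>\<in>Om. sphase plan k \<omega> = c \<and> stime plan k \<omega> \<le> t}" by (auto simp: filt.space_pre_sigma)
      then show "{\<omega> \<in> sphase plan k -` {c} \<inter> space (filt.pre_sigma (stime plan k)). stime plan k \<omega> \<le> t} \<in> sets (filt t)"
        using plan_event by simp
    qed
  qed
  moreover have "AE \<omega> in sample m. strategy_path i plan \<omega> \<and> admissible_path m x plan \<omega>"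
    using plan_good unfolding good_def spath_def by (intro AE_I2) blast
  ultimately show ?thesis unfolding admissible_def using st by blast
qed


section \<open>Loss of the feedback strategy\<close>

lemma kap_pos: "0 < kap"
  using e by linarith

text \<open>\<open>seg_val\<close> gives equality only on segments so short that five times
  \<open>lip\<close> times their length stays below the slack. A segment along which the slack is at
  least \<open>e\<close> is cut into finitely many such pieces.\<close>

lemma seg_val_eq:
  assumes c: "c \<in> {1, 2}" and y: "lo \<le> y" "y + rate m c * (t - s) \<le> hi" and st: "s \<le> t"
    and sl: "\<And>z. y \<le> z \<Longrightarrow> z \<le> y + rate m c * (t - s) \<Longrightarrow> e \<le> slack c z"
  shows "ennreal (exp (- disc m * s) * val c y) + (\<integral>\<^sup>+u\<in>{s<..t}. ennreal (exp (- disc m * u) * (intensity m * val c (y + rate m c * (u - s)))) \<partial>lborel)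
      = (\<integral>\<^sup>+u\<in>{s<..t}. ennreal (exp (- disc m * u) * gain val c (y + rate m c * (u - s))) \<partial>lborel)
        + ennreal (exp (- disc m * t) * val c (y + rate m c * (t - s)))"
proof -
  define z where "z u = y + rate m c * (u - s)" for u
  define A where "A u = ennreal (exp (- disc m * u) * val c (z u))" for u
  define f g where "f u = ennreal (exp (- disc m * u) * (intensity m * val c (z u)))"
    and "g u = ennreal (exp (- disc m * u) * gain val c (z u))" for u
  have c0: "c \<in> {0, 1, 2}" using c by auto
  have [measurable]: "gain val c \<in> borel_measurable borel" "val c \<in> borel_measurable borel"
    using c0 c by (auto intro!: gain_measurable val_bnd bndD(3)[OF val_bnd])
  have [measurable]: "f \<in> borel_measurable borel" "g \<in> borel_measurable borel"
    unfolding f_def g_def z_def by measurable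
  note split = nn_integral_greaterThanAtMost_split
  have r: "0 < rate m c" by (rule rate_pos[OF c])
  have zm: "z u \<le> z v" if "u \<le> v" for u v unfolding z_def using r that by simp
  have short: "A s1 + (\<integral>\<^sup>+u\<in>{s1<..t1}. f u \<partial>lborel) = (\<integral>\<^sup>+u\<in>{s1<..t1}. g u \<partial>lborel) + A t1"
    if s1: "s \<le> s1" "s1 \<le> t1" "t1 \<le> t" "5 * lip * (rate m c * (t1 - s1)) \<le> e" for s1 t1
  proof -
    have zz: "z s1 + rate m c * (u - s1) = z u" for u unfolding z_def by (simp add: algebra_simps)
    have "e \<le> slack c (z s1)" using zm[of s s1] zm[of s1 t] s1 by (intro sl) (auto simp: z_def)
    then have "val c (z s1) + 5 * lip * (rate m c * (t1 - s1)) \<le> val (3 - c) (z s1) + switch m c (3 - c)"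
      using s1(4) unfolding slack_def by linarith
    moreover have "lo \<le> z s1" "z t1 \<le> hi" using zm[of s s1] zm[of t1 t] s1 y by (auto simp: z_def)
    ultimately show ?thesis
      using seg_val(2)[of c "z s1" t1 s1 "3 - c"] c other(1,3)[OF c] s1 unfolding zz A_def f_def g_def by simp
  qed
  have "A s1 + (\<integral>\<^sup>+u\<in>{s1<..t1}. f u \<partial>lborel) = (\<integral>\<^sup>+u\<in>{s1<..t1}. g u \<partial>lborel) + A t1"
    if "s \<le> s1" "s1 \<le> t1" "t1 \<le> t" "5 * lip * (rate m c * (t1 - s1)) \<le> e * real N" for s1 t1 N
    using that
  proof (induction N arbitrary: t1)
    case 0
    then show ?case using e by (intro short) auto
  next
    case (Suc N)
    \<comment> \<open>Splits off the last of \<open>Suc N\<close> equal pieces; this piece satisfies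
      the bound of \<open>short\<close>, and the rest that of the induction hypothesis.\<close>
    define r1 where "r1 = s1 + (t1 - s1) * (real N / real (Suc N))"
    have d: "t1 - r1 = (t1 - s1) / real (Suc N)" "r1 - s1 = (t1 - s1) / real (Suc N) * real N"
      unfolding r1_def by (simp_all add: field_simps)
    have r1: "s1 \<le> r1" "r1 \<le> t1"
    proof -
      have "0 \<le> t1 - r1" "0 \<le> r1 - s1" unfolding d using Suc.prems(2) by auto
      then show "s1 \<le> r1" "r1 \<le> t1" by auto
    qed
    have "5 * lip * (rate m c * (t1 - s1)) / real (Suc N) \<le> e" using Suc.prems(4) by (simp add: field_simps)
    moreover have "5 * lip * (rate m c * (t1 - r1)) = 5 * lip * (rate m c * (t1 - s1)) / real (Suc N)" unfolding d by simp
    moreover have "5 * lip * (rate m c * (r1 - s1)) = 5 * lip * (rate m c * (t1 - s1)) / real (Suc N) * real N" unfolding d by simp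
    ultimately have "5 * lip * (rate m c * (t1 - r1)) \<le> e" "5 * lip * (rate m c * (r1 - s1)) \<le> e * real N"
      by (simp, metis mult_right_mono of_nat_0_le_iff)
    then have 1: "A s1 + (\<integral>\<^sup>+u\<in>{s1<..r1}. f u \<partial>lborel) = (\<integral>\<^sup>+u\<in>{s1<..r1}. g u \<partial>lborel) + A r1"
      and 2: "A r1 + (\<integral>\<^sup>+u\<in>{r1<..t1}. f u \<partial>lborel) = (\<integral>\<^sup>+u\<in>{r1<..t1}. g u \<partial>lborel) + A t1"
      using Suc.IH[of r1] short[of r1 t1] Suc.prems r1 by auto
    have "A s1 + (\<integral>\<^sup>+u\<in>{s1<..t1}. f u \<partial>lborel) = (A s1 + (\<integral>\<^sup>+u\<in>{s1<..r1}. f u \<partial>lborel)) + (\<integral>\<^sup>+u\<in>{r1<..t1}. f u \<partial>lborel)"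
      using split[OF r1, of f] by (simp add: add.assoc)
    also have "\<dots> = (\<integral>\<^sup>+u\<in>{s1<..r1}. g u \<partial>lborel) + (A r1 + (\<integral>\<^sup>+u\<in>{r1<..t1}. f u \<partial>lborel))" unfolding 1 by (simp add: add.assoc)
    also have "\<dots> = (\<integral>\<^sup>+u\<in>{s1<..t1}. g u \<partial>lborel) + A t1" unfolding 2 using split[OF r1, of g] by (simp add: add.assoc)
    finally show ?case .
  qed
  moreover obtain N where "5 * lip * (rate m c * (t - s)) \<le> e * real N"
    using reals_Archimedean3[OF e(1)] by (metis less_imp_le mult.commute)
  ultimately have "A s + (\<integral>\<^sup>+u\<in>{s<..t}. f u \<partial>lborel) = (\<integral>\<^sup>+u\<in>{s<..t}. g u \<partial>lborel) + A t"
    using st by blast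
  then show ?thesis unfolding A_def f_def g_def z_def by simp
qed

text \<open>Every switch within the band of width \<open>e\<close> loses at most \<open>e\<close> and lowers \<open>bal\<close> by at least \<open>1\<close>, while
  between switches \<open>bal\<close> grows at a bounded rate. Adding \<open>e * bal\<close> to the value function therefore
  bounds the total loss without counting switches.\<close>

definition bal :: "nat \<Rightarrow> real \<Rightarrow> real" where
  "bal c y = (if c = 0 then 0 else 2 - 2 / kap * slack c y)"

text \<open>A bound for the growth of \<open>e * bal\<close> per unit of time: \<open>bal\<close>
  multiplies \<open>slack\<close> by \<open>2 / kap\<close>, \<open>slack\<close> has Lipschitz
  constant \<open>2 * lip\<close> in the level, and the level grows at most at
  \<open>rate m 1\<close>.\<close>

definition creep :: real where
  "creep = e * (4 * lip / kap * rate m 1)"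

lemma creep_nonneg: "0 \<le> creep"
  unfolding creep_def using e kap_pos lip_nonneg rates by (auto intro!: mult_nonneg_nonneg divide_nonneg_nonneg)

lemma slack_range: "c \<in> {1, 2} \<Longrightarrow> y \<in> {lo..hi} \<Longrightarrow> slack c y \<in> {0..kap}"
  using slack_nonneg[of c y] slack_nonneg[of "3 - c" y] slack_other[of c y] other(1)[of c] by auto

lemma bal_range: "c \<in> {0, 1, 2} \<Longrightarrow> y \<in> {lo..hi} \<Longrightarrow> bal c y \<in> {0..2}"
  using slack_range[of c y] kap_pos unfolding bal_def by (auto simp: field_simps)

text \<open>As \<open>e\<close> is at most \<open>kap / 4\<close>, the phase given up has
  \<open>bal\<close> at least 3/2 and the other phase has \<open>bal\<close> at most 1/2.\<close>

lemma bal_switch: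
  assumes c: "c \<in> {1, 2}" and y: "y \<in> {lo..hi}" and sl: "slack c y \<le> e"
  shows "bal (3 - c) y + 1 \<le> bal c y"
proof -
  have "4 * slack c y \<le> kap" using sl e(2) by linarith
  then have "4 * slack c y / kap \<le> 1" using kap_pos by simp
  moreover have "c \<noteq> 0" "3 - c \<noteq> 0" using c by auto
  moreover have "2 / kap * (kap - slack c y) = 2 - 2 / kap * slack c y" using kap_pos by (simp add: field_simps)
  ultimately show ?thesis unfolding bal_def slack_other[OF c] by simp
qed

text \<open>Linear growth of \<open>bal\<close> is compared with the discounted integral of a
  constant rate, using \<open>1 + disc m * (t - s) \<le> exp (disc m * (t - s))\<close>.\<close>

lemma bal_creep:
  assumes c: "c \<in> {0, 1, 2}" and st: "0 \<le> s" "s \<le> t" and y: "y \<in> {lo..hi}" "y + rate m c * (t - s) \<in> {lo..hi}"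
  shows "ennreal (exp (- disc m * t) * (e * bal c (y + rate m c * (t - s))))
    \<le> ennreal (exp (- disc m * s) * (e * bal c y)) + (\<integral>\<^sup>+u\<in>{s<..t}. ennreal (exp (- disc m * u) * creep) \<partial>lborel)"
proof -
  let ?y = "y + rate m c * (t - s)"
  have "bal c ?y \<le> bal c y + 4 * lip / kap * (rate m 1 * (t - s))"
  proof (cases "c = 0")
    case True
    then show ?thesis using lip_nonneg kap_pos rates st unfolding bal_def by (auto intro!: mult_nonneg_nonneg divide_nonneg_nonneg)
  next
    case False
    then have c': "c \<in> {1, 2}" using c by auto
    have "slack c y - slack c ?y \<le> 2 * lip * (rate m c * (t - s))"
      using slack_lipschitz[OF c', of y ?y] rate_pos[OF c'] st by (simp add: abs_mult)
    also have "\<dots> \<le> 2 * lip * (rate m 1 * (t - s))"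
      using lip_nonneg rate_le[OF c'] st by (intro mult_left_mono mult_right_mono) auto
    finally have "2 / kap * (slack c y - slack c ?y) \<le> 2 / kap * (2 * lip * (rate m 1 * (t - s)))"
      using kap_pos by (intro mult_left_mono) auto
    then show ?thesis using False unfolding bal_def by (simp add: right_diff_distrib)
  qed
  then have "e * bal c ?y \<le> e * (bal c y + 4 * lip / kap * (rate m 1 * (t - s)))" using e by (intro mult_left_mono) auto
  also have "\<dots> = e * bal c y + creep * (t - s)" unfolding creep_def by (simp add: algebra_simps)
  finally have "exp (- disc m * t) * (e * bal c ?y) \<le> exp (- disc m * t) * (e * bal c y + creep * (t - s))" by simp
  also have "\<dots> \<le> exp (- disc m * s) * (e * bal c y) + (exp (- disc m * s) - exp (- disc m * t)) / disc m * creep"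
  proof -
    have "exp (- disc m * t) * (1 + disc m * (t - s)) \<le> exp (- disc m * t) * exp (disc m * (t - s))"
      by (intro mult_left_mono exp_ge_add_one_self) simp
    also have "\<dots> = exp (- disc m * s)" unfolding exp_add[symmetric] by (simp add: algebra_simps)
    finally have "exp (- disc m * t) * (t - s) \<le> (exp (- disc m * s) - exp (- disc m * t)) / disc m"
      using disc_pos by (simp add: field_simps)
    then have "exp (- disc m * t) * (t - s) * creep \<le> (exp (- disc m * s) - exp (- disc m * t)) / disc m * creep"
      by (intro mult_right_mono creep_nonneg)
    moreover have "exp (- disc m * t) * (e * bal c y) \<le> exp (- disc m * s) * (e * bal c y)"
      using bal_range[OF c y(1)] st disc_pos e by (intro mult_right_mono) auto
    ultimately show ?thesis by (simp add: algebra_simps)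
  qed
  finally show ?thesis
    unfolding discount_integral[OF st creep_nonneg]
    using creep_nonneg bal_range[OF c y(1)] e st disc_pos
    by (subst ennreal_plus[symmetric]) (auto intro!: ennreal_leI mult_nonneg_nonneg divide_nonneg_pos simp del: ennreal_plus)
qed

context
  fixes \<omega> :: 'a
  assumes \<omega>: "\<omega> \<in> Om"
begin

lemma xx: "x \<in> {lo..hi}"
  using x by auto

text \<open>Before the end of the segment \<open>plan_state\<close> applies. At the end itself the
  phase may already have changed, so the bound there is obtained by continuity of
  \<open>slack\<close>, at the price of strictness.\<close>

lemma plan_seg_slack:
  assumes s: "arr n \<omega> \<le> s" "s < t" "t \<le> arr (Suc n) \<omega>" and k: "stime plan k \<omega> \<le> ennreal s" "ennreal t \<le> stime plan (Suc k) \<omega>"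
    and c: "sphase plan k \<omega> \<in> {1, 2}" and z: "lev x plan \<omega> n s \<le> z" "z \<le> lev x plan \<omega> n t"
  shows "e \<le> slack (sphase plan k \<omega>) z"
proof -
  note sp = plan_spath[OF \<omega>]
  let ?c = "sphase plan k \<omega>"
  have s0: "0 \<le> s" using arr_nonneg[OF \<omega>, of n] s by linarith
  have lt: "lev x plan \<omega> n u = lev x plan \<omega> n s + rate m ?c * (u - s)" if "s \<le> u" "u \<le> t" for u
    using lev_seg[OF sp s(1) that(1) k(1)] order.trans[OF ennreal_leI[OF that(2)] k(2)] by simp
  have r: "0 < rate m ?c" by (rule rate_pos[OF c])
  have "z \<in> {z. e \<le> slack ?c z}" if "z \<in> {lev x plan \<omega> n s..<lev x plan \<omega> n t}" for z
  proof -
    define u where "u = s + (z - lev x plan \<omega> n s) / rate m ?c"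
    have u: "s \<le> u" "u < t" "lev x plan \<omega> n u = z"
    proof -
      show "s \<le> u" unfolding u_def using that r by simp
      show ut: "u < t" unfolding u_def using that r lt[of t] s by (simp add: field_simps)
      show "lev x plan \<omega> n u = z" using lt[OF \<open>s \<le> u\<close>] ut r unfolding u_def by simp
    qed
    have "ennreal u < ennreal t" using u s0 by (simp add: ennreal_less_iff)
    then have "phase_at plan \<omega> u = ?c"
      using k order.trans[OF k(1) ennreal_leI[OF u(1)]] by (intro phase_at_eq[OF sp]) (auto intro: less_le_trans)
    then show ?thesis using plan_state[OF \<omega>, of n u] u s c by auto
  qed
  then have "{lev x plan \<omega> n s..<lev x plan \<omega> n t} \<subseteq> {z. e \<le> slack ?c z}" by blast
  moreover have "closed {z. e \<le> slack ?c z}"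
    using slack_continuous[OF c, of UNIV] by (intro closed_Collect_le continuous_intros) auto
  ultimately have "closure {lev x plan \<omega> n s..<lev x plan \<omega> n t} \<subseteq> {z. e \<le> slack ?c z}" by (rule closure_minimal)
  moreover have "lev x plan \<omega> n s < lev x plan \<omega> n t" using lt[of t] r s by simp
  ultimately show ?thesis using z by (auto simp: closure_atLeastLessThan)
qed

text \<open>A switch between phases 1 and 2 loses at most \<open>e\<close>, which the drop of
  \<open>bal\<close> by at least 1 covers. A switch to phase 0 loses nothing: the slack at
  \<open>hi\<close> is still at least \<open>e\<close>, so \<open>val_cap\<close> gives
  equality.\<close>

lemma plan_switch_inside:
  assumes t: "arr n \<omega> < t" "t < arr (Suc n) \<omega>" and k: "stime plan (Suc k) \<omega> = ennreal t"
  defines "c \<equiv> sphase plan k \<omega>" and "c' \<equiv> sphase plan (Suc k) \<omega>" and "y \<equiv> lev x plan \<omega> n t"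
  shows "switch m c c' + (vv c' y + e * bal c' y) \<le> vv c y + e * bal c y"
proof -
  note sp = plan_spath[OF \<omega>] and g = plan_good[OF \<omega>]
  note si = switch_inside[OF g xx t k, folded c_def c'_def y_def]
  have t0: "0 \<le> t" using arr_nonneg[OF \<omega>, of n] t by linarith
  have y: "y \<in> {lo..hi}" unfolding y_def using t by (intro lev_bounds[OF g xx]) auto
  have c0: "c \<noteq> 0" using si(1) by auto
  have "stime plan (Suc k) \<omega> < \<infinity>" using k by simp
  with \<omega> show ?thesis
  proof (cases rule: plan_step)
    case (1 n' j)
    have j: "j \<le> hops n' \<omega>" using 1(2) by simp
    have a: "offset n' \<omega> j < ennreal t" "ennreal (arr n' \<omega>) \<le> offset n' \<omega> j" "ennreal t < ennreal (arr (Suc n') \<omega>)"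
      using offset_hops(5)[OF \<omega> j] offset_hops(3)[OF \<omega>] offset_hops(2)[OF \<omega> 1(2)] 1(3) k by simp_all
    then have "arr n' \<omega> < t" "t < arr (Suc n') \<omega>"
      using le_less_trans[OF a(2,1)] arr_nonneg[OF \<omega>] t0 by (simp_all add: ennreal_less_iff)
    then have nn: "n' = n" using demand_count_eq[OF \<omega>, of n' t] demand_count_eq[OF \<omega>, of n t] t by simp
    define s where "s = enn2real (offset n \<omega> j)"
    have s: "offset n \<omega> j = ennreal s" "arr n \<omega> \<le> s" "s < t"
    proof -
      show 1: "offset n \<omega> j = ennreal s" using offset_real(1)[OF \<omega> j] unfolding nn s_def .
      show 2: "arr n \<omega> \<le> s" using offset_real(2)[OF \<omega> j] unfolding nn s_def by simp
      have "0 \<le> s" unfolding s_def by simp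
      then show "s < t" using a(1) unfolding nn 1 by (simp add: ennreal_less_iff)
    qed
    have hb: "j \<le> hops n \<omega>" "Suc j \<le> hops n \<omega>" using j 1(2) nn by auto
    have lt: "lev x plan \<omega> n t = snd (traj (post n \<omega>) (Suc j))"
      using plan_level_seg[OF \<omega> plan_level_after[OF \<omega>] hb(2), of t] t k 1(3) nn offset_hops(5)[OF \<omega> hb(2)] t0 by simp
    have kk: "k = base n \<omega> + j" using 1(1) nn by simp
    have sl: "e \<le> slack c y"
      unfolding c_def y_def
    proof (rule plan_seg_slack[OF s(2,3) less_imp_le[OF t(2)]])
      show "stime plan k \<omega> \<le> ennreal s" using plan_inside(2)[OF \<omega> hb(1)] s(1) kk by simp
      show "lev x plan \<omega> n s \<le> lev x plan \<omega> n t" using s(3) by (intro monoD[OF lev_mono[OF sp]]) auto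
    qed (use k si(1) in \<open>simp_all add: c_def\<close>)
    from settled_traj[OF stage_invariant(3)[OF \<omega>, of n], of j] show ?thesis
    proof (cases rule: settled_cases)
      case A: (1 d z)
      have cd: "c = d" "y = next_level d z" "c' = (if next_level d z < hi then 3 - d else 0)"
        using 1(4,5) A(1,10) lt unfolding c_def c'_def y_def nn by simp_all
      show ?thesis
      proof (cases "next_level d z < hi")
        case True
        then have s2: "slack c y \<le> e" using next_level_slack(1)[OF A(2) True] cd by simp
        have c': "c' = 3 - c" "c' \<noteq> 0" using True cd A(2) by auto
        have "switch m c c' + val c' y \<le> val c y + e" using s2 unfolding c' slack_def by simp
        moreover have "e * (bal c' y + 1) \<le> e * bal c y"
          unfolding c' using e by (intro mult_left_mono bal_switch[OF si(1) y s2]) auto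
        ultimately show ?thesis using c' c0 unfolding vv_def by (simp add: distrib_left)
      next
        case False
        then have c': "c' = 0" "y = hi" using cd A(7) by auto
        have "val c hi < val (3 - c) hi + switch m c (3 - c)" using sl e(1) unfolding c' slack_def by simp
        then have "val c hi = switch m c 0 + idle val" by (intro val_cap[OF si(1) other(1)[OF si(1)] other(3)[OF si(1)]])
        moreover have "0 \<le> e * bal c y" using bal_range[of c y] si(1) y e by (intro mult_nonneg_nonneg) auto
        ultimately show ?thesis using c0 c' unfolding vv_def by (simp add: bal_def)
      qed
    next
      case 2
      then show ?thesis using 1(4) c0 unfolding c_def nn by simp
    qed
  next
    case (2 n')
    then have "t = arr n' \<omega>" using k t0 arr_nonneg[OF \<omega>, of n'] by simp
    then have False using t arr_le[OF \<omega>, of n' n] arr_le[OF \<omega>, of "Suc n" n'] by (cases "n' \<le> n") auto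
    then show ?thesis ..
  qed
qed

lemma plan_phase:
  "phase_at plan \<omega> (arr n \<omega>) = fst (post n \<omega>)" "phL plan \<omega> (arr (Suc n) \<omega>) = fst (pre (Suc n) \<omega>)"
proof -
  note sp = plan_spath[OF \<omega>]
  have "ennreal (arr n \<omega>) < min (offset n \<omega> (Suc 0)) (ennreal (arr (Suc n) \<omega>))"
    using offset_hops(5)[OF \<omega>, of 0 n] offset_hops(4)[OF \<omega>, of n] arr_less[OF \<omega>, of n "Suc n"] arr_nonneg[OF \<omega>, of n] by (simp add: ennreal_less_iff)
  then have "ennreal (arr n \<omega>) < stime plan (Suc (base n \<omega>)) \<omega>"
    by (rule less_le_trans) (use plan_inside(4)[OF \<omega>, of 0 n] in simp)
  then have "phase_at plan \<omega> (arr n \<omega>) = sphase plan (base n \<omega>) \<omega>"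
    using plan_inside(2)[OF \<omega>, of 0 n] offset_hops(4)[OF \<omega>, of n] by (intro phase_at_eq[OF sp]) simp_all
  then show "phase_at plan \<omega> (arr n \<omega>) = fst (post n \<omega>)" using plan_inside(1)[OF \<omega>, of 0 n] by simp
  have "phL plan \<omega> (arr (Suc n) \<omega>) = sphase plan (cnt (Suc n) \<omega>) \<omega>"
  proof (rule phL_eq[OF sp])
    show "stime plan (cnt (Suc n) \<omega>) \<omega> < ennreal (arr (Suc n) \<omega>)"
      unfolding cnt_Suc using plan_inside(2)[OF \<omega> order.refl] offset_hops(2)[OF \<omega> order.refl] by (rule le_less_trans)
    show "ennreal (arr (Suc n) \<omega>) \<le> stime plan (Suc (cnt (Suc n) \<omega>)) \<omega>" by (rule plan_late[OF \<omega>]) simp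
  qed
  then show "phL plan \<omega> (arr (Suc n) \<omega>) = fst (pre (Suc n) \<omega>)" using plan_at_stage_start[OF \<omega>] by simp
qed

lemma plan_swa: "swa plan n \<omega> = (if fst (post n \<omega>) = fst (pre n \<omega>) then 0
    else ennreal (exp (- disc m * arr n \<omega>) * switch m (fst (pre n \<omega>)) (fst (post n \<omega>))))"
proof -
  note sp = plan_spath[OF \<omega>]
  have *: "k = cnt n \<omega> \<and> base n \<omega> = Suc k" if k: "stime plan (Suc k) \<omega> = ennreal (arr n \<omega>)" for k
  proof -
    have "stime plan (Suc k) \<omega> < \<infinity>" using k by simp
    with \<omega> show ?thesis
    proof (cases rule: plan_step)
      case (1 n' j)
      have "offset n' \<omega> 0 \<le> offset n' \<omega> j" using elapsed_mono[of 0 j] unfolding offset_def by simp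
      also have "\<dots> < offset n' \<omega> (Suc j)" using 1(2) by (intro offset_hops(5)[OF \<omega>]) simp
      finally have "ennreal (arr n' \<omega>) < ennreal (arr n \<omega>)" using offset_hops(4)[OF \<omega>, of n'] 1(3) k by simp
      moreover have "ennreal (arr n \<omega>) < ennreal (arr (Suc n') \<omega>)" using offset_hops(2)[OF \<omega> 1(2)] 1(3) k by simp
      ultimately have "arr n' \<omega> < arr n \<omega>" "arr n \<omega> < arr (Suc n') \<omega>" using arr_nonneg[OF \<omega>] by (simp_all add: ennreal_less_iff)
      then have False using arr_le[OF \<omega>, of n n'] arr_le[OF \<omega>, of "Suc n'" n] by (cases "n \<le> n'") auto
      then show ?thesis ..
    next
      case (2 n')
      then have "arr n' \<omega> = arr n \<omega>" using k arr_nonneg[OF \<omega>] by simp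
      then have "n' = n" using arr_less[OF \<omega>, of n n'] arr_less[OF \<omega>, of n' n] by (cases n n' rule: linorder_cases) auto
      then show ?thesis using 2 by simp
    qed
  qed
  show ?thesis
  proof (cases "fst (post n \<omega>) = fst (pre n \<omega>)")
    case True
    then have "base n \<omega> = cnt n \<omega>" unfolding base_def by simp
    then have "{k. stime plan (Suc k) \<omega> = ennreal (arr n \<omega>)} = {}" using * by fastforce
    then show ?thesis unfolding swa_def using True by simp
  next
    case False
    then have b: "base n \<omega> = Suc (cnt n \<omega>)" unfolding base_def by simp
    then have st: "stime plan (Suc (cnt n \<omega>)) \<omega> = ennreal (arr n \<omega>)" using plan_inside(5)[OF \<omega>, of 0 n] by simp
    have "{k. stime plan (Suc k) \<omega> = ennreal (arr n \<omega>)} = {cnt n \<omega>}" using * st by blast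
    then have "swa plan n \<omega> = sterm plan \<omega> (cnt n \<omega>)" unfolding swa_def by (rule ennreal_suminf_single[OF sp])
    then show ?thesis
      unfolding sterm_def st discount_eq[OF sp arr_nonneg[OF \<omega>]] using False plan_at_stage_start[OF \<omega>, of n] plan_inside(1)[OF \<omega>, of 0 n] b by simp
  qed
qed

lemma plan_decision: "swa plan n \<omega> + pot plan x n \<omega> \<le> ennreal (exp (- disc m * arr n \<omega>) * (wt val (fst (pre n \<omega>)) (snd (pre n \<omega>)) + e))"
proof -
  let ?c = "fst (pre n \<omega>)" and ?d = "fst (post n \<omega>)" and ?y = "snd (pre n \<omega>)" and ?E = "exp (- disc m * arr n \<omega>)"
  note s = stage_invariant[OF \<omega>, of n]
  have d: "?d \<in> {1, 2}" "?d = aim ?c ?y" unfolding post_def using aim_range[OF s(1)] by simp_all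
  have P: "pot plan x n \<omega> = ennreal (?E * val ?d ?y)"
    unfolding pot_def plan_phase plan_level_after[OF \<omega>] vv_def using d(1) by auto
  have v: "0 \<le> val ?d ?y" by (rule bndD(1)[OF val_bnd d(1)])
  show ?thesis
  proof (cases "?d = ?c")
    case True
    then show ?thesis using d(1) P e v plan_swa[of n] unfolding wt_def by (auto intro!: ennreal_leI)
  next
    case False
    have "switch m ?c ?d + val ?d ?y \<le> wt val ?c ?y + e" using aim_loss[OF s(1), of ?y] False d(2) by simp
    moreover have "0 \<le> switch m ?c ?d" using False s(1) d(1) by (intro switch_nn) auto
    moreover have "swa plan n \<omega> + pot plan x n \<omega> = ennreal (?E * (switch m ?c ?d + val ?d ?y))"
      using plan_swa[of n] False P v calculation(2) by (simp add: ennreal_plus[symmetric] distrib_left del: ennreal_plus)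
    ultimately show ?thesis by (auto intro!: ennreal_leI mult_left_mono)
  qed
qed

end


text \<open>Per stage: \<open>2 * e\<close> for the maximal value of \<open>e * bal\<close> at its
  start, \<open>creep / disc m\<close> for the discounted growth during it, and \<open>e\<close> for
  the decision at the demand that ends it.\<close>

definition loss :: real where
  "loss = 3 * e + creep / disc m"

lemma loss_nonneg: "0 \<le> loss"
  unfolding loss_def using creep_nonneg e disc_pos by simp

lemma plan_stage_bound:
  assumes \<omega>: "\<omega> \<in> Om"
  shows "occ plan x (gain val) n \<omega> + swi plan n \<omega> + fin plan x vv n \<omega>
    \<le> pot plan x n \<omega> + occ plan x lamval n \<omega> + ennreal (exp (- disc m * arr n \<omega>) * (2 * e + creep / disc m))"
proof -
  note sp = plan_spath[OF \<omega>] and g = plan_good[OF \<omega>] and xx = xx[OF \<omega>]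
  let ?a = "arr n \<omega>" and ?b = "arr (Suc n) \<omega>"
  have a: "0 \<le> ?a" "?a < ?b" by (rule arr_nonneg[OF \<omega>], rule arr_less[OF \<omega>], simp)
  obtain k l where kl: "stime plan k \<omega> \<le> ennreal ?a" "ennreal ?a < stime plan (Suc k) \<omega>"
    "stime plan l \<omega> < ennreal ?b" "ennreal ?b \<le> stime plan (Suc l) \<omega>" "k \<le> l"
    by (rule switch_index[OF sp a])
  let ?P = "\<lambda>k t. ennreal (exp (- disc m * t) * (vv (sphase plan k \<omega>) (lev x plan \<omega> n t) + e * bal (sphase plan k \<omega>) (lev x plan \<omega> n t)))"
  define F where "F u = ennreal (exp (- disc m * u) * lamval (phL plan \<omega> u) (lev x plan \<omega> n u))" for u
  define Q where "Q u = ennreal (exp (- disc m * u) * creep)" for u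
  define G where "G u = ennreal (exp (- disc m * u) * gain val (phL plan \<omega> u) (lev x plan \<omega> n u))" for u
  have m: "F \<in> borel_measurable borel" "G \<in> borel_measurable borel" "Q \<in> borel_measurable borel"
    unfolding F_def[abs_def] G_def[abs_def] Q_def[abs_def]
    by (rule phL_lev_measurable[OF sp], erule lamval_measurable, rule phL_lev_measurable[OF sp], erule gain_measurable[OF val_bnd], measurable)
  have FQ: "(\<integral>\<^sup>+u\<in>{s<..t}. F u + Q u \<partial>lborel) = (\<integral>\<^sup>+u\<in>{s<..t}. F u \<partial>lborel) + (\<integral>\<^sup>+u\<in>{s<..t}. Q u \<partial>lborel)" for s t
    using m by (simp add: distrib_right nn_integral_add)
  have nnv: "0 \<le> exp (- disc m * t) * vv (sphase plan k \<omega>) y" for t k y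
    using vv_bounds(1)[OF sphase_range[OF sp]] by simp
  have nnb: "0 \<le> exp (- disc m * t) * (e * bal (sphase plan k \<omega>) y)" if "y \<in> {lo..hi}" for t k y
    using bal_range[OF sphase_range[OF sp] that] e by simp
  have P: "?P k t = ennreal (exp (- disc m * t) * vv (sphase plan k \<omega>) (lev x plan \<omega> n t)) + ennreal (exp (- disc m * t) * (e * bal (sphase plan k \<omega>) (lev x plan \<omega> n t)))"
    if "?a \<le> t" "t \<le> ?b" for k t
    using nnv nnb[OF lev_bounds[OF g xx that]] by (simp add: distrib_left ennreal_plus[symmetric] del: ennreal_plus)
  have T: "?P k ?a + (\<integral>\<^sup>+u\<in>{?a<..?b}. F u + Q u \<partial>lborel) \<ge> (\<integral>\<^sup>+u\<in>{?a<..?b}. G u \<partial>lborel) + (\<Sum>j\<in>{k<..l}. sterm plan \<omega> (j - 1)) + ?P l ?b"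
  proof (rule telescope[where R = "(\<ge>)", OF sp _ _ _ _ _ a _ _ kl])
    show "(\<lambda>u. F u + Q u) \<in> borel_measurable borel" "G \<in> borel_measurable borel" using m by measurable
    fix k s t assume st: "?a \<le> s" "s < t" "t \<le> ?b" and k: "stime plan k \<omega> \<le> ennreal s" "ennreal t \<le> stime plan (Suc k) \<omega>"
    let ?c = "sphase plan k \<omega>"
    have s0: "0 \<le> s" using a st by linarith
    have lt: "lev x plan \<omega> n t = lev x plan \<omega> n s + rate m ?c * (t - s)" by (rule lev_seg[OF sp st(1) less_imp_le[OF st(2)] k])
    have lb: "lev x plan \<omega> n s \<in> {lo..hi}" "lev x plan \<omega> n t \<in> {lo..hi}"
      using lev_bounds[OF g xx, of n s] lev_bounds[OF g xx, of n t] st by simp_all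
    have 1: "ennreal (exp (- disc m * s) * vv ?c (lev x plan \<omega> n s)) + (\<integral>\<^sup>+u\<in>{s<..t}. F u \<partial>lborel)
        = (\<integral>\<^sup>+u\<in>{s<..t}. G u \<partial>lborel) + ennreal (exp (- disc m * t) * vv ?c (lev x plan \<omega> n t))"
      unfolding F_def G_def
    proof (rule seg_relation[where R = "(=)", OF g xx refl st k])
      assume c: "?c \<in> {1, 2}" and "lo \<le> lev x plan \<omega> n s" "lev x plan \<omega> n s + rate m ?c * (t - s) \<le> hi"
      then show "ennreal (exp (- disc m * s) * val ?c (lev x plan \<omega> n s)) + (\<integral>\<^sup>+u\<in>{s<..t}. ennreal (exp (- disc m * u) * (intensity m * val ?c (lev x plan \<omega> n s + rate m ?c * (u - s)))) \<partial>lborel)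
        = (\<integral>\<^sup>+u\<in>{s<..t}. ennreal (exp (- disc m * u) * gain val ?c (lev x plan \<omega> n s + rate m ?c * (u - s))) \<partial>lborel)
          + ennreal (exp (- disc m * t) * val ?c (lev x plan \<omega> n s + rate m ?c * (t - s)))"
        using st plan_seg_slack[OF \<omega> st k c] lt by (intro seg_val_eq) auto
    qed
    have 2: "ennreal (exp (- disc m * t) * (e * bal ?c (lev x plan \<omega> n t)))
        \<le> ennreal (exp (- disc m * s) * (e * bal ?c (lev x plan \<omega> n s))) + (\<integral>\<^sup>+u\<in>{s<..t}. Q u \<partial>lborel)"
      using bal_creep[OF sphase_range[OF sp] s0 less_imp_le[OF st(2)] lb(1), of k] lb(2) unfolding lt Q_def by simp
    have "(\<integral>\<^sup>+u\<in>{s<..t}. G u \<partial>lborel) + ?P k t = (ennreal (exp (- disc m * s) * vv ?c (lev x plan \<omega> n s)) + (\<integral>\<^sup>+u\<in>{s<..t}. F u \<partial>lborel))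
        + ennreal (exp (- disc m * t) * (e * bal ?c (lev x plan \<omega> n t)))"
      using st unfolding 1 by (subst P) (simp_all add: add.assoc)
    also have "\<dots> \<le> (ennreal (exp (- disc m * s) * vv ?c (lev x plan \<omega> n s)) + (\<integral>\<^sup>+u\<in>{s<..t}. F u \<partial>lborel))
        + (ennreal (exp (- disc m * s) * (e * bal ?c (lev x plan \<omega> n s))) + (\<integral>\<^sup>+u\<in>{s<..t}. Q u \<partial>lborel))"
      by (intro add_left_mono 2)
    also have "\<dots> = ?P k s + (\<integral>\<^sup>+u\<in>{s<..t}. F u + Q u \<partial>lborel)"
      unfolding FQ using st by (subst P) (simp_all add: ac_simps)
    finally show "?P k s + (\<integral>\<^sup>+u\<in>{s<..t}. F u + Q u \<partial>lborel) \<ge> (\<integral>\<^sup>+u\<in>{s<..t}. G u \<partial>lborel) + ?P k t" .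
  next
    fix k t assume t: "?a < t" "t < ?b" and k: "stime plan (Suc k) \<omega> = ennreal t"
    let ?y = "lev x plan \<omega> n t" and ?c = "sphase plan (Suc k) \<omega>"
    have t0: "0 \<le> t" using a t by linarith
    have "0 \<le> vv ?c ?y + e * bal ?c ?y"
      using vv_bounds(1)[OF sphase_range[OF sp]] bal_range[OF sphase_range[OF sp] lev_bounds[OF g xx, of n t], of "Suc k"] t e by (auto intro!: add_nonneg_nonneg)
    from sterm_plus[OF g xx t0 k switch_inside(2)[OF g xx t k] this]
    show "?P k t \<ge> sterm plan \<omega> (Suc k - 1) + ?P (Suc k) t"
      using plan_switch_inside[OF \<omega> t k] by (auto intro!: ennreal_leI mult_left_mono)
  qed (auto intro: add_right_mono)
  have T1: "?P k ?a \<le> pot plan x n \<omega> + ennreal (exp (- disc m * ?a) * (2 * e))"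
  proof -
    have ph: "phase_at plan \<omega> ?a = sphase plan k \<omega>" by (rule phase_at_eq[OF sp kl(1,2)])
    have "bal (sphase plan k \<omega>) (lev x plan \<omega> n ?a) \<le> 2"
      using bal_range[OF sphase_range[OF sp] lev_bounds[OF g xx, of n ?a], of k] a by auto
    then have "e * bal (sphase plan k \<omega>) (lev x plan \<omega> n ?a) \<le> 2 * e" using e by (simp add: mult.commute)
    then have "ennreal (exp (- disc m * ?a) * (e * bal (sphase plan k \<omega>) (lev x plan \<omega> n ?a))) \<le> ennreal (exp (- disc m * ?a) * (2 * e))"
      by (intro ennreal_leI mult_left_mono) auto
    then show ?thesis using a unfolding pot_def ph lev_arr[OF sp, symmetric] by (subst P) (auto intro: add_left_mono)
  qed
  have T2: "fin plan x vv n \<omega> \<le> ?P l ?b"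
  proof -
    have "phL plan \<omega> ?b = sphase plan l \<omega>" by (rule phL_eq[OF sp kl(3,4)])
    then show ?thesis unfolding fin_def level_before_lev using a by (subst P) simp_all
  qed
  have T3: "(\<integral>\<^sup>+u\<in>{?a<..?b}. Q u \<partial>lborel) \<le> ennreal (exp (- disc m * ?a) * (creep / disc m))"
    unfolding Q_def discount_integral[OF a(1) less_imp_le[OF a(2)] creep_nonneg]
    using creep_nonneg disc_pos by (intro ennreal_leI) (simp add: field_simps)
  have T4: "(\<integral>\<^sup>+u\<in>{?a<..?b}. G u \<partial>lborel) = occ plan x (gain val) n \<omega>" "(\<integral>\<^sup>+u\<in>{?a<..?b}. F u \<partial>lborel) = occ plan x lamval n \<omega>"
    unfolding G_def F_def occ_def by simp_all
  have "occ plan x (gain val) n \<omega> + swi plan n \<omega> + fin plan x vv n \<omega>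
      \<le> occ plan x (gain val) n \<omega> + swi plan n \<omega> + ?P l ?b" by (rule add_left_mono[OF T2])
  also have "\<dots> \<le> ?P k ?a + (occ plan x lamval n \<omega> + (\<integral>\<^sup>+u\<in>{?a<..?b}. Q u \<partial>lborel))"
    using T unfolding FQ swi_eq[OF sp kl(1-4)] T4 .
  also have "\<dots> \<le> (pot plan x n \<omega> + ennreal (exp (- disc m * ?a) * (2 * e))) + (occ plan x lamval n \<omega> + ennreal (exp (- disc m * ?a) * (creep / disc m)))"
    by (intro add_mono T1 T3 order.refl)
  also have "\<dots> = pot plan x n \<omega> + occ plan x lamval n \<omega> + (ennreal (exp (- disc m * ?a) * (2 * e)) + ennreal (exp (- disc m * ?a) * (creep / disc m)))"
    by (simp only: ac_simps)
  also have "ennreal (exp (- disc m * ?a) * (2 * e)) + ennreal (exp (- disc m * ?a) * (creep / disc m)) = ennreal (exp (- disc m * ?a) * (2 * e + creep / disc m))"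
    using e creep_nonneg disc_pos by (subst ennreal_plus[symmetric]) (auto simp: distrib_left)
  finally show ?thesis .
qed

text \<open>The error is stated with the discount at \<open>arr n\<close> instead of
  \<open>arr (Suc n)\<close>, which is weaker but matches \<open>plan_stage_bound\<close>, so that
  all errors enter one geometric series.\<close>

lemma plan_demand_bound:
  assumes \<omega>: "\<omega> \<in> Om"
  shows "swa plan (Suc n) \<omega> + pot plan x (Suc n) \<omega> \<le> resume plan x n \<omega> + ennreal (exp (- disc m * arr n \<omega>) * e)"
proof -
  let ?B = "arr (Suc n) \<omega>" and ?p = "pre (Suc n) \<omega>"
  have J: "resume plan x n \<omega> = ennreal (exp (- disc m * ?B) * wt val (fst ?p) (snd ?p))"
    unfolding dem_def plan_phase(2)[OF \<omega>] level_before_lev level_after_Suc[symmetric] plan_level_after[OF \<omega>] ..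
  have w: "0 \<le> wt val (fst ?p) (snd ?p)" by (rule wt_bounds(1)[OF val_bnd stage_invariant(1)[OF \<omega>]])
  have "swa plan (Suc n) \<omega> + pot plan x (Suc n) \<omega> \<le> ennreal (exp (- disc m * ?B) * (wt val (fst ?p) (snd ?p) + e))"
    by (rule plan_decision[OF \<omega>])
  also have "\<dots> = resume plan x n \<omega> + ennreal (exp (- disc m * ?B) * e)"
    unfolding J using w e by (subst ennreal_plus[symmetric]) (auto simp: distrib_left)
  also have "\<dots> \<le> resume plan x n \<omega> + ennreal (exp (- disc m * arr n \<omega>) * e)"
    using arr_le[OF \<omega>, of n "Suc n"] e disc_pos by (intro add_left_mono ennreal_leI mult_right_mono) auto
  finally show ?thesis .
qed

text \<open>The loss of stage \<open>n\<close> has mean at most \<open>loss * ratio ^ n\<close>, and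
  these bounds are summed over all stages. The additional \<open>e\<close> is due to the decision at
  time 0.\<close>

theorem plan_cost: "cost m x plan \<le> ennreal (val i x + e + loss / (1 - ratio))"
proof -
  let ?E = "\<lambda>X. \<integral>\<^sup>+\<omega>. X \<omega> \<partial>sample m"
  note adm = plan_admissible
  have x': "x \<in> {lo..hi}" using x by auto
  note swi = aem_swi[OF adm x'] and swa = aem_swa[OF adm x'] and gn = aem_gain[OF adm x'] and vv = aem_vv[OF adm x']
    and pt = aem_pot[OF adm x'] and add = aem_add[OF adm]
  have mE: "(\<lambda>\<omega>. ennreal (exp (- disc m * arr n \<omega>) * a)) \<in> borel_measurable (sample m)" for n a by measurable
  have EE: "?E (\<lambda>\<omega>. ennreal (exp (- disc m * arr n \<omega>) * a)) = ennreal (a * ratio ^ n)" if "0 \<le> a" for a n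
  proof -
    have "?E (\<lambda>\<omega>. ennreal (exp (- disc m * arr n \<omega>) * a)) = ?E (\<lambda>\<omega>. ennreal a * ennreal (exp (- disc m * arr n \<omega>)))"
      using that by (simp add: ennreal_mult'[symmetric] mult.commute)
    also have "\<dots> = ennreal a * ennreal (ratio ^ n)" using arr_laplace[of n] by (subst nn_integral_cmult) simp_all
    finally show ?thesis using that by (simp add: ennreal_mult')
  qed
  have step: "stage plan x n + ?E (pot plan x (Suc n)) \<le> ?E (pot plan x n) + ennreal (loss * ratio ^ n)" for n
  proof -
    let ?a = "2 * e + creep / disc m"
    have a: "0 \<le> ?a" using e creep_nonneg disc_pos by simp
    have aE: "aem (\<lambda>\<omega>. ennreal (exp (- disc m * arr n \<omega>) * b))" for b by (rule aem_measurable[OF adm mE])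
    have "?E (occ plan x (gain val) n) + ?E (swi plan n) + ?E (fin plan x vv n) = ?E (\<lambda>\<omega>. occ plan x (gain val) n \<omega> + swi plan n \<omega> + fin plan x vv n \<omega>)"
      by (simp only: nn_add[OF adm add[OF gn swi] vv(3)] nn_add[OF adm gn swi])
    also have "\<dots> \<le> ?E (\<lambda>\<omega>. pot plan x n \<omega> + occ plan x lamval n \<omega> + ennreal (exp (- disc m * arr n \<omega>) * ?a))"
      by (intro nn_integral_mono plan_stage_bound) 
    also have "\<dots> = ?E (pot plan x n) + ?E (occ plan x lamval n) + ennreal (?a * ratio ^ n)"
      by (simp only: nn_add[OF adm add[OF pt vv(2)] aE] nn_add[OF adm pt vv(2)] EE[OF a])
    finally have "?E (fin plan x vv n) + (?E (occ plan x (gain val) n) + ?E (swi plan n)) \<le> ?E (fin plan x vv n) + (?E (pot plan x n) + ennreal (?a * ratio ^ n))"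
      unfolding fin_vv[OF adm x'] by (simp only: ac_simps)
    then have 1: "?E (occ plan x (gain val) n) + ?E (swi plan n) \<le> ?E (pot plan x n) + ennreal (?a * ratio ^ n)"
      using fin_finite[OF adm x', of n] by (simp add: ennreal_add_left_cancel_le)
    have "?E (swa plan (Suc n)) + ?E (pot plan x (Suc n)) = ?E (\<lambda>\<omega>. swa plan (Suc n) \<omega> + pot plan x (Suc n) \<omega>)"
      by (rule nn_add[OF adm swa pt, symmetric])
    also have "\<dots> \<le> ?E (\<lambda>\<omega>. resume plan x n \<omega> + ennreal (exp (- disc m * arr n \<omega>) * e))"
      by (intro nn_integral_mono plan_demand_bound)
    also have "\<dots> = ?E (resume plan x n) + ennreal (e * ratio ^ n)"
      using EE[of e n] e nn_add[OF adm jmp_dem(3)[OF adm x'] aE, of n e] by simp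
    finally have 2: "?E (swa plan (Suc n)) + ?E (pot plan x (Suc n)) \<le> ?E (resume plan x n) + ennreal (e * ratio ^ n)" .
    have "stage plan x n + ?E (pot plan x (Suc n)) = ?E (occ plan x run n) + ?E (short plan x n) + ?E (swi plan n) + (?E (swa plan (Suc n)) + ?E (pot plan x (Suc n)))"
      unfolding stage_def[OF adm x'] by (simp only: ac_simps)
    also have "\<dots> \<le> ?E (occ plan x run n) + ?E (short plan x n) + ?E (swi plan n) + (?E (resume plan x n) + ennreal (e * ratio ^ n))"
      by (intro add_left_mono 2)
    also have "\<dots> = ?E (occ plan x (gain val) n) + ?E (swi plan n) + ennreal (e * ratio ^ n)"
      unfolding occ_gain[OF adm x'] by (simp only: ac_simps)
    also have "\<dots> \<le> ?E (pot plan x n) + ennreal (?a * ratio ^ n) + ennreal (e * ratio ^ n)"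
      by (intro add_right_mono 1)
    also have "\<dots> = ?E (pot plan x n) + ennreal (loss * ratio ^ n)"
    proof -
      have "0 \<le> ?a * ratio ^ n" "0 \<le> e * ratio ^ n" using a e ratio(1) by simp_all
      moreover have "?a * ratio ^ n + e * ratio ^ n = loss * ratio ^ n" unfolding loss_def by (simp add: algebra_simps)
      ultimately show ?thesis by (simp add: add.assoc ennreal_plus[symmetric] del: ennreal_plus)
    qed
    finally show ?thesis .
  qed
  have sum: "(\<Sum>n<N. stage plan x n) + ?E (pot plan x N) \<le> ?E (pot plan x 0) + ennreal (\<Sum>n<N. loss * ratio ^ n)" for N
  proof (induction N)
    case (Suc N)
    have "(\<Sum>n<Suc N. stage plan x n) + ?E (pot plan x (Suc N)) = (\<Sum>n<N. stage plan x n) + (stage plan x N + ?E (pot plan x (Suc N)))"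
      by (simp add: add.assoc)
    also have "\<dots> \<le> (\<Sum>n<N. stage plan x n) + (?E (pot plan x N) + ennreal (loss * ratio ^ N))" by (intro add_left_mono step)
    also have "\<dots> \<le> ?E (pot plan x 0) + ennreal (\<Sum>n<N. loss * ratio ^ n) + ennreal (loss * ratio ^ N)"
      using add_right_mono[OF Suc, of "ennreal (loss * ratio ^ N)"] by (simp only: add.assoc)
    also have "\<dots> = ?E (pot plan x 0) + ennreal (\<Sum>n<Suc N. loss * ratio ^ n)"
      using loss_nonneg ratio(1) unfolding add.assoc by (subst ennreal_plus[symmetric]) (auto intro!: sum_nonneg)
    finally show ?case .
  qed simp
  have "(\<Sum>n<N. stage plan x n) \<le> ?E (pot plan x 0) + ennreal (loss / (1 - ratio))" for N
  proof -
    have "(\<Sum>n<N. stage plan x n) \<le> (\<Sum>n<N. stage plan x n) + ?E (pot plan x N)" by simp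
    also have "\<dots> \<le> ?E (pot plan x 0) + ennreal (\<Sum>n<N. loss * ratio ^ n)" by (rule sum)
    also have "(\<Sum>n<N. loss * ratio ^ n) \<le> (\<Sum>n. loss * ratio ^ n)"
      using ratio loss_nonneg by (intro sum_le_suminf summable_mult summable_geometric) auto
    also have "(\<Sum>n. loss * ratio ^ n) = loss / (1 - ratio)"
      using ratio by (subst suminf_mult) (auto intro!: summable_geometric simp: suminf_geometric)
    finally show ?thesis by (simp add: ennreal_leI add_left_mono)
  qed
  then have "(\<Sum>n. stage plan x n) \<le> ?E (pot plan x 0) + ennreal (loss / (1 - ratio))"
    unfolding suminf_eq_SUP by (intro SUP_least)
  then have "cost m x plan \<le> ?E (swa plan 0) + (?E (pot plan x 0) + ennreal (loss / (1 - ratio)))"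
    unfolding cost_stages[OF adm x'] by (rule add_left_mono)
  also have "\<dots> = ?E (\<lambda>\<omega>. swa plan 0 \<omega> + pot plan x 0 \<omega>) + ennreal (loss / (1 - ratio))"
    unfolding nn_add[OF adm swa pt] by (simp only: add.assoc)
  also have "?E (\<lambda>\<omega>. swa plan 0 \<omega> + pot plan x 0 \<omega>) \<le> ?E (\<lambda>\<omega>. ennreal (val i x + e))"
  proof (rule nn_integral_mono)
    fix \<omega> assume \<omega>: "\<omega> \<in> Om"
    have "wt val i x = val i x" using i unfolding wt_def by auto
    then show "swa plan 0 \<omega> + pot plan x 0 \<omega> \<le> ennreal (val i x + e)"
      using plan_decision[OF \<omega>, of 0] by (simp add: stage_0 arr_0[OF \<omega>])
  qed
  also have "?E (\<lambda>\<omega>. ennreal (val i x + e)) = ennreal (val i x + e)" using P.emeasure_space_1 by simp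
  finally show ?thesis
    using bndD(1)[OF val_bnd i, of x] e loss_nonneg ratio by (subst ennreal_plus) (auto simp: add_right_mono)
qed

end

section \<open>Identification of the optimal cost\<close>

context production_inventory
begin

theorem optimal_cost_val:
  assumes x: "x \<in> {lo..<hi}" and i: "i \<in> {1, 2}"
  shows "optimal_cost m i x = val i x"
proof -
  let ?I = "INF \<pi>\<in>admissible m x i. cost m x \<pi>"
  let ?k = "switch m 1 2 + switch m 2 1"
  \<comment> \<open>Chosen such that the total loss of the feedback strategy,
    \<open>e + loss / (1 - ratio)\<close>, is exactly \<open>e * C\<close>. In particular
    \<open>C\<close> does not depend on \<open>e\<close>.\<close>
  define C where "C = 1 + (3 + 4 * lip / ?k * rate m 1 / disc m) / (1 - ratio)"
  have "0 \<le> 4 * lip / ?k * rate m 1 / disc m"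
    using lip_nonneg switch_pos rates disc_pos by simp
  then have C: "0 < C"
    unfolding C_def using ratio by (intro add_pos_nonneg divide_nonneg_pos) auto
  have v: "0 \<le> val i x" by (rule bndD(1)[OF val_bnd i])
  have "?I \<le> ennreal (val i x) + ennreal \<delta>" if d: "0 < \<delta>" for \<delta>
  proof -
    define e where "e = min (?k / 4) (\<delta> / C)"
    have e: "0 < e" "4 * e \<le> ?k" "e * C \<le> \<delta>" unfolding e_def using switch_pos d C by (auto simp: min_def field_simps)
    interpret fb: feedback m e i x using e i x by unfold_locales
    have "e + fb.loss / (1 - ratio) = e * C" unfolding fb.loss_def fb.creep_def C_def by (simp add: algebra_simps add_divide_distrib)
    then have "val i x + e + fb.loss / (1 - ratio) \<le> val i x + \<delta>" using e(3) by linarith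
    have "?I \<le> cost m x fb.plan" by (rule INF_lower[OF fb.plan_admissible])
    also have "\<dots> \<le> ennreal (val i x + e + fb.loss / (1 - ratio))" by (rule fb.plan_cost)
    also have "\<dots> \<le> ennreal (val i x + \<delta>)" by (rule ennreal_leI) fact
    also have "\<dots> = ennreal (val i x) + ennreal \<delta>" using v d by simp
    finally show ?thesis .
  qed
  then have "?I \<le> ennreal (val i x)" by (rule ennreal_le_epsilon)
  moreover have "ennreal (val i x) \<le> ?I" by (rule INF_greatest) (rule val_le_cost[OF _ x i])
  ultimately have "?I = ennreal (val i x)" by (rule antisym)
  then show ?thesis unfolding optimal_cost_def using v by simp
qed

subsection \<open>The viscosity property\<close>

lemma optimal_cost_ext_val:
  assumes i: "i \<in> {1, 2}" and y: "y \<in> {lo..hi}"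
  shows "optimal_cost_ext m i y = val i y"
proof (cases "y = hi")
  case False
  then show ?thesis using y optimal_cost_val[OF _ i, of y] unfolding optimal_cost_ext_def by simp
next
  case True
  have "isCont (val i) hi" using val_continuous[OF i, of UNIV] by (simp add: continuous_on_eq_continuous_at)
  then have "(val i \<longlongrightarrow> val i hi) (at_left hi)" unfolding isCont_def by (rule filterlim_mono) (auto simp: at_le)
  moreover have "eventually (\<lambda>z. optimal_cost m i z = val i z) (at_left hi)"
    using eventually_at_left_real[OF lo_less_hi] by eventually_elim (auto intro!: optimal_cost_val i)
  ultimately have "(optimal_cost m i \<longlongrightarrow> val i hi) (at_left hi)" by (simp add: filterlim_cong)
  then have "Lim (at_left hi) (optimal_cost m i) = val i hi" by (intro tendsto_Lim) auto
  then show ?thesis using True unfolding optimal_cost_ext_def by simp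
qed

lemma mean_after_demand_continuous:
  assumes c: "c \<in> {1, 2}"
  shows "continuous_on A (\<lambda>y. \<integral>\<alpha>. wt val c (max lo (y - \<alpha>)) \<partial>dlaw)"
proof (rule lipschitz_on_continuous_on[OF lipschitz_onI])
  have c0: "c \<in> {0, 1, 2}" "c \<noteq> 0" using c by auto
  fix y z
  have "\<bar>(\<integral>\<alpha>. wt val c (max lo (y - \<alpha>)) \<partial>dlaw) - (\<integral>\<alpha>. wt val c (max lo (z - \<alpha>)) \<partial>dlaw)\<bar>
      = \<bar>\<integral>\<alpha>. wt val c (max lo (y - \<alpha>)) - wt val c (max lo (z - \<alpha>)) \<partial>dlaw\<bar>"
    by (subst Bochner_Integration.integral_diff) (auto intro: wt_integrable[OF val_bnd c0(1)])
  also have "\<dots> \<le> (\<integral>\<alpha>. \<bar>wt val c (max lo (y - \<alpha>)) - wt val c (max lo (z - \<alpha>))\<bar> \<partial>dlaw)"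
    by (rule integral_abs_bound)
  also have "\<dots> \<le> (\<integral>\<alpha>. lip * \<bar>y - z\<bar> \<partial>dlaw)"
  proof (intro integral_mono integrable_abs Bochner_Integration.integrable_diff wt_integrable[OF val_bnd c0(1)])
    fix \<alpha>
    have "\<bar>wt val c (max lo (y - \<alpha>)) - wt val c (max lo (z - \<alpha>))\<bar> \<le> lip * \<bar>max lo (y - \<alpha>) - max lo (z - \<alpha>)\<bar>"
      unfolding wt_def using c0(2) val_lipschitz[OF c] by simp
    also have "\<dots> \<le> lip * \<bar>y - z\<bar>" by (intro mult_left_mono lip_nonneg) auto
    finally show "\<bar>wt val c (max lo (y - \<alpha>)) - wt val c (max lo (z - \<alpha>))\<bar> \<le> lip * \<bar>y - z\<bar>" .
  qed simp
  finally show "dist (\<integral>\<alpha>. wt val c (max lo (y - \<alpha>)) \<partial>dlaw) (\<integral>\<alpha>. wt val c (max lo (z - \<alpha>)) \<partial>dlaw) \<le> lip * dist y z"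
    using law.prob_space by (simp add: dist_real_def)
qed (rule lip_nonneg)

text \<open>The holding cost and the expected penalty may jump, and for both only right-continuity
  is known; the mean of \<open>val\<close> after a demand is Lipschitz in the level.\<close>

lemma gain_val_continuous_right:
  assumes c: "c \<in> {1, 2}" and x: "x \<in> {lo..<hi}"
  shows "continuous (at_right x) (gain val c)"
proof -
  have "continuous (at_right x) (\<lambda>y. \<integral>\<alpha>. wt val c (max lo (y - \<alpha>)) \<partial>dlaw)"
    using mean_after_demand_continuous[OF c, of "{x..}"] by (auto simp: continuous_on_eq_continuous_within intro: continuous_within_subset)
  then show ?thesis
    unfolding gain_def[abs_def] jmp_def using run_continuous_right[OF c x] penalty_right_continuous x
    by (intro continuous_intros) auto
qed

text \<open>The operator treats demands that are met and demands that empty the stock down to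
  \<open>lo\<close> in separate terms. Clipping at \<open>lo\<close> merges them into one integral
  against \<open>dlaw\<close>, and positivity of the demands justifies the lower limit 0 of the
  first.\<close>

lemma hjb_op_eq:
  assumes i: "i \<in> {1, 2}" and x: "x \<in> {lo..<hi}" and \<psi>: "continuous_on {lo..hi} \<psi>"
  shows "hjb_op m i \<psi> x = rate m i * vector_derivative \<psi> (at x within {lo..hi}) - tot * \<psi> x + run i x
    + intensity m * (expected_penalty m x + (\<integral>\<alpha>. \<psi> (clip (x - \<alpha>)) \<partial>dlaw))"
    and "integrable dlaw (\<lambda>\<alpha>. \<psi> (clip (x - \<alpha>)))"
proof -
  define \<phi> where "\<phi> z = \<psi> (clip z)" for z
  have "continuous_on UNIV \<phi>"
    unfolding \<phi>_def by (rule continuous_on_compose2[OF \<psi>]) (use lo_less_hi in \<open>auto simp: clip_def intro!: continuous_intros\<close>)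
  then have [measurable]: "\<phi> \<in> borel_measurable borel" by (rule borel_measurable_continuous_onI)
  have "bounded (\<psi> ` {lo..hi})" by (intro compact_imp_bounded compact_continuous_image \<psi> compact_Icc)
  then obtain B where "\<forall>y\<in>\<psi> ` {lo..hi}. norm y \<le> B" unfolding bounded_iff by blast
  then have B: "norm (\<phi> z) \<le> B" for z by (simp add: \<phi>_def)
  have int: "integrable dlaw (\<lambda>\<alpha>. \<phi> (x - \<alpha>))"
    by (rule law.integrable_const_bound[of _ B]) (auto intro!: AE_I2 B[simplified])
  then show "integrable dlaw (\<lambda>\<alpha>. \<psi> (clip (x - \<alpha>)))" unfolding \<phi>_def .
  have int1: "integrable dlaw (\<lambda>\<alpha>. indicator {0..x - lo} \<alpha> * \<phi> (x - \<alpha>))"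
    using integrable_mult_indicator[OF _ int, of "{0..x - lo}"] by simp
  have int2: "integrable dlaw (\<lambda>\<alpha>. indicator {x - lo<..} \<alpha> * \<psi> lo)"
    by (intro integrable_mult_left integrable_real_indicator) (auto simp: less_top[symmetric])
  have "(\<integral>\<alpha>. \<phi> (x - \<alpha>) \<partial>dlaw) = (\<integral>\<alpha>. indicator {0..x - lo} \<alpha> * \<phi> (x - \<alpha>) + indicator {x - lo<..} \<alpha> * \<psi> lo \<partial>dlaw)"
  proof (rule integral_cong_AE)
    show "AE \<alpha> in dlaw. \<phi> (x - \<alpha>) = indicator {0..x - lo} \<alpha> * \<phi> (x - \<alpha>) + indicator {x - lo<..} \<alpha> * \<psi> lo"
      using AE_dlaw_pos
    proof eventually_elim
      case (elim \<alpha>)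
      have "clip (x - \<alpha>) = lo" if "x - lo < \<alpha>" using that x elim unfolding clip_def by auto
      then show ?case using elim unfolding \<phi>_def by (auto simp: indicator_def)
    qed
  qed simp_all
  also have "\<dots> = (\<integral>\<alpha>. indicator {0..x - lo} \<alpha> * \<phi> (x - \<alpha>) \<partial>dlaw) + (\<integral>\<alpha>. indicator {x - lo<..} \<alpha> * \<psi> lo \<partial>dlaw)"
    by (rule Bochner_Integration.integral_add[OF int1 int2])
  also have "(\<integral>\<alpha>. indicator {0..x - lo} \<alpha> * \<phi> (x - \<alpha>) \<partial>dlaw) = (LINT \<alpha>:{0..x - lo}|dlaw. \<psi> (x - \<alpha>))"
    unfolding set_lebesgue_integral_def \<phi>_def using x by (intro Bochner_Integration.integral_cong) (auto simp: indicator_def)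
  also have "(\<integral>\<alpha>. indicator {x - lo<..} \<alpha> * \<psi> lo \<partial>dlaw) = \<psi> lo * (1 - cdf dlaw (x - lo))"
  proof -
    have "{x - lo<..} = space dlaw - {..x - lo}" by auto
    then have "measure dlaw {x - lo<..} = 1 - cdf dlaw (x - lo)" unfolding cdf_def by (simp only: law.prob_compl sets_dlaw atMost_borel)
    then show ?thesis by simp
  qed
  finally have split: "(\<integral>\<alpha>. \<psi> (clip (x - \<alpha>)) \<partial>dlaw) = (LINT \<alpha>:{0..x - lo}|dlaw. \<psi> (x - \<alpha>)) + \<psi> lo * (1 - cdf dlaw (x - lo))"
    unfolding \<phi>_def .
  show "hjb_op m i \<psi> x = rate m i * vector_derivative \<psi> (at x within {lo..hi}) - tot * \<psi> x + run i x
    + intensity m * (expected_penalty m x + (\<integral>\<alpha>. \<psi> (clip (x - \<alpha>)) \<partial>dlaw))"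
    unfolding hjb_op_def split using i x by (auto simp: run_def distrib_left)
qed

text \<open>Comparing a test function with the dynamic programming inequality over \<open>[x, r]\<close> and letting \<open>r\<close>
  decrease to \<open>x\<close> gives the sign of the one-sided derivative computed here.\<close>

lemma test_derivative:
  assumes i: "i \<in> {1, 2}" and x: "x \<in> {lo..<hi}" and \<psi>: "(\<psi> has_vector_derivative D) (at x within {lo..hi})"
  shows "((\<lambda>r. along val i x r + dsc i r * \<psi> r) has_real_derivative
    dsc i x / rate m i * (rate m i * D - tot * \<psi> x + gain val i x)) (at x within {x..hi})"
proof -
  let ?f = "\<lambda>z. dsc i z * gain val i z / rate m i"
  have r: "0 < rate m i" by (rule rate_pos[OF i])
  have "continuous (at_right x) (dsc i)" unfolding dsc_def[abs_def] using r by (intro continuous_intros) auto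
  then have "continuous (at_right x) ?f"
    using gain_val_continuous_right[OF i x] r by (intro continuous_intros) auto
  then have "continuous (at x within {x..hi}) ?f"
    using x by (simp add: continuous_within at_within_Icc_at_right)
  then have "((\<lambda>r. integral {x..r} ?f) has_vector_derivative ?f x) (at x within {x..hi} - {})"
    using along_integrable[OF val_bnd i, of x hi] x by (intro integral_has_vector_derivative_continuous_at) auto
  then have 1: "((\<lambda>r. along val i x r) has_real_derivative ?f x) (at x within {x..hi})"
    unfolding along_def by (simp add: has_real_derivative_iff_has_vector_derivative)
  have 2: "(\<psi> has_real_derivative D) (at x within {x..hi})"
    unfolding has_real_derivative_iff_has_vector_derivative by (rule has_vector_derivative_within_subset[OF \<psi>]) (use x in auto)
  have 3: "(dsc i has_real_derivative - (tot / rate m i) * dsc i x) (at x within {x..hi})"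
    unfolding dsc_def[abs_def] using r by (auto intro!: derivative_eq_intros)
  show ?thesis
    by (rule DERIV_cong[OF DERIV_add[OF 1 DERIV_mult[OF 3 2]]]) (use r in \<open>simp add: field_simps\<close>)
qed

end

lemma C1_onD:
  assumes "C1_on {a..b} \<psi>" "x \<in> {a..b}" "a < b"
  shows "continuous_on {a..b} \<psi>" "(\<psi> has_vector_derivative vector_derivative \<psi> (at x within {a..b})) (at x within {a..b})"
proof -
  obtain D where D: "\<And>x. x \<in> {a..b} \<Longrightarrow> (\<psi> has_vector_derivative D x) (at x within {a..b})"
    using assms(1) unfolding C1_on_def by blast
  then show "continuous_on {a..b} \<psi>" by (meson continuous_on_eq_continuous_within has_vector_derivative_continuous)
  have "\<psi> differentiable at x within {a..b}" using D[OF assms(2)] by (rule differentiableI_vector)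
  then show "(\<psi> has_vector_derivative vector_derivative \<psi> (at x within {a..b})) (at x within {a..b})"
    by (simp add: vector_derivative_works)
qed

context production_inventory
begin

context
  fixes i j :: nat and x :: real
  assumes ij: "i \<in> {1, 2}" "j \<in> {1, 2}" "i \<noteq> j" and x: "x \<in> {lo..<hi}"
begin

lemma mean_after_demand_eq: "(\<integral>\<alpha>. wt val i (max lo (x - \<alpha>)) \<partial>dlaw) = (\<integral>\<alpha>. val i (clip (x - \<alpha>)) \<partial>dlaw)"
proof (rule integral_cong_AE)
  have [measurable]: "val i \<in> borel_measurable borel" "wt val i \<in> borel_measurable borel"
    using bndD(3)[OF val_bnd ij(1)] wt_bounds(3)[OF val_bnd, of i] ij(1) by auto
  show "(\<lambda>\<alpha>. wt val i (max lo (x - \<alpha>))) \<in> borel_measurable dlaw" "(\<lambda>\<alpha>. val i (clip (x - \<alpha>))) \<in> borel_measurable dlaw"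
    by measurable
  show "AE \<alpha> in dlaw. wt val i (max lo (x - \<alpha>)) = val i (clip (x - \<alpha>))"
    using AE_dlaw_pos by eventually_elim (use ij(1) x in \<open>auto simp: wt_def clip_def\<close>)
qed

text \<open>If the operator were negative, the value of producing up to \<open>r\<close> and then
  paying the test function would drop strictly below \<open>val i x\<close> for \<open>r\<close>
  slightly above \<open>x\<close>. As the test function lies above \<open>val i\<close>, this
  contradicts the drift inequality.\<close>

lemma supersolution_inequality:
  assumes \<psi>: "C1_on {lo..hi} \<psi>" "\<psi> x = val i x" and ge: "\<And>y. y \<in> {lo..hi} \<Longrightarrow> val i y \<le> \<psi> y"
  shows "0 \<le> hjb_op m i \<psi> x"
proof (rule ccontr)
  have xx: "x \<in> {lo..hi}" using x by auto
  note C = C1_onD[OF \<psi>(1) xx lo_less_hi]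
  note h = hjb_op_eq[OF ij(1) x C(1)]
  let ?h = "\<lambda>r. along val i x r + dsc i r * \<psi> r"
  let ?D = "rate m i * vector_derivative \<psi> (at x within {lo..hi}) - tot * \<psi> x + gain val i x"
  assume neg: "\<not> 0 \<le> hjb_op m i \<psi> x"
  have "(\<integral>\<alpha>. val i (clip (x - \<alpha>)) \<partial>dlaw) \<le> (\<integral>\<alpha>. \<psi> (clip (x - \<alpha>)) \<partial>dlaw)"
    by (intro integral_mono hjb_op_eq(2)[OF ij(1) x] C(1) val_continuous ij ge) simp
  then have "intensity m * (\<integral>\<alpha>. val i (clip (x - \<alpha>)) \<partial>dlaw) \<le> intensity m * (\<integral>\<alpha>. \<psi> (clip (x - \<alpha>)) \<partial>dlaw)"
    using intensity_pos by (intro mult_left_mono) auto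
  \<comment> \<open>Only the nonlocal term differs: the test function touches \<open>val i\<close>
    at \<open>x\<close> from above, so its mean after a demand is the larger one.\<close>
  then have "?D \<le> hjb_op m i \<psi> x" unfolding h gain_def jmp_def mean_after_demand_eq by (simp add: distrib_left)
  then have "dsc i x / rate m i * ?D < 0" using neg rate_pos[OF ij(1)] by (intro mult_pos_neg) auto
  from has_real_derivative_neg_dec_right[OF test_derivative[OF ij(1) x C(2)] this]
  obtain d where d: "0 < d" "\<And>h. 0 < h \<Longrightarrow> x + h \<in> {x..hi} \<Longrightarrow> h < d \<Longrightarrow> ?h (x + h) < ?h x" by blast
  define h where "h = min (d / 2) (hi - x)"
  have hh: "0 < h" "x + h \<in> {x..hi}" "h < d" unfolding h_def using d(1) x by auto
  have "dsc i x * val i x \<le> along val i x (x + h) + dsc i (x + h) * val i (x + h)"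
    using x hh by (intro subvalD(2)[OF val_subval ij(1)]) auto
  also have "\<dots> \<le> ?h (x + h)" using x hh by (intro add_left_mono mult_left_mono ge) (auto simp: less_imp_le[OF dsc_pos])
  finally show False using d(2)[OF hh] \<psi>(2) by simp
qed

text \<open>The mirror image, with \<open>val_follow\<close> instead of the drift inequality: where
  switching is strictly suboptimal, producing over a short interval is exactly optimal, and a test
  function below \<open>val i\<close> cannot make it look strictly more expensive.\<close>

lemma subsolution_inequality:
  assumes \<psi>: "C1_on {lo..hi} \<psi>" "\<psi> x = val i x" and le: "\<And>y. y \<in> {lo..hi} \<Longrightarrow> \<psi> y \<le> val i y"
    and lt: "val i x < val j x + switch m i j"
  shows "hjb_op m i \<psi> x \<le> 0"
proof (rule ccontr)
  have xx: "x \<in> {lo..hi}" using x by auto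
  note C = C1_onD[OF \<psi>(1) xx lo_less_hi]
  note h = hjb_op_eq[OF ij(1) x C(1)]
  let ?h = "\<lambda>r. along val i x r + dsc i r * \<psi> r"
  let ?D = "rate m i * vector_derivative \<psi> (at x within {lo..hi}) - tot * \<psi> x + gain val i x"
  assume pos: "\<not> hjb_op m i \<psi> x \<le> 0"
  have "(\<integral>\<alpha>. \<psi> (clip (x - \<alpha>)) \<partial>dlaw) \<le> (\<integral>\<alpha>. val i (clip (x - \<alpha>)) \<partial>dlaw)"
    by (intro integral_mono hjb_op_eq(2)[OF ij(1) x] C(1) val_continuous ij le) simp
  then have "intensity m * (\<integral>\<alpha>. \<psi> (clip (x - \<alpha>)) \<partial>dlaw) \<le> intensity m * (\<integral>\<alpha>. val i (clip (x - \<alpha>)) \<partial>dlaw)"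
    using intensity_pos by (intro mult_left_mono) auto
  then have "hjb_op m i \<psi> x \<le> ?D" unfolding h gain_def jmp_def mean_after_demand_eq by (simp add: distrib_left)
  then have "0 < dsc i x / rate m i * ?D" using pos rate_pos[OF ij(1)] by (intro mult_pos_pos) auto
  from has_real_derivative_pos_inc_right[OF test_derivative[OF ij(1) x C(2)] this]
  obtain d where d: "0 < d" "\<And>h. 0 < h \<Longrightarrow> x + h \<in> {x..hi} \<Longrightarrow> h < d \<Longrightarrow> ?h x < ?h (x + h)" by blast
  \<comment> \<open>A distance over which the strict gap at \<open>x\<close> still satisfies the
    assumption of \<open>val_follow\<close>; \<open>lip + 1\<close> avoids a zero
    denominator.\<close>
  define s where "s = (val j x + switch m i j - val i x) / (3 * (lip + 1))"
  have s: "0 < s" "3 * lip * s \<le> val j x + switch m i j - val i x"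
  proof -
    show "0 < s" unfolding s_def using lt lip_nonneg by simp
    then have "3 * lip * s \<le> 3 * (lip + 1) * s" by (intro mult_right_mono) auto
    also have "\<dots> = val j x + switch m i j - val i x" unfolding s_def using lip_nonneg by simp
    finally show "3 * lip * s \<le> val j x + switch m i j - val i x" .
  qed
  define h where "h = min s (min (d / 2) (hi - x))"
  have hh: "0 < h" "x + h \<in> {x..hi}" "h < d" "h \<le> s" unfolding h_def using d(1) x s(1) by auto
  have "3 * lip * h \<le> 3 * lip * s" using hh(4) lip_nonneg by (intro mult_left_mono) auto
  then have "dsc i x * val i x = along val i x (x + h) + dsc i (x + h) * val i (x + h)"
    using x hh s(2) by (intro val_follow[OF ij]) auto
  moreover have "?h (x + h) \<le> along val i x (x + h) + dsc i (x + h) * val i (x + h)"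
    using x hh by (intro add_left_mono mult_left_mono le) (auto simp: less_imp_le[OF dsc_pos])
  ultimately show False using d(2)[OF hh(1-3)] \<psi>(2) by simp
qed

lemma val_viscosity: "viscosity_solution_at m i j (optimal_cost_ext m i) x"
proof -
  have xx: "x \<in> {lo..hi}" using x by auto
  note v = optimal_cost_ext_val[OF ij(1)] optimal_cost_ext_val[OF ij(2)]
  have "lip-lipschitz_on {lo..hi} (optimal_cost_ext m i)"
    using val_lipschitz[OF ij(1)] v(1) by (intro lipschitz_onI lip_nonneg) (auto simp: dist_real_def)
  moreover have "min (hjb_op m i \<psi> x) (optimal_cost_ext m j x + switch m i j - optimal_cost_ext m i x) \<le> 0"
    if "C1_on {lo..hi} \<psi> \<and> \<psi> x = optimal_cost_ext m i x \<and>
      (\<forall>y\<in>{lo..hi}. optimal_cost_ext m i x - \<psi> x \<le> optimal_cost_ext m i y - \<psi> y)" for \<psi>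
    using that subsolution_inequality[of \<psi>] v xx by (auto simp: min_le_iff_disj not_less[symmetric])
  moreover have "0 \<le> min (hjb_op m i \<phi> x) (optimal_cost_ext m j x + switch m i j - optimal_cost_ext m i x)"
    if "C1_on {lo..hi} \<phi> \<and> \<phi> x = optimal_cost_ext m i x \<and>
      (\<forall>y\<in>{lo..hi}. optimal_cost_ext m i y - \<phi> y \<le> optimal_cost_ext m i x - \<phi> x)" for \<phi>
    using that supersolution_inequality[of \<phi>] subvalD(1)[OF val_subval ij xx] v xx by auto
  ultimately show ?thesis
    unfolding viscosity_solution_at_def viscosity_subsolution_at_def viscosity_supersolution_at_def by blast
qed

end

end

theorem proposition4p2:
  fixes m :: "'a inventory" and i j :: nat and x :: real
  assumes "production_inventory m"
    and "{i, j} = {1, 2}"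
    and "x \<in> {low m..<cap m}"
  shows "viscosity_solution_at m i j (optimal_cost_ext m i) x"
proof -
  interpret production_inventory m by fact
  from assms(2) have "i \<in> {1, 2}" "j \<in> {1, 2}" "i \<noteq> j" by (auto simp: doubleton_eq_iff)
  then show ?thesis using assms(3) by (rule val_viscosity)
qed

end
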